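(* Let $\epsilon > 0$ and let $u_0^{\epsilon} \in L^2(\mathbb{R}^3)$ be a vector field $\mathbb{R}^3 \to \mathbb{R}^3$ with decay character $r^{\ast} = r^{\ast}(u_0^{\epsilon})$ satisfying $-\frac{3}{2} < r^{\ast} < \infty$. Then for any weak solution $u^{\epsilon}$ of $$\partial_t u^{\epsilon} + (u^{\epsilon} \cdot \nabla) u^{\epsilon} + \alpha |u^{\epsilon}|^2 u^{\epsilon} = \Delta u^{\epsilon} + \frac{1}{\epsilon} \nabla (\operatorname{div} u^{\epsilon}), \qquad u^{\epsilon}(x,0) = u_0^{\epsilon}(x), \qquad x \in \mathbb{R}^3,\ t > 0,$$ we have that for $\alpha > \frac{\epsilon}{4}$, a constant $C = C(\alpha, \epsilon, \|u_0^{\epsilon}\|_{L^2})$ and any $\delta > 0$, $$\| u^{\epsilon}(t) \|_{L^2(\mathbb{R}^3)}^2 \leq C (1+t)^{-\min\left\{ \frac{3}{2} + r^{\ast},\ \frac{3}{2} - \delta \right\}}.$$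
   Context: Decay character: for $u_0 \in L^2(\mathbb{R}^n)$ (scalar- or vector-valued) with Fourier transform $\widehat{u}_0$, and $r \in \left(-\frac{n}{2}, \infty\right)$, the decay indicator is $$P_r(u_0) = \lim_{\rho \to 0} \rho^{-2r-n} \int_{B(\rho)} |\widehat{u}_0(\xi)|^2 \, d\xi ,$$ where $B(\rho)$ is the ball of radius $\rho$ centered at the origin. The decay character $r^{\ast} = r^{\ast}(u_0)$ is the unique $r \in \left(-\frac{n}{2}, \infty\right)$ such that $0 < P_r(u_0) < \infty$, provided that this number exists. If it does not exist, one sets $r^{\ast} = -\frac{n}{2}$ when $P_r(u_0) = \infty$ for all $r \in \left(-\frac{n}{2}, \infty\right)$, and $r^{\ast} = \infty$ when $P_r(u_0) = 0$ for all $r \in \left(-\frac{n}{2}, \infty\right)$. Here $n = 3$. Weak solution: a solution in the sense of distributions, with initial datum $u_0^{\epsilon}$, belonging to $L^{\infty}(\mathbb{R}_+, L^2(\mathbb{R}^3)) \cap L^2(\mathbb{R}_+, \dot{H}^1(\mathbb{R}^3)) \cap L^4(\mathbb{R}_+, L^4(\mathbb{R}^3))$ (time variable first, space variable second).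
   Formalization: The constant C may depend on the datum u_0 itself (not only on α, ε and the L² norm of u_0), since by scaling no constant depending on u_0 only through its norm can work; C is uniform in the solution and in δ, and the bound is stated for almost every t > 0. *)

theory Defs
  imports "HOL-Analysis.Analysis"
begin

section \<open>Square-integrable functions, Fourier transform, decay character\<close>

text \<open>Elements of Lebesgue spaces are represented by Borel functions; all notions below are
  invariant under modification on null sets.\<close>

definition L2_sqnorm :: "('a::euclidean_space \<Rightarrow> 'b::real_normed_vector) \<Rightarrow> ennreal" where
  "L2_sqnorm f = (\<integral>\<^sup>+x. ennreal ((norm (f x))\<^sup>2) \<partial>lborel)"

definition in_L2 :: "('a::euclidean_space \<Rightarrow> 'b::real_normed_vector) \<Rightarrow> bool" where
  "in_L2 f \<longleftrightarrow> f \<in> borel_measurable lborel \<and> L2_sqnorm f < \<infinity>"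

definition truncated_fourier :: "real \<Rightarrow> (real^'n \<Rightarrow> real^'m) \<Rightarrow> real^'n \<Rightarrow> complex^'m" where
  "truncated_fourier R f \<xi> =
     (LINT x:cball 0 R|lborel. (\<chi> j. cis (- (\<xi> \<bullet> x)) * complex_of_real (f x $ j)))"

text \<open>A square-integrable function need not be integrable, so its Fourier transform is the
  \<open>L\<^sup>2\<close>-limit of the Fourier integrals over growing balls. It exists and is unique up to null
  sets by Plancherel's theorem. No normalising factor is used; such a factor would only multiply
  the decay indicators by a positive constant.\<close>

definition is_L2_fourier :: "(real^'n \<Rightarrow> real^'m) \<Rightarrow> (real^'n \<Rightarrow> complex^'m) \<Rightarrow> bool" where
  "is_L2_fourier f g \<longleftrightarrow>
     in_L2 g \<and> ((\<lambda>R. L2_sqnorm (\<lambda>\<xi>. truncated_fourier R f \<xi> - g \<xi>)) \<longlongrightarrow> 0) at_top"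

definition L2_fourier :: "(real^'n \<Rightarrow> real^'m) \<Rightarrow> real^'n \<Rightarrow> complex^'m" where
  "L2_fourier f = (SOME g. is_L2_fourier f g)"

text \<open>The limit defining the decay indicator may be infinite, or fail to exist; hence a
  relation with values in the extended nonnegative reals.\<close>

definition has_decay_indicator :: "(real^'n \<Rightarrow> real^'m) \<Rightarrow> real \<Rightarrow> ennreal \<Rightarrow> bool" where
  "has_decay_indicator f r P \<longleftrightarrow>
     ((\<lambda>\<rho>. ennreal (\<rho> powr (- 2 * r - real CARD('n))) *
            (\<integral>\<^sup>+\<xi>\<in>ball 0 \<rho>. ennreal ((norm (L2_fourier f \<xi>))\<^sup>2) \<partial>lborel)) \<longlongrightarrow> P) (at_right 0)"

definition pos_finite_indicator :: "(real^'n \<Rightarrow> real^'m) \<Rightarrow> real \<Rightarrow> bool" where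
  "pos_finite_indicator f r \<longleftrightarrow>
     - (real CARD('n) / 2) < r \<and> (\<exists>P. has_decay_indicator f r P \<and> 0 < P \<and> P < \<infinity>)"

text \<open>The decay character is not defined for every function, hence again a relation.\<close>

definition has_decay_character :: "(real^'n \<Rightarrow> real^'m) \<Rightarrow> ereal \<Rightarrow> bool" where
  "has_decay_character f s \<longleftrightarrow>
     (\<exists>r. s = ereal r \<and> pos_finite_indicator f r \<and> (\<forall>r'. pos_finite_indicator f r' \<longrightarrow> r' = r)) \<or>
     (s = ereal (- (real CARD('n) / 2)) \<and>
        (\<forall>r > - (real CARD('n) / 2). has_decay_indicator f r \<infinity>)) \<or>
     (s = \<infinity> \<and> (\<forall>r > - (real CARD('n) / 2). has_decay_indicator f r 0))"


section \<open>Test functions and differential operators\<close>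

primrec Ck :: "nat \<Rightarrow> ('a::euclidean_space \<Rightarrow> 'b::real_normed_vector) \<Rightarrow> bool" where
  "Ck 0 f = continuous_on UNIV f"
| "Ck (Suc k) f = (\<exists>f'. (\<forall>x. (f has_derivative f' x) (at x)) \<and> (\<forall>v. Ck k (\<lambda>x. f' x v)))"

definition test_function :: "('a::euclidean_space \<Rightarrow> 'b::real_normed_vector) \<Rightarrow> bool" where
  "test_function \<phi> \<longleftrightarrow> (\<forall>k. Ck k \<phi>) \<and> compact (closure {x. \<phi> x \<noteq> 0})"

definition partial :: "'n \<Rightarrow> (real^'n \<Rightarrow> 'b::real_normed_vector) \<Rightarrow> real^'n \<Rightarrow> 'b" where
  "partial j \<psi> x = frechet_derivative \<psi> (at x) (axis j 1)"

definition time_deriv :: "(real \<times> (real^3) \<Rightarrow> real^3) \<Rightarrow> real \<times> (real^3) \<Rightarrow> real^3" where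
  "time_deriv \<phi> z = frechet_derivative \<phi> (at z) (1, 0)"

definition laplacian :: "(real^'n \<Rightarrow> 'b::real_normed_vector) \<Rightarrow> real^'n \<Rightarrow> 'b" where
  "laplacian \<psi> x = (\<Sum>j\<in>UNIV. partial j (partial j \<psi>) x)"

definition divergence :: "(real^'n \<Rightarrow> real^'n) \<Rightarrow> real^'n \<Rightarrow> real" where
  "divergence \<psi> x = (\<Sum>j\<in>UNIV. partial j \<psi> x $ j)"

definition grad_div :: "(real^'n \<Rightarrow> real^'n) \<Rightarrow> real^'n \<Rightarrow> real^'n" where
  "grad_div \<psi> x = (\<chi> i. partial i (divergence \<psi>) x)"

definition locally_integrable :: "('a::euclidean_space \<Rightarrow> 'b::{banach,second_countable_topology}) \<Rightarrow> bool" where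
  "locally_integrable f \<longleftrightarrow> (\<forall>K. compact K \<longrightarrow> set_integrable lborel K f)"

text \<open>\<open>g x $ i $ j\<close> is the distributional derivative of the component \<open>f x $ i\<close> in direction \<open>j\<close>.\<close>

definition is_weak_gradient :: "(real^'n \<Rightarrow> real^'m) \<Rightarrow> (real^'n \<Rightarrow> real^'n^'m) \<Rightarrow> bool" where
  "is_weak_gradient f g \<longleftrightarrow>
     locally_integrable f \<and> locally_integrable g \<and>
     (\<forall>\<psi> i j. test_function (\<psi> :: real^'n \<Rightarrow> real) \<longrightarrow>
        (LINT x|lborel. f x $ i * partial j \<psi> x) = - (LINT x|lborel. g x $ i $ j * \<psi> x))"


section \<open>Weak solutions\<close>

definition in_Linf_L2 :: "(real \<Rightarrow> real^3 \<Rightarrow> real^3) \<Rightarrow> bool" where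
  "in_Linf_L2 u \<longleftrightarrow> (\<exists>M::real. AE t in lborel. 0 < t \<longrightarrow> L2_sqnorm (u t) \<le> ennreal M)"

definition in_L4_L4 :: "(real \<Rightarrow> real^3 \<Rightarrow> real^3) \<Rightarrow> bool" where
  "in_L4_L4 u \<longleftrightarrow>
     (\<integral>\<^sup>+t\<in>{0<..}. (\<integral>\<^sup>+x. ennreal ((norm (u t x)) ^ 4) \<partial>lborel) \<partial>lborel) < \<infinity>"

text \<open>Membership in \<open>L\<^sup>2(0,\<infinity>; H\<^sup>1)\<close>, homogeneous version, witnessed by the spatial gradient \<open>G\<close>,
  which is unique up to null sets.\<close>

definition in_L2_H1_dot ::
  "(real \<Rightarrow> real^3 \<Rightarrow> real^3) \<Rightarrow> (real \<Rightarrow> real^3 \<Rightarrow> real^3^3) \<Rightarrow> bool" where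
  "in_L2_H1_dot u G \<longleftrightarrow>
     (\<lambda>(t, x). G t x) \<in> borel_measurable lborel \<and>
     (AE t in lborel. 0 < t \<longrightarrow> is_weak_gradient (u t) (G t)) \<and>
     (\<integral>\<^sup>+t\<in>{0<..}. L2_sqnorm (G t) \<partial>lborel) < \<infinity>"

text \<open>The equation, tested against smooth \<open>\<phi>\<close> that are compactly supported in space-time but need
  not vanish at time 0; the term with \<open>u0\<close> encodes the initial condition. Since \<open>G t x\<close> is the
  Jacobian of \<open>u t\<close>, the vector \<open>G t x *v u t x\<close> is the convection term \<open>(u \<cdot> \<nabla>) u\<close>.\<close>

definition solves_distributionally ::
  "real \<Rightarrow> real \<Rightarrow> (real^3 \<Rightarrow> real^3) \<Rightarrow> (real \<Rightarrow> real^3 \<Rightarrow> real^3) \<Rightarrow>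
     (real \<Rightarrow> real^3 \<Rightarrow> real^3^3) \<Rightarrow> bool" where
  "solves_distributionally \<epsilon> \<alpha> u0 u G \<longleftrightarrow>
     (\<forall>\<phi> :: real \<times> (real^3) \<Rightarrow> real^3. test_function \<phi> \<longrightarrow>
        (LINT (t, x):{0<..} \<times> UNIV|lborel.
            - (u t x \<bullet> time_deriv \<phi> (t, x))
            + (G t x *v u t x) \<bullet> \<phi> (t, x)
            + \<alpha> * (norm (u t x))\<^sup>2 * (u t x \<bullet> \<phi> (t, x)))
        = (LINT x|lborel. u0 x \<bullet> \<phi> (0, x))
        + (LINT (t, x):{0<..} \<times> UNIV|lborel.
            u t x \<bullet> laplacian (\<lambda>y. \<phi> (t, y)) x
            + (1 / \<epsilon>) * (u t x \<bullet> grad_div (\<lambda>y. \<phi> (t, y)) x)))"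

definition weak_solution ::
  "real \<Rightarrow> real \<Rightarrow> (real^3 \<Rightarrow> real^3) \<Rightarrow> (real \<Rightarrow> real^3 \<Rightarrow> real^3) \<Rightarrow> bool" where
  "weak_solution \<epsilon> \<alpha> u0 u \<longleftrightarrow>
     (\<lambda>(t, x). u t x) \<in> borel_measurable lborel \<and>
     in_Linf_L2 u \<and> in_L4_L4 u \<and>
     (\<exists>G. in_L2_H1_dot u G \<and> solves_distributionally \<epsilon> \<alpha> u0 u G)"

end

theory Submission
  imports Defs "HOL-Probability.Probability"
begin

text \<open>Mollifying the equation in space and letting the mollifier concentrate gives the energy equality,
  because \<open>u \<in> L\<^sup>4 L\<^sup>4\<close> makes every nonlinear term integrable. The cubic term of the dissipation is
  \<open>- \<integral> |u|\<^sup>2 div u / 2\<close>; as \<open>\<alpha> > \<epsilon> / 4\<close>, it is absorbed by \<open>|div u|\<^sup>2 / \<epsilon>\<close> and \<open>\<alpha> |u|\<^sup>4\<close>, so that the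
  dissipation dominates \<open>|\<nabla>u|\<^sup>2 + c |u|\<^sup>4\<close>.

  Instead of splitting the frequencies of \<open>u\<close>, one compares \<open>u\<close> with its mollification \<open>k\<^sub>s * u\<close> at a scale
  \<open>s\<close> proportional to the square root of the time: \<open>\<parallel>u\<parallel>\<^sup>2 \<le> 2 \<parallel>k\<^sub>s * u\<parallel>\<^sup>2 + 2 s\<^sup>2 \<parallel>\<nabla>u\<parallel>\<^sup>2\<close>. Integrated over
  \<open>[a, 2a]\<close>, the energy equality then bounds \<open>E(2a)\<close> by \<open>E(a)/16\<close>, the contribution of \<open>k\<^sub>s * u0\<close>, and a
  contribution of the nonlinearity, which is at most a multiple of \<open>a powr (-3/2)\<close> times the integral of \<open>E\<close>
  over \<open>[0, 2a]\<close> since \<open>\<parallel>k\<^sub>s\<parallel>\<^sup>2\<close> is proportional to \<open>s\<close> to the power \<open>-3\<close>. By Plancherel's identity, summing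
  over dyadic shells, the decay character bounds \<open>\<parallel>k\<^sub>s * u0\<parallel>\<^sup>2\<close> by a multiple of \<open>a powr (-\<gamma>)\<close> with
  \<open>\<gamma> = min (3/2 + r) (3/2)\<close>. Iterating over dyadic times, \<open>E\<close> itself decays like \<open>(1 + t) powr (-\<gamma>)\<close>, which
  beats the claimed rate for every \<open>\<delta>\<close>.\<close>

section \<open>Calculus of smooth functions\<close>

text \<open>The exponent 3/2 comes from measuring the nonlinearity in L1. Each component is a sum of
  products \<open>adv i j * U j\<close> with \<open>adv i j\<close> square integrable in space-time,
  so Cauchy-Schwarz in time bounds the square of the time integral of its L1 norm by a constant
  times the integral of E. After dyadic summation with weight \<open>2 powr \<gamma>\<close> per
  step, the energy at time 2^j enters with weight \<open>(2 powr (- 1/2))^j\<close>; these weights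
  are summable for every \<gamma> \<le> 3/2, which lets the iteration close.

  Weak solutions supply information at almost every time only. This is met three times: the solution
  is altered on a null set of times, the mollified equation is treated as a distributional ODE at
  each fixed x, and E is replaced by an antitone representative.

  The time integral of \<open>adv_sq\<close> is bounded through the dissipation by the initial
  energy, so every constant can be fixed before a solution is given. The decay character concerns
  the datum alone, so only the datum is Fourier transformed; since the mollifier is even, its real
  cosine and sine transforms suffice.\<close>

lemma Ck_Suc_imp_Ck: "Ck (Suc k) f \<Longrightarrow> Ck k f"
proof (induction k arbitrary: f)
  case 0
  then show ?case
    by (auto simp: continuous_on_eq_continuous_at intro: has_derivative_continuous)
next
  case (Suc k)
  then obtain f' where f': "\<And>x. (f has_derivative f' x) (at x)" "\<And>v. Ck (Suc k) (\<lambda>x. f' x v)"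
    by auto
  with Suc.IH have "\<And>v. Ck k (\<lambda>x. f' x v)" by blast
  with f'(1) show ?case by auto
qed

lemma Ck_const: "Ck k (\<lambda>x. c)"
proof (induction k arbitrary: c)
  case 0 then show ?case by simp
next
  case (Suc k)
  show ?case by (auto intro!: exI[of _ "\<lambda>x v. 0"] derivative_eq_intros Suc)
qed

lemma Ck_add: "Ck k f \<Longrightarrow> Ck k g \<Longrightarrow> Ck k (\<lambda>x. f x + g x)"
proof (induction k arbitrary: f g)
  case 0 then show ?case by (auto intro: continuous_intros)
next
  case (Suc k)
  from Suc.prems obtain f' g' where
    f': "\<And>x. (f has_derivative f' x) (at x)" "\<And>v. Ck k (\<lambda>x. f' x v)" and
    g': "\<And>x. (g has_derivative g' x) (at x)" "\<And>v. Ck k (\<lambda>x. g' x v)" by auto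
  show ?case using f' g'
    by (auto intro!: exI[of _ "\<lambda>x v. f' x v + g' x v"] derivative_intros Suc.IH)
qed

lemma Ck_bounded_linear_left:
  "bounded_linear L \<Longrightarrow> Ck k f \<Longrightarrow> Ck k (\<lambda>x. L (f x))"
proof (induction k arbitrary: f)
  case 0 then show ?case
    by (auto intro: bounded_linear.continuous_on)
next
  case (Suc k)
  from Suc.prems obtain f' where
    f': "\<And>x. (f has_derivative f' x) (at x)" "\<And>v. Ck k (\<lambda>x. f' x v)" by auto
  have "((\<lambda>x. L (f x)) has_derivative (\<lambda>v. L (f' x v))) (at x)" for x
    by (rule bounded_linear.has_derivative[OF Suc.prems(1) f'(1)])
  moreover have "Ck k (\<lambda>x. L (f' x v))" for v
    by (rule Suc.IH[OF Suc.prems(1) f'(2)])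
  ultimately show ?case by (auto intro!: exI[of _ "\<lambda>x v. L (f' x v)"])
qed

lemma Ck_affine_right:
  "bounded_linear L \<Longrightarrow> Ck k f \<Longrightarrow> Ck k (\<lambda>x. f (a + L x))"
proof (induction k arbitrary: f)
  case 0
  then have "continuous_on UNIV L" by (simp add: linear_continuous_on)
  with 0 show ?case
    by (auto intro!: continuous_intros continuous_on_compose2[of UNIV f])
next
  case (Suc k)
  from Suc.prems obtain f' where
    f': "\<And>x. (f has_derivative f' x) (at x)" "\<And>v. Ck k (\<lambda>x. f' x v)" by auto
  have "((\<lambda>x. f (a + L x)) has_derivative (\<lambda>v. f' (a + L x) (L v))) (at x)" for x
  proof -
    have "((\<lambda>x. a + L x) has_derivative L) (at x)"
      using Suc.prems(1) by (auto intro!: derivative_eq_intros bounded_linear_imp_has_derivative)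
    from has_derivative_compose[OF this f'(1)] show ?thesis by simp
  qed
  then show ?case using f' Suc.prems(1)
    by (auto intro!: exI[of _ "\<lambda>x v. f' (a + L x) (L v)"] Suc.IH)
qed

lemma Ck_linear: "bounded_linear L \<Longrightarrow> Ck k L"
proof (cases k)
  case 0
  then show "bounded_linear L \<Longrightarrow> Ck k L" by (simp add: linear_continuous_on)
next
  case (Suc j)
  then show "bounded_linear L \<Longrightarrow> Ck k L"
    by (auto intro!: exI[of _ "\<lambda>x. L"] bounded_linear_imp_has_derivative Ck_const)
qed

lemma Ck_bilinear:
  assumes B: "bounded_bilinear B"
  shows "Ck k f \<Longrightarrow> Ck k g \<Longrightarrow> Ck k (\<lambda>x. B (f x) (g x))"
proof (induction k arbitrary: f g)
  case 0 then show ?case by (auto intro: bounded_bilinear.continuous_on[OF B])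
next
  case (Suc k)
  from Suc.prems obtain f' g' where
    f': "\<And>x. (f has_derivative f' x) (at x)" "\<And>v. Ck k (\<lambda>x. f' x v)" and
    g': "\<And>x. (g has_derivative g' x) (at x)" "\<And>v. Ck k (\<lambda>x. g' x v)" by auto
  have "Ck k f" "Ck k g" using Suc.prems by (auto simp del: Ck.simps intro: Ck_Suc_imp_Ck)
  then show ?case using f' g'
    by (auto intro!: exI[of _ "\<lambda>x v. B (f x) (g' x v) + B (f' x v) (g x)"]
        bounded_bilinear.FDERIV[OF B] Suc.IH Ck_add)
qed

lemmas Ck_mult = Ck_bilinear[OF bounded_bilinear_mult]
lemmas Ck_scaleR = Ck_bilinear[OF bounded_bilinear_scaleR]
lemmas Ck_inner = Ck_bilinear[OF bounded_bilinear_inner]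

text \<open>The outer function has a real argument, so its derivative is multiplication by
  \<open>f' y 1\<close>. The derivative of the composite is then a product of two scalar functions,
  to which \<open>Ck_mult\<close> and the induction hypothesis apply.\<close>

lemma Ck_compose_real:
  fixes f :: "real \<Rightarrow> real" and g :: "'a::euclidean_space \<Rightarrow> real"
  shows "Ck k f \<Longrightarrow> Ck k g \<Longrightarrow> Ck k (\<lambda>x. f (g x))"
proof (induction k arbitrary: f g)
  case 0 then show ?case by (auto intro: continuous_on_compose2[of UNIV f])
next
  case (Suc k)
  from Suc.prems obtain f' g' where
    f': "\<And>x. (f has_derivative f' x) (at x)" "\<And>v. Ck k (\<lambda>x. f' x v)" and
    g': "\<And>x. (g has_derivative g' x) (at x)" "\<And>v. Ck k (\<lambda>x. g' x v)" by auto
  have g: "Ck k g" using Suc.prems by (auto simp del: Ck.simps intro: Ck_Suc_imp_Ck)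
  have lin: "f' y v = f' y 1 * v" for y v
    using linear_scale[OF has_derivative_linear[OF f'(1)[of y]], of v 1] by simp
  have "((\<lambda>x. f (g x)) has_derivative (\<lambda>v. f' (g x) 1 * g' x v)) (at x)" for x
  proof -
    have "((\<lambda>x. f (g x)) has_derivative (\<lambda>v. f' (g x) (g' x v))) (at x)"
      using has_derivative_compose[OF g'(1) f'(1)] by simp
    moreover have "(\<lambda>v. f' (g x) (g' x v)) = (\<lambda>v. f' (g x) 1 * g' x v)"
      by (rule ext) (rule lin)
    ultimately show ?thesis by simp
  qed
  moreover have "Ck k (\<lambda>x. f' (g x) 1 * g' x v)" for v
    by (rule Ck_mult[OF Suc.IH[OF f'(2) g] g'(2)])
  ultimately show ?case by (auto intro!: exI[of _ "\<lambda>x v. f' (g x) 1 * g' x v"])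
qed

lemma Ck_uminus: "Ck k f \<Longrightarrow> Ck k (\<lambda>x. - f x)"
  by (rule Ck_bounded_linear_left[OF bounded_linear_minus[OF bounded_linear_ident]])

lemma Ck_diff: "Ck k f \<Longrightarrow> Ck k g \<Longrightarrow> Ck k (\<lambda>x. f x - g x)"
  unfolding diff_conv_add_uminus by (intro Ck_add Ck_uminus)

lemma Ck_SucI_deriv:
  fixes f :: "real \<Rightarrow> 'b::real_normed_vector"
  assumes "\<And>x. (f has_vector_derivative f' x) (at x)" "Ck k f'"
  shows "Ck (Suc k) f"
  using assms
  by (auto intro!: exI[of _ "\<lambda>x v. v *\<^sub>R f' x"] Ck_scaleR Ck_const simp: has_vector_derivative_def)

abbreviation smooth :: "('a::euclidean_space \<Rightarrow> 'b::real_normed_vector) \<Rightarrow> bool" where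
  "smooth f \<equiv> \<forall>k. Ck k f"

lemma smooth_has_derivative:
  assumes "smooth f"
  shows "(f has_derivative frechet_derivative f (at x)) (at x)"
proof -
  from assms have "Ck 1 f" by blast
  then have "\<exists>f'. (f has_derivative f') (at x)" unfolding One_nat_def by auto
  then show ?thesis using frechet_derivative_works differentiable_def by blast
qed

lemma smooth_derivative:
  assumes "smooth f"
  shows "smooth (\<lambda>x. frechet_derivative f (at x) v)"
proof
  fix k
  from assms have "Ck (Suc k) f" by blast
  then obtain f' where f': "\<And>x. (f has_derivative f' x) (at x)" "\<And>v. Ck k (\<lambda>x. f' x v)"
    by auto
  have "frechet_derivative f (at x) = f' x" for x
    using f'(1) frechet_derivative_at by metis
  then show "Ck k (\<lambda>x. frechet_derivative f (at x) v)" using f'(2) by simp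
qed

lemma smooth_partial: "smooth \<psi> \<Longrightarrow> smooth (partial j \<psi>)"
  unfolding partial_def[abs_def] by (rule smooth_derivative)

lemma smooth_continuous: "smooth f \<Longrightarrow> continuous_on S f"
  by (metis Ck.simps(1) continuous_on_subset top_greatest)

section \<open>A smooth function that is flat at the origin\<close>

definition flat :: "nat \<Rightarrow> real \<Rightarrow> real" where
  "flat n x = (if x > 0 then exp (- (1 / x)) / x ^ n else 0)"

lemma flat_nonneg: "0 \<le> flat n x" by (simp add: flat_def)

text \<open>With \<open>y = 1 / x\<close>, one term \<open>y ^ (n + m) / fact (n + m)\<close> of the
  exponential series already bounds \<open>exp y\<close> from below. As \<open>m\<close> is free,
  any power of x can be gained.\<close>

lemma flat_bound: "flat n x \<le> fact (n + m) * \<bar>x\<bar> ^ m"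
proof (cases "x > 0")
  case True
  define y where "y = 1 / x"
  have y: "y > 0" using True by (simp add: y_def)
  have "y ^ (n+m) / fact (n+m) \<le> exp y"
  proof -
    have "(\<Sum>i\<in>{n+m}. y ^ i /\<^sub>R fact i) \<le> exp y"
      unfolding exp_def using y by (intro sum_le_suminf summable_exp_generic) auto
    then show ?thesis by (simp add: field_simps)
  qed
  then have "y ^ (n+m) * exp (-y) \<le> fact (n + m)"
    by (simp add: exp_minus field_simps)
  then show ?thesis using True by (simp add: y_def flat_def field_simps power_add)
qed (simp add: flat_def)

text \<open>The powers of 1/x are in the family because differentiation then maps its span into
  itself, and smoothness of all members becomes one induction on the order. At 0 the difference
  quotient is killed by \<open>flat_bound\<close> with exponent 2.\<close>

lemma flat_has_derivative:
  "(flat n has_real_derivative flat (n+2) x - real n * flat (n+1) x) (at x)"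
proof -
  consider "x > 0" | "x < 0" | "x = 0" by linarith
  then show ?thesis
  proof cases
    case 1
    have "((\<lambda>x. exp (- (1 / x)) / x ^ n) has_real_derivative flat (n+2) x - real n * flat (n+1) x) (at x)"
      using 1 apply (auto intro!: derivative_eq_intros simp: flat_def)
      apply (cases n; simp add: field_simps power2_eq_square)
      done
    then show ?thesis
      by (rule has_field_derivative_transform_within_open[where S="{0<..}"]) (use 1 in \<open>auto simp: flat_def\<close>)
  next
    case 2
    have "((\<lambda>x::real. 0) has_real_derivative 0) (at x)" by simp
    moreover have "flat (n+2) x - real n * flat (n+1) x = 0" using 2 by (simp add: flat_def)
    ultimately have "((\<lambda>x::real. 0) has_real_derivative flat (n+2) x - real n * flat (n+1) x) (at x)"
      by simp
    then show ?thesis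
      by (rule has_field_derivative_transform_within_open[where S="{..<0}"]) (use 2 in \<open>auto simp: flat_def\<close>)
  next
    case 3
    have "((\<lambda>h. (flat n (0 + h) - flat n 0) / h) \<longlongrightarrow> 0) (at 0)"
    proof (rule Lim_null_comparison[where g="\<lambda>h. fact (n+2) * \<bar>h\<bar>"])
      show "\<forall>\<^sub>F h in at 0. norm ((flat n (0 + h) - flat n 0) / h) \<le> fact (n + 2) * \<bar>h\<bar>"
      proof (rule always_eventually, rule allI)
        fix h :: real
        have "norm (flat n (0+h) - flat n 0) \<le> fact (n + 2) * \<bar>h\<bar>\<^sup>2"
          using flat_bound[of n h 2] flat_nonneg[of n h] by (simp add: flat_def)
        then show "norm ((flat n (0 + h) - flat n 0) / h) \<le> fact (n + 2) * \<bar>h\<bar>"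
          by (cases "h = 0") (auto simp: divide_simps power2_eq_square mult.assoc)
      qed
      show "((\<lambda>h::real. fact (n+2) * \<bar>h\<bar>) \<longlongrightarrow> 0) (at 0)"
        by (rule tendsto_eq_intros refl | simp)+
    qed
    then show ?thesis using 3 by (simp add: DERIV_def flat_def)
  qed
qed

lemma smooth_flat: "smooth (flat n)"
proof
  fix k show "Ck k (flat n)"
  proof (induction k arbitrary: n)
    case 0
    show ?case using flat_has_derivative
      by (auto simp: continuous_on_eq_continuous_at intro: DERIV_isCont)
  next
    case (Suc k)
    show ?case
      by (rule Ck_SucI_deriv[where f'="\<lambda>x. flat (n+2) x - real n * flat (n+1) x"])
         (auto intro!: Ck_diff Ck_mult Ck_const Suc simp del: of_nat_add
             simp: has_real_derivative_iff_has_vector_derivative[symmetric] flat_has_derivative[simplified])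
  qed
qed

lemma flat_pos_iff: "flat n x > 0 \<longleftrightarrow> x > 0"
  by (simp add: flat_def)

section \<open>Square-integrable functions\<close>

lemma tendsto_zero_bound:
  fixes f g :: "'i \<Rightarrow> real"
  assumes "\<And>i. 0 \<le> f i" "\<And>i. f i \<le> g i" "(g \<longlongrightarrow> 0) F"
  shows "(f \<longlongrightarrow> 0) F"
  by (rule tendsto_sandwich[OF _ _ tendsto_const assms(3)]) (auto intro: always_eventually assms)

text \<open>The cases c = 1 and c = -1 together cover both translations and the reflection
  \<open>z - x\<close> used in convolutions.\<close>

lemma lborel_distr_isometry:
  fixes t :: "'a::euclidean_space"
  assumes "\<bar>c\<bar> = 1"
  shows "distr lborel borel (\<lambda>x. t + c *\<^sub>R x) = lborel"
  using lborel_affine[of c t] assms by (auto simp: density_1 one_ennreal_def[symmetric])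

lemma nn_integral_lborel_shift:
  fixes f :: "'a::euclidean_space \<Rightarrow> ennreal"
  assumes [measurable]: "f \<in> borel_measurable borel"
  shows "(\<integral>\<^sup>+x. f (x - z) \<partial>lborel) = (\<integral>\<^sup>+x. f x \<partial>lborel)"
    and "(\<integral>\<^sup>+x. f (z - x) \<partial>lborel) = (\<integral>\<^sup>+x. f x \<partial>lborel)"
    and "(\<integral>\<^sup>+x. f (x + z) \<partial>lborel) = (\<integral>\<^sup>+x. f x \<partial>lborel)"
proof -
  have *: "(\<integral>\<^sup>+x. f (t + c *\<^sub>R x) \<partial>lborel) = (\<integral>\<^sup>+x. f x \<partial>lborel)" if "\<bar>c\<bar> = 1" for t c
    by (subst (2) lborel_distr_isometry[OF that, of t, symmetric], subst nn_integral_distr) auto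
  show "(\<integral>\<^sup>+x. f (x - z) \<partial>lborel) = (\<integral>\<^sup>+x. f x \<partial>lborel)"
    and "(\<integral>\<^sup>+x. f (z - x) \<partial>lborel) = (\<integral>\<^sup>+x. f x \<partial>lborel)"
    and "(\<integral>\<^sup>+x. f (x + z) \<partial>lborel) = (\<integral>\<^sup>+x. f x \<partial>lborel)"
    using *[of 1 "-z"] *[of "-1" z] *[of 1 z] by (simp_all add: add.commute)
qed

lemma integrable_lborel_shift:
  fixes f :: "'a::euclidean_space \<Rightarrow> 'b::{banach, second_countable_topology}"
  assumes "integrable lborel f"
  shows "integrable lborel (\<lambda>x. f (x - z))"
    and "integrable lborel (\<lambda>x. f (z - x))"
    and "integrable lborel (\<lambda>x. f (x + z))"
proof -
  have *: "integrable lborel (\<lambda>x. f (t + c *\<^sub>R x))" if "\<bar>c\<bar> = 1" for t c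
    using assms by (subst (asm) lborel_distr_isometry[OF that, of t, symmetric], subst (asm) integrable_distr_eq)
      (auto simp: integrable_distr_eq dest: borel_measurable_integrable)
  show "integrable lborel (\<lambda>x. f (x - z))"
    and "integrable lborel (\<lambda>x. f (z - x))"
    and "integrable lborel (\<lambda>x. f (x + z))"
    using *[of 1 "-z"] *[of "-1" z] *[of 1 z] by (simp_all add: add.commute)
qed

lemma integral_lborel_shift:
  fixes f :: "'a::euclidean_space \<Rightarrow> 'b::{banach, second_countable_topology}"
  assumes [measurable]: "f \<in> borel_measurable borel"
  shows "(LBINT x. f (x - z)) = (LBINT x. f x)"
    and "(LBINT x. f (z - x)) = (LBINT x. f x)"
    and "(LBINT x. f (x + z)) = (LBINT x. f x)"
proof -
  have *: "(LBINT x. f (t + c *\<^sub>R x)) = (LBINT x. f x)" if "\<bar>c\<bar> = 1" for t c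
    by (subst (2) lborel_distr_isometry[OF that, of t, symmetric], subst integral_distr) auto
  show "(LBINT x. f (x - z)) = (LBINT x. f x)"
    and "(LBINT x. f (z - x)) = (LBINT x. f x)"
    and "(LBINT x. f (x + z)) = (LBINT x. f x)"
    using *[of 1 "-z"] *[of "-1" z] *[of 1 z] by (simp_all add: add.commute)
qed

section \<open>Cauchy-Schwarz and the class L2\<close>

lemma ennreal_mult_le_squares: "p * q \<le> (p\<^sup>2 + q\<^sup>2) / (2::ennreal)"
proof (cases p; cases q)
  fix a b assume "p = ennreal a" "0 \<le> a" "q = ennreal b" "0 \<le> b"
  moreover have "a * b \<le> (a\<^sup>2 + b\<^sup>2) / 2"
    using sum_squares_bound[of a b] by (simp add: field_simps)
  ultimately show ?thesis
    by (simp add: ennreal_mult[symmetric] ennreal_power ennreal_plus[symmetric]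
        ennreal_divide_numeral ennreal_leI del: ennreal_plus)
qed (auto simp: ennreal_top_divide power2_eq_square ennreal_mult_top ennreal_top_mult top_add add_top)

text \<open>The square is an iterated integral, and the inequality between p q and (p^2 + q^2)/2 is
  applied to \<open>p = f x * g y\<close>, \<open>q = g x * f y\<close>. Nothing is divided by a
  norm, so vanishing or infinite integrals need no separate case; the inner integrals factor, so no
  exchange of integrals occurs either.\<close>

lemma Cauchy_Schwarz_nn_integral:
  assumes [measurable]: "f \<in> borel_measurable M" "g \<in> borel_measurable M"
  shows "(\<integral>\<^sup>+x. f x * g x \<partial>M)\<^sup>2 \<le> (\<integral>\<^sup>+x. (f x)\<^sup>2 \<partial>M) * (\<integral>\<^sup>+x. (g x)\<^sup>2 \<partial>M)"
proof -
  let ?A = "\<integral>\<^sup>+x. (f x)\<^sup>2 \<partial>M" and ?B = "\<integral>\<^sup>+x. (g x)\<^sup>2 \<partial>M"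
  have "(\<integral>\<^sup>+x. f x * g x \<partial>M)\<^sup>2 = (\<integral>\<^sup>+x. \<integral>\<^sup>+y. (f x * g y) * (g x * f y) \<partial>M \<partial>M)"
  proof -
    have "(\<integral>\<^sup>+x. f x * g x \<partial>M)\<^sup>2 = (\<integral>\<^sup>+x. f x * g x * (\<integral>\<^sup>+y. f y * g y \<partial>M) \<partial>M)"
      by (simp add: power2_eq_square nn_integral_multc)
    also have "\<dots> = (\<integral>\<^sup>+x. \<integral>\<^sup>+y. (f x * g x) * (f y * g y) \<partial>M \<partial>M)"
      by (simp add: nn_integral_cmult)
    finally show ?thesis by (simp add: mult_ac)
  qed
  also have "\<dots> \<le> (\<integral>\<^sup>+x. \<integral>\<^sup>+y. ((f x * g y)\<^sup>2 + (g x * f y)\<^sup>2) / 2 \<partial>M \<partial>M)"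
    by (intro nn_integral_mono ennreal_mult_le_squares)
  also have "\<dots> = (?A * ?B + ?B * ?A) / 2"
    by (simp add: nn_integral_divide nn_integral_add nn_integral_cmult nn_integral_multc power_mult_distrib)
  also have "\<dots> = ?A * ?B"
    by (simp add: mult.commute[of ?B] mult_2[symmetric] ennreal_mult_divide_eq mult.commute[of 2])
  finally show ?thesis .
qed

lemma in_L2_iff:
  fixes f :: "'a::euclidean_space \<Rightarrow> real"
  shows "in_L2 f \<longleftrightarrow> f \<in> borel_measurable lborel \<and> integrable lborel (\<lambda>x. (f x)\<^sup>2)"
  by (auto simp: in_L2_def L2_sqnorm_def integrable_iff_bounded)

lemma in_L2_measurable [measurable_dest]:
  fixes f :: "'a::euclidean_space \<Rightarrow> real"
  shows "in_L2 f \<Longrightarrow> f \<in> borel_measurable borel"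
  by (simp add: in_L2_iff)

lemma in_L2_integrable: 
  fixes f :: "'a::euclidean_space \<Rightarrow> real"
  shows "in_L2 f \<Longrightarrow> integrable lborel (\<lambda>x. (f x)\<^sup>2)"
  by (simp add: in_L2_iff)

text \<open>Real counterpart of \<open>L2_sqnorm\<close>, for arithmetic without infinities. A
  Bochner integral is 0 when its integrand is not integrable, so the two are related only under
  \<open>in_L2\<close>.\<close>

definition sq :: "('a::euclidean_space \<Rightarrow> real) \<Rightarrow> real" where
  "sq f = (LBINT x. (f x)\<^sup>2)"

lemma sq_nonneg [simp]: "0 \<le> sq f" by (simp add: sq_def)

lemma L2_sqnorm_eq_sq:
  fixes f :: "'a::euclidean_space \<Rightarrow> real"
  shows "in_L2 f \<Longrightarrow> L2_sqnorm f = ennreal (sq f)"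
  by (simp add: in_L2_iff L2_sqnorm_def sq_def nn_integral_eq_integral)

lemma L2_sqnorm_real:
  fixes f :: "'a::euclidean_space \<Rightarrow> real"
  shows "L2_sqnorm f = (\<integral>\<^sup>+x. ennreal ((f x)\<^sup>2) \<partial>lborel)"
  by (simp add: L2_sqnorm_def)

text \<open>The standard exit from an estimate carried out in \<open>ennreal\<close>: a finite bound
  gives membership and the real inequality together.\<close>

lemma in_L2I_bound:
  fixes f :: "'a::euclidean_space \<Rightarrow> real"
  assumes "f \<in> borel_measurable borel" "L2_sqnorm f \<le> ennreal c" "0 \<le> c"
  shows "in_L2 f" "sq f \<le> c"
proof -
  show f: "in_L2 f" using assms by (auto simp: in_L2_def intro: le_less_trans)
  show "sq f \<le> c" using assms L2_sqnorm_eq_sq[OF f] by simp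
qed

lemma in_L2_mult_integrable:
  fixes f g :: "'a::euclidean_space \<Rightarrow> real"
  assumes f: "in_L2 f" and g: "in_L2 g"
  shows "integrable lborel (\<lambda>x. f x * g x)"
proof (rule Bochner_Integration.integrable_bound)
  show "integrable lborel (\<lambda>x. (f x)\<^sup>2 + (g x)\<^sup>2)"
    using f g by (auto simp: in_L2_iff)
  show "(\<lambda>x. f x * g x) \<in> borel_measurable lborel"
    using f g by (auto simp: in_L2_iff)
  show "AE x in lborel. norm (f x * g x) \<le> norm ((f x)\<^sup>2 + (g x)\<^sup>2)"
  proof (rule AE_I2)
    fix x
    have "2 * \<bar>f x\<bar> * \<bar>g x\<bar> \<le> (f x)\<^sup>2 + (g x)\<^sup>2"
      using sum_squares_bound[of "\<bar>f x\<bar>" "\<bar>g x\<bar>"] by simp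
    moreover have "0 \<le> \<bar>f x\<bar> * \<bar>g x\<bar>" by simp
    ultimately have "\<bar>f x\<bar> * \<bar>g x\<bar> \<le> (f x)\<^sup>2 + (g x)\<^sup>2" by linarith
    then show "norm (f x * g x) \<le> norm ((f x)\<^sup>2 + (g x)\<^sup>2)" by (simp add: abs_mult)
  qed
qed

lemma in_L2_add:
  fixes f g :: "'a::euclidean_space \<Rightarrow> real"
  assumes f: "in_L2 f" and g: "in_L2 g"
  shows "in_L2 (\<lambda>x. f x + g x)"
  using f g in_L2_mult_integrable[OF f g] by (auto simp: in_L2_iff power2_sum mult.assoc)

lemma in_L2_cmult:
  fixes f :: "'a::euclidean_space \<Rightarrow> real"
  assumes f: "in_L2 f"
  shows "in_L2 (\<lambda>x. c * f x)"
  using f by (auto simp: in_L2_iff power_mult_distrib)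

lemma in_L2_uminus:
  fixes f :: "'a::euclidean_space \<Rightarrow> real"
  shows "in_L2 f \<Longrightarrow> in_L2 (\<lambda>x. - f x)"
  by (auto simp: in_L2_iff)

lemma in_L2_diff:
  fixes f g :: "'a::euclidean_space \<Rightarrow> real"
  assumes f: "in_L2 f" and g: "in_L2 g"
  shows "in_L2 (\<lambda>x. f x - g x)"
  using in_L2_add[OF f in_L2_uminus[OF g]] by simp

lemma in_L2_zero: "in_L2 (\<lambda>x::'a::euclidean_space. 0::real)"
  by (simp add: in_L2_iff)

lemma in_L2_sum:
  fixes f :: "'i \<Rightarrow> 'a::euclidean_space \<Rightarrow> real"
  assumes "\<And>i. i \<in> I \<Longrightarrow> in_L2 (f i)"
  shows "in_L2 (\<lambda>x. \<Sum>i\<in>I. f i x)"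
  using assms by (induction I rule: infinite_finite_induct) (auto intro: in_L2_zero in_L2_add)

lemma Cauchy_Schwarz_L2:
  fixes f g :: "'a::euclidean_space \<Rightarrow> real"
  assumes f: "in_L2 f" and g: "in_L2 g"
  shows "(LBINT x. f x * g x)\<^sup>2 \<le> sq f * sq g"
    and "(LBINT x. \<bar>f x * g x\<bar>)\<^sup>2 \<le> sq f * sq g"
proof -
  have m [measurable]: "f \<in> borel_measurable borel" "g \<in> borel_measurable borel"
    using f g by (auto simp: in_L2_iff)
  have "(\<integral>\<^sup>+x. ennreal \<bar>f x * g x\<bar> \<partial>lborel)\<^sup>2 \<le> ennreal (sq f * sq g)"
    using Cauchy_Schwarz_nn_integral[of "\<lambda>x. ennreal \<bar>f x\<bar>" lborel "\<lambda>x. ennreal \<bar>g x\<bar>"]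
      L2_sqnorm_eq_sq[OF f] L2_sqnorm_eq_sq[OF g]
    by (simp add: ennreal_mult[symmetric] ennreal_power abs_mult L2_sqnorm_real)
  then show *: "(LBINT x. \<bar>f x * g x\<bar>)\<^sup>2 \<le> sq f * sq g"
    using in_L2_mult_integrable[OF f g]
    by (subst (asm) nn_integral_eq_integral) (auto simp: ennreal_power integral_nonneg)
  have "\<bar>LBINT x. f x * g x\<bar> \<le> (LBINT x. \<bar>f x * g x\<bar>)"
    by (rule integral_abs_bound)
  then have "(LBINT x. f x * g x)\<^sup>2 \<le> (LBINT x. \<bar>f x * g x\<bar>)\<^sup>2"
    by (simp add: abs_le_square_iff[symmetric] integral_nonneg)
  with * show "(LBINT x. f x * g x)\<^sup>2 \<le> sq f * sq g" by simp
qed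

lemma sq_add_le:
  fixes f g :: "'a::euclidean_space \<Rightarrow> real"
  assumes f: "in_L2 f" and g: "in_L2 g"
  shows "sq (\<lambda>x. f x + g x) \<le> 2 * sq f + 2 * sq g"
proof -
  have "sq (\<lambda>x. f x + g x) \<le> (LBINT x. 2 * (f x)\<^sup>2 + 2 * (g x)\<^sup>2)"
    unfolding sq_def
  proof (rule integral_mono)
    show "integrable lborel (\<lambda>x. (f x + g x)\<^sup>2)" using in_L2_add[OF f g] by (simp add: in_L2_iff)
    show "integrable lborel (\<lambda>x. 2 * (f x)\<^sup>2 + 2 * (g x)\<^sup>2)" using f g by (auto simp: in_L2_iff)
    show "(f x + g x)\<^sup>2 \<le> 2 * (f x)\<^sup>2 + 2 * (g x)\<^sup>2" for x
      using sum_squares_bound[of "f x" "g x"] by (simp add: power2_sum)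
  qed
  also have "\<dots> = 2 * sq f + 2 * sq g"
    using f g by (simp add: sq_def in_L2_iff)
  finally show ?thesis .
qed

text \<open>Expanding around the limits leaves three products, each with at least one factor tending
  to 0 in L2, and Cauchy-Schwarz disposes of each.\<close>

lemma tendsto_L2_inner:
  fixes f g :: "'a::euclidean_space \<Rightarrow> real"
  assumes fn: "\<And>n. in_L2 (fn n)" and f: "in_L2 f" and gn: "\<And>n. in_L2 (gn n)" and g: "in_L2 g"
    and lf: "((\<lambda>n. sq (\<lambda>x. fn n x - f x)) \<longlongrightarrow> 0) F" and lg: "((\<lambda>n. sq (\<lambda>x. gn n x - g x)) \<longlongrightarrow> 0) F"
  shows "((\<lambda>n. LBINT x. fn n x * gn n x) \<longlongrightarrow> (LBINT x. f x * g x)) F"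
proof -
  let ?d = "\<lambda>n x. fn n x - f x" and ?e = "\<lambda>n x. gn n x - g x"
  have d: "in_L2 (?d n)" and e: "in_L2 (?e n)" for n
    using in_L2_diff fn f gn g by auto
  have eq: "(LBINT x. fn n x * gn n x) = (LBINT x. f x * g x) +
     ((LBINT x. ?d n x * ?e n x) + (LBINT x. f x * ?e n x) + (LBINT x. ?d n x * g x))" for n
  proof -
    have "(LBINT x. fn n x * gn n x) =
      (LBINT x. f x * g x + (?d n x * ?e n x + f x * ?e n x + ?d n x * g x))"
      by (intro Bochner_Integration.integral_cong) (auto simp: algebra_simps)
    then show ?thesis
      by (simp add: in_L2_mult_integrable d e f g)
  qed
  have null: "((\<lambda>n. LBINT x. p n x * q n x) \<longlongrightarrow> 0) F"
    if p: "\<And>n. in_L2 (p n)" and q: "\<And>n. in_L2 (q n)" and "((\<lambda>n. sq (p n) * sq (q n)) \<longlongrightarrow> 0) F" for p q :: "_ \<Rightarrow> 'a \<Rightarrow> real"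
  proof -
    have "((\<lambda>n. (LBINT x. p n x * q n x)\<^sup>2) \<longlongrightarrow> 0) F"
      by (rule tendsto_sandwich[OF _ _ tendsto_const that(3)])
         (auto intro: always_eventually Cauchy_Schwarz_L2 p q)
    then have "((\<lambda>n. sqrt ((LBINT x. p n x * q n x)\<^sup>2)) \<longlongrightarrow> sqrt 0) F"
      by (rule tendsto_real_sqrt)
    then show ?thesis by (simp add: tendsto_rabs_zero_iff)
  qed
  have "((\<lambda>n. (LBINT x. f x * g x) +
     ((LBINT x. ?d n x * ?e n x) + (LBINT x. f x * ?e n x) + (LBINT x. ?d n x * g x)))
     \<longlongrightarrow> (LBINT x. f x * g x) + (0 + 0 + 0)) F"
    by (intro tendsto_add tendsto_const null d e f g tendsto_mult_right_zero tendsto_mult_left_zero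
        tendsto_mult_zero lf lg)
  then show ?thesis unfolding eq by simp
qed

lemma tendsto_L2_sq:
  fixes f :: "'a::euclidean_space \<Rightarrow> real"
  assumes fn: "\<And>n. in_L2 (fn n)" and f: "in_L2 f"
    and lf: "((\<lambda>n. sq (\<lambda>x. fn n x - f x)) \<longlongrightarrow> 0) F"
  shows "((\<lambda>n. sq (fn n)) \<longlongrightarrow> sq f) F"
  using tendsto_L2_inner[OF fn f fn f lf lf] by (simp add: sq_def power2_eq_square)

section \<open>The class L4\<close>

definition in_L4 :: "('a::euclidean_space \<Rightarrow> real) \<Rightarrow> bool" where
  "in_L4 f \<longleftrightarrow> f \<in> borel_measurable lborel \<and> in_L2 (\<lambda>x. (f x)\<^sup>2)"

abbreviation quart :: "('a::euclidean_space \<Rightarrow> real) \<Rightarrow> real" where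
  "quart f \<equiv> sq (\<lambda>x. (f x)\<^sup>2)"

lemma in_L4_measurable [measurable_dest]: "in_L4 f \<Longrightarrow> f \<in> borel_measurable borel"
  by (simp add: in_L4_def)

text \<open>With L4 encoded as "the square lies in L2", Hoelder's inequality is Cauchy-Schwarz for
  the two squares; \<open>quart\<close> is the fourth power of the L4 norm.\<close>

lemma in_L4_mult:
  assumes f: "in_L4 f" and g: "in_L4 g"
  shows "in_L2 (\<lambda>x. f x * g x)" "(sq (\<lambda>x. f x * g x))\<^sup>2 \<le> quart f * quart g"
proof -
  have [measurable]: "f \<in> borel_measurable borel" "g \<in> borel_measurable borel"
    using f g by (auto dest: in_L4_measurable)
  from f g have 2: "in_L2 (\<lambda>x. (f x)\<^sup>2)" "in_L2 (\<lambda>x. (g x)\<^sup>2)" by (auto simp: in_L4_def)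
  from in_L2_mult_integrable[OF this] show "in_L2 (\<lambda>x. f x * g x)"
    by (simp add: in_L2_iff power_mult_distrib)
  from Cauchy_Schwarz_L2(1)[OF 2] show "(sq (\<lambda>x. f x * g x))\<^sup>2 \<le> quart f * quart g"
    by (simp add: sq_def power_mult_distrib)
qed

lemma in_L4_add:
  assumes f: "in_L4 f" and g: "in_L4 g"
  shows "in_L4 (\<lambda>x. f x + g x)"
proof -
  have [measurable]: "f \<in> borel_measurable borel" "g \<in> borel_measurable borel"
    using f g by (auto dest: in_L4_measurable)
  have "in_L2 (\<lambda>x. (f x)\<^sup>2 + 2 * (f x * g x) + (g x)\<^sup>2)"
    using f g by (intro in_L2_add in_L2_cmult in_L4_mult) (auto simp: in_L4_def)
  then have "in_L2 (\<lambda>x. (f x + g x)\<^sup>2)"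
    by (simp add: power2_sum mult.assoc add_ac)
  then show ?thesis by (simp add: in_L4_def)
qed

lemma in_L4_diff:
  assumes f: "in_L4 f" and g: "in_L4 g"
  shows "in_L4 (\<lambda>x. f x - g x)"
  using in_L4_add[OF f, of "\<lambda>x. - g x"] g by (auto simp: in_L4_def)

text \<open>Combined with \<open>tendsto_L2_inner\<close> this passes to the limit in triple
  products with two L4 factors and one L2 factor, the shape of all nonlinear terms below.\<close>

lemma tendsto_L4_mult:
  assumes fn: "\<And>n. in_L4 (fn n)" and f: "in_L4 f" and gn: "\<And>n. in_L4 (gn n)" and g: "in_L4 g"
    and lf: "((\<lambda>n. quart (\<lambda>x. fn n x - f x)) \<longlongrightarrow> 0) F" and lg: "((\<lambda>n. quart (\<lambda>x. gn n x - g x)) \<longlongrightarrow> 0) F"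
  shows "((\<lambda>n. sq (\<lambda>x. fn n x * gn n x - f x * g x)) \<longlongrightarrow> 0) F"
proof -
  let ?d = "\<lambda>n x. fn n x - f x" and ?e = "\<lambda>n x. gn n x - g x"
  have d: "in_L4 (?d n)" and e: "in_L4 (?e n)" for n
    using in_L4_diff fn f gn g by auto
  have null: "((\<lambda>n. sq (\<lambda>x. p n x * q n x)) \<longlongrightarrow> 0) F"
    if p: "\<And>n. in_L4 (p n)" and q: "\<And>n. in_L4 (q n)" and "((\<lambda>n. quart (p n) * quart (q n)) \<longlongrightarrow> 0) F" for p q :: "_ \<Rightarrow> 'b \<Rightarrow> real"
  proof -
    have "((\<lambda>n. (sq (\<lambda>x. p n x * q n x))\<^sup>2) \<longlongrightarrow> 0) F"
      by (rule tendsto_sandwich[OF _ _ tendsto_const that(3)])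
         (auto intro: always_eventually in_L4_mult p q)
    then have "((\<lambda>n. sqrt ((sq (\<lambda>x. p n x * q n x))\<^sup>2)) \<longlongrightarrow> sqrt 0) F"
      by (rule tendsto_real_sqrt)
    then show ?thesis by simp
  qed
  have b: "sq (\<lambda>x. fn n x * gn n x - f x * g x) \<le> 2 * (2 * sq (\<lambda>x. ?d n x * ?e n x) + 2 * sq (\<lambda>x. f x * ?e n x)) + 2 * sq (\<lambda>x. ?d n x * g x)" for n
  proof -
    have "(\<lambda>x. fn n x * gn n x - f x * g x) = (\<lambda>x. (?d n x * ?e n x + f x * ?e n x) + ?d n x * g x)"
      by (auto simp: algebra_simps)
    then have "sq (\<lambda>x. fn n x * gn n x - f x * g x) = sq (\<lambda>x. (?d n x * ?e n x + f x * ?e n x) + ?d n x * g x)"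
      by (rule arg_cong)
    moreover have "sq (\<lambda>x. (?d n x * ?e n x + f x * ?e n x) + ?d n x * g x)
        \<le> 2 * sq (\<lambda>x. ?d n x * ?e n x + f x * ?e n x) + 2 * sq (\<lambda>x. ?d n x * g x)"
      by (intro sq_add_le in_L2_add in_L4_mult(1) d e f g)
    moreover have "sq (\<lambda>x. ?d n x * ?e n x + f x * ?e n x) \<le> 2 * sq (\<lambda>x. ?d n x * ?e n x) + 2 * sq (\<lambda>x. f x * ?e n x)"
      by (intro sq_add_le in_L2_add in_L4_mult(1) d e f g)
    moreover have "a \<le> 2 * (2 * e + 2 * e') + 2 * d" if "a = b" "b \<le> 2 * c + 2 * d" "c \<le> 2 * e + 2 * e'"
      for a b c d e e' :: real
      using that by simp
    ultimately show ?thesis by blast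
  qed
  have "((\<lambda>n. 2 * (2 * sq (\<lambda>x. ?d n x * ?e n x) + 2 * sq (\<lambda>x. f x * ?e n x)) + 2 * sq (\<lambda>x. ?d n x * g x)) \<longlongrightarrow> 2 * (2 * 0 + 2 * 0) + 2 * 0) F"
    by (intro tendsto_add tendsto_mult tendsto_const null d e f g tendsto_mult_right_zero tendsto_mult_left_zero
        tendsto_mult_zero lf lg)
  then show ?thesis
    by (intro tendsto_zero_bound[OF _ b]) simp_all
qed

section \<open>Continuity of translations\<close>

definition L1_translation :: "('a::euclidean_space \<Rightarrow> real) \<Rightarrow> 'a \<Rightarrow> real" where
  "L1_translation f z = (LBINT x. \<bar>f (x - z) - f x\<bar>)"

lemma integrable_translation_diff:
  fixes f :: "'a::euclidean_space \<Rightarrow> real"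
  shows "integrable lborel f \<Longrightarrow> integrable lborel (\<lambda>x. \<bar>f (x - z) - f x\<bar>)"
  by (intro integrable_abs Bochner_Integration.integrable_diff integrable_lborel_shift)

lemma L1_translation_nonneg: "0 \<le> L1_translation f z"
  by (simp add: L1_translation_def)

lemma L1_translation_approx:
  fixes f g :: "'a::euclidean_space \<Rightarrow> real"
  assumes f: "integrable lborel f" and g: "integrable lborel g"
  shows "L1_translation f z \<le> L1_translation g z + 2 * (LBINT x. \<bar>f x - g x\<bar>)"
proof -
  have fg: "integrable lborel (\<lambda>x. \<bar>f x - g x\<bar>)" using f g by auto
  have "L1_translation f z \<le> (LBINT x. \<bar>g (x - z) - g x\<bar> + (\<bar>f (x - z) - g (x - z)\<bar> + \<bar>f x - g x\<bar>))"
    unfolding L1_translation_def using f g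
    by (intro integral_mono integrable_translation_diff Bochner_Integration.integrable_add
        integrable_lborel_shift(1)[OF fg, of z] fg) auto
  also have "\<dots> = L1_translation g z + ((LBINT x. \<bar>f (x - z) - g (x - z)\<bar>) + (LBINT x. \<bar>f x - g x\<bar>))"
    unfolding L1_translation_def
    using integrable_translation_diff[OF g, of z] integrable_lborel_shift(1)[OF fg, of z] fg by simp
  also have "(LBINT x. \<bar>f (x - z) - g (x - z)\<bar>) = (LBINT x. \<bar>f x - g x\<bar>)"
    using integral_lborel_shift(1)[of "\<lambda>x. \<bar>f x - g x\<bar>" z] fg by auto
  finally show ?thesis by simp
qed

text \<open>By \<open>L1_translation_approx\<close> the error of replacing f by g is at most twice
  their L1 distance, uniformly in the shift; hence the property is closed in L1.\<close>

lemma L1_translation_tendsto_closure: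
  fixes f :: "'a::euclidean_space \<Rightarrow> real"
  assumes f: "integrable lborel f" and X: "X \<longlonglongrightarrow> (0::'a)"
    and approx: "\<And>e. e > 0 \<Longrightarrow> \<exists>g. integrable lborel g \<and> (LBINT x. \<bar>f x - g x\<bar>) \<le> e \<and>
        (\<lambda>n. L1_translation g (X n)) \<longlonglongrightarrow> 0"
  shows "(\<lambda>n. L1_translation f (X n)) \<longlonglongrightarrow> 0"
proof (rule LIMSEQ_I)
  fix r :: real assume "r > 0"
  with approx[of "r / 4"] obtain g where g: "integrable lborel g" "(LBINT x. \<bar>f x - g x\<bar>) \<le> r / 4"
    "(\<lambda>n. L1_translation g (X n)) \<longlonglongrightarrow> 0" by auto
  from LIMSEQ_D[OF g(3), of "r / 2"] \<open>r > 0\<close> obtain N where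
    N: "\<And>n. n \<ge> N \<Longrightarrow> \<bar>L1_translation g (X n)\<bar> < r / 2" by auto
  have "norm (L1_translation f (X n) - 0) < r" if "n \<ge> N" for n
    using L1_translation_approx[OF f g(1), of "X n"] N[OF that] g(2) L1_translation_nonneg[of f "X n"]
    by (simp add: abs_less_iff)
  then show "\<exists>N. \<forall>n\<ge>N. norm (L1_translation f (X n) - 0) < r" by blast
qed

text \<open>Translation preserves the integral of the indicator, so mass gained equals mass lost and
  only points x of \<open>U\<close> with x - z outside \<open>U\<close> need counting. Their
  indicator is dominated by that of \<open>U\<close> and vanishes eventually at each point because
  \<open>U\<close> is open.\<close>

lemma L1_translation_open:
  fixes U :: "'a::euclidean_space set"
  assumes U: "open U" "emeasure lborel U < \<infinity>" and X: "X \<longlonglongrightarrow> (0::'a)"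
  shows "(\<lambda>n. L1_translation (indicator U) (X n)) \<longlonglongrightarrow> 0"
proof -
  let ?i = "indicator U :: 'a \<Rightarrow> real"
  have [measurable]: "U \<in> sets borel" using U by auto
  have int: "integrable lborel ?i" using U by simp
  have eq: "L1_translation ?i z = 2 * (LBINT x. max 0 (?i x - ?i (x - z)))" for z
  proof -
    have i2: "integrable lborel (\<lambda>x. max 0 (?i x - ?i (x - z)))"
      using int integrable_lborel_shift(1)[OF int, of z] by auto
    have "L1_translation ?i z = (LBINT x. 2 * max 0 (?i x - ?i (x - z)) + (?i (x - z) - ?i x))"
      unfolding L1_translation_def
      by (intro Bochner_Integration.integral_cong) (auto simp: indicator_def)
    also have "\<dots> = 2 * (LBINT x. max 0 (?i x - ?i (x - z))) + ((LBINT x. ?i (x - z)) - (LBINT x. ?i x))"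
      using i2 int integrable_lborel_shift(1)[OF int, of z] by simp
    finally show ?thesis using integral_lborel_shift(1)[of ?i z] by simp
  qed
  have "(\<lambda>n. LBINT x. max 0 (?i x - ?i (x - X n))) \<longlonglongrightarrow> (LBINT x::'a. (0::real))"
  proof (rule integral_dominated_convergence[where w="?i"])
    show "AE x in lborel. (\<lambda>n. max 0 (?i x - ?i (x - X n))) \<longlonglongrightarrow> 0"
    proof (rule AE_I2)
      fix x
      show "(\<lambda>n. max 0 (?i x - ?i (x - X n))) \<longlonglongrightarrow> 0"
      proof (cases "x \<in> U")
        case True
        have "(\<lambda>n. x - X n) \<longlonglongrightarrow> x - 0" by (intro tendsto_intros X)
        then have "eventually (\<lambda>n. x - X n \<in> U) sequentially"
          using U(1) True by (auto simp: tendsto_def)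
        then have "eventually (\<lambda>n. max 0 (?i x - ?i (x - X n)) = 0) sequentially"
          by eventually_elim (use True in auto)
        then show ?thesis by (rule tendsto_eventually)
      qed (auto simp: indicator_def)
    qed
    show "AE x in lborel. norm (max 0 (?i x - ?i (x - X n))) \<le> ?i x" for n
      by (auto split: split_indicator)
  qed (use int in auto)
  then show ?thesis unfolding eq by (auto intro: tendsto_mult_right_zero)
qed

text \<open>Open sets are handled by \<open>L1_translation_open\<close>; outer regularity extends
  this to sets of finite measure, and the induction rule for integrable functions adds linear
  combinations and dominated limits.\<close>

lemma L1_translation_tendsto:
  fixes f :: "'a::euclidean_space \<Rightarrow> real"
  assumes f: "integrable lborel f" and X: "X \<longlonglongrightarrow> (0::'a)"
  shows "(\<lambda>n. L1_translation f (X n)) \<longlonglongrightarrow> 0"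
  using f
proof (induction rule: integrable_induct)
  case (base A c)
  then have [measurable]: "A \<in> sets borel" by simp
  have "(\<lambda>n. L1_translation (indicator A :: 'a \<Rightarrow> real) (X n)) \<longlonglongrightarrow> 0"
  proof (rule L1_translation_tendsto_closure[OF _ X])
    show "integrable lborel (indicator A :: 'a \<Rightarrow> real)" using base by simp
    fix e :: real assume "e > 0"
    from outer_regular_lborel[OF _ this, of A] obtain U where
      U: "open U" "A \<subseteq> U" "emeasure lborel (U - A) < ennreal e" by auto
    have [measurable]: "U \<in> sets borel" using U by simp
    have "emeasure lborel U = emeasure lborel A + emeasure lborel (U - A)"
      using U by (subst plus_emeasure) (auto simp: Un_absorb1)
    also have "\<dots> < \<infinity>" using U(3) base by (auto simp: less_top[symmetric] intro: less_trans)
    finally have fin: "emeasure lborel U < \<infinity>" .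
    have "(LBINT x. \<bar>indicator A x - indicator U x :: real\<bar>) = (LBINT x. indicator (U - A) x)"
      using U(2) by (intro Bochner_Integration.integral_cong) (auto split: split_indicator)
    also have "\<dots> = measure lborel (U - A)" by simp
    also have "\<dots> \<le> e" using U(3) \<open>e > 0\<close> by (simp add: measure_def enn2real_leI less_imp_le)
    finally show "\<exists>g. integrable lborel g \<and> (LBINT x. \<bar>indicator A x - g x\<bar>) \<le> e \<and>
        (\<lambda>n. L1_translation g (X n)) \<longlonglongrightarrow> 0"
      using L1_translation_open[OF U(1) fin X] fin
      by (intro exI[of _ "indicator U"]) simp
  qed
  then have "(\<lambda>n. \<bar>c\<bar> * L1_translation (indicator A :: 'a \<Rightarrow> real) (X n)) \<longlonglongrightarrow> 0"
    by (rule tendsto_mult_right_zero)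
  moreover have "L1_translation (\<lambda>x. indicator A x *\<^sub>R c) z = \<bar>c\<bar> * L1_translation (indicator A :: 'a \<Rightarrow> real) z" for z
    by (simp add: L1_translation_def left_diff_distrib[symmetric] abs_mult mult.commute[of _ "\<bar>c\<bar>"])
  ultimately show ?case by simp
next
  case (add f g)
  have "L1_translation (\<lambda>x. f x + g x) z \<le> L1_translation f z + L1_translation g z" for z
  proof -
    have "L1_translation (\<lambda>x. f x + g x) z \<le> (LBINT x. \<bar>f (x - z) - f x\<bar> + \<bar>g (x - z) - g x\<bar>)"
      unfolding L1_translation_def
      by (intro integral_mono integrable_translation_diff[of "\<lambda>x. f x + g x"] Bochner_Integration.integrable_add
          integrable_translation_diff add) auto
    also have "\<dots> = L1_translation f z + L1_translation g z"
      unfolding L1_translation_def using integrable_translation_diff add by (subst Bochner_Integration.integral_add) auto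
    finally show ?thesis .
  qed
  then show ?case
    by (intro tendsto_zero_bound[OF L1_translation_nonneg _ tendsto_add_zero[OF add(3,4)]])
next
  case (lim f s)
  show ?case
  proof (rule L1_translation_tendsto_closure[OF lim(4) X])
    fix e :: real assume "e > 0"
    have "(\<lambda>i. LBINT x. \<bar>f x - s i x\<bar>) \<longlonglongrightarrow> (LBINT x::'a. (0::real))"
    proof (rule integral_dominated_convergence[where w="\<lambda>x. 3 * \<bar>f x\<bar>"])
      show "AE x in lborel. (\<lambda>i. \<bar>f x - s i x\<bar>) \<longlonglongrightarrow> 0"
      proof (rule AE_I2)
        fix x
        have "(\<lambda>i. \<bar>f x - s i x\<bar>) \<longlonglongrightarrow> \<bar>f x - f x\<bar>"
          using lim(2) by (intro tendsto_intros) auto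
        then show "(\<lambda>i. \<bar>f x - s i x\<bar>) \<longlonglongrightarrow> 0" by simp
      qed
      show "AE x in lborel. norm \<bar>f x - s i x\<bar> \<le> 3 * \<bar>f x\<bar>" for i
      proof (rule AE_I2)
        fix x :: 'a
        have "\<bar>s i x\<bar> \<le> 2 * \<bar>f x\<bar>" using lim(3)[of x i] by simp
        then show "norm \<bar>f x - s i x\<bar> \<le> 3 * \<bar>f x\<bar>" by simp
      qed
    qed (use lim(1,4) in auto)
    then have "(\<lambda>i. LBINT x. \<bar>f x - s i x\<bar>) \<longlonglongrightarrow> 0" by simp
    from LIMSEQ_D[OF this \<open>e > 0\<close>] obtain i where "\<bar>LBINT x. \<bar>f x - s i x\<bar>\<bar> < e" by auto
    then show "\<exists>g. integrable lborel g \<and> (LBINT x. \<bar>f x - g x\<bar>) \<le> e \<and>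
        (\<lambda>n. L1_translation g (X n)) \<longlonglongrightarrow> 0"
      using lim(1,5) by (intro exI[of _ "s i"]) auto
  qed
qed

text \<open>The signed square \<open>f * \<bar>f\<bar>\<close> lies in L1 when f lies in L2, and in
  L2 when f lies in L4. This inequality therefore derives continuity of translations in L2 from L1,
  and in L4 from L2. The factor 2 is used for arguments of opposite sign.\<close>

lemma signed_square_diff: "(a - b)\<^sup>2 \<le> 2 * \<bar>a * \<bar>a\<bar> - b * \<bar>b\<bar>\<bar>" for a b :: real
proof -
  have same: "(a - b)\<^sup>2 \<le> 2 * \<bar>a * a - b * b\<bar>" if "0 \<le> a" "0 \<le> b" for a b :: real
  proof -
    have "(a - b)\<^sup>2 = \<bar>a - b\<bar> * \<bar>a - b\<bar>" by (simp add: power2_eq_square)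
    also have "\<dots> \<le> \<bar>a - b\<bar> * \<bar>a + b\<bar>" using that by (intro mult_left_mono) auto
    also have "\<dots> = \<bar>a * a - b * b\<bar>" by (simp add: abs_mult[symmetric] algebra_simps)
    also have "\<dots> \<le> 2 * \<bar>a * a - b * b\<bar>" by simp
    finally show ?thesis .
  qed
  have opp: "(a + b)\<^sup>2 \<le> 2 * (a * a + b * b)" for a b :: real
    using sum_squares_bound[of a b] by (simp add: power2_eq_square algebra_simps)
  consider "0 \<le> a" "0 \<le> b" | "a \<le> 0" "b \<le> 0" | "0 \<le> a" "b \<le> 0" | "a \<le> 0" "0 \<le> b" by linarith
  then show ?thesis
  proof cases
    case 1 then show ?thesis using same[of a b] by simp
  next
    case 2 then show ?thesis using same[of "-a" "-b"] by (simp add: power2_commute abs_minus_commute)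
  next
    case 3 then show ?thesis using opp[of a "-b"] by simp
  next
    case 4
    then have "a * \<bar>a\<bar> - b * \<bar>b\<bar> = - (a * a + b * b)" by (simp add: abs_of_nonpos)
    then have "\<bar>a * \<bar>a\<bar> - b * \<bar>b\<bar>\<bar> = a * a + b * b" by (simp only: abs_minus) simp
    then show ?thesis using opp[of "-a" b] by (simp add: power2_commute)
  qed
qed

lemma in_L2_shift:
  fixes f :: "'a::euclidean_space \<Rightarrow> real"
  assumes "in_L2 f"
  shows "in_L2 (\<lambda>x. f (x - z))" "in_L2 (\<lambda>x. f (z - x))" "in_L2 (\<lambda>x. f (x + z))"
  using assms integrable_lborel_shift[of "\<lambda>x. (f x)\<^sup>2" z] by (auto simp: in_L2_iff)

lemma sq_shift:
  fixes f :: "'a::euclidean_space \<Rightarrow> real"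
  assumes [measurable]: "f \<in> borel_measurable borel"
  shows "sq (\<lambda>x. f (x - z)) = sq f" "sq (\<lambda>x. f (z - x)) = sq f" "sq (\<lambda>x. f (x + z)) = sq f"
  unfolding sq_def using integral_lborel_shift[of "\<lambda>x. (f x)\<^sup>2" z] by auto

lemma L2_translation_tendsto:
  fixes f :: "'a::euclidean_space \<Rightarrow> real"
  assumes f: "in_L2 f" and X: "X \<longlonglongrightarrow> (0::'a)"
  shows "(\<lambda>n. sq (\<lambda>x. f (x - X n) - f x)) \<longlonglongrightarrow> 0"
proof -
  let ?g = "\<lambda>x. f x * \<bar>f x\<bar>"
  have [measurable]: "f \<in> borel_measurable borel" using f by (rule in_L2_measurable)
  have g: "integrable lborel ?g"
    using in_L2_integrable[OF f] by (rule Bochner_Integration.integrable_bound) (auto simp: power2_eq_square abs_mult)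
  have "sq (\<lambda>x. f (x - z) - f x) \<le> 2 * L1_translation ?g z" for z
  proof -
    have "sq (\<lambda>x. f (x - z) - f x) \<le> (LBINT x. 2 * \<bar>?g (x - z) - ?g x\<bar>)"
      unfolding sq_def
      by (intro integral_mono in_L2_integrable in_L2_diff f in_L2_shift integrable_mult_right
          integrable_translation_diff[OF g, simplified] signed_square_diff)
    then show ?thesis by (simp add: L1_translation_def)
  qed
  then show ?thesis
    by (intro tendsto_zero_bound[OF sq_nonneg _ tendsto_mult_right_zero[OF L1_translation_tendsto[OF g X]]])
qed

lemma L4_translation_tendsto:
  fixes f :: "'a::euclidean_space \<Rightarrow> real"
  assumes f: "in_L4 f" and X: "X \<longlonglongrightarrow> (0::'a)"
  shows "(\<lambda>n. quart (\<lambda>x. f (x - X n) - f x)) \<longlonglongrightarrow> 0"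
proof -
  let ?g = "\<lambda>x. f x * \<bar>f x\<bar>"
  have [measurable]: "f \<in> borel_measurable borel" using f by (rule in_L4_measurable)
  have g: "in_L2 ?g"
    using f by (auto simp: in_L4_def in_L2_iff power_mult_distrib)
  have shift: "in_L4 (\<lambda>x. f (x - z))" for z
    using f in_L2_shift(1)[of "\<lambda>x. (f x)\<^sup>2" z] by (auto simp: in_L4_def)
  have "quart (\<lambda>x. f (x - z) - f x) \<le> 4 * sq (\<lambda>x. ?g (x - z) - ?g x)" for z
  proof -
    have "quart (\<lambda>x. f (x - z) - f x) \<le> (LBINT x. 4 * (?g (x - z) - ?g x)\<^sup>2)"
      unfolding sq_def
    proof (rule integral_mono)
      show "integrable lborel (\<lambda>x. ((f (x - z) - f x)\<^sup>2)\<^sup>2)"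
        using in_L4_diff[OF shift f] by (simp add: in_L4_def in_L2_iff)
      show "integrable lborel (\<lambda>x. 4 * (?g (x - z) - ?g x)\<^sup>2)"
        using in_L2_diff[OF in_L2_shift(1)[OF g] g] by (simp add: in_L2_iff)
      show "((f (x - z) - f x)\<^sup>2)\<^sup>2 \<le> 4 * (?g (x - z) - ?g x)\<^sup>2" for x
      proof -
        have "((f (x - z) - f x)\<^sup>2)\<^sup>2 \<le> (2 * \<bar>?g (x - z) - ?g x\<bar>)\<^sup>2"
          by (intro power_mono signed_square_diff) auto
        then show ?thesis by (simp add: power_mult_distrib)
      qed
    qed
    then show ?thesis by (simp add: sq_def)
  qed
  then show ?thesis
    by (intro tendsto_zero_bound[OF sq_nonneg _ tendsto_mult_right_zero[OF L2_translation_tendsto[OF g X]]])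
qed

lemma L2_translation_bound:
  fixes f :: "'a::euclidean_space \<Rightarrow> real"
  assumes f: "in_L2 f"
  shows "sq (\<lambda>x. f (x - z) - f x) \<le> 4 * sq f"
  using sq_add_le[OF in_L2_shift(1)[OF f, of z] in_L2_uminus[OF f]] sq_shift(1)[of f z] in_L2_measurable[OF f]
  by (simp add: sq_def)

section \<open>Convolution\<close>

definition kernel :: "('a::euclidean_space \<Rightarrow> real) \<Rightarrow> bool" where
  "kernel k \<longleftrightarrow> continuous_on UNIV k \<and> (\<exists>R. \<forall>x. R < norm x \<longrightarrow> k x = 0)"

lemma kernel_measurable [measurable_dest]: "kernel k \<Longrightarrow> k \<in> borel_measurable borel"
  by (auto simp: kernel_def intro: borel_measurable_continuous_onI)

lemma kernel_integrable:
  fixes k :: "'a::euclidean_space \<Rightarrow> real"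
  assumes "kernel k" shows "integrable lborel k"
proof -
  from assms obtain R where c: "continuous_on UNIV k" and R: "\<And>x. R < norm x \<Longrightarrow> k x = 0"
    by (auto simp: kernel_def)
  have "integrable lborel (\<lambda>x. indicator (cball 0 R) x *\<^sub>R k x)"
    by (rule borel_integrable_compact) (use c in \<open>auto intro: continuous_on_subset\<close>)
  moreover have "(\<lambda>x. indicator (cball 0 R) x *\<^sub>R k x) = k"
    using R by (force simp: indicator_def)
  ultimately show ?thesis by simp
qed

lemma kernel_mult: "kernel k \<Longrightarrow> continuous_on UNIV f \<Longrightarrow> kernel (\<lambda>x. k x * f x)"
  by (auto simp: kernel_def intro: continuous_on_mult)

lemma kernel_in_L2: "kernel k \<Longrightarrow> in_L2 k"
  using kernel_integrable[OF kernel_mult[of k k]]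
  by (auto simp: in_L2_iff power2_eq_square kernel_def intro: borel_measurable_continuous_onI)

lemma kernel_reflect:
  fixes k :: "'a::euclidean_space \<Rightarrow> real"
  assumes "kernel k" shows "kernel (\<lambda>x. k (a - x))"
proof -
  from assms obtain R where c: "continuous_on UNIV k" and R: "\<And>x. R < norm x \<Longrightarrow> k x = 0"
    by (auto simp: kernel_def)
  have "continuous_on UNIV (\<lambda>x. k (a - x))"
    by (rule continuous_on_compose2[OF c]) (auto intro: continuous_intros)
  moreover have "k (a - x) = 0" if "R + norm a < norm x" for x
    using that norm_triangle_ineq2[of x a] by (intro R) (simp add: norm_minus_commute)
  ultimately show ?thesis by (auto simp: kernel_def)
qed

lemma kernel_bounded:
  fixes k :: "'a::euclidean_space \<Rightarrow> real"
  assumes "kernel k" obtains B where "B > 0" "\<And>x. \<bar>k x\<bar> \<le> B"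
proof -
  from assms obtain R where c: "continuous_on UNIV k" and R: "\<And>x. R < norm x \<Longrightarrow> k x = 0"
    by (auto simp: kernel_def)
  have "compact (k ` cball 0 R)"
    by (rule compact_continuous_image) (use c in \<open>auto intro: continuous_on_subset\<close>)
  then obtain B where B: "B > 0" "\<And>x. x \<in> cball 0 R \<Longrightarrow> \<bar>k x\<bar> \<le> B"
    by (auto dest!: compact_imp_bounded simp: bounded_pos)
  have "\<bar>k x\<bar> \<le> B" for x
    using B R[of x] by (cases "R < norm x") auto
  with B(1) that show ?thesis by blast
qed

definition conv :: "('a::euclidean_space \<Rightarrow> real) \<Rightarrow> ('a \<Rightarrow> real) \<Rightarrow> 'a \<Rightarrow> real" where
  "conv k f x = (LBINT y. k (x - y) * f y)"

lemma conv_measurable [measurable]: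
  assumes [measurable]: "k \<in> borel_measurable borel" "f \<in> borel_measurable borel"
  shows "conv k f \<in> borel_measurable borel"
  unfolding conv_def[abs_def] by measurable

text \<open>Under this condition the integral in \<open>conv\<close> converges for each kernel at
  each point and never takes its default value, so linearity and differentiation under the integral
  hold everywhere rather than almost everywhere.\<close>

definition conv_ok :: "('a::euclidean_space \<Rightarrow> real) \<Rightarrow> bool" where
  "conv_ok f \<longleftrightarrow> f \<in> borel_measurable borel \<and> (\<forall>k x. kernel k \<longrightarrow> integrable lborel (\<lambda>y. k (x - y) * f y))"

lemma conv_okD: "conv_ok f \<Longrightarrow> kernel k \<Longrightarrow> integrable lborel (\<lambda>y. k (x - y) * f y)"
  by (simp add: conv_ok_def)

lemma conv_ok_measurable [measurable_dest]: "conv_ok f \<Longrightarrow> f \<in> borel_measurable borel"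
  by (simp add: conv_ok_def)

lemma conv_ok_L2: "in_L2 f \<Longrightarrow> conv_ok f"
  by (auto simp: conv_ok_def intro!: in_L2_mult_integrable kernel_in_L2 kernel_reflect dest: in_L2_measurable)

lemma conv_add: "conv_ok f \<Longrightarrow> conv_ok g \<Longrightarrow> kernel k \<Longrightarrow> conv k (\<lambda>x. f x + g x) x = conv k f x + conv k g x"
  by (simp add: conv_def distrib_left conv_okD)

section \<open>Young's inequalities for convolutions\<close>

lemma weighted_Cauchy_Schwarz:
  fixes k :: "'a \<Rightarrow> real" and h :: "'a \<Rightarrow> ennreal"
  assumes [measurable]: "k \<in> borel_measurable M" "h \<in> borel_measurable M"
  shows "(\<integral>\<^sup>+x. ennreal \<bar>k x\<bar> * h x \<partial>M)\<^sup>2 \<le> (\<integral>\<^sup>+x. ennreal \<bar>k x\<bar> \<partial>M) * (\<integral>\<^sup>+x. ennreal \<bar>k x\<bar> * (h x)\<^sup>2 \<partial>M)"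
proof -
  have s: "ennreal (sqrt \<bar>c\<bar>) * ennreal (sqrt \<bar>c\<bar>) = ennreal \<bar>c\<bar>" for c
    by (simp add: ennreal_mult[symmetric])
  have s1: "ennreal (sqrt \<bar>c\<bar>) * (ennreal (sqrt \<bar>c\<bar>) * t) = ennreal \<bar>c\<bar> * t" for c t
    by (simp only: mult.assoc[symmetric] s)
  have s2: "(ennreal (sqrt \<bar>c\<bar>))\<^sup>2 = ennreal \<bar>c\<bar>" for c
    by (simp only: power2_eq_square s)
  have "(\<integral>\<^sup>+x. ennreal (sqrt \<bar>k x\<bar>) * (ennreal (sqrt \<bar>k x\<bar>) * h x) \<partial>M)\<^sup>2 \<le>
    (\<integral>\<^sup>+x. (ennreal (sqrt \<bar>k x\<bar>))\<^sup>2 \<partial>M) * (\<integral>\<^sup>+x. (ennreal (sqrt \<bar>k x\<bar>) * h x)\<^sup>2 \<partial>M)"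
    by (rule Cauchy_Schwarz_nn_integral) auto
  then show ?thesis unfolding power_mult_distrib s2 s1 .
qed

text \<open>Free of hypotheses: where the defining integral diverges, \<open>conv\<close> has the
  default value 0 and the bound is trivial.\<close>

lemma conv_le_nn:
  fixes k f :: "'a::euclidean_space \<Rightarrow> real"
  shows "ennreal \<bar>conv k f x\<bar> \<le> (\<integral>\<^sup>+y. ennreal \<bar>k (x - y)\<bar> * ennreal \<bar>f y\<bar> \<partial>lborel)"
proof (cases "integrable lborel (\<lambda>y. k (x - y) * f y)")
  case True
  show ?thesis unfolding conv_def
    using integral_norm_bound_ennreal[OF True] by (simp add: abs_mult ennreal_mult)
qed (simp add: conv_def not_integrable_integral_eq)

lemma nn_conv_integral:
  fixes k :: "'a::euclidean_space \<Rightarrow> real" and h :: "'a \<Rightarrow> ennreal"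
  assumes [measurable]: "k \<in> borel_measurable borel" "h \<in> borel_measurable borel"
  shows "(\<integral>\<^sup>+x. \<integral>\<^sup>+y. ennreal \<bar>k (x - y)\<bar> * h y \<partial>lborel \<partial>lborel) = (\<integral>\<^sup>+x. ennreal \<bar>k x\<bar> \<partial>lborel) * (\<integral>\<^sup>+x. h x \<partial>lborel)"
proof -
  have "(\<integral>\<^sup>+x. \<integral>\<^sup>+y. ennreal \<bar>k (x - y)\<bar> * h y \<partial>lborel \<partial>lborel) = (\<integral>\<^sup>+y. \<integral>\<^sup>+x. ennreal \<bar>k (x - y)\<bar> * h y \<partial>lborel \<partial>lborel)"
    by (rule lborel_pair.Fubini') measurable
  also have "\<dots> = (\<integral>\<^sup>+y. (\<integral>\<^sup>+x. ennreal \<bar>k x\<bar> \<partial>lborel) * h y \<partial>lborel)"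
    by (simp add: nn_integral_multc nn_integral_lborel_shift(1)[of "\<lambda>x. ennreal \<bar>k x\<bar>"])
  finally show ?thesis by (simp add: nn_integral_cmult)
qed

lemma nn_conv_sq_le:
  fixes k :: "'a::euclidean_space \<Rightarrow> real" and h :: "'a \<Rightarrow> ennreal"
  assumes [measurable]: "k \<in> borel_measurable borel" "h \<in> borel_measurable borel"
  shows "(\<integral>\<^sup>+y. ennreal \<bar>k (x - y)\<bar> * h y \<partial>lborel)\<^sup>2 \<le> 
    (\<integral>\<^sup>+x. ennreal \<bar>k x\<bar> \<partial>lborel) * (\<integral>\<^sup>+y. ennreal \<bar>k (x - y)\<bar> * (h y)\<^sup>2 \<partial>lborel)"
  using weighted_Cauchy_Schwarz[of "\<lambda>y. k (x - y)" lborel h] nn_integral_lborel_shift(2)[of "\<lambda>y. ennreal \<bar>k y\<bar>" x]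
  by simp

text \<open>Cauchy-Schwarz with weight |k| bounds the square of k * f pointwise by the L1 norm of k
  times the convolution of |k| with f^2; integrating in x by Tonelli supplies the second
  factor.\<close>

lemma conv_Young:
  fixes k f :: "'a::euclidean_space \<Rightarrow> real"
  assumes k: "integrable lborel k" and f: "in_L2 f"
  shows "in_L2 (conv k f)" "sq (conv k f) \<le> (LBINT x. \<bar>k x\<bar>)\<^sup>2 * sq f"
proof -
  have [measurable]: "k \<in> borel_measurable borel" "f \<in> borel_measurable borel"
    using k in_L2_measurable[OF f] by auto
  let ?K = "\<integral>\<^sup>+x. ennreal \<bar>k x\<bar> \<partial>lborel"
  have "L2_sqnorm (conv k f) \<le> (\<integral>\<^sup>+x. ?K * (\<integral>\<^sup>+y. ennreal \<bar>k (x - y)\<bar> * ennreal ((f y)\<^sup>2) \<partial>lborel) \<partial>lborel)"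
    unfolding L2_sqnorm_real
  proof (rule nn_integral_mono)
    fix x
    have "ennreal ((conv k f x)\<^sup>2) = (ennreal \<bar>conv k f x\<bar>)\<^sup>2" by (simp add: ennreal_power)
    also have "\<dots> \<le> (\<integral>\<^sup>+y. ennreal \<bar>k (x - y)\<bar> * ennreal \<bar>f y\<bar> \<partial>lborel)\<^sup>2"
      by (intro power_mono conv_le_nn) auto
    also have "\<dots> \<le> ?K * (\<integral>\<^sup>+y. ennreal \<bar>k (x - y)\<bar> * (ennreal \<bar>f y\<bar>)\<^sup>2 \<partial>lborel)"
      by (rule nn_conv_sq_le) auto
    finally show "ennreal ((conv k f x)\<^sup>2) \<le> ?K * (\<integral>\<^sup>+y. ennreal \<bar>k (x - y)\<bar> * ennreal ((f y)\<^sup>2) \<partial>lborel)"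
      by (simp add: ennreal_power)
  qed
  also have "\<dots> = ?K * (?K * L2_sqnorm f)"
    unfolding L2_sqnorm_real by (subst nn_integral_cmult, measurable) (subst nn_conv_integral, measurable)
  also have "\<dots> = ennreal ((LBINT x. \<bar>k x\<bar>)\<^sup>2 * sq f)"
    using k by (simp add: L2_sqnorm_eq_sq[OF f] nn_integral_eq_integral ennreal_mult[symmetric] integral_nonneg power2_eq_square mult.assoc)
  finally have le: "L2_sqnorm (conv k f) \<le> ennreal ((LBINT x. \<bar>k x\<bar>)\<^sup>2 * sq f)" .
  show "in_L2 (conv k f)" "sq (conv k f) \<le> (LBINT x. \<bar>k x\<bar>)\<^sup>2 * sq f"
    using in_L2I_bound[OF _ le] by simp_all
qed

text \<open>As before with the roles exchanged: the weight is |f|. This is the form for the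
  nonlinearity, which is controlled in L1 only, and it is the source of the factor
  \<open>sq k\<close> in the decay estimate.\<close>

lemma conv_Young_L1:
  fixes k f :: "'a::euclidean_space \<Rightarrow> real"
  assumes k: "in_L2 k" and f: "integrable lborel f"
  shows "in_L2 (conv k f)" "sq (conv k f) \<le> sq k * (LBINT x. \<bar>f x\<bar>)\<^sup>2"
proof -
  have [measurable]: "k \<in> borel_measurable borel" "f \<in> borel_measurable borel"
    using f in_L2_measurable[OF k] by auto
  let ?K = "\<integral>\<^sup>+x. ennreal \<bar>f x\<bar> \<partial>lborel"
  have "L2_sqnorm (conv k f) \<le> (\<integral>\<^sup>+x. ?K * (\<integral>\<^sup>+y. ennreal \<bar>(k (x - y))\<^sup>2\<bar> * ennreal \<bar>f y\<bar> \<partial>lborel) \<partial>lborel)"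
    unfolding L2_sqnorm_real
  proof (rule nn_integral_mono)
    fix x
    have "ennreal ((conv k f x)\<^sup>2) = (ennreal \<bar>conv k f x\<bar>)\<^sup>2" by (simp add: ennreal_power)
    also have "\<dots> \<le> (\<integral>\<^sup>+y. ennreal \<bar>f y\<bar> * ennreal \<bar>k (x - y)\<bar> \<partial>lborel)\<^sup>2"
      using conv_le_nn[of k f x] by (intro power_mono) (auto simp: mult.commute)
    also have "\<dots> \<le> ?K * (\<integral>\<^sup>+y. ennreal \<bar>f y\<bar> * (ennreal \<bar>k (x - y)\<bar>)\<^sup>2 \<partial>lborel)"
      by (rule weighted_Cauchy_Schwarz) auto
    finally show "ennreal ((conv k f x)\<^sup>2) \<le> ?K * (\<integral>\<^sup>+y. ennreal \<bar>(k (x - y))\<^sup>2\<bar> * ennreal \<bar>f y\<bar> \<partial>lborel)"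
      by (simp add: ennreal_power mult.commute)
  qed
  also have "\<dots> = ?K * (L2_sqnorm k * ?K)"
    unfolding L2_sqnorm_real
    using nn_conv_integral[of "\<lambda>x. (k x)\<^sup>2" "\<lambda>y. ennreal \<bar>f y\<bar>"]
    by (subst nn_integral_cmult) auto
  also have "\<dots> = ennreal (sq k * (LBINT x. \<bar>f x\<bar>)\<^sup>2)"
    using f by (simp add: L2_sqnorm_eq_sq[OF k] nn_integral_eq_integral ennreal_mult[symmetric] integral_nonneg power2_eq_square mult_ac)
  finally have le: "L2_sqnorm (conv k f) \<le> ennreal (sq k * (LBINT x. \<bar>f x\<bar>)\<^sup>2)" .
  show "in_L2 (conv k f)" "sq (conv k f) \<le> sq k * (LBINT x. \<bar>f x\<bar>)\<^sup>2"
    using in_L2I_bound[OF _ le] by simp_all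
qed

text \<open>The weighted Cauchy-Schwarz inequality is used twice, which gives K^2 * K = K^3 in front
  of the integrand; Tonelli gives the fourth factor.\<close>

lemma conv_Young_L4:
  fixes k f :: "'a::euclidean_space \<Rightarrow> real"
  assumes k: "integrable lborel k" and f: "in_L4 f"
  shows "in_L4 (conv k f)" "quart (conv k f) \<le> (LBINT x. \<bar>k x\<bar>)^4 * quart f"
proof -
  have [measurable]: "k \<in> borel_measurable borel" "f \<in> borel_measurable borel"
    using k in_L4_measurable[OF f] by auto
  have f2: "in_L2 (\<lambda>x. (f x)\<^sup>2)" using f by (simp add: in_L4_def)
  let ?K = "\<integral>\<^sup>+x. ennreal \<bar>k x\<bar> \<partial>lborel"
  have "L2_sqnorm (\<lambda>x. (conv k f x)\<^sup>2) \<le> (\<integral>\<^sup>+x. ?K ^ 3 * (\<integral>\<^sup>+y. ennreal \<bar>k (x - y)\<bar> * ennreal (((f y)\<^sup>2)\<^sup>2) \<partial>lborel) \<partial>lborel)"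
    unfolding L2_sqnorm_real
  proof (rule nn_integral_mono)
    fix x
    have "ennreal (((conv k f x)\<^sup>2)\<^sup>2) = ((ennreal \<bar>conv k f x\<bar>)\<^sup>2)\<^sup>2" by (simp add: ennreal_power)
    also have "\<dots> \<le> ((\<integral>\<^sup>+y. ennreal \<bar>k (x - y)\<bar> * ennreal \<bar>f y\<bar> \<partial>lborel)\<^sup>2)\<^sup>2"
      by (intro power_mono conv_le_nn) auto
    also have "\<dots> \<le> (?K * (\<integral>\<^sup>+y. ennreal \<bar>k (x - y)\<bar> * (ennreal \<bar>f y\<bar>)\<^sup>2 \<partial>lborel))\<^sup>2"
      by (intro power_mono nn_conv_sq_le) auto
    also have "\<dots> = ?K\<^sup>2 * (\<integral>\<^sup>+y. ennreal \<bar>k (x - y)\<bar> * (ennreal \<bar>f y\<bar>)\<^sup>2 \<partial>lborel)\<^sup>2"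
      by (simp add: power_mult_distrib)
    also have "\<dots> \<le> ?K\<^sup>2 * (?K * (\<integral>\<^sup>+y. ennreal \<bar>k (x - y)\<bar> * ((ennreal \<bar>f y\<bar>)\<^sup>2)\<^sup>2 \<partial>lborel))"
      by (intro mult_left_mono nn_conv_sq_le) auto
    also have "\<dots> = ?K ^ 3 * (\<integral>\<^sup>+y. ennreal \<bar>k (x - y)\<bar> * ((ennreal \<bar>f y\<bar>)\<^sup>2)\<^sup>2 \<partial>lborel)"
      by (simp add: power2_eq_square power3_eq_cube mult.assoc)
    finally show "ennreal (((conv k f x)\<^sup>2)\<^sup>2) \<le> ?K ^ 3 * (\<integral>\<^sup>+y. ennreal \<bar>k (x - y)\<bar> * ennreal (((f y)\<^sup>2)\<^sup>2) \<partial>lborel)"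
      by (simp add: ennreal_power)
  qed
  also have "\<dots> = ?K ^ 3 * (?K * L2_sqnorm (\<lambda>x. (f x)\<^sup>2))"
    unfolding L2_sqnorm_real by (subst nn_integral_cmult, measurable) (subst nn_conv_integral, measurable)
  also have "\<dots> = ennreal ((LBINT x. \<bar>k x\<bar>)^4 * quart f)"
  proof -
    have K: "?K = ennreal (LBINT x. \<bar>k x\<bar>)" using k by (simp add: nn_integral_eq_integral)
    have "c ^ 3 * (c * q) = c ^ 4 * q" for c q :: real by (simp add: eval_nat_numeral)
    then show ?thesis unfolding K L2_sqnorm_eq_sq[OF f2]
      by (simp add: ennreal_power ennreal_mult[symmetric] integral_nonneg)
  qed
  finally have le: "L2_sqnorm (\<lambda>x. (conv k f x)\<^sup>2) \<le> ennreal ((LBINT x. \<bar>k x\<bar>)^4 * quart f)" .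
  show "in_L4 (conv k f)" "quart (conv k f) \<le> (LBINT x. \<bar>k x\<bar>)^4 * quart f"
    using in_L2I_bound[OF _ le] by (simp_all add: in_L4_def)
qed

section \<open>Probability kernels and approximate identities\<close>

definition prob_kernel :: "('a::euclidean_space \<Rightarrow> real) \<Rightarrow> bool" where
  "prob_kernel k \<longleftrightarrow> integrable lborel k \<and> (\<forall>x. 0 \<le> k x) \<and> (LBINT x. k x) = 1"

lemma prob_kernel_nn: "prob_kernel k \<Longrightarrow> (\<integral>\<^sup>+x. ennreal \<bar>k x\<bar> \<partial>lborel) = 1"
  by (simp add: prob_kernel_def nn_integral_eq_integral)

lemma prob_kernel_Jensen:
  assumes k: "prob_kernel k" and [measurable]: "h \<in> borel_measurable borel"
  shows "(\<integral>\<^sup>+x. ennreal \<bar>k x\<bar> * h x \<partial>lborel)\<^sup>2 \<le> (\<integral>\<^sup>+x. ennreal \<bar>k x\<bar> * (h x)\<^sup>2 \<partial>lborel)"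
proof -
  have [measurable]: "k \<in> borel_measurable borel" using k by (auto simp: prob_kernel_def)
  show ?thesis using weighted_Cauchy_Schwarz[of k lborel h] prob_kernel_nn[OF k] by simp
qed

lemma prob_kernel_contraction:
  assumes "prob_kernel k"
  shows "in_L2 f \<Longrightarrow> in_L2 (conv k f)" "in_L2 f \<Longrightarrow> sq (conv k f) \<le> sq f"
    "in_L4 f \<Longrightarrow> in_L4 (conv k f)" "in_L4 f \<Longrightarrow> quart (conv k f) \<le> quart f"
  using assms conv_Young[of k f] conv_Young_L4[of k f] by (auto simp: prob_kernel_def)

text \<open>Unit mass lets \<open>f x\<close> be written as the integral of
  \<open>k z * f x\<close>, so that the error becomes an average of the increments of f.\<close>

lemma conv_minus_le_nn:
  fixes k f :: "'a::euclidean_space \<Rightarrow> real"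
  assumes k: "prob_kernel k" and int: "integrable lborel (\<lambda>y. k (x - y) * f y)"
    and [measurable]: "f \<in> borel_measurable borel"
  shows "ennreal \<bar>conv k f x - f x\<bar> \<le> (\<integral>\<^sup>+z. ennreal \<bar>k z\<bar> * ennreal \<bar>f (x - z) - f x\<bar> \<partial>lborel)"
proof -
  have ki: "integrable lborel k" and [measurable]: "k \<in> borel_measurable borel" and k1: "(LBINT x. k x) = 1"
    using k by (auto simp: prob_kernel_def)
  have i2: "integrable lborel (\<lambda>z. k z * f (x - z))"
    using integrable_lborel_shift(2)[OF int, of x] by simp
  have eq: "conv k f x = (LBINT z. k z * f (x - z))"
    unfolding conv_def using integral_lborel_shift(2)[of "\<lambda>y. k (x - y) * f y" x] by simp
  have i3: "integrable lborel (\<lambda>z. k z * (f (x - z) - f x))"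
    using i2 ki by (simp add: right_diff_distrib)
  have "conv k f x - f x = (LBINT z. k z * (f (x - z) - f x))"
    using i2 ki k1 by (simp add: eq right_diff_distrib)
  then show ?thesis
    using integral_norm_bound_ennreal[OF i3] by (simp add: abs_mult ennreal_mult)
qed

text \<open>Jensen for the probability density k, then Tonelli, so that the squared increment is
  integrated over x first.\<close>

lemma conv_minus_L2:
  fixes k f :: "'a::euclidean_space \<Rightarrow> real"
  assumes k: "prob_kernel k" and int: "\<And>x. integrable lborel (\<lambda>y. k (x - y) * f y)" and f: "in_L2 f"
  shows "L2_sqnorm (\<lambda>x. conv k f x - f x) \<le> (\<integral>\<^sup>+z. ennreal \<bar>k z\<bar> * ennreal (sq (\<lambda>x. f (x - z) - f x)) \<partial>lborel)"
proof -
  have [measurable]: "k \<in> borel_measurable borel" "f \<in> borel_measurable borel"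
    using k in_L2_measurable[OF f] by (auto simp: prob_kernel_def)
  have "L2_sqnorm (\<lambda>x. conv k f x - f x) \<le> (\<integral>\<^sup>+x. \<integral>\<^sup>+z. ennreal \<bar>k z\<bar> * ennreal ((f (x - z) - f x)\<^sup>2) \<partial>lborel \<partial>lborel)"
    unfolding L2_sqnorm_real
  proof (rule nn_integral_mono)
    fix x
    have "ennreal ((conv k f x - f x)\<^sup>2) = (ennreal \<bar>conv k f x - f x\<bar>)\<^sup>2" by (simp add: ennreal_power)
    also have "\<dots> \<le> (\<integral>\<^sup>+z. ennreal \<bar>k z\<bar> * ennreal \<bar>f (x - z) - f x\<bar> \<partial>lborel)\<^sup>2"
      by (intro power_mono conv_minus_le_nn k int) auto
    also have "\<dots> \<le> (\<integral>\<^sup>+z. ennreal \<bar>k z\<bar> * (ennreal \<bar>f (x - z) - f x\<bar>)\<^sup>2 \<partial>lborel)"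
      by (rule prob_kernel_Jensen[OF k]) auto
    finally show "ennreal ((conv k f x - f x)\<^sup>2) \<le> (\<integral>\<^sup>+z. ennreal \<bar>k z\<bar> * ennreal ((f (x - z) - f x)\<^sup>2) \<partial>lborel)"
      by (simp add: ennreal_power)
  qed
  also have "\<dots> = (\<integral>\<^sup>+z. \<integral>\<^sup>+x. ennreal \<bar>k z\<bar> * ennreal ((f (x - z) - f x)\<^sup>2) \<partial>lborel \<partial>lborel)"
    by (rule lborel_pair.Fubini') measurable
  also have "\<dots> = (\<integral>\<^sup>+z. ennreal \<bar>k z\<bar> * ennreal (sq (\<lambda>x. f (x - z) - f x)) \<partial>lborel)"
    using L2_sqnorm_eq_sq[OF in_L2_diff[OF in_L2_shift(1)[OF f] f]]
    by (simp add: nn_integral_cmult L2_sqnorm_real)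
  finally show ?thesis .
qed

lemma conv_minus_L4:
  fixes k f :: "'a::euclidean_space \<Rightarrow> real"
  assumes k: "prob_kernel k" and int: "\<And>x. integrable lborel (\<lambda>y. k (x - y) * f y)" and f: "in_L4 f"
  shows "L2_sqnorm (\<lambda>x. (conv k f x - f x)\<^sup>2) \<le> (\<integral>\<^sup>+z. ennreal \<bar>k z\<bar> * ennreal (quart (\<lambda>x. f (x - z) - f x)) \<partial>lborel)"
proof -
  have [measurable]: "k \<in> borel_measurable borel" "f \<in> borel_measurable borel"
    using k in_L4_measurable[OF f] by (auto simp: prob_kernel_def)
  have d: "in_L2 (\<lambda>x. (f (x - z) - f x)\<^sup>2)" for z
    using in_L4_diff[of "\<lambda>x. f (x - z)" f] in_L2_shift(1)[of "\<lambda>x. (f x)\<^sup>2" z] f by (simp add: in_L4_def)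
  have "L2_sqnorm (\<lambda>x. (conv k f x - f x)\<^sup>2) \<le> (\<integral>\<^sup>+x. \<integral>\<^sup>+z. ennreal \<bar>k z\<bar> * ennreal (((f (x - z) - f x)\<^sup>2)\<^sup>2) \<partial>lborel \<partial>lborel)"
    unfolding L2_sqnorm_real
  proof (rule nn_integral_mono)
    fix x
    have "ennreal (((conv k f x - f x)\<^sup>2)\<^sup>2) = ((ennreal \<bar>conv k f x - f x\<bar>)\<^sup>2)\<^sup>2" by (simp add: ennreal_power)
    also have "\<dots> \<le> ((\<integral>\<^sup>+z. ennreal \<bar>k z\<bar> * ennreal \<bar>f (x - z) - f x\<bar> \<partial>lborel)\<^sup>2)\<^sup>2"
      by (intro power_mono conv_minus_le_nn k int) auto
    also have "\<dots> \<le> (\<integral>\<^sup>+z. ennreal \<bar>k z\<bar> * (ennreal \<bar>f (x - z) - f x\<bar>)\<^sup>2 \<partial>lborel)\<^sup>2"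
      by (intro power_mono prob_kernel_Jensen[OF k]) auto
    also have "\<dots> \<le> (\<integral>\<^sup>+z. ennreal \<bar>k z\<bar> * ((ennreal \<bar>f (x - z) - f x\<bar>)\<^sup>2)\<^sup>2 \<partial>lborel)"
      by (rule prob_kernel_Jensen[OF k]) auto
    finally show "ennreal (((conv k f x - f x)\<^sup>2)\<^sup>2) \<le> (\<integral>\<^sup>+z. ennreal \<bar>k z\<bar> * ennreal (((f (x - z) - f x)\<^sup>2)\<^sup>2) \<partial>lborel)"
      by (simp add: ennreal_power)
  qed
  also have "\<dots> = (\<integral>\<^sup>+z. \<integral>\<^sup>+x. ennreal \<bar>k z\<bar> * ennreal (((f (x - z) - f x)\<^sup>2)\<^sup>2) \<partial>lborel \<partial>lborel)"
    by (rule lborel_pair.Fubini') measurable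
  also have "\<dots> = (\<integral>\<^sup>+z. ennreal \<bar>k z\<bar> * ennreal (quart (\<lambda>x. f (x - z) - f x)) \<partial>lborel)"
    using L2_sqnorm_eq_sq[OF d]
    by (simp add: nn_integral_cmult L2_sqnorm_real)
  finally show ?thesis .
qed

definition approx_identity :: "(nat \<Rightarrow> 'a::euclidean_space \<Rightarrow> real) \<Rightarrow> bool" where
  "approx_identity k \<longleftrightarrow> (\<forall>n. prob_kernel (k n)) \<and>
     (\<forall>d>0. (\<lambda>n. LBINT z. indicator {z. d \<le> norm z} z * k n z) \<longlonglongrightarrow> 0)"

text \<open>Split at radius d: inside, \<open>w\<close> is small and the mass is at most 1; outside,
  \<open>w\<close> is at most \<open>M\<close> and the mass tends to 0. The modulus \<open>w\<close>
  is left abstract so that the L2 and L4 increments share the argument.\<close>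

lemma approx_identity_average:
  fixes w :: "'a::euclidean_space \<Rightarrow> real" and E :: "nat \<Rightarrow> real"
  assumes k: "approx_identity k" and w: "\<And>z. 0 \<le> w z" "\<And>z. w z \<le> M"
    and cont: "\<And>X. X \<longlonglongrightarrow> 0 \<Longrightarrow> (\<lambda>n. w (X n)) \<longlonglongrightarrow> 0"
    and E: "\<And>n. 0 \<le> E n" "\<And>n. ennreal (E n) \<le> (\<integral>\<^sup>+z. ennreal \<bar>k n z\<bar> * ennreal (w z) \<partial>lborel)"
  shows "E \<longlonglongrightarrow> 0"
proof (rule LIMSEQ_I)
  fix r :: real assume r: "r > 0"
  have M: "0 \<le> M" using w[of 0] by simp
  have "(w \<longlongrightarrow> 0) (at 0)"
    unfolding tendsto_at_iff_sequentially using cont by (auto simp: o_def)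
  then have "eventually (\<lambda>z. w z < r / 2) (at 0)" using r w(1) by (auto simp: tendsto_iff dist_real_def elim: eventually_mono dest!: spec[of _ "r/2"])
  then obtain d where d: "d > 0" "\<And>z. z \<noteq> 0 \<Longrightarrow> norm z < d \<Longrightarrow> w z < r / 2"
    by (auto simp: eventually_at dist_norm)
  \<comment> \<open>The punctured limit says nothing about the origin; the hypothesis applied to the
    constant sequence 0 does.\<close>
  have "w 0 = 0"
    using cont[of "\<lambda>n. 0"] by (simp add: LIMSEQ_const_iff)
  have d: "d > 0" "\<And>z. norm z < d \<Longrightarrow> w z \<le> r / 2"
  proof -
    show "w z \<le> r / 2" if "norm z < d" for z
      using d(2)[of z] that \<open>w 0 = 0\<close> r by (cases "z = 0") auto
  qed (fact d(1))
  let ?T = "\<lambda>n. LBINT z. indicator {z. d \<le> norm z} z * k n z"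
  have le: "E n \<le> r / 2 + M * ?T n" for n
  proof -
    have ki: "integrable lborel (k n)" and kp: "\<And>x. 0 \<le> k n x" and k1: "(LBINT x. k n x) = 1"
      and pk: "prob_kernel (k n)"
      using k by (auto simp: approx_identity_def prob_kernel_def)
    have i2: "integrable lborel (\<lambda>z. indicator {z. d \<le> norm z} z * k n z)"
      using ki by (intro integrable_real_mult_indicator[of _ _ "k n", simplified mult.commute]) auto
    have "ennreal (E n) \<le> (\<integral>\<^sup>+z. ennreal (r / 2 * k n z + M * (indicator {z. d \<le> norm z} z * k n z)) \<partial>lborel)"
    proof (rule order_trans[OF E(2)], rule nn_integral_mono)
      fix z
      have "k n z * w z \<le> r / 2 * k n z + M * (indicator {z. d \<le> norm z} z * k n z)"
      proof (cases "norm z < d")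
        case True
        then show ?thesis using mult_right_mono[OF d(2)[OF True] kp[of z]] by (simp add: mult.commute)
      next
        case False
        then have "k n z * w z \<le> M * k n z" using w(2)[of z] kp[of z] by (simp add: mult.commute mult_right_mono)
        moreover have "0 \<le> r / 2 * k n z" using r kp[of z] by simp
        ultimately show ?thesis using False by simp
      qed
      then show "ennreal \<bar>k n z\<bar> * ennreal (w z) \<le> ennreal (r / 2 * k n z + M * (indicator {z. d \<le> norm z} z * k n z))"
        using kp w(1) by (simp add: ennreal_mult[symmetric] ennreal_leI)
    qed
    also have "\<dots> = ennreal (r / 2 + M * ?T n)"
      using ki i2 kp r M k1 by (subst nn_integral_eq_integral) auto
    finally show ?thesis
      using r M kp by (subst (asm) ennreal_le_iff) (auto intro!: add_nonneg_nonneg mult_nonneg_nonneg integral_nonneg)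
  qed
  have "(\<lambda>n. M * ?T n) \<longlonglongrightarrow> 0"
    using k d(1) by (intro tendsto_mult_right_zero) (auto simp: approx_identity_def)
  from LIMSEQ_D[OF this, of "r / 2"] r obtain N where N: "\<And>n. n \<ge> N \<Longrightarrow> \<bar>M * ?T n\<bar> < r / 2" by auto
  have "norm (E n - 0) < r" if "n \<ge> N" for n
    using le[of n] N[OF that] E(1)[of n] by (simp add: abs_less_iff)
  then show "\<exists>N. \<forall>n\<ge>N. norm (E n - 0) < r" by blast
qed

lemma approx_identity_prob: "approx_identity k \<Longrightarrow> prob_kernel (k n)"
  by (simp add: approx_identity_def)

text \<open>Integrability of the convolution integrand is a hypothesis and is not drawn from
  \<open>kernel\<close>, because the Gaussians have no compact support.\<close>

lemma approx_identity_L2: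
  fixes f :: "'a::euclidean_space \<Rightarrow> real"
  assumes k: "approx_identity k" and int: "\<And>n x. integrable lborel (\<lambda>y. k n (x - y) * f y)" and f: "in_L2 f"
  shows "(\<lambda>n. sq (\<lambda>x. conv (k n) f x - f x)) \<longlonglongrightarrow> 0"
proof (rule approx_identity_average[OF k, where w="\<lambda>z. sq (\<lambda>x. f (x - z) - f x)" and M="4 * sq f"])
  fix n
  have pk: "prob_kernel (k n)" using k by (rule approx_identity_prob)
  show "ennreal (sq (\<lambda>x. conv (k n) f x - f x)) \<le> (\<integral>\<^sup>+z. ennreal \<bar>k n z\<bar> * ennreal (sq (\<lambda>x. f (x - z) - f x)) \<partial>lborel)"
    using conv_minus_L2[OF pk int f] L2_sqnorm_eq_sq[OF in_L2_diff[OF prob_kernel_contraction(1)[OF pk f] f]] by simp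
qed (use f in \<open>auto intro: L2_translation_bound L2_translation_tendsto\<close>)

lemma L4_translation_bound:
  fixes f :: "'a::euclidean_space \<Rightarrow> real"
  assumes f: "in_L4 f"
  shows "quart (\<lambda>x. f (x - z) - f x) \<le> 16 * quart f"
proof -
  have [measurable]: "f \<in> borel_measurable borel" using f by (rule in_L4_measurable)
  have f2: "in_L2 (\<lambda>x. (f x)\<^sup>2)" using f by (simp add: in_L4_def)
  have f2s: "in_L2 (\<lambda>x. (f (x - z))\<^sup>2)" using in_L2_shift(1)[OF f2] .
  have "quart (\<lambda>x. f (x - z) - f x) \<le> (LBINT x. 4 * ((f (x - z))\<^sup>2 + (f x)\<^sup>2)\<^sup>2)"
    unfolding sq_def
  proof (rule integral_mono)
    show "integrable lborel (\<lambda>x. ((f (x - z) - f x)\<^sup>2)\<^sup>2)"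
      using in_L4_diff[of "\<lambda>x. f (x - z)" f] f f2s by (simp add: in_L4_def in_L2_iff)
    show "integrable lborel (\<lambda>x. 4 * ((f (x - z))\<^sup>2 + (f x)\<^sup>2)\<^sup>2)"
      using in_L2_add[OF f2s f2] by (simp add: in_L2_iff)
    fix x
    have "(f (x - z) - f x)\<^sup>2 \<le> 2 * ((f (x - z))\<^sup>2 + (f x)\<^sup>2)"
      using sum_squares_bound[of "f (x - z)" "- f x"] by (simp add: power2_diff)
    then have "((f (x - z) - f x)\<^sup>2)\<^sup>2 \<le> (2 * ((f (x - z))\<^sup>2 + (f x)\<^sup>2))\<^sup>2"
      by (rule power_mono) simp
    then show "((f (x - z) - f x)\<^sup>2)\<^sup>2 \<le> 4 * ((f (x - z))\<^sup>2 + (f x)\<^sup>2)\<^sup>2"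
      by (simp only: power_mult_distrib) simp
  qed
  also have "\<dots> = 4 * sq (\<lambda>x. (f (x - z))\<^sup>2 + (f x)\<^sup>2)" by (simp add: sq_def)
  also have "\<dots> \<le> 4 * (2 * quart f + 2 * quart f)"
    using sq_add_le[OF f2s f2] sq_shift(1)[of "\<lambda>x. (f x)\<^sup>2" z] by simp
  finally show ?thesis by simp
qed

lemma approx_identity_L4:
  fixes f :: "'a::euclidean_space \<Rightarrow> real"
  assumes k: "approx_identity k" and int: "\<And>n x. integrable lborel (\<lambda>y. k n (x - y) * f y)" and f: "in_L4 f"
  shows "(\<lambda>n. quart (\<lambda>x. conv (k n) f x - f x)) \<longlonglongrightarrow> 0"
proof (rule approx_identity_average[OF k, where w="\<lambda>z. quart (\<lambda>x. f (x - z) - f x)" and M="16 * quart f"])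
  fix n
  have pk: "prob_kernel (k n)" using k by (rule approx_identity_prob)
  have "in_L4 (\<lambda>x. conv (k n) f x - f x)"
    using in_L4_diff[OF prob_kernel_contraction(3)[OF pk f] f] .
  then show "ennreal (quart (\<lambda>x. conv (k n) f x - f x)) \<le> (\<integral>\<^sup>+z. ennreal \<bar>k n z\<bar> * ennreal (quart (\<lambda>x. f (x - z) - f x)) \<partial>lborel)"
    using conv_minus_L4[OF pk int f] L2_sqnorm_eq_sq[of "\<lambda>x. (conv (k n) f x - f x)\<^sup>2"] by (simp add: in_L4_def)
qed (use f in \<open>auto intro: L4_translation_bound L4_translation_tendsto\<close>)

section \<open>Directional derivatives\<close>

text \<open>Differentiability along the lines in one direction is all that the fundamental theorem
  of calculus requires, and it passes from a kernel to its convolutions without any total derivative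
  of the latter.\<close>

definition dir_deriv :: "'a::euclidean_space \<Rightarrow> ('a \<Rightarrow> 'b::real_normed_vector) \<Rightarrow> ('a \<Rightarrow> 'b) \<Rightarrow> bool" where
  "dir_deriv e f f' \<longleftrightarrow> (\<forall>x. ((\<lambda>s. f (x + s *\<^sub>R e)) has_vector_derivative f' x) (at 0))"

lemma dir_deriv_at:
  assumes "dir_deriv e f f'"
  shows "((\<lambda>s. f (x + s *\<^sub>R e)) has_vector_derivative f' (x + s *\<^sub>R e)) (at s)"
proof -
  have "((\<lambda>t. f ((x + s *\<^sub>R e) + t *\<^sub>R e)) has_vector_derivative f' (x + s *\<^sub>R e)) (at (s - s))"
    using assms by (simp add: dir_deriv_def)
  moreover have "((\<lambda>t. t - s) has_vector_derivative 1) (at s)"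
    by (auto intro!: derivative_eq_intros)
  ultimately have "((\<lambda>t. f ((x + s *\<^sub>R e) + t *\<^sub>R e)) \<circ> (\<lambda>t. t - s) has_vector_derivative 1 *\<^sub>R f' (x + s *\<^sub>R e)) (at s)"
    by (intro vector_diff_chain_at) (auto simp: o_def)
  then show ?thesis by (simp add: o_def algebra_simps)
qed

lemma dir_deriv_mult:
  fixes f g :: "'a::euclidean_space \<Rightarrow> real"
  assumes "dir_deriv e f f'" "dir_deriv e g g'"
  shows "dir_deriv e (\<lambda>x. f x * g x) (\<lambda>x. f x * g' x + f' x * g x)"
  using assms unfolding dir_deriv_def
  by (auto simp: has_real_derivative_iff_has_vector_derivative[symmetric] intro!: derivative_eq_intros)

text \<open>Integration by parts without boundary terms: the increment
  \<open>f (x + e) - f x\<close> integrates to 0 by translation invariance, and by Fubini it also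
  integrates to the integral of \<open>f'\<close>, since each translate contributes the same amount
  and the segment has length 1.\<close>

lemma integral_dir_deriv_zero:
  fixes f f' :: "'a::euclidean_space \<Rightarrow> 'b::euclidean_space"
  assumes d: "dir_deriv e f f'" and cont: "continuous_on UNIV f'"
    and f: "integrable lborel f" and f': "integrable lborel f'"
  shows "(LBINT x. f' x) = 0"
proof -
  have [measurable]: "f \<in> borel_measurable borel" "f' \<in> borel_measurable borel" using f f' by auto
  let ?g = "\<lambda>(s, x). indicator {0..1::real} s *\<^sub>R f' (x + s *\<^sub>R e)"
  have eq: "f (x + e) - f x = (LBINT s. indicator {0..1::real} s *\<^sub>R f' (x + s *\<^sub>R e))" for x
  proof -
    have "(LBINT s. indicator {0..1::real} s *\<^sub>R f' (x + s *\<^sub>R e)) = f (x + 1 *\<^sub>R e) - f (x + 0 *\<^sub>R e)"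
    proof (rule integral_FTC_Icc)
      show "continuous_on {0..1} (\<lambda>s. f' (x + s *\<^sub>R e))"
        by (rule continuous_on_compose2[OF cont]) (auto intro!: continuous_intros)
    qed (auto intro: has_vector_derivative_at_within dir_deriv_at[OF d])
    then show ?thesis by simp
  qed
  have nn: "(\<integral>\<^sup>+x. ennreal (norm (f' (x + s *\<^sub>R e))) \<partial>lborel) = (\<integral>\<^sup>+x. ennreal (norm (f' x)) \<partial>lborel)" for s
    by (rule nn_integral_lborel_shift(3)) measurable
  have int: "integrable (lborel \<Otimes>\<^sub>M lborel) ?g"
  proof (rule integrableI_bounded)
    have "(\<integral>\<^sup>+z. ennreal (norm (?g z)) \<partial>(lborel \<Otimes>\<^sub>M lborel)) = 
      (\<integral>\<^sup>+s. \<integral>\<^sup>+x. ennreal (norm (?g (s, x))) \<partial>lborel \<partial>lborel)"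
      by (rule lborel.nn_integral_fst[symmetric]) measurable
    also have "\<dots> = (\<integral>\<^sup>+s. indicator {0..1::real} s * (\<integral>\<^sup>+x. ennreal (norm (f' x)) \<partial>lborel) \<partial>lborel)"
      by (intro nn_integral_cong) (auto simp: indicator_def nn)
    also have "\<dots> = (\<integral>\<^sup>+x. ennreal (norm (f' x)) \<partial>lborel)"
      by (simp add: nn_integral_multc)
    also have "\<dots> < \<infinity>" using f' by (simp add: integrable_iff_bounded)
    finally show "(\<integral>\<^sup>+z. ennreal (norm (?g z)) \<partial>(lborel \<Otimes>\<^sub>M lborel)) < \<infinity>" .
  qed measurable
  have "0 = (LBINT x. f (x + e) - f x)"
    using integral_lborel_shift(3)[of f e] f integrable_lborel_shift(3)[OF f, of e] by simp
  also have "\<dots> = (LBINT x. LBINT s. indicator {0..1::real} s *\<^sub>R f' (x + s *\<^sub>R e))"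
    by (simp add: eq)
  also have "\<dots> = (LBINT s. LBINT x. indicator {0..1::real} s *\<^sub>R f' (x + s *\<^sub>R e))"
    using lborel_pair.Fubini_integral[OF int] by simp
  also have "\<dots> = (LBINT s. indicator {0..1::real} s *\<^sub>R (LBINT x. f' x))"
    using integral_lborel_shift(3)[of f'] by simp
  also have "\<dots> = (LBINT x. f' x)" by simp
  finally show ?thesis by simp
qed

text \<open>The increment is the mean of \<open>f'\<close> over a unit segment. Cauchy-Schwarz on
  that segment and translation invariance give the constant 1.\<close>

lemma sq_increment_le:
  fixes f f' :: "'a::euclidean_space \<Rightarrow> real"
  assumes d: "dir_deriv e f f'" and cont: "continuous_on UNIV f'"
    and f: "in_L2 f" and f': "in_L2 f'"
  shows "sq (\<lambda>x. f (x + e) - f x) \<le> sq f'"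
proof -
  have [measurable]: "f \<in> borel_measurable borel" "f' \<in> borel_measurable borel"
    using in_L2_measurable f f' by auto
  let ?I = "\<lambda>s. indicator {0..1::real} s :: real"
  have pt: "ennreal ((f (x + e) - f x)\<^sup>2) \<le> (\<integral>\<^sup>+s. ennreal \<bar>?I s\<bar> * ennreal ((f' (x + s *\<^sub>R e))\<^sup>2) \<partial>lborel)" for x
  proof -
    have c: "continuous_on {0..1} (\<lambda>s. f' (x + s *\<^sub>R e))"
      by (rule continuous_on_compose2[OF cont]) (auto intro!: continuous_intros)
    have hb: "has_bochner_integral lborel (\<lambda>s. ?I s *\<^sub>R f' (x + s *\<^sub>R e)) (f (x + 1 *\<^sub>R e) - f (x + 0 *\<^sub>R e))"
      by (rule has_bochner_integral_FTC_Icc) (auto intro: has_vector_derivative_at_within dir_deriv_at[OF d] c)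
    then have "ennreal \<bar>f (x + e) - f x\<bar> \<le> (\<integral>\<^sup>+s. ennreal \<bar>?I s\<bar> * ennreal \<bar>f' (x + s *\<^sub>R e)\<bar> \<partial>lborel)"
      using has_bochner_integral_norm_bound[OF hb] by (simp add: abs_mult ennreal_mult)
    then have "ennreal ((f (x + e) - f x)\<^sup>2) \<le> (\<integral>\<^sup>+s. ennreal \<bar>?I s\<bar> * ennreal \<bar>f' (x + s *\<^sub>R e)\<bar> \<partial>lborel)\<^sup>2"
      using power_mono[of "ennreal \<bar>f (x + e) - f x\<bar>" _ 2] by (simp add: ennreal_power)
    also have "\<dots> \<le> (\<integral>\<^sup>+s. ennreal \<bar>?I s\<bar> \<partial>lborel) * (\<integral>\<^sup>+s. ennreal \<bar>?I s\<bar> * (ennreal \<bar>f' (x + s *\<^sub>R e)\<bar>)\<^sup>2 \<partial>lborel)"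
      by (rule weighted_Cauchy_Schwarz) auto
    finally show ?thesis by (simp add: ennreal_power ennreal_indicator)
  qed
  have "L2_sqnorm (\<lambda>x. f (x + e) - f x) \<le> (\<integral>\<^sup>+x. \<integral>\<^sup>+s. ennreal \<bar>?I s\<bar> * ennreal ((f' (x + s *\<^sub>R e))\<^sup>2) \<partial>lborel \<partial>lborel)"
    unfolding L2_sqnorm_real by (intro nn_integral_mono pt)
  also have "\<dots> = (\<integral>\<^sup>+s. \<integral>\<^sup>+x. ennreal \<bar>?I s\<bar> * ennreal ((f' (x + s *\<^sub>R e))\<^sup>2) \<partial>lborel \<partial>lborel)"
    by (rule lborel_pair.Fubini') measurable
  also have "\<dots> = (\<integral>\<^sup>+s. ennreal \<bar>?I s\<bar> * L2_sqnorm f' \<partial>lborel)"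
    using nn_integral_lborel_shift(3)[of "\<lambda>x. ennreal ((f' x)\<^sup>2)"]
    by (simp add: nn_integral_cmult L2_sqnorm_real)
  also have "\<dots> = ennreal (sq f')"
    by (simp add: nn_integral_multc ennreal_indicator L2_sqnorm_eq_sq[OF f'])
  finally show ?thesis
    by (rule in_L2I_bound(2)[rotated]) auto
qed

section \<open>Convolution inherits smoothness from the kernel\<close>

lemma kernel_dominating:
  fixes k :: "'a::euclidean_space \<Rightarrow> real"
  assumes k: "kernel k"
  obtains w where "kernel w" "\<And>x h. norm h \<le> 1 \<Longrightarrow> \<bar>k (x + h)\<bar> \<le> w x"
proof -
  from k obtain R where R: "\<And>x. R < norm x \<Longrightarrow> k x = 0" by (auto simp: kernel_def)
  obtain B where B: "B > 0" "\<And>x. \<bar>k x\<bar> \<le> B" using kernel_bounded[OF k] by blast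
  \<comment> \<open>A continuous cutoff of height \<open>B\<close> equal to \<open>B\<close> up to
    radius R + 1, which contains every x with \<open>k (x + h) \<noteq> 0\<close> and |h| \<le> 1.
    Being a kernel itself, it yields an integrable majorant through \<open>conv_ok\<close>.\<close>
  let ?w = "\<lambda>x::'a. B * max 0 (min 1 (R + 2 - norm x))"
  have "kernel ?w" by (auto simp: kernel_def intro!: continuous_intros exI[of _ "R + 2"])
  moreover have "\<bar>k (x + h)\<bar> \<le> ?w x" if "norm h \<le> 1" for x h
  proof (cases "norm x \<le> R + 1")
    case True
    then have "?w x = B" by (simp add: min_def)
    with B show ?thesis by simp
  next
    case False
    then have "R < norm (x + h)" using that norm_triangle_ineq2[of x "-h"] by simp
    then have "k (x + h) = 0" by (rule R)
    then show ?thesis using B(1) by simp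
  qed
  ultimately show ?thesis using that by blast
qed

lemma conv_continuous:
  fixes k f :: "'a::euclidean_space \<Rightarrow> real"
  assumes k: "kernel k" and f: "conv_ok f"
  shows "continuous_on UNIV (conv k f)"
proof -
  have [measurable]: "k \<in> borel_measurable borel" "f \<in> borel_measurable borel"
    using kernel_measurable[OF k] conv_ok_measurable[OF f] by auto
  obtain w where w: "kernel w" "\<And>x h. norm h \<le> 1 \<Longrightarrow> \<bar>k (x + h)\<bar> \<le> w x"
    using kernel_dominating[OF k] by blast
  have [measurable]: "w \<in> borel_measurable borel" using w(1) by (rule kernel_measurable)
  have kc: "continuous_on UNIV k" using k by (simp add: kernel_def)
  show ?thesis unfolding continuous_on_sequentially
  proof (intro ballI allI impI)
    fix X and x :: 'a assume X: "(\<forall>n. X n \<in> UNIV) \<and> X \<longlonglongrightarrow> x"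
    then obtain N where N: "\<And>n. n \<ge> N \<Longrightarrow> norm (X n - x) < 1"
      using LIMSEQ_D[of X x 1] by auto
    have "(\<lambda>n. LBINT y. k (X (n + N) - y) * f y) \<longlonglongrightarrow> (LBINT y. k (x - y) * f y)"
    proof (rule integral_dominated_convergence[where w="\<lambda>y. \<bar>w (x - y) * f y\<bar>"])
      show "integrable lborel (\<lambda>y. \<bar>w (x - y) * f y\<bar>)"
        using conv_okD[OF f w(1)] by (rule integrable_abs)
      show "AE y in lborel. (\<lambda>n. k (X (n + N) - y) * f y) \<longlonglongrightarrow> k (x - y) * f y"
      proof (rule AE_I2)
        fix y
        have "(\<lambda>n. X (n + N) - y) \<longlonglongrightarrow> x - y"
          using X LIMSEQ_ignore_initial_segment[of X x N] by (intro tendsto_intros) auto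
        then have "(\<lambda>n. k (X (n + N) - y)) \<longlonglongrightarrow> k (x - y)"
          using kc by (intro continuous_on_tendsto_compose[OF kc]) auto
        then show "(\<lambda>n. k (X (n + N) - y) * f y) \<longlonglongrightarrow> k (x - y) * f y"
          by (intro tendsto_intros)
      qed
      show "AE y in lborel. norm (k (X (n + N) - y) * f y) \<le> \<bar>w (x - y) * f y\<bar>" for n
      proof (rule AE_I2)
        fix y
        have "\<bar>k ((x - y) + (X (n + N) - x))\<bar> \<le> w (x - y)"
          using N[of "n + N"] by (intro w(2)) simp
        then show "norm (k (X (n + N) - y) * f y) \<le> \<bar>w (x - y) * f y\<bar>"
          by (simp add: abs_mult mult_right_mono order_trans[OF _ abs_ge_self])
      qed
    qed measurable
    then have "(\<lambda>n. conv k f (X (n + N))) \<longlonglongrightarrow> conv k f x" by (simp add: conv_def)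
    then have "(\<lambda>n. conv k f (X n)) \<longlonglongrightarrow> conv k f x" by (rule LIMSEQ_offset)
    then show "(conv k f \<circ> X) \<longlonglongrightarrow> conv k f x" by (simp add: o_def)
  qed
qed

lemma conv_dir_deriv:
  fixes k k' f :: "'a::euclidean_space \<Rightarrow> real"
  assumes k: "kernel k" and k': "kernel k'" and d: "dir_deriv e k k'" and f: "conv_ok f"
  shows "dir_deriv e (conv k f) (conv k' f)"
  unfolding dir_deriv_def
proof
  fix x
  have [measurable]: "k \<in> borel_measurable borel" "k' \<in> borel_measurable borel" "f \<in> borel_measurable borel"
    using kernel_measurable[OF k] kernel_measurable[OF k'] conv_ok_measurable[OF f] by auto
  obtain w where w: "kernel w" "\<And>x h. norm h \<le> 1 \<Longrightarrow> \<bar>k' (x + h)\<bar> \<le> w x"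
    using kernel_dominating[OF k'] by blast
  have [measurable]: "w \<in> borel_measurable borel" using w(1) by (rule kernel_measurable)
  have dk: "((\<lambda>s. k (z + s *\<^sub>R e)) has_real_derivative k' (z + s *\<^sub>R e)) (at s)" for z s
    using dir_deriv_at[OF d] by (simp add: has_real_derivative_iff_has_vector_derivative)
  \<comment> \<open>For |h| < r an intermediate point moves by at most 1, the range in which
    \<open>w\<close> dominates.\<close>
  define r where "r = 1 / (1 + norm e)"
  have "1 + norm e > 0" by (simp add: add_pos_nonneg)
  then have r: "r > 0" "r * norm e \<le> 1" by (auto simp: r_def field_simps)
  have bound: "\<bar>(k (z + h *\<^sub>R e) - k z) / h\<bar> \<le> w z" if h: "h \<noteq> 0" "\<bar>h\<bar> < r" for z h
  proof -
    have "\<exists>s. \<bar>s\<bar> \<le> \<bar>h\<bar> \<and> k (z + h *\<^sub>R e) - k z = h * k' (z + s *\<^sub>R e)"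
    proof (cases "h > 0")
      case True
      from MVT2[OF True, of "\<lambda>s. k (z + s *\<^sub>R e)" "\<lambda>s. k' (z + s *\<^sub>R e)"] dk
      obtain s where "0 < s" "s < h" "k (z + h *\<^sub>R e) - k (z + 0 *\<^sub>R e) = (h - 0) * k' (z + s *\<^sub>R e)" by blast
      then show ?thesis by (intro exI[of _ s]) auto
    next
      case False
      then have "h < 0" using h by simp
      from MVT2[OF this, of "\<lambda>s. k (z + s *\<^sub>R e)" "\<lambda>s. k' (z + s *\<^sub>R e)"] dk
      obtain s where "h < s" "s < 0" "k (z + 0 *\<^sub>R e) - k (z + h *\<^sub>R e) = (0 - h) * k' (z + s *\<^sub>R e)" by blast
      then show ?thesis by (intro exI[of _ s]) (auto simp: algebra_simps)
    qed
    then obtain s where s: "\<bar>s\<bar> \<le> \<bar>h\<bar>" "k (z + h *\<^sub>R e) - k z = h * k' (z + s *\<^sub>R e)" by blast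
    have "norm (s *\<^sub>R e) \<le> r * norm e" using s(1) h(2) by (simp add: mult_right_mono)
    then have "norm (s *\<^sub>R e) \<le> 1" using r(2) by linarith
    from w(2)[OF this, of z] s(2) h(1) show ?thesis by simp
  qed
  \<comment> \<open>The limit is taken inside (-r, r) so that the mean value bound applies to every
    term of the sequence; openness of the interval then restores the full limit at 0.\<close>
  have "((\<lambda>h. (conv k f (x + (0 + h) *\<^sub>R e) - conv k f (x + 0 *\<^sub>R e)) / h) \<longlongrightarrow> conv k' f x) (at 0 within {-r<..<r})"
    unfolding tendsto_at_iff_sequentially
  proof (intro allI impI)
    fix X :: "nat \<Rightarrow> real" assume X: "\<forall>i. X i \<in> {-r<..<r} - {0}" "X \<longlonglongrightarrow> 0"
    have lim: "(\<lambda>i. LBINT y. (k ((x - y) + X i *\<^sub>R e) - k (x - y)) / X i * f y) \<longlonglongrightarrow> (LBINT y. k' (x - y) * f y)"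
    proof (rule integral_dominated_convergence[where w="\<lambda>y. \<bar>w (x - y) * f y\<bar>"])
      show "integrable lborel (\<lambda>y. \<bar>w (x - y) * f y\<bar>)"
        using conv_okD[OF f w(1)] by (rule integrable_abs)
      show "AE y in lborel. (\<lambda>i. (k ((x - y) + X i *\<^sub>R e) - k (x - y)) / X i * f y) \<longlonglongrightarrow> k' (x - y) * f y"
      proof (rule AE_I2)
        fix y
        have "((\<lambda>h. (k ((x - y) + (0 + h) *\<^sub>R e) - k ((x - y) + 0 *\<^sub>R e)) / h) \<longlongrightarrow> k' (x - y)) (at 0)"
          using dk[of "x - y" 0] by (simp add: DERIV_def)
        then have "(\<lambda>i. (k ((x - y) + X i *\<^sub>R e) - k (x - y)) / X i) \<longlonglongrightarrow> k' (x - y)"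
          unfolding tendsto_at_iff_sequentially using X by (auto simp: o_def)
        then show "(\<lambda>i. (k ((x - y) + X i *\<^sub>R e) - k (x - y)) / X i * f y) \<longlonglongrightarrow> k' (x - y) * f y"
          by (intro tendsto_intros)
      qed
      show "AE y in lborel. norm ((k ((x - y) + X i *\<^sub>R e) - k (x - y)) / X i * f y) \<le> \<bar>w (x - y) * f y\<bar>" for i
      proof (rule AE_I2)
        fix y
        have "\<bar>(k ((x - y) + X i *\<^sub>R e) - k (x - y)) / X i\<bar> \<le> \<bar>w (x - y)\<bar>"
          using X(1)[rule_format, of i]
          by (intro order_trans[OF bound abs_ge_self]) (auto simp: abs_less_iff minus_less_iff)
        then show "norm ((k ((x - y) + X i *\<^sub>R e) - k (x - y)) / X i * f y) \<le> \<bar>w (x - y) * f y\<bar>"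
          unfolding real_norm_def abs_mult by (intro mult_right_mono) auto
      qed
    qed measurable
    have eq: "(conv k f (x + X i *\<^sub>R e) - conv k f x) / X i = (LBINT y. (k ((x - y) + X i *\<^sub>R e) - k (x - y)) / X i * f y)" for i
    proof -
      have "integrable lborel (\<lambda>y. k ((x - y) + X i *\<^sub>R e) * f y)"
        using conv_okD[OF f k, of "x + X i *\<^sub>R e"] by (simp add: algebra_simps)
      then have "(LBINT y. (k ((x - y) + X i *\<^sub>R e) * f y - k (x - y) * f y) / X i) =
        ((LBINT y. k ((x - y) + X i *\<^sub>R e) * f y) - (LBINT y. k (x - y) * f y)) / X i"
        using conv_okD[OF f k, of x] by simp
      then show ?thesis
        by (simp add: conv_def algebra_simps diff_divide_distrib)
    qed
    have "(\<lambda>i. (conv k f (x + X i *\<^sub>R e) - conv k f x) / X i) \<longlonglongrightarrow> conv k' f x"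
      unfolding eq using lim by (simp only: conv_def)
    then show "((\<lambda>h. (conv k f (x + (0 + h) *\<^sub>R e) - conv k f (x + 0 *\<^sub>R e)) / h) \<circ> X) \<longlonglongrightarrow> conv k' f x"
      by (simp add: o_def)
  qed
  moreover have "at 0 within {-r<..<r} = at (0::real)"
    using r(1) by (intro at_within_open) auto
  ultimately have "((\<lambda>s. conv k f (x + s *\<^sub>R e)) has_real_derivative conv k' f x) (at 0)"
    by (simp add: DERIV_def)
  then show "((\<lambda>s. conv k f (x + s *\<^sub>R e)) has_vector_derivative conv k' f x) (at 0)"
    by (simp add: has_real_derivative_iff_has_vector_derivative)
qed

text \<open>Fubini's theorem; absolute convergence holds because Cauchy-Schwarz bounds the inner
  integral uniformly in y. The pairing of L1 with L2 is the one that arises when the mollified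
  nonlinearity is tested with the mollified velocity.\<close>

lemma conv_adjoint:
  fixes k f g :: "'a::euclidean_space \<Rightarrow> real"
  assumes k: "kernel k" and f: "integrable lborel f" and g: "in_L2 g"
  shows "(LBINT x. conv k f x * g x) = (LBINT y. f y * conv (\<lambda>z. k (- z)) g y)"
proof -
  have [measurable]: "k \<in> borel_measurable borel" "f \<in> borel_measurable borel" "g \<in> borel_measurable borel"
    using kernel_measurable[OF k] in_L2_measurable[OF g] f by auto
  let ?h = "\<lambda>(y, x). k (x - y) * f y * g x"
  have k2: "in_L2 (\<lambda>x. k (x - y))" "sq (\<lambda>x. k (x - y)) = sq k" for y
    using in_L2_shift(1)[OF kernel_in_L2[OF k]] sq_shift(1)[of k] by auto
  have int: "integrable (lborel \<Otimes>\<^sub>M lborel) ?h"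
  proof (rule integrableI_bounded)
    have "(\<integral>\<^sup>+z. ennreal (norm (?h z)) \<partial>(lborel \<Otimes>\<^sub>M lborel)) = 
      (\<integral>\<^sup>+y. \<integral>\<^sup>+x. ennreal (norm (?h (y, x))) \<partial>lborel \<partial>lborel)"
      by (rule lborel.nn_integral_fst[symmetric]) measurable
    also have "\<dots> \<le> (\<integral>\<^sup>+y. ennreal \<bar>f y\<bar> * ennreal (sqrt (sq k * sq g)) \<partial>lborel)"
    proof (rule nn_integral_mono)
      fix y
      have i: "integrable lborel (\<lambda>x. \<bar>k (x - y) * g x\<bar>)"
        using in_L2_mult_integrable[OF k2(1) g] by (rule integrable_abs)
      have "(\<integral>\<^sup>+x. ennreal (norm (?h (y, x))) \<partial>lborel) = ennreal \<bar>f y\<bar> * (\<integral>\<^sup>+x. ennreal \<bar>k (x - y) * g x\<bar> \<partial>lborel)"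
        by (subst nn_integral_cmult[symmetric]) (auto simp: ennreal_mult[symmetric] abs_mult mult_ac)
      also have "(\<integral>\<^sup>+x. ennreal \<bar>k (x - y) * g x\<bar> \<partial>lborel) = ennreal (LBINT x. \<bar>k (x - y) * g x\<bar>)"
        using i by (intro nn_integral_eq_integral) auto
      also have "(LBINT x. \<bar>k (x - y) * g x\<bar>) \<le> sqrt (sq k * sq g)"
        using Cauchy_Schwarz_L2(2)[OF k2(1) g] by (intro real_le_rsqrt) (simp add: k2)
      finally show "(\<integral>\<^sup>+x. ennreal (norm (?h (y, x))) \<partial>lborel) \<le> ennreal \<bar>f y\<bar> * ennreal (sqrt (sq k * sq g))"
        by (simp add: mult_left_mono ennreal_leI)
    qed
    also have "\<dots> < \<infinity>"
      using f by (simp add: nn_integral_multc integrable_iff_bounded ennreal_mult_less_top)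
    finally show "(\<integral>\<^sup>+z. ennreal (norm (?h z)) \<partial>(lborel \<Otimes>\<^sub>M lborel)) < \<infinity>" .
  qed measurable
  have "(LBINT x. conv k f x * g x) = (LBINT x. LBINT y. k (x - y) * f y * g x)"
    by (simp add: conv_def)
  also have "\<dots> = (LBINT y. LBINT x. k (x - y) * f y * g x)"
    using lborel_pair.Fubini_integral[OF int] by simp
  also have "\<dots> = (LBINT y. f y * (LBINT x. k (x - y) * g x))"
    by (simp add: mult.assoc mult.left_commute[of "k _"])
  finally show ?thesis by (simp add: conv_def)
qed

section \<open>Test functions and mollifiers\<close>

lemma compact_support_iff:
  fixes f :: "'a::euclidean_space \<Rightarrow> 'b::real_normed_vector"
  shows "compact (closure {x. f x \<noteq> 0}) \<longleftrightarrow> (\<exists>R. \<forall>x. R < norm x \<longrightarrow> f x = 0)"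
proof -
  have "compact (closure {x. f x \<noteq> 0}) \<longleftrightarrow> bounded {x. f x \<noteq> 0}"
    by (meson bounded_closure bounded_subset closure_subset compact_eq_bounded_closed closed_closure)
  also have "\<dots> \<longleftrightarrow> (\<exists>R. \<forall>x. R < norm x \<longrightarrow> f x = 0)"
    unfolding bounded_iff by (auto simp: not_le[symmetric])
  finally show ?thesis .
qed

lemma test_function_iff:
  fixes f :: "'a::euclidean_space \<Rightarrow> 'b::real_normed_vector"
  shows "test_function f \<longleftrightarrow> smooth f \<and> (\<exists>R. \<forall>x. R < norm x \<longrightarrow> f x = 0)"
  by (simp only: test_function_def compact_support_iff)

lemma test_function_kernel: "test_function k \<Longrightarrow> kernel k"
  by (auto simp: test_function_iff kernel_def intro: smooth_continuous)

lemma test_function_derivative: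
  fixes f :: "'a::euclidean_space \<Rightarrow> 'b::real_normed_vector"
  assumes "test_function f"
  shows "test_function (\<lambda>x. frechet_derivative f (at x) v)"
proof -
  from assms obtain R where sm: "smooth f" and R: "\<And>x. R < norm x \<Longrightarrow> f x = 0"
    by (auto simp: test_function_iff)
  have "frechet_derivative f (at x) v = 0" if x: "R < norm x" for x
  proof -
    have "((\<lambda>x. 0) has_derivative (\<lambda>x. 0)) (at x within UNIV)" by simp
    moreover have "open {x::'a. R < norm x}" by (intro open_Collect_less continuous_intros)
    ultimately have "(f has_derivative (\<lambda>x. 0)) (at x)"
      using x R by (intro has_derivative_transform_within_open[of "\<lambda>x. 0" "\<lambda>x. 0" x UNIV "{x. R < norm x}" f]) auto
    then show ?thesis by (simp add: frechet_derivative_at[symmetric])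
  qed
  with smooth_derivative[OF sm] show ?thesis by (auto simp: test_function_iff)
qed

lemma test_function_partial: "test_function k \<Longrightarrow> test_function (partial j k)"
  unfolding partial_def[abs_def] by (rule test_function_derivative)

lemma smooth_dir_deriv:
  assumes "smooth f"
  shows "dir_deriv e f (\<lambda>x. frechet_derivative f (at x) e)"
  unfolding dir_deriv_def
proof
  fix x
  have "((\<lambda>s. x + s *\<^sub>R e) has_derivative (\<lambda>s. s *\<^sub>R e)) (at 0)"
    by (auto intro!: derivative_eq_intros)
  moreover have "(f has_derivative frechet_derivative f (at x)) (at (x + 0 *\<^sub>R e))"
    using smooth_has_derivative[OF assms] by simp
  ultimately have "((\<lambda>s. f (x + s *\<^sub>R e)) has_derivative (\<lambda>s. frechet_derivative f (at x) (s *\<^sub>R e))) (at 0)"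
    by (rule has_derivative_compose)
  moreover have "frechet_derivative f (at x) (s *\<^sub>R e) = s *\<^sub>R frechet_derivative f (at x) e" for s
    using has_derivative_linear[OF smooth_has_derivative[OF assms]] by (rule linear_scale)
  ultimately show "((\<lambda>s. f (x + s *\<^sub>R e)) has_vector_derivative frechet_derivative f (at x) e) (at 0)"
    by (simp add: has_vector_derivative_def)
qed

lemma test_function_dir_deriv: "test_function k \<Longrightarrow> dir_deriv (axis j 1) k (partial j k)"
  using smooth_dir_deriv[of k "axis j 1"] by (simp add: test_function_iff partial_def[abs_def])

lemma bounded_linear_minus_id: "bounded_linear (\<lambda>x::'a::real_normed_vector. - x)"
  by (rule bounded_linear_minus[OF bounded_linear_ident])

lemma test_function_reflect:
  fixes k :: "'a::euclidean_space \<Rightarrow> 'b::real_normed_vector"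
  assumes "test_function k"
  shows "test_function (\<lambda>y. k (x - y))"
proof -
  from assms obtain R where sm: "smooth k" and R: "\<And>x. R < norm x \<Longrightarrow> k x = 0"
    by (auto simp: test_function_iff)
  have "smooth (\<lambda>y. k (x - y))"
    using Ck_affine_right[OF bounded_linear_minus_id, of _ k x] sm by simp
  moreover have "k (x - y) = 0" if "R + norm x < norm y" for y
    using that norm_triangle_ineq2[of y x] by (intro R) (simp add: norm_minus_commute)
  ultimately show ?thesis by (auto simp: test_function_iff)
qed

lemma partial_reflect:
  fixes k :: "real^'n \<Rightarrow> 'b::real_normed_vector"
  assumes "smooth k"
  shows "partial j (\<lambda>y. k (x - y)) y = - partial j k (x - y)"
proof -
  have "((\<lambda>y. x - y) has_derivative (\<lambda>v. - v)) (at y)" by (auto intro!: derivative_eq_intros)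
  then have "((\<lambda>y. k (x - y)) has_derivative (\<lambda>v. frechet_derivative k (at (x - y)) (- v))) (at y)"
    using smooth_has_derivative[OF assms] by (rule has_derivative_compose)
  then have "frechet_derivative (\<lambda>y. k (x - y)) (at y) = (\<lambda>v. frechet_derivative k (at (x - y)) (- v))"
    by (rule frechet_derivative_at[symmetric])
  then show ?thesis
    using linear_neg[OF has_derivative_linear[OF smooth_has_derivative[OF assms]]]
    by (simp add: partial_def)
qed

section \<open>Weak derivatives in L2\<close>

definition weak_partial :: "'n \<Rightarrow> (real^'n \<Rightarrow> real) \<Rightarrow> (real^'n \<Rightarrow> real) \<Rightarrow> bool" where
  "weak_partial j f g \<longleftrightarrow> in_L2 f \<and> in_L2 g \<and>
     (\<forall>\<psi>. test_function \<psi> \<longrightarrow> (LBINT x. f x * partial j \<psi> x) = - (LBINT x. g x * \<psi> x))"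

lemma weak_partial_L2: "weak_partial j f g \<Longrightarrow> in_L2 f" "weak_partial j f g \<Longrightarrow> in_L2 g"
  by (auto simp: weak_partial_def)

text \<open>The definition is tested with \<open>y \<mapsto> k (x - y)\<close>; the minus sign from
  differentiating the reflected kernel cancels the one in the weak derivative.\<close>

lemma weak_partial_conv:
  assumes w: "weak_partial j f g" and k: "test_function k"
  shows "conv (partial j k) f = conv k g"
proof
  fix x
  have "(LBINT y. f y * partial j (\<lambda>y. k (x - y)) y) = - (LBINT y. g y * k (x - y))"
    using w test_function_reflect[OF k] by (auto simp: weak_partial_def)
  then show "conv (partial j k) f x = conv k g x"
    using k by (simp add: partial_reflect test_function_iff conv_def mult.commute)
qed

lemma conv_test_dir_deriv:
  assumes "test_function k" "conv_ok f"
  shows "dir_deriv (axis j 1) (conv k f) (conv (partial j k) f)"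
  using assms by (intro conv_dir_deriv test_function_kernel test_function_partial test_function_dir_deriv)

text \<open>The integral of the derivative of the product \<open>conv k f * conv k g\<close>
  vanishes. No weak derivative of f or g is involved, as the kernel carries the derivative.\<close>

lemma conv_partial_antisym:
  assumes k: "test_function k" and f: "in_L2 f" and g: "in_L2 g"
  shows "(LBINT x. conv k f x * conv (partial j k) g x) = - (LBINT x. conv (partial j k) f x * conv k g x)"
proof -
  note kk = test_function_kernel[OF k] and kp = test_function_kernel[OF test_function_partial[OF k, of j]]
  note L = conv_Young(1)[OF kernel_integrable[OF kk] f] conv_Young(1)[OF kernel_integrable[OF kk] g]
    conv_Young(1)[OF kernel_integrable[OF kp] f] conv_Young(1)[OF kernel_integrable[OF kp] g]
  note ok = conv_ok_L2[OF f] conv_ok_L2[OF g]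
  have "(LBINT x. conv k f x * conv (partial j k) g x + conv (partial j k) f x * conv k g x) = 0"
  proof (rule integral_dir_deriv_zero)
    show "dir_deriv (axis j 1) (\<lambda>x. conv k f x * conv k g x) (\<lambda>x. conv k f x * conv (partial j k) g x + conv (partial j k) f x * conv k g x)"
      by (intro dir_deriv_mult conv_test_dir_deriv k ok)
    show "continuous_on UNIV (\<lambda>x. conv k f x * conv (partial j k) g x + conv (partial j k) f x * conv k g x)"
      by (intro continuous_intros conv_continuous kk kp ok)
  qed (auto intro!: in_L2_mult_integrable L)
  then show ?thesis using in_L2_mult_integrable[OF L(1,4)] in_L2_mult_integrable[OF L(3,2)] by simp
qed

section \<open>The standard mollifier of radius s\<close>

definition mollifier :: "real \<Rightarrow> 'a::euclidean_space \<Rightarrow> real" where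
  "mollifier s x = flat 0 (1 - (x /\<^sub>R s) \<bullet> (x /\<^sub>R s)) / (LBINT y::'a. flat 0 (1 - (y /\<^sub>R s) \<bullet> (y /\<^sub>R s)))"

lemma bump_test_function:
  assumes "s > 0"
  shows "test_function (\<lambda>x::'a::euclidean_space. flat 0 (1 - (x /\<^sub>R s) \<bullet> (x /\<^sub>R s)))"
proof -
  have "Ck k (\<lambda>x::'a. 1 - (x /\<^sub>R s) \<bullet> (x /\<^sub>R s))" for k
    by (intro Ck_diff Ck_inner Ck_const Ck_linear bounded_linear_scaleR_right)
  then have "smooth (\<lambda>x::'a. flat 0 (1 - (x /\<^sub>R s) \<bullet> (x /\<^sub>R s)))"
    using smooth_flat[of 0] Ck_compose_real by blast
  moreover have "flat 0 (1 - (x /\<^sub>R s) \<bullet> (x /\<^sub>R s)) = 0" if "s < norm x" for x :: 'a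
  proof -
    have "s * s < x \<bullet> x"
      using that assms mult_strict_mono'[of s "norm x" s "norm x"]
      by (simp add: dot_square_norm power2_eq_square)
    then have "1 - (x /\<^sub>R s) \<bullet> (x /\<^sub>R s) \<le> 0" using assms by (simp add: field_simps)
    then show ?thesis by (simp add: flat_def)
  qed
  ultimately show ?thesis by (auto simp: test_function_iff)
qed

lemma bump_integral_pos:
  assumes "s > 0"
  shows "(LBINT y::'a::euclidean_space. flat 0 (1 - (y /\<^sub>R s) \<bullet> (y /\<^sub>R s))) > 0"
proof -
  let ?b = "\<lambda>y::'a. flat 0 (1 - (y /\<^sub>R s) \<bullet> (y /\<^sub>R s))"
  have int: "integrable lborel ?b"
    by (rule kernel_integrable[OF test_function_kernel[OF bump_test_function[OF assms]]])
  have "(LBINT y. ?b y) \<noteq> 0"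
  proof
    assume "(LBINT y. ?b y) = 0"
    then have "AE y in lborel. ?b y = 0"
      using int by (subst (asm) integral_nonneg_eq_0_iff_AE) (auto simp: flat_nonneg)
    moreover have "?b y \<noteq> 0" if "y \<in> ball 0 s" for y
    proof -
      have "y \<bullet> y < s * s"
        using that assms mult_strict_mono'[of "norm y" s "norm y" s]
        by (simp add: dot_square_norm power2_eq_square)
      then have "1 - (y /\<^sub>R s) \<bullet> (y /\<^sub>R s) > 0" using assms by (simp add: field_simps)
      then show ?thesis using flat_pos_iff[of 0] by (metis less_irrefl)
    qed
    ultimately have "AE y in lborel. y \<notin> ball (0::'a) s" by (auto elim: eventually_mono)
    then have "emeasure lborel (ball (0::'a) s) = 0"
      by (subst (asm) AE_iff_measurable[of "ball (0::'a) s"]) auto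
    then have "measure lborel (ball (0::'a) s) = 0" by (simp add: measure_def)
    then show False using content_ball_pos[OF assms, of "0::'a"] by simp
  qed
  moreover have "(LBINT y. ?b y) \<ge> 0" by (intro Bochner_Integration.integral_nonneg) (simp add: flat_nonneg)
  ultimately show ?thesis by linarith
qed

lemma test_function_cmult:
  fixes f :: "'a::euclidean_space \<Rightarrow> real"
  shows "test_function f \<Longrightarrow> test_function (\<lambda>x. c * f x)"
  by (auto simp: test_function_iff intro!: Ck_mult Ck_const)

lemma mollifier_test_function: "s > 0 \<Longrightarrow> test_function (mollifier s)"
  using test_function_cmult[OF bump_test_function, of s]
  unfolding mollifier_def[abs_def] divide_inverse mult.commute[of _ "inverse _"] by blast

lemma mollifier_even: "mollifier s (- x) = mollifier s x"
  by (simp add: mollifier_def)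

lemma mollifier_support: 
  assumes "s > 0" "s \<le> norm x" shows "mollifier s x = 0"
proof -
  have "s * s \<le> x \<bullet> x"
    using assms by (simp add: dot_square_norm power2_eq_square mult_mono)
  then have "1 - (x /\<^sub>R s) \<bullet> (x /\<^sub>R s) \<le> 0" using assms by (simp add: field_simps)
  then show ?thesis by (simp add: mollifier_def flat_def)
qed

lemma mollifier_kernel: "s > 0 \<Longrightarrow> kernel (mollifier s)"
  by (intro test_function_kernel mollifier_test_function)

lemma mollifier_prob: 
  assumes "s > 0" shows "prob_kernel (mollifier s :: 'a::euclidean_space \<Rightarrow> real)"
  unfolding prob_kernel_def
proof (intro conjI allI)
  show "integrable lborel (mollifier s :: 'a \<Rightarrow> real)"
    using assms by (intro kernel_integrable mollifier_kernel)
  show "0 \<le> mollifier s x" for x :: 'a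
    unfolding mollifier_def by (intro divide_nonneg_nonneg flat_nonneg Bochner_Integration.integral_nonneg)
  show "(LBINT x::'a. mollifier s x) = 1"
    using bump_integral_pos[OF assms, where 'a='a] by (simp add: mollifier_def)
qed

text \<open>Once the radius 1/(1+n) is below d, the support misses the region |z| \<ge> d and the
  tail integral is exactly 0.\<close>

lemma mollifier_approx_identity: "approx_identity (\<lambda>n. mollifier (1 / (1 + real n)) :: 'a::euclidean_space \<Rightarrow> real)"
  unfolding approx_identity_def
proof (intro conjI allI impI)
  have pos: "0 < 1 / (1 + real n)" for n by simp
  show "prob_kernel (mollifier (1 / (1 + real n)) :: 'a \<Rightarrow> real)" for n using mollifier_prob[OF pos] .
  fix d :: real assume d: "d > 0"
  have "(\<lambda>n. 1 / (1 + real n)) \<longlonglongrightarrow> 0"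
    using LIMSEQ_inverse_real_of_nat by (simp add: inverse_eq_divide add.commute)
  then have "eventually (\<lambda>n. 1 / (1 + real n) < d) sequentially" using d by (rule order_tendstoD)
  then have "eventually (\<lambda>n. (LBINT z::'a. indicator {z. d \<le> norm z} z * mollifier (1 / (1 + real n)) z) = 0) sequentially"
  proof eventually_elim
    case (elim n)
    have "(\<lambda>z::'a. indicator {z. d \<le> norm z} z * mollifier (1 / (1 + real n)) z) = (\<lambda>z. 0)"
    proof
      fix z :: 'a
      show "indicator {z. d \<le> norm z} z * mollifier (1 / (1 + real n)) z = 0"
      proof (cases "d \<le> norm z")
        case True
        with elim have "1 / (1 + real n) \<le> norm z" by linarith
        then show ?thesis by (simp only: mollifier_support[OF pos] mult_zero_right)
      qed (simp add: indicator_def)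
    qed
    then show ?case by (simp only:) simp
  qed
  then show "(\<lambda>n. LBINT z::'a. indicator {z. d \<le> norm z} z * mollifier (1 / (1 + real n)) z) \<longlonglongrightarrow> 0"
    by (rule tendsto_eventually)
qed

section \<open>Calculus with weak derivatives by mollification\<close>

abbreviation moll :: "nat \<Rightarrow> 'a::euclidean_space \<Rightarrow> real" where
  "moll n \<equiv> mollifier (1 / (1 + real n))"

lemma moll_test_function: "test_function (moll n)" and moll_prob: "prob_kernel (moll n)"
  by (auto intro: mollifier_test_function mollifier_prob)

lemma moll_L2:
  fixes f :: "'a::euclidean_space \<Rightarrow> real"
  assumes "in_L2 f"
  shows "in_L2 (conv (moll n) f)" "sq (conv (moll n) f) \<le> sq f"
    "(\<lambda>n. sq (\<lambda>x. conv (moll n) f x - f x)) \<longlonglongrightarrow> 0" "(\<lambda>n. sq (conv (moll n) f)) \<longlonglongrightarrow> sq f"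
proof -
  show a: "in_L2 (conv (moll n) f)" "sq (conv (moll n) f) \<le> sq f" for n
    using prob_kernel_contraction[OF moll_prob] assms by auto
  show b: "(\<lambda>n. sq (\<lambda>x. conv (moll n) f x - f x)) \<longlonglongrightarrow> 0"
    by (intro approx_identity_L2 mollifier_approx_identity conv_okD[OF conv_ok_L2] mollifier_kernel assms) auto
  show "(\<lambda>n. sq (conv (moll n) f)) \<longlonglongrightarrow> sq f"
    by (rule tendsto_L2_sq[OF a(1) assms b])
qed

lemma moll_L4:
  fixes f :: "'a::euclidean_space \<Rightarrow> real"
  assumes f4: "in_L4 f" and f2: "in_L2 f"
  shows "in_L4 (conv (moll n) f)" "quart (conv (moll n) f) \<le> quart f"
    "(\<lambda>n. quart (\<lambda>x. conv (moll n) f x - f x)) \<longlonglongrightarrow> 0"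
proof -
  show a: "in_L4 (conv (moll n) f)" "quart (conv (moll n) f) \<le> quart f" for n
    using prob_kernel_contraction(3,4)[OF moll_prob f4] by auto
  show b: "(\<lambda>n. quart (\<lambda>x. conv (moll n) f x - f x)) \<longlonglongrightarrow> 0"
    by (intro approx_identity_L4 mollifier_approx_identity conv_okD[OF conv_ok_L2] mollifier_kernel f2 f4) auto
qed

text \<open>The product rule for v^2 z, integrated. For the mollified functions it is classical and
  has no boundary terms; each of the two triple products then converges because two factors converge
  in L4 and the derivative in L2.\<close>

lemma weak_partial_cubic:
  assumes v: "weak_partial j v p" "in_L4 v" and z: "weak_partial j z q" "in_L4 z"
  shows "2 * (LBINT x. v x * z x * p x) + (LBINT x. v x * v x * q x) = 0"
proof -
  note L2 = weak_partial_L2[OF v(1)] weak_partial_L2[OF z(1)]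
  let ?c = "\<lambda>n f. conv (moll n) f"
  have eq: "2 * (LBINT x. ?c n v x * ?c n z x * ?c n p x) + (LBINT x. ?c n v x * ?c n v x * ?c n q x) = 0" for n
  proof -
    note k = moll_test_function[of n, where 'a="real^'a"]
    note M2 = moll_L2(1)[OF L2(1), of n] moll_L2(1)[OF L2(2), of n] moll_L2(1)[OF L2(3), of n] moll_L2(1)[OF L2(4), of n]
    note M4 = moll_L4(1)[OF v(2) L2(1), of n] moll_L4(1)[OF z(2) L2(3), of n]
    note ok = conv_ok_L2[OF L2(1)] conv_ok_L2[OF L2(2)] conv_ok_L2[OF L2(3)] conv_ok_L2[OF L2(4)]
    have dv: "dir_deriv (axis j 1) (?c n v) (?c n p)"
      using conv_test_dir_deriv[OF k ok(1), of j] weak_partial_conv[OF v(1) k] by simp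
    have dz: "dir_deriv (axis j 1) (?c n z) (?c n q)"
      using conv_test_dir_deriv[OF k ok(3), of j] weak_partial_conv[OF z(1) k] by simp
    let ?F' = "\<lambda>x. ?c n v x * ?c n v x * ?c n q x + (?c n v x * ?c n p x + ?c n p x * ?c n v x) * ?c n z x"
    have i1: "integrable lborel (\<lambda>x. ?c n v x * ?c n v x * ?c n q x)"
      by (intro in_L2_mult_integrable in_L4_mult(1) M2 M4)
    have i2: "integrable lborel (\<lambda>x. ?c n v x * ?c n z x * ?c n p x)"
      by (intro in_L2_mult_integrable in_L4_mult(1) M2 M4)
    have F': "?F' = (\<lambda>x. ?c n v x * ?c n v x * ?c n q x + 2 * (?c n v x * ?c n z x * ?c n p x))"
      by (auto simp: algebra_simps)
    have "(LBINT x. ?F' x) = 0"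
    proof (rule integral_dir_deriv_zero)
      show "dir_deriv (axis j 1) (\<lambda>x. (?c n v x * ?c n v x) * ?c n z x) ?F'"
        by (intro dir_deriv_mult dv dz)
      show "continuous_on UNIV ?F'"
        by (intro continuous_intros conv_continuous ok test_function_kernel k)
      show "integrable lborel (\<lambda>x. (?c n v x * ?c n v x) * ?c n z x)"
        by (intro in_L2_mult_integrable in_L4_mult(1) M2 M4)
      show "integrable lborel ?F'" unfolding F' using i1 i2 by simp
    qed
    then show ?thesis unfolding F' using i1 i2 by simp
  qed
  have lim: "(\<lambda>n. LBINT x. ?c n f x * ?c n g x * ?c n h x) \<longlonglongrightarrow> (LBINT x. f x * g x * h x)"
    if "in_L4 f" "in_L2 f" "in_L4 g" "in_L2 g" "in_L2 h" for f g h :: "real^'a \<Rightarrow> real"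
    using that
    by (intro tendsto_L2_inner tendsto_L4_mult in_L4_mult(1) moll_L4 moll_L2)
  have "(\<lambda>n. 2 * (LBINT x. ?c n v x * ?c n z x * ?c n p x) + (LBINT x. ?c n v x * ?c n v x * ?c n q x))
     \<longlonglongrightarrow> 2 * (LBINT x. v x * z x * p x) + (LBINT x. v x * v x * q x)"
    by (intro tendsto_intros lim v z L2)
  then show ?thesis unfolding eq by (simp add: LIMSEQ_const_iff)
qed

text \<open>For mollified f the increment is bounded through \<open>sq_increment_le\<close>; its
  directional derivative is the mollification of a combination of the weak derivatives, so the bound
  is uniform in the scale and survives the limit.\<close>

lemma weak_gradient_increment:
  fixes f :: "real^'n \<Rightarrow> real"
  assumes w: "\<And>j. weak_partial j f (g j)"
  shows "sq (\<lambda>x. f (x - z) - f x) \<le> (norm z)\<^sup>2 * (\<Sum>j\<in>UNIV. sq (g j))"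
proof -
  have f: "in_L2 f" and g: "in_L2 (g j)" for j using weak_partial_L2[OF w] by auto
  let ?e = "- z"
  \<comment> \<open>The weak derivative of f in the direction -z.\<close>
  let ?h = "\<lambda>x. \<Sum>j\<in>UNIV. ?e $ j * g j x"
  have h: "in_L2 ?h" by (intro in_L2_sum in_L2_cmult g)
  have "sq ?h \<le> (LBINT x. (norm z)\<^sup>2 * (\<Sum>j\<in>UNIV. (g j x)\<^sup>2))"
    unfolding sq_def
  proof (rule integral_mono)
    show "integrable lborel (\<lambda>x. (?h x)\<^sup>2)" using h by (rule in_L2_integrable)
    show "integrable lborel (\<lambda>x. (norm z)\<^sup>2 * (\<Sum>j\<in>UNIV. (g j x)\<^sup>2))"
      by (intro integrable_mult_right Bochner_Integration.integrable_sum in_L2_integrable g)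
    show "(?h x)\<^sup>2 \<le> (norm z)\<^sup>2 * (\<Sum>j\<in>UNIV. (g j x)\<^sup>2)" for x
    proof -
      have "(?h x)\<^sup>2 \<le> (\<Sum>j\<in>UNIV. (?e $ j)\<^sup>2) * (\<Sum>j\<in>UNIV. (g j x)\<^sup>2)"
        by (rule Cauchy_Schwarz_ineq_sum)
      also have "(\<Sum>j\<in>UNIV. (?e $ j)\<^sup>2) = (norm z)\<^sup>2"
        by (simp add: norm_vec_def L2_set_def sum_nonneg)
      finally show ?thesis .
    qed
  qed
  also have "\<dots> = (norm z)\<^sup>2 * (\<Sum>j\<in>UNIV. sq (g j))"
    using g by (simp add: sq_def in_L2_integrable)
  finally have hle: "sq ?h \<le> (norm z)\<^sup>2 * (\<Sum>j\<in>UNIV. sq (g j))" .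
  have le: "sq (\<lambda>x. conv (moll n) f (x + ?e) - conv (moll n) f x) \<le> sq ?h" for n
  proof -
    note k = moll_test_function[of n, where 'a="real^'n"]
    let ?k' = "\<lambda>x. frechet_derivative (moll n) (at x) ?e"
    have k': "test_function ?k'" using k by (rule test_function_derivative)
    have lin: "?k' x = (\<Sum>j\<in>UNIV. ?e $ j * partial j (moll n) x)" for x
    proof -
      have l: "linear (frechet_derivative (moll n) (at x))"
        using k by (intro has_derivative_linear[OF smooth_has_derivative]) (simp add: test_function_iff)
      have "?e = (\<Sum>j\<in>UNIV. ?e $ j *\<^sub>R axis j 1)" using basis_expansion[of ?e] by (simp add: scalar_mult_eq_scaleR)
      then have "?k' x = frechet_derivative (moll n) (at x) (\<Sum>j\<in>UNIV. ?e $ j *\<^sub>R axis j 1)" by (rule arg_cong)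
      also have "\<dots> = (\<Sum>j\<in>UNIV. ?e $ j *\<^sub>R partial j (moll n) x)"
        by (simp add: linear_sum[OF l] linear_scale[OF l] partial_def del: vector_uminus_component)
      finally show ?thesis by simp
    qed
    have conv: "conv ?k' f = conv (moll n) ?h"
    proof
      fix x
      have "conv ?k' f x = (LBINT y. (\<Sum>j\<in>UNIV. ?e $ j * (partial j (moll n) (x - y) * f y)))"
        by (simp only: conv_def lin sum_distrib_right mult.assoc)
      also have "\<dots> = (\<Sum>j\<in>UNIV. ?e $ j * conv (partial j (moll n)) f x)"
        unfolding conv_def using conv_okD[OF conv_ok_L2[OF f] test_function_kernel[OF test_function_partial[OF k]]]
        by (subst Bochner_Integration.integral_sum) (auto simp del: vector_uminus_component)
      also have "\<dots> = (\<Sum>j\<in>UNIV. ?e $ j * conv (moll n) (g j) x)"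
        by (simp add: weak_partial_conv[OF w k])
      also have "\<dots> = (LBINT y. (\<Sum>j\<in>UNIV. ?e $ j * (moll n (x - y) * g j y)))"
        unfolding conv_def using conv_okD[OF conv_ok_L2[OF g] test_function_kernel[OF k]]
        by (subst Bochner_Integration.integral_sum) (auto simp del: vector_uminus_component)
      also have "\<dots> = conv (moll n) ?h x"
        unfolding conv_def sum_distrib_left by (simp only: mult.left_commute)
      finally show "conv ?k' f x = conv (moll n) ?h x" .
    qed
    have "dir_deriv ?e (conv (moll n) f) (conv (moll n) ?h)"
      unfolding conv[symmetric] using k k' f
      by (intro conv_dir_deriv test_function_kernel smooth_dir_deriv conv_ok_L2) (auto simp: test_function_iff)
    then have "sq (\<lambda>x. conv (moll n) f (x + ?e) - conv (moll n) f x) \<le> sq (conv (moll n) ?h)"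
      by (intro sq_increment_le conv_continuous test_function_kernel k conv_ok_L2 h moll_L2 f)
    also have "\<dots> \<le> sq ?h" by (rule moll_L2(2)[OF h])
    finally show ?thesis .
  qed
  have "(\<lambda>n. sq (\<lambda>x. conv (moll n) f (x + ?e) - conv (moll n) f x)) \<longlonglongrightarrow> sq (\<lambda>x. f (x + ?e) - f x)"
  proof (rule tendsto_L2_sq)
    show "in_L2 (\<lambda>x. conv (moll n) f (x + ?e) - conv (moll n) f x)" for n
      by (intro in_L2_diff in_L2_shift(3) moll_L2 f)
    show "in_L2 (\<lambda>x. f (x + ?e) - f x)" by (intro in_L2_diff in_L2_shift(3) f)
    let ?d = "\<lambda>n x. conv (moll n) f x - f x"
    have d: "in_L2 (?d n)" for n by (intro in_L2_diff moll_L2 f)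
    have b: "sq (\<lambda>x. conv (moll n) f (x + ?e) - conv (moll n) f x - (f (x + ?e) - f x)) \<le> 4 * sq (?d n)" for n
      using L2_translation_bound[OF d, of n z] by (simp add: algebra_simps)
    show "(\<lambda>n. sq (\<lambda>x. conv (moll n) f (x + ?e) - conv (moll n) f x - (f (x + ?e) - f x))) \<longlonglongrightarrow> 0"
      by (rule tendsto_zero_bound[OF sq_nonneg b tendsto_mult_right_zero[OF moll_L2(3)[OF f]]])
  qed
  then have "sq (\<lambda>x. f (x + ?e) - f x) \<le> sq ?h"
    by (rule LIMSEQ_le_const2) (use le in blast)
  then show ?thesis using hle by simp
qed

text \<open>The error is an average of increments over the support of the mollifier, where |z| < s;
  hence the factor s^2. This inequality takes the place of a cutoff of high frequencies.\<close>

lemma mollifier_error: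
  fixes f :: "real^'n \<Rightarrow> real"
  assumes w: "\<And>j. weak_partial j f (g j)" and s: "s > 0"
  shows "sq (\<lambda>x. conv (mollifier s) f x - f x) \<le> s\<^sup>2 * (\<Sum>j\<in>UNIV. sq (g j))"
proof -
  have f: "in_L2 f" using weak_partial_L2[OF w] by auto
  note pk = mollifier_prob[OF s, where 'a="real^'n"]
  let ?S = "\<Sum>j\<in>UNIV. sq (g j)"
  have S: "?S \<ge> 0" by (intro sum_nonneg) simp
  have "L2_sqnorm (\<lambda>x. conv (mollifier s) f x - f x)
      \<le> (\<integral>\<^sup>+z. ennreal \<bar>mollifier s z\<bar> * ennreal (sq (\<lambda>x. f (x - z) - f x)) \<partial>lborel)"
    by (intro conv_minus_L2 pk conv_okD[OF conv_ok_L2] mollifier_kernel s f)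
  also have "\<dots> \<le> (\<integral>\<^sup>+z. ennreal \<bar>mollifier s (z::real^'n)\<bar> * ennreal (s\<^sup>2 * ?S) \<partial>lborel)"
  proof (rule nn_integral_mono)
    fix z :: "real^'n"
    show "ennreal \<bar>mollifier s z\<bar> * ennreal (sq (\<lambda>x. f (x - z) - f x)) \<le> ennreal \<bar>mollifier s z\<bar> * ennreal (s\<^sup>2 * ?S)"
    proof (cases "norm z < s")
      case True
      have "sq (\<lambda>x. f (x - z) - f x) \<le> (norm z)\<^sup>2 * ?S" by (rule weak_gradient_increment[OF w])
      also have "\<dots> \<le> s\<^sup>2 * ?S" using True S s by (intro mult_right_mono power_mono) auto
      finally show ?thesis by (intro mult_left_mono ennreal_leI) auto
    next
      case False
      then show ?thesis using mollifier_support[OF s, of z] by simp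
    qed
  qed
  also have "\<dots> = ennreal (s\<^sup>2 * ?S)"
    using pk prob_kernel_nn[OF pk] by (subst nn_integral_multc) (auto simp: prob_kernel_def)
  finally show ?thesis
  proof (rule in_L2I_bound(2)[rotated])
    show "(\<lambda>x. conv (mollifier s) f x - f x) \<in> borel_measurable borel"
      using in_L2_measurable[OF in_L2_diff[OF prob_kernel_contraction(1)[OF pk f] f]] .
  qed (use S in simp)
qed

section \<open>Distributional ordinary differential equations\<close>

text \<open>The positive and negative parts of g are densities of two finite measures that agree on
  all half-lines, hence everywhere; densities of equal measures agree almost everywhere.\<close>

lemma AE_zero_of_tail_integrals:
  fixes g :: "real \<Rightarrow> real"
  assumes g: "integrable lborel g" and zero: "\<And>x. (LBINT t. indicator {x<..} t * g t) = 0"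
  shows "AE t in lborel. g t = 0"
proof -
  have [measurable]: "g \<in> borel_measurable borel" using g by auto
  let ?p = "\<lambda>t. max 0 (g t)" and ?n = "\<lambda>t. max 0 (- g t)"
  have p: "integrable lborel ?p" and n: "integrable lborel ?n" using g by auto
  have em: "emeasure (density lborel (\<lambda>t. ennreal (h t))) {x<..} = ennreal (LBINT t. indicator {x<..} t * h t)"
    if h: "integrable lborel h" "\<And>t. 0 \<le> h t" for h :: "real \<Rightarrow> real" and x
  proof -
    have [measurable]: "h \<in> borel_measurable borel" using h by auto
    have i: "integrable lborel (\<lambda>t. indicator {x<..} t * h t)"
      using h(1) by (rule Bochner_Integration.integrable_bound) (auto simp: indicator_def)
    have "emeasure (density lborel (\<lambda>t. ennreal (h t))) {x<..} = (\<integral>\<^sup>+t. ennreal (indicator {x<..} t * h t) \<partial>lborel)"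
      by (subst emeasure_density) (auto simp: indicator_def intro!: nn_integral_cong)
    also have "\<dots> = ennreal (LBINT t. indicator {x<..} t * h t)"
      using i h(2) by (intro nn_integral_eq_integral) auto
    finally show ?thesis .
  qed
  have "density lborel (\<lambda>t. ennreal (?p t)) = density lborel (\<lambda>t. ennreal (?n t))"
  proof (rule measure_eqI_lessThan)
    fix x
    have i: "integrable lborel (\<lambda>t. indicator {x<..} t * h t)" if "integrable lborel h" for h :: "real \<Rightarrow> real"
      using that by (rule Bochner_Integration.integrable_bound) (use that in \<open>auto simp: indicator_def\<close>)
    have "(LBINT t. indicator {x<..} t * ?p t) - (LBINT t. indicator {x<..} t * ?n t)
        = (LBINT t. indicator {x<..} t * ?p t - indicator {x<..} t * ?n t)"
      by (rule Bochner_Integration.integral_diff[symmetric, OF i[OF p] i[OF n]])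
    also have "\<dots> = (LBINT t. indicator {x<..} t * g t)"
      by (intro Bochner_Integration.integral_cong) (auto simp: max_def indicator_def)
    finally have "(LBINT t. indicator {x<..} t * ?p t) = (LBINT t. indicator {x<..} t * ?n t)"
      using zero[of x] by linarith
    then show "emeasure (density lborel (\<lambda>t. ennreal (?p t))) {x<..} = emeasure (density lborel (\<lambda>t. ennreal (?n t))) {x<..}"
      by (simp only: em[OF p max.cobounded1] em[OF n max.cobounded1])
  next
    show "emeasure (density lborel (\<lambda>t. ennreal (?p t))) {x<..} < \<infinity>" for x
      by (simp only: em[OF p max.cobounded1] ennreal_less_top infinity_ennreal_def)
  qed simp_all
  then have "AE t in lborel. ennreal (?p t) = ennreal (?n t)"
    using p by (subst (asm) finite_density_unique) (auto simp: integrable_iff_bounded)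
  then show ?thesis by eventually_elim (auto simp: max_def split: if_splits)
qed

text \<open>Vanishing at nonpositive times is built in, so an integral over \<open>{..t}\<close> is
  an integral from 0 to t and test functions may be arbitrary on the negative axis.\<close>

definition loc_integrable :: "(real \<Rightarrow> real) \<Rightarrow> bool" where
  "loc_integrable f \<longleftrightarrow> f \<in> borel_measurable borel \<and> (\<forall>t\<le>0. f t = 0) \<and>
     (\<forall>T. integrable lborel (\<lambda>t. indicator {..T} t * f t))"

lemma loc_integrableD:
  assumes "loc_integrable f"
  shows "f \<in> borel_measurable borel" "t \<le> 0 \<Longrightarrow> f t = 0" "integrable lborel (\<lambda>t. indicator {..T} t * f t)"
  using assms by (auto simp: loc_integrable_def)

lemma loc_integrable_mult_bounded:
  assumes f: "loc_integrable f" and g: "g \<in> borel_measurable borel" "\<And>t. \<bar>g t\<bar> \<le> B" "\<And>t. T < t \<Longrightarrow> g t = 0"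
  shows "integrable lborel (\<lambda>t. g t * f t)"
proof (rule Bochner_Integration.integrable_bound[OF integrable_mult_right[OF loc_integrableD(3)[OF f, of T], of B]])
  show "(\<lambda>t. g t * f t) \<in> borel_measurable lborel" using loc_integrableD(1)[OF f] g(1) by simp
  show "AE t in lborel. norm (g t * f t) \<le> norm (B * (indicator {..T} t * f t))"
  proof (rule AE_I2)
    fix t
    have "\<bar>g t\<bar> * \<bar>f t\<bar> \<le> \<bar>B\<bar> * \<bar>f t\<bar>" using g(2)[of t] by (intro mult_right_mono) auto
    then show "norm (g t * f t) \<le> norm (B * (indicator {..T} t * f t))"
      using g(3)[of t] by (cases "t \<le> T") (auto simp: abs_mult)
  qed
qed

text \<open>Every \<open>\<psi>\<close> supported in \<open>[a, b]\<close>, \<open>0 \<le> a\<close>, is minus the derivative on the positive axis of a test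
  function: its total mass is compensated on the negative axis, which the weak equation does not see.\<close>

lemma compensated_primitive:
  fixes \<psi> :: "real \<Rightarrow> real"
  assumes sm: "smooth \<psi>" and supp: "\<And>t. t < a \<or> b < t \<Longrightarrow> \<psi> t = 0" and ab: "0 \<le> a" "a < b"
  obtains \<theta> \<rho> where "test_function \<theta>" "test_function \<rho>" "\<And>t. 0 \<le> t \<Longrightarrow> \<rho> t = 0"
    "\<And>t. (\<theta> has_real_derivative (\<rho> t - \<psi> t)) (at t)"
    "\<And>t. 0 \<le> t \<Longrightarrow> \<theta> t = (LBINT s. indicator {t<..} s * \<psi> s)"
proof -
  let ?m = "LBINT s. \<psi> s"
  have test\<psi>: "test_function \<psi>"
  proof -
    have "\<psi> t = 0" if "b < \<bar>t\<bar>" for t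
      using that ab by (intro supp) (auto simp: abs_real_def split: if_splits)
    then show ?thesis using sm by (auto simp: test_function_iff)
  qed
  have int\<psi>: "integrable lborel \<psi>" by (rule kernel_integrable[OF test_function_kernel[OF test\<psi>]])
  have cont\<psi>: "continuous_on S \<psi>" for S using sm by (rule smooth_continuous)
  \<comment> \<open>A bump of mass 1 with centre -1/2 and radius 1/2, hence supported in
    [-1, 0].\<close>
  define r where "r t = mollifier (1/2) (- (1/2) - t)" for t :: real
  define \<rho> where "\<rho> t = ?m * r t" for t
  have testr: "test_function r" unfolding r_def[abs_def]
    by (rule test_function_reflect) (simp add: mollifier_test_function)
  have r0: "r t = 0" if "t \<le> -1 \<or> 0 \<le> t" for t
    unfolding r_def using that by (intro mollifier_support) auto
  have intr: "integrable lborel r" by (rule kernel_integrable[OF test_function_kernel[OF testr]])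
  have r1: "(LBINT t. r t) = 1"
    unfolding r_def using mollifier_prob[of "1/2", where 'a=real]
    by (subst integral_lborel_shift(2)) (auto simp: prob_kernel_def)
  have test\<rho>: "test_function \<rho>" unfolding \<rho>_def[abs_def] using testr by (rule test_function_cmult)
  then have sm\<rho>: "smooth \<rho>" by (simp add: test_function_iff)
  have cont\<chi>: "continuous_on S (\<lambda>t. \<rho> t - \<psi> t)" for S
    by (rule continuous_on_diff[OF smooth_continuous[OF sm\<rho>] cont\<psi>])
  have "\<exists>F. \<forall>x::real. -\<infinity> < ereal x \<longrightarrow> ereal x < \<infinity> \<longrightarrow> (F has_vector_derivative (\<rho> x - \<psi> x)) (at x)"
    using cont\<chi>[of UNIV] by (intro einterval_antiderivative) (auto simp: continuous_on_eq_continuous_at)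
  then obtain F where F: "\<And>x. (F has_vector_derivative (\<rho> x - \<psi> x)) (at x)" by auto
  define \<theta> where "\<theta> t = F t - F (-1)" for t
  have d\<theta>: "(\<theta> has_real_derivative (\<rho> t - \<psi> t)) (at t)" for t
    using F[of t] unfolding \<theta>_def by (auto simp: has_real_derivative_iff_has_vector_derivative[symmetric] intro!: derivative_eq_intros)
  have ftc: "\<theta> t = (LBINT s. indicator {-1..t} s * (\<rho> s - \<psi> s))" if "-1 \<le> t" for t
    using integral_FTC_Icc[OF that, of F "\<lambda>s. \<rho> s - \<psi> s"] F cont\<chi>
    by (simp add: \<theta>_def has_vector_derivative_at_within)
  have pos: "\<theta> t = (LBINT s. indicator {t<..} s * \<psi> s)" if t: "0 \<le> t" for t
  proof -
    have i1: "integrable lborel (\<lambda>s. indicator {..t} s * \<psi> s)"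
      using int\<psi> by (rule Bochner_Integration.integrable_bound) (use int\<psi> in \<open>auto simp: indicator_def\<close>)
    have i2: "integrable lborel \<rho>" by (rule kernel_integrable[OF test_function_kernel[OF test\<rho>]])
    have "indicator {-1..t} s * (\<rho> s - \<psi> s) = \<rho> s - indicator {..t} s * \<psi> s" for s
      using r0[of s] supp[of s] ab t by (auto simp: indicator_def \<rho>_def)
    then have "\<theta> t = (LBINT s. \<rho> s - indicator {..t} s * \<psi> s)" using ftc t by simp
    also have "\<dots> = ?m - (LBINT s. indicator {..t} s * \<psi> s)"
    proof -
      have "(LBINT s. \<rho> s) = ?m" by (simp add: \<rho>_def r1)
      then show ?thesis using i1 i2 by simp
    qed
    also have "\<dots> = (LBINT s. \<psi> s - indicator {..t} s * \<psi> s)" using i1 int\<psi> by simp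
    also have "\<dots> = (LBINT s. indicator {t<..} s * \<psi> s)"
      by (intro Bochner_Integration.integral_cong) (auto simp: indicator_def)
    finally show ?thesis .
  qed
  have zero_right: "\<theta> t = 0" if "b < t" for t
  proof -
    have "(\<lambda>s. indicator {t<..} s * \<psi> s) = (\<lambda>s. 0)" using supp that by (auto simp: indicator_def)
    then show ?thesis using pos[of t] that ab by simp
  qed
  have zero_left: "\<theta> t = 0" if "t < -1" for t
  proof -
    have "\<rho> s - \<psi> s = 0" if "s \<le> -1" for s using r0[of s] supp[of s] ab that by (simp add: \<rho>_def)
    then have "(\<theta> has_real_derivative 0) (at s)" if "s \<le> -1" for s using d\<theta>[of s] that by simp
    moreover have "continuous_on {t..-1} \<theta>"
      using d\<theta> by (intro continuous_at_imp_continuous_on ballI) (rule DERIV_isCont)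
    ultimately have "\<theta> (-1) = \<theta> t" using that by (intro DERIV_isconst_end) auto
    then show ?thesis by (simp add: \<theta>_def)
  qed
  have "Ck k \<theta>" for k
  proof (cases k)
    case 0
    then show ?thesis using d\<theta> by (auto intro!: continuous_at_imp_continuous_on DERIV_isCont)
  next
    case (Suc n)
    have "Ck n (\<lambda>t. \<rho> t - \<psi> t)" using sm\<rho> sm by (intro Ck_diff) auto
    then have "Ck (Suc n) \<theta>"
      using d\<theta> by (intro Ck_SucI_deriv) (auto simp: has_real_derivative_iff_has_vector_derivative)
    then show ?thesis using Suc by simp
  qed
  then have "test_function \<theta>"
    using zero_left zero_right ab
    by (auto simp: test_function_iff abs_real_def split: if_splits intro!: exI[of _ "max 1 b"])
  with that test\<rho> d\<theta> pos r0 show ?thesis by (auto simp: \<rho>_def)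
qed

text \<open>Fubini on the triangle t < s. The closed half-line on the right differs from the open
  one in the single point t = s.\<close>

lemma integral_swap_triangle:
  fixes f g :: "real \<Rightarrow> real"
  assumes f: "integrable lborel f" and g: "integrable lborel g"
  shows "(LBINT t. f t * (LBINT s. indicator {t<..} s * g s)) =
         (LBINT s. g s * (LBINT t. indicator {..s} t * f t))"
proof -
  have [measurable]: "f \<in> borel_measurable borel" "g \<in> borel_measurable borel" using f g by auto
  let ?h = "\<lambda>(t, s). indicator {z::real\<times>real. fst z < snd z} (t, s) * (f t * g s)"
  have fg: "integrable (lborel \<Otimes>\<^sub>M lborel) (\<lambda>(t, s). f t * g s)"
  proof (rule lborel_pair.Fubini_integrable)
    show "integrable lborel (\<lambda>x. LBINT y. norm (case (x, y) of (t, s) \<Rightarrow> f t * g s))"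
      using f by (simp add: abs_mult)
    show "AE x in lborel. integrable lborel (\<lambda>y. case (x, y) of (t, s) \<Rightarrow> f t * g s)"
      using g by simp
  qed measurable
  have [measurable]: "{z::real\<times>real. fst z < snd z} \<in> sets (borel \<Otimes>\<^sub>M borel)"
    unfolding borel_prod by (intro borel_open open_Collect_less continuous_intros)
  have h: "integrable (lborel \<Otimes>\<^sub>M lborel) ?h"
  proof (rule Bochner_Integration.integrable_bound[OF fg])
    show "?h \<in> borel_measurable (lborel \<Otimes>\<^sub>M lborel)" by measurable
  qed (auto simp: indicator_def)
  have "(LBINT t. f t * (LBINT s. indicator {t<..} s * g s)) = (LBINT t. LBINT s. ?h (t, s))"
  proof (rule Bochner_Integration.integral_cong[OF refl])
    fix t
    have "(LBINT s. ?h (t, s)) = (LBINT s. f t * (indicator {t<..} s * g s))"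
      by (intro Bochner_Integration.integral_cong) (auto simp: indicator_def)
    then show "f t * (LBINT s. indicator {t<..} s * g s) = (LBINT s. ?h (t, s))" by simp
  qed
  also have "\<dots> = (LBINT s. LBINT t. ?h (t, s))"
    using lborel_pair.Fubini_integral[OF h] by simp
  also have "\<dots> = (LBINT s. g s * (LBINT t. indicator {..s} t * f t))"
  proof (rule Bochner_Integration.integral_cong[OF refl])
    fix s
    have "(LBINT t. ?h (t, s)) = (LBINT t. indicator {..<s} t * (f t * g s))"
      by (intro Bochner_Integration.integral_cong) (auto simp: indicator_def)
    also have "\<dots> = (LBINT t. g s * (indicator {..s} t * f t))"
    proof (rule integral_cong_AE)
      show "AE t in lborel. indicator {..<s} t * (f t * g s) = g s * (indicator {..s} t * f t)"
        using AE_lborel_singleton[of s] by eventually_elim (auto simp: indicator_def)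
    qed auto
    finally show "(LBINT t. ?h (t, s)) = g s * (LBINT t. indicator {..s} t * f t)" by simp
  qed
  finally show ?thesis .
qed

text \<open>Let D be the difference of w and the claimed primitive. The compensated primitive of a
  bump \<psi> is an admissible test function, and exchanging integrals turns the weak equation into
  \<open>\<integral> \<psi> D = 0\<close>. Bumps increasing to the indicator of (a, b) show that D
  integrates to 0 over every such interval.\<close>

lemma weak_ode:
  fixes w F :: "real \<Rightarrow> real"
  assumes w: "loc_integrable w" and F: "loc_integrable F"
    and weak: "\<And>\<theta> \<theta>'. test_function \<theta> \<Longrightarrow> test_function \<theta>' \<Longrightarrow> (\<And>t. (\<theta> has_real_derivative \<theta>' t) (at t)) \<Longrightarrow>
       - (LBINT t. \<theta>' t * w t) = \<theta> 0 * w0 + (LBINT t. \<theta> t * F t)"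
  shows "AE t in lborel. t > 0 \<longrightarrow> w t = w0 + (LBINT s. indicator {..t} s * F s)"
proof -
  have [measurable]: "w \<in> borel_measurable borel" "F \<in> borel_measurable borel"
    using loc_integrableD(1) w F by auto
  define W where "W t = w0 + (LBINT s. indicator {..t} s * F s)" for t
  define D where "D t = indicator {0<..} t * (w t - W t)" for t
  have "(\<lambda>t. LBINT s. indicator {z::real\<times>real. snd z \<le> fst z} (t, s) * F s) \<in> borel_measurable borel"
  proof -
    have [measurable]: "{z::real\<times>real. snd z \<le> fst z} \<in> sets (borel \<Otimes>\<^sub>M borel)"
      unfolding borel_prod by (intro borel_closed closed_Collect_le continuous_intros)
    show ?thesis by measurable
  qed
  then have [measurable]: "W \<in> borel_measurable borel"
    unfolding W_def[abs_def] by (simp add: indicator_def)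
  have [measurable]: "D \<in> borel_measurable borel" unfolding D_def[abs_def] by measurable
  have Wb: "\<bar>W t\<bar> \<le> \<bar>w0\<bar> + (LBINT s. \<bar>indicator {..T} s * F s\<bar>)" if "t \<le> T" for t T
  proof -
    have "\<bar>LBINT s. indicator {..t} s * F s\<bar> \<le> (LBINT s. \<bar>indicator {..t} s * F s\<bar>)"
      by (rule integral_abs_bound)
    also have "\<dots> \<le> (LBINT s. \<bar>indicator {..T} s * F s\<bar>)"
      using loc_integrableD(3)[OF F] that by (intro integral_mono integrable_abs) (auto simp: indicator_def)
    finally show ?thesis unfolding W_def by linarith
  qed
  have Wloc: "loc_integrable (\<lambda>t. indicator {0<..} t * W t)"
    unfolding loc_integrable_def
  proof (intro conjI allI impI)
    fix T
    let ?B = "\<bar>w0\<bar> + (LBINT s. \<bar>indicator {..T} s * F s\<bar>)"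
    have "integrable lborel (\<lambda>t. indicator {0..T} t *\<^sub>R ?B)"
      by (intro integrable_scaleR_left integrable_real_indicator) (auto simp: emeasure_lborel_Icc_eq)
    then show "integrable lborel (\<lambda>t. indicator {..T} t * (indicator {0<..} t * W t))"
      by (rule Bochner_Integration.integrable_bound) (use Wb in \<open>auto simp: indicator_def intro!: order_trans[OF _ abs_ge_self]\<close>)
  qed auto
  have Dint: "integrable lborel (\<lambda>t. indicator {..T} t * D t)" for T
  proof -
    have "indicator {..T} t * D t = indicator {..T} t * w t - indicator {..T} t * (indicator {0<..} t * W t)" for t
      using loc_integrableD(2)[OF w, of t] by (auto simp: D_def indicator_def)
    then show ?thesis using loc_integrableD(3)[OF w, of T] loc_integrableD(3)[OF Wloc, of T] by simp
  qed
  have zero: "(LBINT t. indicator {a<..<b} t * D t) = 0" if ab: "0 \<le> a" "a < b" for a b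
  proof -
    \<comment> \<open>On (a, b) this is exp(-1/(n (t-a)(b-t))), which is at most 1 and tends to 1;
      outside it is 0.\<close>
    define \<psi> where "\<psi> n t = flat 0 (real n * ((t - a) * (b - t)))" for n t
    have sm: "smooth (\<psi> n)" for n
    proof
      fix k
      have *: "Ck k (\<lambda>t::real. real n * ((t - a) * (b - t)))"
        by (intro Ck_mult Ck_diff Ck_const Ck_linear bounded_linear_ident)
      show "Ck k (\<psi> n)" unfolding \<psi>_def[abs_def] by (rule Ck_compose_real[OF spec[OF smooth_flat] *])
    qed
    have supp: "\<psi> n t = 0" if "t \<notin> {a<..<b}" for n t
    proof -
      have "(t - a) * (b - t) \<le> 0" using that ab by (auto simp: mult_le_0_iff)
      then have "real n * ((t - a) * (b - t)) \<le> 0" by (simp add: mult_nonneg_nonpos)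
      then show ?thesis by (simp add: \<psi>_def flat_def)
    qed
    have le1: "\<bar>\<psi> n t\<bar> \<le> 1" for n t by (simp add: \<psi>_def flat_def)
    have \<psi>m [measurable]: "\<psi> n \<in> borel_measurable borel" for n
      by (intro borel_measurable_continuous_onI smooth_continuous sm)
    have int\<psi>: "integrable lborel (\<psi> n)" for n
    proof -
      have "integrable lborel (\<lambda>t. indicator {a..b} t *\<^sub>R (1::real))" by (intro integrable_scaleR_left integrable_real_indicator) (auto simp: emeasure_lborel_Icc_eq)
      then show ?thesis
        by (rule Bochner_Integration.integrable_bound) (use supp le1 in \<open>auto simp: indicator_def\<close>)
    qed
    have z: "(LBINT t. \<psi> n t * D t) = 0" for n
    proof -
      obtain \<theta> \<rho> where \<theta>: "test_function \<theta>" "test_function \<rho>" "\<And>t. 0 \<le> t \<Longrightarrow> \<rho> t = 0"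
        "\<And>t. (\<theta> has_real_derivative (\<rho> t - \<psi> n t)) (at t)"
        "\<And>t. 0 \<le> t \<Longrightarrow> \<theta> t = (LBINT s. indicator {t<..} s * \<psi> n s)"
        by (rule compensated_primitive[OF sm _ ab]) (auto intro: supp)
      have t\<psi>: "test_function (\<lambda>t. \<rho> t - \<psi> n t)"
      proof -
        have "smooth (\<lambda>t. \<rho> t - \<psi> n t)" using \<theta>(2) sm by (auto simp: test_function_iff intro!: Ck_diff)
        moreover obtain R where R: "\<And>t. R < \<bar>t\<bar> \<Longrightarrow> \<rho> t = 0" using \<theta>(2) by (auto simp: test_function_iff)
        have "\<rho> t - \<psi> n t = 0" if "max R b < \<bar>t\<bar>" for t
          using R[of t] supp[of t n] that ab by (auto simp: abs_real_def split: if_splits)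
        ultimately show ?thesis by (auto simp: test_function_iff intro!: exI[of _ "max R b"])
      qed
      \<comment> \<open>The compensating mass \<open>\<rho>\<close> lives on negative times, where w
        vanishes.\<close>
      have mn: "(\<rho> t - \<psi> n t) * w t = - (\<psi> n t * w t)" for t
        using \<theta>(3)[of t] loc_integrableD(2)[OF w, of t] by (cases "0 \<le> t") auto
      have F_eq: "\<theta> t * F t = (indicator {..b} t * F t) * (LBINT s. indicator {t<..} s * \<psi> n s)" for t
      proof (cases "0 \<le> t \<and> t \<le> b")
        case True then show ?thesis using \<theta>(5)[of t] by simp
      next
        case False
        have "(\<lambda>s. indicator {t<..} s * \<psi> n s) = (\<lambda>s. 0)" if "b < t"
          using supp[of _ n] that by (auto simp: indicator_def)
        then show ?thesis using False \<theta>(5)[of t] loc_integrableD(2)[OF F, of t] ab by (cases "b < t") auto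
      qed
      have \<psi>w: "integrable lborel (\<lambda>t. \<psi> n t * w t)" "integrable lborel (\<lambda>t. \<psi> n t * (indicator {0<..} t * W t))"
        by (rule loc_integrable_mult_bounded[OF w \<psi>m le1, of b], use supp in simp,
            rule loc_integrable_mult_bounded[OF Wloc \<psi>m le1, of b], use supp in simp)
      have "(LBINT t. \<psi> n t * w t) = \<theta> 0 * w0 + (LBINT t. \<theta> t * F t)"
        using weak[OF \<theta>(1) t\<psi> \<theta>(4)] by (simp add: mn)
      also have "\<theta> 0 = (LBINT s. \<psi> n s)"
      proof -
        have "(\<lambda>s. indicator {0<..} s * \<psi> n s) = \<psi> n"
        proof
          fix s show "indicator {0<..} s * \<psi> n s = \<psi> n s"
            using supp[of s n] ab by (cases "0 < s") auto
        qed
        then show ?thesis using \<theta>(5)[of 0] by simp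
      qed
      also have "(LBINT t. \<theta> t * F t) = (LBINT s. \<psi> n s * (LBINT t. indicator {..s} t * (indicator {..b} t * F t)))"
        unfolding F_eq by (rule integral_swap_triangle[OF loc_integrableD(3)[OF F] int\<psi>])
      also have "\<dots> = (LBINT s. \<psi> n s * (indicator {0<..} s * W s) - \<psi> n s * w0)"
      proof (rule Bochner_Integration.integral_cong[OF refl])
        fix s
        show "\<psi> n s * (LBINT t. indicator {..s} t * (indicator {..b} t * F t)) = \<psi> n s * (indicator {0<..} s * W s) - \<psi> n s * w0"
        proof (cases "s \<in> {a<..<b}")
          case True
          have "(LBINT t. indicator {..s} t * (indicator {..b} t * F t)) = (LBINT t. indicator {..s} t * F t)"
            using True by (intro Bochner_Integration.integral_cong) (auto simp: indicator_def)
          then show ?thesis using True ab by (simp add: W_def algebra_simps)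
        qed (simp add: supp)
      qed
      also have "\<dots> = (LBINT s. \<psi> n s * (indicator {0<..} s * W s)) - (LBINT s. \<psi> n s) * w0"
        using int\<psi> \<psi>w(2) by simp
      finally have "(LBINT t. \<psi> n t * w t) - (LBINT s. \<psi> n s * (indicator {0<..} s * W s)) = 0" by simp
      moreover have "\<psi> n t * D t = \<psi> n t * w t - \<psi> n t * (indicator {0<..} t * W t)" for t
        using loc_integrableD(2)[OF w, of t] by (auto simp: D_def indicator_def algebra_simps)
      ultimately show ?thesis using \<psi>w by simp
    qed
    have "(\<lambda>n. LBINT t. \<psi> n t * D t) \<longlonglongrightarrow> (LBINT t. indicator {a<..<b} t * D t)"
    proof (rule integral_dominated_convergence[where w="\<lambda>t. \<bar>indicator {..b} t * D t\<bar>"])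
      show "integrable lborel (\<lambda>t. \<bar>indicator {..b} t * D t\<bar>)" using Dint by (rule integrable_abs)
      show "AE t in lborel. (\<lambda>n. \<psi> n t * D t) \<longlonglongrightarrow> indicator {a<..<b} t * D t"
      proof (rule AE_I2)
        fix t
        have "(\<lambda>n. \<psi> n t) \<longlonglongrightarrow> indicator {a<..<b} t"
        proof (cases "t \<in> {a<..<b}")
          case True
          define c where "c = (t - a) * (b - t)"
          have \<psi>c: "\<psi> n t = flat 0 (real n * c)" for n by (simp only: \<psi>_def c_def)
          have c: "c > 0" using True by (simp add: c_def)
          have "(\<lambda>n. exp (- (inverse c * inverse (real n)))) \<longlonglongrightarrow> exp (- (inverse c * 0))"
            by (intro tendsto_intros lim_inverse_n)
          moreover have "eventually (\<lambda>n. exp (- (inverse c * inverse (real n))) = \<psi> n t) sequentially"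
            using eventually_gt_at_top[of 0] by eventually_elim
              (use c in \<open>simp add: \<psi>c flat_def inverse_eq_divide mult.commute\<close>)
          ultimately show ?thesis using True by (auto dest: tendsto_cong[THEN iffD1, rotated])
        qed (simp add: supp)
        then show "(\<lambda>n. \<psi> n t * D t) \<longlonglongrightarrow> indicator {a<..<b} t * D t" by (intro tendsto_intros)
      qed
      show "AE t in lborel. norm (\<psi> n t * D t) \<le> \<bar>indicator {..b} t * D t\<bar>" for n
      proof (rule AE_I2)
        fix t
        show "norm (\<psi> n t * D t) \<le> \<bar>indicator {..b} t * D t\<bar>"
          using supp[of t n] mult_right_mono[OF le1[of n t], of "\<bar>D t\<bar>"]
          by (cases "t \<le> b") (auto simp: abs_mult)
      qed
    qed measurable
    then show ?thesis by (simp add: z LIMSEQ_const_iff)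
  qed
  \<comment> \<open>D is integrable only up to finite times, so the tail criterion is applied to
    each truncation and countably many truncations are combined.\<close>
  have "AE t in lborel. indicator {..<T} t * D t = 0" for T
  proof (rule AE_zero_of_tail_integrals)
    have "indicator {..<T} t * D t = indicator {..<T} t * (indicator {..T} t * D t)" for t by (auto simp: indicator_def)
    then show "integrable lborel (\<lambda>t. indicator {..<T} t * D t)"
      by (simp only:) (rule Bochner_Integration.integrable_bound[OF Dint[of T]], auto simp: indicator_def)
    fix x
    have E: "(\<lambda>t. indicator {x<..} t * (indicator {..<T} t * D t)) = (\<lambda>t. indicator {max x 0<..<T} t * D t)"
      by (auto simp: indicator_def D_def)
    show "(LBINT t. indicator {x<..} t * (indicator {..<T} t * D t)) = 0"
      unfolding E using zero[of "max x 0" T] by (cases "max x 0 < T") auto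
  qed
  then have "AE t in lborel. \<forall>n. indicator {..<real n} t * D t = 0" by (subst AE_all_countable) blast
  then show ?thesis
  proof eventually_elim
    case (elim t)
    obtain n where "t < real n" using reals_Archimedean2 by blast
    then show ?case using spec[OF elim, of n] by (auto simp: D_def W_def)
  qed
qed

text \<open>The chain rule for an absolutely continuous function without differentiation: the
  integral of \<open>f r * f s\<close> over the triangle r \<le> s is, by the symmetry under
  exchange, half the square of the integral of f.\<close>

lemma square_of_primitive:
  fixes f :: "real \<Rightarrow> real"
  assumes f: "integrable lborel (\<lambda>s. indicator {..t} s * f s)"
    and W: "\<And>s. s \<le> t \<Longrightarrow> W s = c + (LBINT r. indicator {..s} r * f r)"
  shows "(W t)\<^sup>2 = c\<^sup>2 + 2 * (LBINT s. indicator {..t} s * (W s * f s))"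
proof -
  define g where "g s = indicator {..t} s * f s" for s
  have g: "integrable lborel g" using f unfolding g_def[abs_def] .
  then have [measurable]: "g \<in> borel_measurable borel" by auto
  let ?A = "LBINT s. g s"
  let ?lo = "\<lambda>s. LBINT r. indicator {..s} r * g r" and ?hi = "\<lambda>s. LBINT r. indicator {s<..} r * g r"
  have il: "integrable lborel (\<lambda>r. indicator S r * g r)" if [measurable]: "S \<in> sets borel" for S
    using g by (rule Bochner_Integration.integrable_bound) (auto simp: indicator_def)
  have split: "?lo s + ?hi s = ?A" for s
  proof -
    have "?lo s + ?hi s = (LBINT r. indicator {..s} r * g r + indicator {s<..} r * g r)"
      by (rule Bochner_Integration.integral_add[symmetric]) (auto intro: il)
    also have "\<dots> = ?A" by (intro Bochner_Integration.integral_cong) (auto simp: indicator_def)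
    finally show ?thesis .
  qed
  have lo_bound: "\<bar>?lo s\<bar> \<le> (LBINT r. \<bar>g r\<bar>)" for s
  proof -
    have "\<bar>?lo s\<bar> \<le> (LBINT r. \<bar>indicator {..s} r * g r\<bar>)" by (rule integral_abs_bound)
    also have "\<dots> \<le> (LBINT r. \<bar>g r\<bar>)"
      using g il[of "{..s}"] by (intro integral_mono integrable_abs) (auto simp: indicator_def)
    finally show ?thesis .
  qed
  have [measurable]: "?lo \<in> borel_measurable borel"
  proof -
    have [measurable]: "{z::real\<times>real. snd z \<le> fst z} \<in> sets (borel \<Otimes>\<^sub>M borel)"
      unfolding borel_prod by (intro borel_closed closed_Collect_le continuous_intros)
    have "(\<lambda>t. LBINT s. indicator {z::real\<times>real. snd z \<le> fst z} (t, s) * g s) \<in> borel_measurable borel"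
      by measurable
    then show ?thesis by (simp add: indicator_def)
  qed
  have ilo: "integrable lborel (\<lambda>s. g s * ?lo s)"
  proof (rule Bochner_Integration.integrable_bound[OF integrable_mult_left[OF g]])
    show "AE s in lborel. norm (g s * ?lo s) \<le> norm (g s * (LBINT r. \<bar>g r\<bar>))"
      using lo_bound by (auto simp: abs_mult intro!: mult_left_mono order_trans[OF lo_bound abs_ge_self])
  qed measurable
  have hi: "?hi s = ?A - ?lo s" for s using split[of s] by simp
  let ?P = "LBINT s. g s * ?lo s"
  have "?P = (LBINT s. g s * ?hi s)" by (rule integral_swap_triangle[OF g g, symmetric])
  also have "\<dots> = (LBINT s. g s * ?A - g s * ?lo s)" unfolding hi by (simp only: right_diff_distrib)
  also have "\<dots> = ?A * ?A - ?P" using g ilo by simp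
  finally have P: "2 * ?P = ?A * ?A" by simp
  have eq: "indicator {..t} s * (W s * f s) = g s * c + g s * ?lo s" for s
  proof (cases "s \<le> t")
    case True
    have "(LBINT r. indicator {..s} r * f r) = ?lo s"
      using True by (intro Bochner_Integration.integral_cong) (auto simp: g_def indicator_def)
    then show ?thesis using True by (simp add: W g_def algebra_simps)
  qed (simp add: g_def)
  have "(LBINT s. indicator {..t} s * (W s * f s)) = ?A * c + ?P"
    unfolding eq using g ilo by simp
  moreover have "W t = c + ?A" using W[of t] by (simp add: g_def)
  moreover have "(c + ?A)\<^sup>2 = c\<^sup>2 + 2 * (?A * c + ?P)" using P by (simp add: power2_sum power2_eq_square algebra_simps)
  ultimately show ?thesis by simp
qed

lemma measurable_compose2:
  "case_prod f \<in> measurable (M \<Otimes>\<^sub>M N) L \<Longrightarrow> g \<in> measurable K M \<Longrightarrow> h \<in> measurable K N \<Longrightarrow> (\<lambda>x. f (g x) (h x)) \<in> measurable K L"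
  using measurable_compose[OF measurable_Pair, of g K M h N "case_prod f" L] by simp

text \<open>At each fixed x the equation is an ODE and \<open>square_of_primitive\<close> applies;
  the result is integrated over x. The L2 bounds on w and F up to time T make \<open>w * F\<close>
  integrable in space-time, so the order of the two integrations may be changed.\<close>

lemma energy_identity:
  fixes w F :: "real \<Rightarrow> 'a::euclidean_space \<Rightarrow> real"
  assumes wm: "case_prod w \<in> borel_measurable (borel \<Otimes>\<^sub>M borel)" and Fm: "case_prod F \<in> borel_measurable (borel \<Otimes>\<^sub>M borel)"
    and F0: "\<And>t x. t \<le> 0 \<Longrightarrow> F t x = 0" and w2: "\<And>t. in_L2 (w t)"
    and wfin: "\<And>T. (\<integral>\<^sup>+t. indicator {0..T} t * L2_sqnorm (w t) \<partial>lborel) < \<infinity>"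
    and Ffin: "\<And>T. (\<integral>\<^sup>+t. indicator {0..T} t * L2_sqnorm (F t) \<partial>lborel) < \<infinity>"
    and W0: "in_L2 W0" and Fl: "\<And>x. loc_integrable (\<lambda>t. F t x)"
    and eq: "\<And>x. AE t in lborel. t > 0 \<longrightarrow> w t x = W0 x + (LBINT s. indicator {..t} s * F s x)"
  shows "AE t in lborel. t > 0 \<longrightarrow> sq (w t) = sq W0 + 2 * (LBINT s. indicator {..t} s * (LBINT x. w s x * F s x))"
    and "integrable lborel (\<lambda>s. indicator {..T} s * (LBINT x. w s x * F s x))"
proof -
  define W where "W t x = W0 x + (LBINT s. indicator {..t} s * F s x)" for t x
  have [measurable]: "W0 \<in> borel_measurable borel" using W0 by (rule in_L2_measurable)
  have wm' [measurable]: "(\<lambda>z. w (fst z) (snd z)) \<in> borel_measurable (borel \<Otimes>\<^sub>M borel)"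
    using measurable_compose2[OF wm measurable_fst measurable_snd] .
  have Fm' [measurable]: "(\<lambda>z. F (fst z) (snd z)) \<in> borel_measurable (borel \<Otimes>\<^sub>M borel)"
    using measurable_compose2[OF Fm measurable_fst measurable_snd] .
  have Wm: "case_prod W \<in> borel_measurable (borel \<Otimes>\<^sub>M borel)"
  proof -
    have tri [measurable]: "{z::real\<times>real. snd z \<le> fst z} \<in> sets (borel \<Otimes>\<^sub>M borel)"
      unfolding borel_prod by (intro borel_closed closed_Collect_le continuous_intros)
    have "(\<lambda>p. F (snd p) (snd (fst p))) \<in> borel_measurable ((borel \<Otimes>\<^sub>M borel) \<Otimes>\<^sub>M borel)"
      by (rule measurable_compose2[OF Fm]) measurable
    then have m: "(\<lambda>p. indicator {z::real\<times>real. snd z \<le> fst z} (fst (fst p), snd p) * F (snd p) (snd (fst p))) \<in> borel_measurable ((borel \<Otimes>\<^sub>M borel) \<Otimes>\<^sub>M borel)"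
      by (intro borel_measurable_times measurable_compose[OF _ borel_measurable_indicator[OF tri]]) measurable
    then have "(\<lambda>q::real \<times> 'a. LBINT s. indicator {z::real\<times>real. snd z \<le> fst z} (fst q, s) * F s (snd q)) \<in> borel_measurable (borel \<Otimes>\<^sub>M borel)"
      by (intro lborel.borel_measurable_lebesgue_integral) (simp add: split_beta')
    then have "(\<lambda>q::real \<times> 'a. W0 (snd q) + (LBINT s. indicator {z::real\<times>real. snd z \<le> fst z} (fst q, s) * F s (snd q))) \<in> borel_measurable (borel \<Otimes>\<^sub>M borel)"
      by measurable
    then show ?thesis by (simp add: W_def split_beta' indicator_def)
  qed
  \<comment> \<open>The exceptional set of times in \<open>eq\<close> depends on x. By Fubini the
    quantifiers may be exchanged: for almost every t the identity holds for almost every x.\<close>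
  have AEx: "AE t in lborel. AE x in lborel. t > 0 \<longrightarrow> w t x = W t x"
  proof -
    have "{z \<in> space (borel \<Otimes>\<^sub>M borel). fst z > (0::real) \<longrightarrow> w (fst z) (snd z) = W (fst z) (snd z)} \<in> sets (borel \<Otimes>\<^sub>M borel)"
      using measurable_compose2[OF Wm measurable_fst measurable_snd] by measurable
    then have "{z \<in> space (lborel \<Otimes>\<^sub>M lborel). fst z > (0::real) \<longrightarrow> w (fst z) (snd z) = W (fst z) (snd z)} \<in> sets (lborel \<Otimes>\<^sub>M lborel)"
      by (simp add: space_pair_measure)
    from lborel_pair.AE_commute[OF this] eq show ?thesis unfolding W_def by simp
  qed
  have intwF: "integrable (lborel \<Otimes>\<^sub>M lborel) (\<lambda>(s, x). indicator {..T} s * (w s x * F s x))" for T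
  proof (rule integrableI_bounded)
    show "(\<lambda>(s, x). indicator {..T} s * (w s x * F s x)) \<in> borel_measurable (lborel \<Otimes>\<^sub>M lborel)"
      by (simp add: split_beta') measurable
    have pt: "(\<integral>\<^sup>+x. ennreal (norm (indicator {..T} s * (w s x * F s x))) \<partial>lborel)
      \<le> indicator {0..T} s * L2_sqnorm (w s) + indicator {0..T} s * L2_sqnorm (F s)" for s
    proof (cases "s \<in> {0..T}")
      case True
      have [measurable]: "w s \<in> borel_measurable borel" "F s \<in> borel_measurable borel"
        using measurable_compose2[OF wm, of "\<lambda>_. s" borel "\<lambda>x. x"] measurable_compose2[OF Fm, of "\<lambda>_. s" borel "\<lambda>x. x"] by auto
      have "\<bar>a * b\<bar> \<le> a\<^sup>2 + b\<^sup>2" for a b :: real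
      proof -
        have "2 * \<bar>a\<bar> * \<bar>b\<bar> \<le> a\<^sup>2 + b\<^sup>2" using sum_squares_bound[of "\<bar>a\<bar>" "\<bar>b\<bar>"] by simp
        moreover have "0 \<le> \<bar>a\<bar> * \<bar>b\<bar>" by simp
        ultimately show ?thesis unfolding abs_mult by linarith
      qed
      then have "(\<integral>\<^sup>+x. ennreal (norm (indicator {..T} s * (w s x * F s x))) \<partial>lborel) \<le> (\<integral>\<^sup>+x. ennreal ((w s x)\<^sup>2) + ennreal ((F s x)\<^sup>2) \<partial>lborel)"
        using True by (intro nn_integral_mono) (simp add: ennreal_plus[symmetric] ennreal_leI del: ennreal_plus)
      also have "\<dots> = L2_sqnorm (w s) + L2_sqnorm (F s)"
        by (simp add: nn_integral_add L2_sqnorm_real)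
      finally show ?thesis using True by simp
    next
      case False
      then have z: "ennreal (norm (indicator {..T} s * (w s x * F s x))) = 0" for x
        using F0[of s x] by (auto simp: indicator_def)
      show ?thesis by (simp only: z) simp
    qed
    have "(\<lambda>s. L2_sqnorm (w s)) \<in> borel_measurable borel" "(\<lambda>s. L2_sqnorm (F s)) \<in> borel_measurable borel"
      unfolding L2_sqnorm_real by (intro lborel.borel_measurable_nn_integral, simp add: split_beta')+
    then have m [measurable]: "(\<lambda>s. L2_sqnorm (w s)) \<in> borel_measurable lborel" "(\<lambda>s. L2_sqnorm (F s)) \<in> borel_measurable lborel"
      by simp_all
    have "(\<integral>\<^sup>+z. ennreal (norm (case z of (s, x) \<Rightarrow> indicator {..T} s * (w s x * F s x))) \<partial>(lborel \<Otimes>\<^sub>M lborel))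
      = (\<integral>\<^sup>+s. \<integral>\<^sup>+x. ennreal (norm (indicator {..T} s * (w s x * F s x))) \<partial>lborel \<partial>lborel)"
      by (subst lborel.nn_integral_fst[symmetric]) (simp_all add: split_beta')
    also have "\<dots> \<le> (\<integral>\<^sup>+s. indicator {0..T} s * L2_sqnorm (w s) + indicator {0..T} s * L2_sqnorm (F s) \<partial>lborel)"
      by (intro nn_integral_mono pt)
    also have "\<dots> = (\<integral>\<^sup>+s. indicator {0..T} s * L2_sqnorm (w s) \<partial>lborel) + (\<integral>\<^sup>+s. indicator {0..T} s * L2_sqnorm (F s) \<partial>lborel)"
      by (rule nn_integral_add) measurable
    also have "\<dots> < \<infinity>" using wfin[of T] Ffin[of T] by simp
    finally show "(\<integral>\<^sup>+z. ennreal (norm (case z of (s, x) \<Rightarrow> indicator {..T} s * (w s x * F s x))) \<partial>(lborel \<Otimes>\<^sub>M lborel)) < \<infinity>" .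
  qed
  have sqW: "(W t x)\<^sup>2 = (W0 x)\<^sup>2 + 2 * (LBINT s. indicator {..t} s * (w s x * F s x))" for t x
  proof -
    have "(W t x)\<^sup>2 = (W0 x)\<^sup>2 + 2 * (LBINT s. indicator {..t} s * (W s x * F s x))"
      by (rule square_of_primitive) (use loc_integrableD(3)[OF Fl] in \<open>auto simp: W_def\<close>)
    also have "(LBINT s. indicator {..t} s * (W s x * F s x)) = (LBINT s. indicator {..t} s * (w s x * F s x))"
    proof (rule integral_cong_AE)
      have "(\<lambda>s. W s x) \<in> borel_measurable borel" "(\<lambda>s. w s x) \<in> borel_measurable borel" "(\<lambda>s. F s x) \<in> borel_measurable borel"
        by (rule measurable_compose2[OF Wm] measurable_compose2[OF wm] measurable_compose2[OF Fm], simp, simp)+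
      then show "(\<lambda>s. indicator {..t} s * (W s x * F s x)) \<in> borel_measurable lborel"
        "(\<lambda>s. indicator {..t} s * (w s x * F s x)) \<in> borel_measurable lborel" by simp_all
      show "AE s in lborel. indicator {..t} s * (W s x * F s x) = indicator {..t} s * (w s x * F s x)"
        using eq[of x]
      proof eventually_elim
        case (elim s)
        then show ?case using F0[of s x] by (cases "s > 0") (auto simp: W_def)
      qed
    qed
    finally show ?thesis .
  qed
  show "integrable lborel (\<lambda>s. indicator {..T} s * (LBINT x. w s x * F s x))"
    using lborel_pair.integrable_fst'[OF intwF[of T]] by simp
  show "AE t in lborel. t > 0 \<longrightarrow> sq (w t) = sq W0 + 2 * (LBINT s. indicator {..t} s * (LBINT x. w s x * F s x))"
    using AEx
  proof eventually_elim
    case (elim t)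
    show ?case
    proof
      assume t: "t > 0"
      let ?I = "\<lambda>x. LBINT s. indicator {..t} s * (w s x * F s x)"
      have I: "integrable lborel ?I"
        using lborel_pair.integrable_fst'[OF lborel_pair.integrable_product_swap[OF intwF[of t]]] by simp
      have "sq (w t) = (LBINT x. (W t x)\<^sup>2)"
        unfolding sq_def
      proof (rule integral_cong_AE)
        show "(\<lambda>x. (w t x)\<^sup>2) \<in> borel_measurable lborel" using in_L2_measurable[OF w2[of t]] by simp
        show "(\<lambda>x. (W t x)\<^sup>2) \<in> borel_measurable lborel"
          using measurable_compose2[OF Wm, of "\<lambda>_. t" borel "\<lambda>x. x"] by simp
        show "AE x in lborel. (w t x)\<^sup>2 = (W t x)\<^sup>2" using elim by eventually_elim (use t in simp)
      qed
      also have "\<dots> = (LBINT x. (W0 x)\<^sup>2 + 2 * ?I x)" by (simp only: sqW)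
      also have "\<dots> = sq W0 + 2 * (LBINT x. ?I x)"
        using in_L2_integrable[OF W0] I by (simp add: sq_def)
      also have "(LBINT x. ?I x) = (LBINT s. LBINT x. indicator {..t} s * (w s x * F s x))"
        using lborel_pair.Fubini_integral[OF intwF[of t]] by simp
      also have "\<dots> = (LBINT s. indicator {..t} s * (LBINT x. w s x * F s x))"
        by simp
      finally show "sq (w t) = sq W0 + 2 * (LBINT s. indicator {..t} s * (LBINT x. w s x * F s x))" .
    qed
  qed
qed

section \<open>Separated test functions in space-time\<close>

text \<open>A common class for quantities square integrable in space (\<open>U\<close>,
  \<open>DU\<close>, \<open>dvg\<close>) and for the nonlinearity, which is only integrable: after
  pairing with a kernel in space and cutting at time T the space-time integral is finite, as Fubini
  and \<open>weak_ode\<close> demand.\<close>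

definition slab :: "(real \<Rightarrow> 'a::euclidean_space \<Rightarrow> real) \<Rightarrow> bool" where
  "slab p \<longleftrightarrow> case_prod p \<in> borel_measurable (borel \<Otimes>\<^sub>M borel) \<and> (\<forall>t\<le>0. \<forall>x. p t x = 0) \<and>
     (\<forall>k T. kernel k \<longrightarrow> (\<integral>\<^sup>+t. indicator {0..T} t * (\<integral>\<^sup>+y. ennreal \<bar>k y * p t y\<bar> \<partial>lborel) \<partial>lborel) < \<infinity>)"

lemma case_prod_section:
  assumes "case_prod p \<in> borel_measurable (borel \<Otimes>\<^sub>M borel)"
  shows "p t \<in> borel_measurable borel" "(\<lambda>t. p t x) \<in> borel_measurable borel"
  using measurable_compose2[OF assms, of "\<lambda>_. t" borel "\<lambda>x. x"] measurable_compose2[OF assms, of "\<lambda>t. t" borel "\<lambda>_. x"] by auto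

lemma slab_measurable: "slab p \<Longrightarrow> case_prod p \<in> borel_measurable (borel \<Otimes>\<^sub>M borel)"
  by (simp add: slab_def)

lemma slab_integrable:
  fixes p :: "real \<Rightarrow> 'a::euclidean_space \<Rightarrow> real"
  assumes p: "slab p" and k: "kernel k" and \<theta>: "\<theta> \<in> borel_measurable borel" "\<And>t. \<bar>\<theta> t\<bar> \<le> B" "\<And>t. T < t \<Longrightarrow> \<theta> t = 0"
  shows "integrable (lborel \<Otimes>\<^sub>M lborel) (\<lambda>(t, y). \<theta> t * (k y * p t y))"
    and "integrable lborel (\<lambda>t. \<theta> t * (LBINT y. k y * p t y))"
    and "(LINT z|(lborel \<Otimes>\<^sub>M lborel). \<theta> (fst z) * (k (snd z) * p (fst z) (snd z))) = (LBINT t. \<theta> t * (LBINT y. k y * p t y))"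
proof -
  note [measurable] = kernel_measurable[OF k] \<theta>(1)
  have pm: "case_prod p \<in> borel_measurable (borel \<Otimes>\<^sub>M borel)" using p by (rule slab_measurable)
  have [measurable]: "(\<lambda>z. p (fst z) (snd z)) \<in> borel_measurable (borel \<Otimes>\<^sub>M borel)"
    using measurable_compose2[OF pm measurable_fst measurable_snd] .
  have B: "B \<ge> 0" using \<theta>(2)[of 0] by linarith
  show int: "integrable (lborel \<Otimes>\<^sub>M lborel) (\<lambda>(t, y). \<theta> t * (k y * p t y))"
  proof (rule integrableI_bounded)
    show "(\<lambda>(t, y). \<theta> t * (k y * p t y)) \<in> borel_measurable (lborel \<Otimes>\<^sub>M lborel)"
      by (simp add: split_beta') measurable
    have "(\<integral>\<^sup>+z. ennreal (norm (case z of (t, y) \<Rightarrow> \<theta> t * (k y * p t y))) \<partial>(lborel \<Otimes>\<^sub>M lborel))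
      = (\<integral>\<^sup>+t. \<integral>\<^sup>+y. ennreal (norm (\<theta> t * (k y * p t y))) \<partial>lborel \<partial>lborel)"
      by (subst lborel.nn_integral_fst[symmetric]) (simp_all add: split_beta')
    also have "\<dots> \<le> (\<integral>\<^sup>+t. ennreal B * (indicator {0..T} t * (\<integral>\<^sup>+y. ennreal \<bar>k y * p t y\<bar> \<partial>lborel)) \<partial>lborel)"
    proof (rule nn_integral_mono)
      fix t
      have pt [measurable]: "p t \<in> borel_measurable borel" using case_prod_section[OF pm] by auto
      show "(\<integral>\<^sup>+y. ennreal (norm (\<theta> t * (k y * p t y))) \<partial>lborel) \<le> ennreal B * (indicator {0..T} t * (\<integral>\<^sup>+y. ennreal \<bar>k y * p t y\<bar> \<partial>lborel))"
      proof (cases "t \<in> {0..T}")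
        case True
        have "(\<integral>\<^sup>+y. ennreal (norm (\<theta> t * (k y * p t y))) \<partial>lborel) = ennreal \<bar>\<theta> t\<bar> * (\<integral>\<^sup>+y. ennreal \<bar>k y * p t y\<bar> \<partial>lborel)"
          by (subst nn_integral_cmult[symmetric]) (auto simp: ennreal_mult[symmetric] abs_mult)
        also have "\<dots> \<le> ennreal B * (\<integral>\<^sup>+y. ennreal \<bar>k y * p t y\<bar> \<partial>lborel)"
          using \<theta>(2) by (intro mult_right_mono ennreal_leI) auto
        finally show ?thesis using True by simp
      next
        case False
        then have z: "ennreal (norm (\<theta> t * (k y * p t y))) = 0" for y
          using p \<theta>(3)[of t] by (auto simp: slab_def)
        show ?thesis by (simp only: z) simp
      qed
    qed
    also have "\<dots> = ennreal B * (\<integral>\<^sup>+t. indicator {0..T} t * (\<integral>\<^sup>+y. ennreal \<bar>k y * p t y\<bar> \<partial>lborel) \<partial>lborel)"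
    proof (rule nn_integral_cmult)
      have "(\<lambda>t. \<integral>\<^sup>+y. ennreal \<bar>k y * p t y\<bar> \<partial>lborel) \<in> borel_measurable borel"
        by (intro lborel.borel_measurable_nn_integral) (simp add: split_beta')
      then show "(\<lambda>t. indicator {0..T} t * (\<integral>\<^sup>+y. ennreal \<bar>k y * p t y\<bar> \<partial>lborel)) \<in> borel_measurable lborel"
        by simp
    qed
    also have "\<dots> < \<infinity>" using p k by (simp add: slab_def ennreal_mult_less_top)
    finally show "(\<integral>\<^sup>+z. ennreal (norm (case z of (t, y) \<Rightarrow> \<theta> t * (k y * p t y))) \<partial>(lborel \<Otimes>\<^sub>M lborel)) < \<infinity>" .
  qed
  show "integrable lborel (\<lambda>t. \<theta> t * (LBINT y. k y * p t y))"
    using lborel_pair.integrable_fst'[OF int] by simp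
  show "(LINT z|(lborel \<Otimes>\<^sub>M lborel). \<theta> (fst z) * (k (snd z) * p (fst z) (snd z))) = (LBINT t. \<theta> t * (LBINT y. k y * p t y))"
    using lborel_pair.integral_fst'[OF int] by (simp add: split_beta')
qed

lemma slab_loc_integrable:
  fixes p :: "real \<Rightarrow> 'a::euclidean_space \<Rightarrow> real"
  assumes p: "slab p" and k: "kernel k"
  shows "loc_integrable (\<lambda>t. LBINT y. k y * p t y)"
  unfolding loc_integrable_def
proof (intro conjI allI impI)
  note [measurable] = kernel_measurable[OF k]
  have pm: "case_prod p \<in> borel_measurable (borel \<Otimes>\<^sub>M borel)" using p by (rule slab_measurable)
  have [measurable]: "(\<lambda>z. p (fst z) (snd z)) \<in> borel_measurable (borel \<Otimes>\<^sub>M borel)"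
    using measurable_compose2[OF pm measurable_fst measurable_snd] .
  show "(\<lambda>t. LBINT y. k y * p t y) \<in> borel_measurable borel"
    by (intro lborel.borel_measurable_lebesgue_integral) (simp add: split_beta')
  show "(LBINT y. k y * p t y) = 0" if "t \<le> 0" for t using p that by (simp add: slab_def)
  show "integrable lborel (\<lambda>t. indicator {..T} t * (LBINT y. k y * p t y))" for T
    by (rule slab_integrable(2)[OF p k, of _ 1 T]) (auto simp: indicator_def)
qed

lemma loc_integrable_add:
  assumes "loc_integrable f" "loc_integrable g"
  shows "loc_integrable (\<lambda>t. f t + g t)"
  using assms by (auto simp: loc_integrable_def distrib_left)

lemma loc_integrable_cmult:
  assumes "loc_integrable f"
  shows "loc_integrable (\<lambda>t. c * f t)"
  using assms by (auto simp: loc_integrable_def mult.left_commute)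

lemma loc_integrable_diff:
  assumes "loc_integrable f" "loc_integrable g"
  shows "loc_integrable (\<lambda>t. f t - g t)"
  using loc_integrable_add[OF assms(1) loc_integrable_cmult[OF assms(2), of "-1"]] by simp

lemma loc_integrable_sum:
  assumes "\<And>i. i \<in> I \<Longrightarrow> loc_integrable (f i)"
  shows "loc_integrable (\<lambda>t. \<Sum>i\<in>I. f i t)"
  using assms
proof (induction I rule: infinite_finite_induct)
  case (insert i I) then show ?case by (simp add: loc_integrable_add)
qed (auto simp: loc_integrable_def)

lemma conv_measurable_param:
  fixes p :: "real \<Rightarrow> 'a::euclidean_space \<Rightarrow> real"
  assumes pm: "case_prod p \<in> borel_measurable (borel \<Otimes>\<^sub>M borel)" and k [measurable]: "k \<in> borel_measurable borel"
  shows "case_prod (\<lambda>t. conv k (p t)) \<in> borel_measurable (borel \<Otimes>\<^sub>M borel)"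
proof -
  have "(\<lambda>q. p (fst (fst q)) (snd q)) \<in> borel_measurable ((borel \<Otimes>\<^sub>M borel) \<Otimes>\<^sub>M borel)"
    by (rule measurable_compose2[OF pm]) measurable
  then have "(\<lambda>q. k (snd (fst q) - snd q) * p (fst (fst q)) (snd q)) \<in> borel_measurable ((borel \<Otimes>\<^sub>M borel) \<Otimes>\<^sub>M borel)"
    by measurable
  then have "(\<lambda>q::real \<times> 'a. LBINT y. k (snd q - y) * p (fst q) y) \<in> borel_measurable (borel \<Otimes>\<^sub>M borel)"
    by (intro lborel.borel_measurable_lebesgue_integral) (simp add: split_beta')
  then show ?thesis by (simp add: conv_def split_beta')
qed

section \<open>Membership criteria for space-time functions\<close>

lemma L2_sqnorm_measurable_param:
  fixes p :: "real \<Rightarrow> 'a::euclidean_space \<Rightarrow> real"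
  assumes pm: "case_prod p \<in> borel_measurable (borel \<Otimes>\<^sub>M borel)"
  shows "(\<lambda>t. L2_sqnorm (p t)) \<in> borel_measurable borel"
proof -
  have [measurable]: "(\<lambda>z. p (fst z) (snd z)) \<in> borel_measurable (borel \<Otimes>\<^sub>M borel)"
    using measurable_compose2[OF pm measurable_fst measurable_snd] .
  show ?thesis
    unfolding L2_sqnorm_real by (intro lborel.borel_measurable_nn_integral) (simp add: split_beta')
qed

lemma sq_measurable_param:
  fixes p :: "real \<Rightarrow> 'a::euclidean_space \<Rightarrow> real"
  assumes pm: "case_prod p \<in> borel_measurable (borel \<Otimes>\<^sub>M borel)"
  shows "(\<lambda>t. sq (p t)) \<in> borel_measurable borel"
proof -
  have [measurable]: "(\<lambda>z. p (fst z) (snd z)) \<in> borel_measurable (borel \<Otimes>\<^sub>M borel)"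
    using measurable_compose2[OF pm measurable_fst measurable_snd] .
  show ?thesis
    unfolding sq_def by (intro lborel.borel_measurable_lebesgue_integral) (simp add: split_beta')
qed

lemma abs_mult_le_squares: "\<bar>a * b\<bar> \<le> a\<^sup>2 + b\<^sup>2" for a b :: real
proof -
  have "2 * \<bar>a\<bar> * \<bar>b\<bar> \<le> a\<^sup>2 + b\<^sup>2" using sum_squares_bound[of "\<bar>a\<bar>" "\<bar>b\<bar>"] by simp
  moreover have "0 \<le> \<bar>a\<bar> * \<bar>b\<bar>" by simp
  ultimately show ?thesis unfolding abs_mult by linarith
qed

lemma nn_integral_abs_mult_le:
  fixes f g :: "'a::euclidean_space \<Rightarrow> real"
  assumes [measurable]: "f \<in> borel_measurable borel" "g \<in> borel_measurable borel"
  shows "(\<integral>\<^sup>+y. ennreal \<bar>f y * g y\<bar> \<partial>lborel) \<le> L2_sqnorm f + L2_sqnorm g"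
proof -
  have "(\<integral>\<^sup>+y. ennreal \<bar>f y * g y\<bar> \<partial>lborel) \<le> (\<integral>\<^sup>+y. ennreal ((f y)\<^sup>2) + ennreal ((g y)\<^sup>2) \<partial>lborel)"
    using abs_mult_le_squares
    by (intro nn_integral_mono) (simp add: ennreal_plus[symmetric] ennreal_leI del: ennreal_plus)
  also have "\<dots> = L2_sqnorm f + L2_sqnorm g" by (simp add: nn_integral_add L2_sqnorm_real)
  finally show ?thesis .
qed

lemma slabI_L2:
  fixes p :: "real \<Rightarrow> 'a::euclidean_space \<Rightarrow> real"
  assumes pm: "case_prod p \<in> borel_measurable (borel \<Otimes>\<^sub>M borel)" and p0: "\<And>t x. t \<le> 0 \<Longrightarrow> p t x = 0"
    and fin: "\<And>T. (\<integral>\<^sup>+t. indicator {0..T} t * L2_sqnorm (p t) \<partial>lborel) < \<infinity>"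
  shows "slab p"
  unfolding slab_def
proof (intro conjI allI impI)
  fix k :: "'a \<Rightarrow> real" and T assume k: "kernel k"
  have [measurable]: "(\<lambda>t. L2_sqnorm (p t)) \<in> borel_measurable borel" using pm by (rule L2_sqnorm_measurable_param)
  have "(\<integral>\<^sup>+t. indicator {0..T} t * (\<integral>\<^sup>+y. ennreal \<bar>k y * p t y\<bar> \<partial>lborel) \<partial>lborel)
    \<le> (\<integral>\<^sup>+t. indicator {0..T} t * L2_sqnorm k + indicator {0..T} t * L2_sqnorm (p t) \<partial>lborel)"
    using case_prod_section(1)[OF pm] kernel_measurable[OF k]
    by (intro nn_integral_mono) (simp add: distrib_left[symmetric] mult_left_mono nn_integral_abs_mult_le)
  also have "\<dots> = (\<integral>\<^sup>+t. indicator {0..T} t * L2_sqnorm k \<partial>lborel) + (\<integral>\<^sup>+t. indicator {0..T} t * L2_sqnorm (p t) \<partial>lborel)"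
    by (rule nn_integral_add) measurable
  also have "\<dots> < \<infinity>"
    using fin[of T] kernel_in_L2[OF k] by (simp add: nn_integral_multc in_L2_def ennreal_mult_less_top emeasure_lborel_Icc_eq)
  finally show "(\<integral>\<^sup>+t. indicator {0..T} t * (\<integral>\<^sup>+y. ennreal \<bar>k y * p t y\<bar> \<partial>lborel) \<partial>lborel) < \<infinity>" .
qed (use pm p0 in auto)

lemma slabI_L1:
  fixes p :: "real \<Rightarrow> 'a::euclidean_space \<Rightarrow> real"
  assumes pm: "case_prod p \<in> borel_measurable (borel \<Otimes>\<^sub>M borel)" and p0: "\<And>t x. t \<le> 0 \<Longrightarrow> p t x = 0"
    and fin: "\<And>T. (\<integral>\<^sup>+t. indicator {0..T} t * (\<integral>\<^sup>+y. ennreal \<bar>p t y\<bar> \<partial>lborel) \<partial>lborel) < \<infinity>"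
  shows "slab p"
  unfolding slab_def
proof (intro conjI allI impI)
  fix k :: "'a \<Rightarrow> real" and T assume k: "kernel k"
  have pm' [measurable]: "(\<lambda>z. p (fst z) (snd z)) \<in> borel_measurable (borel \<Otimes>\<^sub>M borel)"
    using measurable_compose2[OF pm measurable_fst measurable_snd] .
  have [measurable]: "(\<lambda>t. \<integral>\<^sup>+y. ennreal \<bar>p t y\<bar> \<partial>lborel) \<in> borel_measurable borel"
    by (intro lborel.borel_measurable_nn_integral) (simp add: split_beta')
  obtain B where B: "B > 0" "\<And>x. \<bar>k x\<bar> \<le> B" using kernel_bounded[OF k] by blast
  have "(\<integral>\<^sup>+t. indicator {0..T} t * (\<integral>\<^sup>+y. ennreal \<bar>k y * p t y\<bar> \<partial>lborel) \<partial>lborel)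
    \<le> (\<integral>\<^sup>+t. ennreal B * (indicator {0..T} t * (\<integral>\<^sup>+y. ennreal \<bar>p t y\<bar> \<partial>lborel)) \<partial>lborel)"
  proof (rule nn_integral_mono)
    fix t
    have [measurable]: "p t \<in> borel_measurable borel" using case_prod_section(1)[OF pm] .
    have "(\<integral>\<^sup>+y. ennreal \<bar>k y * p t y\<bar> \<partial>lborel) \<le> (\<integral>\<^sup>+y. ennreal B * ennreal \<bar>p t y\<bar> \<partial>lborel)"
      using B by (intro nn_integral_mono) (simp add: ennreal_mult[symmetric] abs_mult ennreal_leI mult_right_mono)
    also have "\<dots> = ennreal B * (\<integral>\<^sup>+y. ennreal \<bar>p t y\<bar> \<partial>lborel)" by (rule nn_integral_cmult) measurable
    finally show "indicator {0..T} t * (\<integral>\<^sup>+y. ennreal \<bar>k y * p t y\<bar> \<partial>lborel) \<le> ennreal B * (indicator {0..T} t * (\<integral>\<^sup>+y. ennreal \<bar>p t y\<bar> \<partial>lborel))"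
      by (cases "t \<in> {0..T}") auto
  qed
  also have "\<dots> = ennreal B * (\<integral>\<^sup>+t. indicator {0..T} t * (\<integral>\<^sup>+y. ennreal \<bar>p t y\<bar> \<partial>lborel) \<partial>lborel)"
    by (rule nn_integral_cmult) measurable
  also have "\<dots> < \<infinity>" using fin by (simp add: ennreal_mult_less_top)
  finally show "(\<integral>\<^sup>+t. indicator {0..T} t * (\<integral>\<^sup>+y. ennreal \<bar>k y * p t y\<bar> \<partial>lborel) \<partial>lborel) < \<infinity>" .
qed (use pm p0 in auto)

section \<open>Product test functions and their derivatives\<close>

lemma test_function_product:
  fixes \<theta> :: "real \<Rightarrow> real" and k :: "'a::euclidean_space \<Rightarrow> real" and v :: "'b::real_normed_vector"
  assumes \<theta>: "test_function \<theta>" and k: "test_function k"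
  shows "test_function (\<lambda>z. (\<theta> (fst z) * k (snd z)) *\<^sub>R v)"
proof -
  have "Ck n (\<lambda>z::real\<times>'a. \<theta> (fst z))" "Ck n (\<lambda>z::real\<times>'a. k (snd z))" for n
    using Ck_affine_right[OF bounded_linear_fst, of n \<theta> 0] Ck_affine_right[OF bounded_linear_snd, of n k 0] \<theta> k
    by (simp_all add: test_function_iff)
  then have "smooth (\<lambda>z. (\<theta> (fst z) * k (snd z)) *\<^sub>R v)"
    by (intro allI Ck_scaleR Ck_mult Ck_const)
  moreover obtain R S where R: "\<And>t. R < norm t \<Longrightarrow> \<theta> t = 0" and S: "\<And>x. S < norm x \<Longrightarrow> k x = 0"
    using \<theta> k by (auto simp: test_function_iff)
  have "(\<theta> (fst z) * k (snd z)) *\<^sub>R v = 0" if "\<bar>R\<bar> + \<bar>S\<bar> < norm z" for z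
  proof -
    have "norm z \<le> norm (fst z) + norm (snd z)" using norm_Pair_le[of "fst z" "snd z"] by simp
    then have "R < norm (fst z) \<or> S < norm (snd z)" using that by linarith
    then show ?thesis using R S by auto
  qed
  ultimately show ?thesis unfolding test_function_iff by blast
qed

lemma partial_scaleR:
  fixes k :: "real^'n \<Rightarrow> real"
  assumes "smooth k"
  shows "partial j (\<lambda>y. (c * k y) *\<^sub>R v) x = (c * partial j k x) *\<^sub>R v"
proof -
  have "((\<lambda>y. (c * k y) *\<^sub>R v) has_derivative (\<lambda>h. (c * frechet_derivative k (at x) h) *\<^sub>R v)) (at x)"
    using smooth_has_derivative[OF assms, of x] by (auto intro!: derivative_eq_intros)
  then show ?thesis unfolding partial_def by (simp add: frechet_derivative_at[symmetric])
qed

lemma partial_cmult: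
  fixes k :: "real^'n \<Rightarrow> real"
  assumes "smooth k"
  shows "partial j (\<lambda>y. c * k y) x = c * partial j k x"
  using partial_scaleR[OF assms, of j c "1::real" x] by simp

lemma laplacian_scaleR:
  fixes k :: "real^'n \<Rightarrow> real"
  assumes k: "smooth k"
  shows "laplacian (\<lambda>y. (c * k y) *\<^sub>R v) x = (c * (\<Sum>j\<in>UNIV. partial j (partial j k) x)) *\<^sub>R v"
proof -
  have "partial j (\<lambda>y. (c * k y) *\<^sub>R v) = (\<lambda>y. (c * partial j k y) *\<^sub>R v)" for j
    by (rule ext) (rule partial_scaleR[OF k])
  then show ?thesis unfolding laplacian_def
    by (simp add: partial_scaleR[OF smooth_partial[OF k]] sum_distrib_left scaleR_sum_left)
qed

lemma grad_div_scaleR_axis: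
  fixes k :: "real^'n \<Rightarrow> real"
  assumes k: "smooth k"
  shows "grad_div (\<lambda>y. (c * k y) *\<^sub>R axis i 1) x = (\<chi> l. c * partial l (partial i k) x)"
proof -
  have "divergence (\<lambda>y. (c * k y) *\<^sub>R axis i 1) = (\<lambda>y. c * partial i k y)"
  proof
    fix y
    have "divergence (\<lambda>y. (c * k y) *\<^sub>R axis i 1) y = (\<Sum>j\<in>UNIV. if j = i then c * partial i k y else 0)"
      unfolding divergence_def by (intro sum.cong) (auto simp: partial_scaleR[OF k] axis_def)
    then show "divergence (\<lambda>y. (c * k y) *\<^sub>R axis i 1) y = c * partial i k y" by simp
  qed
  then show ?thesis unfolding grad_div_def by (simp add: partial_cmult[OF smooth_partial[OF k]])
qed

lemma time_deriv_product:
  fixes \<theta> \<theta>' :: "real \<Rightarrow> real" and k :: "real^3 \<Rightarrow> real"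
  assumes "(\<theta> has_real_derivative \<theta>' t) (at t)" and k: "smooth k"
  shows "time_deriv (\<lambda>z. (\<theta> (fst z) * k (snd z)) *\<^sub>R v) (t, x) = (\<theta>' t * k x) *\<^sub>R v"
proof -
  have 1: "((\<lambda>z::real\<times>(real^3). \<theta> (fst z)) has_derivative (\<lambda>h. \<theta>' t * fst h)) (at (t, x))"
    using has_derivative_compose[OF has_derivative_fst[OF has_derivative_ident], of \<theta> "\<lambda>h. \<theta>' t * h" "(t, x)" UNIV] assms(1)
    by (simp add: has_field_derivative_def)
  have 2: "((\<lambda>z::real\<times>(real^3). k (snd z)) has_derivative (\<lambda>h. frechet_derivative k (at x) (snd h))) (at (t, x))"
    using has_derivative_compose[OF has_derivative_snd[OF has_derivative_ident], of k "frechet_derivative k (at x)" "(t, x)" UNIV]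
      smooth_has_derivative[OF k, of x] by simp
  have "frechet_derivative k (at x) 0 = 0"
    using linear_0[OF has_derivative_linear[OF smooth_has_derivative[OF k]]] .
  moreover have "((\<lambda>z. (\<theta> (fst z) * k (snd z)) *\<^sub>R v) has_derivative
      (\<lambda>h. (\<theta> t * frechet_derivative k (at x) (snd h) + \<theta>' t * fst h * k x) *\<^sub>R v)) (at (t, x))"
    using has_derivative_scaleR_left[OF has_derivative_mult[OF 1 2], of v] by simp
  ultimately show ?thesis unfolding time_deriv_def by (simp add: frechet_derivative_at[symmetric])
qed

section \<open>The mollified equation\<close>

lemma sq_mult_le:
  fixes f g :: "'a::euclidean_space \<Rightarrow> real"
  assumes f: "in_L4 f" and g: "in_L4 g"
  shows "sq (\<lambda>x. f x * g x) \<le> quart f + quart g"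
proof -
  have "sq (\<lambda>x. f x * g x) \<le> (LBINT x. ((f x)\<^sup>2)\<^sup>2 + ((g x)\<^sup>2)\<^sup>2)"
    unfolding sq_def
  proof (rule integral_mono)
    show "integrable lborel (\<lambda>x. (f x * g x)\<^sup>2)"
      by (rule in_L2_integrable[OF in_L4_mult(1)[OF f g]])
    show "integrable lborel (\<lambda>x. ((f x)\<^sup>2)\<^sup>2 + ((g x)\<^sup>2)\<^sup>2)"
      using f g by (simp add: in_L4_def in_L2_iff)
    show "(f x * g x)\<^sup>2 \<le> ((f x)\<^sup>2)\<^sup>2 + ((g x)\<^sup>2)\<^sup>2" for x
      using abs_mult_le_squares[of "(f x)\<^sup>2" "(g x)\<^sup>2"] by (simp add: power_mult_distrib)
  qed
  also have "\<dots> = quart f + quart g"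
    using f g by (simp add: sq_def in_L4_def in_L2_iff)
  finally show ?thesis .
qed

text \<open>A normalised weak solution: no "almost every t" remains, everything is split into scalar
  components, and u and its gradient vanish at nonpositive times so that integrals over the half
  space-time become integrals over the whole. \<open>weak_solution_regularization\<close> produces
  it.\<close>

locale global_solution =
  fixes \<epsilon> \<alpha> M :: real and u0 :: "real^3 \<Rightarrow> real^3" and u :: "real \<Rightarrow> real^3 \<Rightarrow> real^3"
    and G :: "real \<Rightarrow> real^3 \<Rightarrow> real^3^3"
  assumes eps: "\<epsilon> > 0" and u0_L2: "\<And>i. in_L2 (\<lambda>x. u0 x $ i)"
    and u_measurable: "\<And>i. case_prod (\<lambda>t x. u t x $ i) \<in> borel_measurable (borel \<Otimes>\<^sub>M borel)"
    and G_measurable: "\<And>i j. case_prod (\<lambda>t x. G t x $ i $ j) \<in> borel_measurable (borel \<Otimes>\<^sub>M borel)"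
    and u_neg: "\<And>t x. t \<le> 0 \<Longrightarrow> u t x = 0" and G_neg: "\<And>t x. t \<le> 0 \<Longrightarrow> G t x = 0"
    and u_bound: "\<And>t. (\<Sum>i\<in>UNIV. sq (\<lambda>x. u t x $ i)) \<le> M"
    and u_L4: "\<And>i t. in_L4 (\<lambda>x. u t x $ i)"
    and u_L4_fin: "\<And>i. (\<integral>\<^sup>+t. ennreal (quart (\<lambda>x. u t x $ i)) \<partial>lborel) < \<infinity>"
    and G_fin: "\<And>i j. (\<integral>\<^sup>+t. ennreal (sq (\<lambda>x. G t x $ i $ j)) \<partial>lborel) < \<infinity>"
    and weak_grad: "\<And>i j t. weak_partial j (\<lambda>x. u t x $ i) (\<lambda>x. G t x $ i $ j)"
    and weak_eq: "\<And>\<phi> :: real \<times> (real^3) \<Rightarrow> real^3. test_function \<phi> \<Longrightarrow>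
        (LBINT z. - (u (fst z) (snd z) \<bullet> time_deriv \<phi> z)
            + (G (fst z) (snd z) *v u (fst z) (snd z)) \<bullet> \<phi> z
            + \<alpha> * (norm (u (fst z) (snd z)))\<^sup>2 * (u (fst z) (snd z) \<bullet> \<phi> z))
        = (LBINT x. u0 x \<bullet> \<phi> (0, x))
        + (LBINT z. u (fst z) (snd z) \<bullet> laplacian (\<lambda>y. \<phi> (fst z, y)) (snd z)
            + (1 / \<epsilon>) * (u (fst z) (snd z) \<bullet> grad_div (\<lambda>y. \<phi> (fst z, y)) (snd z)))"
begin

abbreviation "U i t \<equiv> (\<lambda>x. u t x $ i)"
abbreviation "DU i j t \<equiv> (\<lambda>x. G t x $ i $ j)"
abbreviation "U0 i \<equiv> (\<lambda>x. u0 x $ i)"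

definition energy :: "real \<Rightarrow> real" where "energy t = (\<Sum>i\<in>UNIV. sq (U i t))"

definition dvg :: "real \<Rightarrow> real^3 \<Rightarrow> real" where "dvg t x = (\<Sum>l\<in>UNIV. DU l l t x)"

text \<open>The nonlinearity \<open>(u \<cdot> \<nabla>) u + \<alpha> |u|\<^sup>2 u\<close> has the components \<open>\<Sum>j. adv i j * u j\<close>
  with all coefficients \<open>adv i j\<close> square integrable in space and time.\<close>

definition adv :: "3 \<Rightarrow> 3 \<Rightarrow> real \<Rightarrow> real^3 \<Rightarrow> real" where
  "adv i j t x = DU i j t x + \<alpha> * (U i t x * U j t x)"

definition nonlin :: "3 \<Rightarrow> real \<Rightarrow> real^3 \<Rightarrow> real" where
  "nonlin i t x = (\<Sum>j\<in>UNIV. adv i j t x * U j t x)"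

definition adv_sq :: "real \<Rightarrow> real" where
  "adv_sq t = (\<Sum>i\<in>UNIV. \<Sum>j\<in>UNIV. sq (adv i j t))"

lemma U_L2: "in_L2 (U i t)" and DU_L2: "in_L2 (DU i j t)"
  using weak_partial_L2[OF weak_grad] by auto

lemma energy_le: "energy t \<le> M" using u_bound by (simp add: energy_def)

lemma sq_U_le: "sq (U i t) \<le> energy t"
  unfolding energy_def by (rule member_le_sum) auto

lemma energy_nonneg: "0 \<le> energy t" unfolding energy_def by (intro sum_nonneg) simp

lemma M_nonneg: "0 \<le> M" using energy_le[of 0] energy_nonneg[of 0] by linarith

lemma adv_L2: "in_L2 (adv i j t)"
  unfolding adv_def[abs_def] by (intro in_L2_add in_L2_cmult DU_L2 in_L4_mult(1) u_L4)

lemma dvg_L2: "in_L2 (dvg t)"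
  unfolding dvg_def[abs_def] by (intro in_L2_sum DU_L2)

lemma nonlin_integrable: "integrable lborel (nonlin i t)"
  unfolding nonlin_def[abs_def] by (intro Bochner_Integration.integrable_sum in_L2_mult_integrable adv_L2 U_L2)

lemma Um [measurable]: "(\<lambda>z. u (fst z) (snd z) $ i) \<in> borel_measurable (borel \<Otimes>\<^sub>M borel)"
  using measurable_compose2[OF u_measurable measurable_fst measurable_snd] .

lemma DUm [measurable]: "(\<lambda>z. G (fst z) (snd z) $ i $ j) \<in> borel_measurable (borel \<Otimes>\<^sub>M borel)"
  using measurable_compose2[OF G_measurable measurable_fst measurable_snd] .

lemma adv_measurable: "case_prod (adv i j) \<in> borel_measurable (borel \<Otimes>\<^sub>M borel)"
  unfolding split_beta' adv_def by measurable

lemma advm [measurable]: "(\<lambda>z. adv i j (fst z) (snd z)) \<in> borel_measurable (borel \<Otimes>\<^sub>M borel)"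
  using measurable_compose2[OF adv_measurable measurable_fst measurable_snd] .

lemma nonlin_measurable: "case_prod (nonlin i) \<in> borel_measurable (borel \<Otimes>\<^sub>M borel)"
  unfolding split_beta' nonlin_def by measurable

lemma dvg_measurable: "case_prod dvg \<in> borel_measurable (borel \<Otimes>\<^sub>M borel)"
  unfolding split_beta' dvg_def by measurable

lemma sq_adv_le: "sq (adv i j t) \<le> 2 * sq (DU i j t) + 2 * \<alpha>\<^sup>2 * (quart (U i t) + quart (U j t))"
proof -
  have "sq (adv i j t) \<le> 2 * sq (DU i j t) + 2 * sq (\<lambda>x. \<alpha> * (U i t x * U j t x))"
    unfolding adv_def[abs_def] by (intro sq_add_le in_L2_cmult DU_L2 in_L4_mult(1) u_L4)
  moreover have "sq (\<lambda>x. \<alpha> * (U i t x * U j t x)) \<le> \<alpha>\<^sup>2 * (quart (U i t) + quart (U j t))"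
  proof -
    have "sq (\<lambda>x. U i t x * U j t x) \<le> quart (U i t) + quart (U j t)" by (rule sq_mult_le[OF u_L4 u_L4])
    then have "\<alpha>\<^sup>2 * sq (\<lambda>x. U i t x * U j t x) \<le> \<alpha>\<^sup>2 * (quart (U i t) + quart (U j t))"
      by (rule mult_left_mono) simp
    then show ?thesis by (simp add: sq_def power_mult_distrib)
  qed
  ultimately show ?thesis by (simp add: mult.assoc)
qed

lemma quart_integrable: "integrable lborel (\<lambda>t. quart (U i t))"
proof (rule integrableI_bounded)
  have "case_prod (\<lambda>t x. (U i t x)\<^sup>2) \<in> borel_measurable (borel \<Otimes>\<^sub>M borel)" unfolding split_beta' by measurable
  from sq_measurable_param[OF this] show "(\<lambda>t. quart (U i t)) \<in> borel_measurable lborel" by simp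
qed (use u_L4_fin in simp)

lemma sq_DU_integrable: "integrable lborel (\<lambda>t. sq (DU i j t))"
  using sq_measurable_param[OF G_measurable] G_fin by (intro integrableI_bounded) simp_all

lemma sq_adv_integrable: "integrable lborel (\<lambda>t. sq (adv i j t))"
proof (rule Bochner_Integration.integrable_bound)
  show "integrable lborel (\<lambda>t. 2 * sq (DU i j t) + 2 * \<alpha>\<^sup>2 * (quart (U i t) + quart (U j t)))"
    using sq_DU_integrable quart_integrable by simp
  show "(\<lambda>t. sq (adv i j t)) \<in> borel_measurable lborel" using sq_measurable_param[OF adv_measurable] by simp
  show "AE t in lborel. norm (sq (adv i j t)) \<le> norm (2 * sq (DU i j t) + 2 * \<alpha>\<^sup>2 * (quart (U i t) + quart (U j t)))"
    using sq_adv_le by (intro AE_I2) (simp add: order_trans[OF _ abs_ge_self])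
qed

lemma adv_sq_integrable: "integrable lborel adv_sq"
  unfolding adv_sq_def[abs_def] by (intro Bochner_Integration.integrable_sum sq_adv_integrable)

lemma adv_sq_nonneg: "0 \<le> adv_sq t" unfolding adv_sq_def by (intro sum_nonneg) simp

lemma energy_measurable [measurable]: "energy \<in> borel_measurable borel"
  unfolding energy_def[abs_def] using sq_measurable_param[OF u_measurable] by measurable

text \<open>Each component of the nonlinearity is a sum of products of two L2 functions. The factor
  \<open>adv_sq\<close> is integrable over all times, while \<open>energy\<close> is the quantity
  whose decay is sought; keeping them apart makes the later estimate self-improving.\<close>

lemma nonlin_L1_sq: "(LBINT x. \<bar>nonlin i t x\<bar>)\<^sup>2 \<le> adv_sq t * energy t"
proof -
  have "(LBINT x. \<bar>nonlin i t x\<bar>) \<le> (LBINT x. (\<Sum>j\<in>UNIV. \<bar>adv i j t x * U j t x\<bar>))"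
    using nonlin_integrable unfolding nonlin_def
    by (intro integral_mono integrable_abs Bochner_Integration.integrable_sum in_L2_mult_integrable adv_L2 U_L2 sum_abs)
  also have "\<dots> = (\<Sum>j\<in>UNIV. LBINT x. \<bar>adv i j t x * U j t x\<bar>)"
    by (intro Bochner_Integration.integral_sum integrable_abs in_L2_mult_integrable adv_L2 U_L2)
  also have "\<dots> \<le> (\<Sum>j\<in>UNIV. sqrt (sq (adv i j t)) * sqrt (sq (U j t)))"
    using Cauchy_Schwarz_L2(2)[OF adv_L2 U_L2] by (intro sum_mono) (simp add: real_sqrt_mult[symmetric] real_le_rsqrt)
  finally have "(LBINT x. \<bar>nonlin i t x\<bar>)\<^sup>2 \<le> (\<Sum>j\<in>UNIV. sqrt (sq (adv i j t)) * sqrt (sq (U j t)))\<^sup>2"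
    by (intro power_mono) (auto intro: Bochner_Integration.integral_nonneg)
  also have "\<dots> \<le> (\<Sum>j\<in>UNIV. (sqrt (sq (adv i j t)))\<^sup>2) * (\<Sum>j\<in>UNIV. (sqrt (sq (U j t)))\<^sup>2)"
    by (rule Cauchy_Schwarz_ineq_sum)
  also have "\<dots> = (\<Sum>j\<in>UNIV. sq (adv i j t)) * energy t" by (simp add: energy_def)
  also have "\<dots> \<le> adv_sq t * energy t"
    unfolding adv_sq_def by (intro mult_right_mono energy_nonneg member_le_sum[of i UNIV "\<lambda>i. \<Sum>j\<in>UNIV. sq (adv i j t)"] sum_nonneg) auto
  finally show ?thesis .
qed

lemma nonlin_L1_le: "(LBINT x. \<bar>nonlin i t x\<bar>) \<le> adv_sq t + energy t"
proof -
  have "adv_sq t * energy t \<le> (adv_sq t + energy t)\<^sup>2"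
    using adv_sq_nonneg[of t] energy_nonneg[of t] by (simp add: power2_sum)
  then have "(LBINT x. \<bar>nonlin i t x\<bar>)\<^sup>2 \<le> (adv_sq t + energy t)\<^sup>2" using nonlin_L1_sq[of i t] by linarith
  then show ?thesis using adv_sq_nonneg[of t] energy_nonneg[of t] by (rule power2_le_imp_le[OF _ add_nonneg_nonneg])
qed

lemma slab_U: "slab (U i)"
proof (rule slabI_L2[OF u_measurable])
  fix T
  have "(\<integral>\<^sup>+t. indicator {0..T} t * L2_sqnorm (U i t) \<partial>lborel) \<le> (\<integral>\<^sup>+t. indicator {0..T} t * ennreal M \<partial>lborel)"
    using order_trans[OF sq_U_le energy_le] by (intro nn_integral_mono mult_left_mono) (simp_all add: L2_sqnorm_eq_sq[OF U_L2] ennreal_leI)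
  also have "\<dots> < \<infinity>" by (simp add: nn_integral_multc ennreal_mult_less_top emeasure_lborel_Icc_eq)
  finally show "(\<integral>\<^sup>+t. indicator {0..T} t * L2_sqnorm (U i t) \<partial>lborel) < \<infinity>" .
qed (simp add: u_neg)

lemma slab_L2_integrable:
  assumes m: "case_prod p \<in> borel_measurable (borel \<Otimes>\<^sub>M borel)" and z: "\<And>t x. t \<le> 0 \<Longrightarrow> p t x = 0"
    and p: "\<And>t. in_L2 (p t)" and i: "integrable lborel (\<lambda>t. sq (p t))"
  shows "slab (p :: real \<Rightarrow> real^3 \<Rightarrow> real)"
proof (rule slabI_L2[OF m z])
  fix T
  have "(\<integral>\<^sup>+t. indicator {0..T} t * L2_sqnorm (p t) \<partial>lborel) \<le> (\<integral>\<^sup>+t. ennreal (sq (p t)) \<partial>lborel)"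
    by (intro nn_integral_mono) (simp add: L2_sqnorm_eq_sq[OF p] indicator_def)
  also have "\<dots> < \<infinity>" using i by (simp add: integrable_iff_bounded)
  finally show "(\<integral>\<^sup>+t. indicator {0..T} t * L2_sqnorm (p t) \<partial>lborel) < \<infinity>" .
qed

lemma slab_DU: "slab (DU i j)"
  by (intro slab_L2_integrable G_measurable DU_L2 sq_DU_integrable) (simp add: G_neg)

lemma sq_sum_le:
  fixes f :: "'i::finite \<Rightarrow> real^3 \<Rightarrow> real"
  assumes f: "\<And>i. in_L2 (f i)"
  shows "sq (\<lambda>x. \<Sum>i\<in>UNIV. f i x) \<le> real CARD('i) * (\<Sum>i\<in>UNIV. sq (f i))"
proof -
  have "sq (\<lambda>x. \<Sum>i\<in>UNIV. f i x) \<le> (LBINT x. real CARD('i) * (\<Sum>i\<in>UNIV. (f i x)\<^sup>2))"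
    unfolding sq_def
  proof (rule integral_mono)
    show "integrable lborel (\<lambda>x. (\<Sum>i\<in>UNIV. f i x)\<^sup>2)" by (intro in_L2_integrable in_L2_sum f)
    show "integrable lborel (\<lambda>x. real CARD('i) * (\<Sum>i\<in>UNIV. (f i x)\<^sup>2))"
      by (intro integrable_mult_right Bochner_Integration.integrable_sum in_L2_integrable f)
    show "(\<Sum>i\<in>UNIV. f i x)\<^sup>2 \<le> real CARD('i) * (\<Sum>i\<in>UNIV. (f i x)\<^sup>2)" for x
      using Cauchy_Schwarz_ineq_sum[of "\<lambda>_. 1" "\<lambda>i. f i x" UNIV] by simp
  qed
  also have "\<dots> = real CARD('i) * (\<Sum>i\<in>UNIV. sq (f i))"
    using f by (simp add: sq_def in_L2_integrable)
  finally show ?thesis .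
qed

lemma sq_dvg_le: "sq (dvg t) \<le> 3 * (\<Sum>l\<in>UNIV. sq (DU l l t))"
  using sq_sum_le[of "\<lambda>l. DU l l t"] DU_L2 by (simp add: dvg_def[abs_def])

lemma sq_dvg_integrable: "integrable lborel (\<lambda>t. sq (dvg t))"
proof (rule Bochner_Integration.integrable_bound)
  show "integrable lborel (\<lambda>t. 3 * (\<Sum>l\<in>UNIV. sq (DU l l t)))"
    by (intro integrable_mult_right Bochner_Integration.integrable_sum sq_DU_integrable)
  show "(\<lambda>t. sq (dvg t)) \<in> borel_measurable lborel" using sq_measurable_param[OF dvg_measurable] by simp
  show "AE t in lborel. norm (sq (dvg t)) \<le> norm (3 * (\<Sum>l\<in>UNIV. sq (DU l l t)))"
    using sq_dvg_le by (intro AE_I2) (simp add: order_trans[OF _ abs_ge_self])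
qed

lemma slab_dvg: "slab dvg"
  by (intro slab_L2_integrable dvg_measurable dvg_L2 sq_dvg_integrable) (simp add: dvg_def G_neg)

lemma slab_nonlin: "slab (nonlin i)"
proof (rule slabI_L1[OF nonlin_measurable])
  fix T
  have "(\<integral>\<^sup>+t. indicator {0..T} t * (\<integral>\<^sup>+y. ennreal \<bar>nonlin i t y\<bar> \<partial>lborel) \<partial>lborel)
     \<le> (\<integral>\<^sup>+t. ennreal (adv_sq t) + indicator {0..T} t * ennreal M \<partial>lborel)"
  proof (rule nn_integral_mono)
    fix t
    have "(\<integral>\<^sup>+y. ennreal \<bar>nonlin i t y\<bar> \<partial>lborel) = ennreal (LBINT y. \<bar>nonlin i t y\<bar>)"
      using nonlin_integrable by (intro nn_integral_eq_integral) auto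
    also have "\<dots> \<le> ennreal (adv_sq t + M)"
      using nonlin_L1_le[of i t] energy_le[of t] by (intro ennreal_leI) linarith
    also have "\<dots> = ennreal (adv_sq t) + ennreal M" using adv_sq_nonneg M_nonneg by (rule ennreal_plus)
    finally show "indicator {0..T} t * (\<integral>\<^sup>+y. ennreal \<bar>nonlin i t y\<bar> \<partial>lborel) \<le> ennreal (adv_sq t) + indicator {0..T} t * ennreal M"
      by (auto simp: indicator_def)
  qed
  also have "\<dots> = (\<integral>\<^sup>+t. ennreal (adv_sq t) \<partial>lborel) + (\<integral>\<^sup>+t. indicator {0..T} t * ennreal M \<partial>lborel)"
    using adv_sq_integrable by (intro nn_integral_add) auto
  also have "\<dots> < \<infinity>"
    using adv_sq_integrable adv_sq_nonneg
    by (simp add: integrable_iff_bounded nn_integral_multc ennreal_mult_less_top emeasure_lborel_Icc_eq)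
  finally show "(\<integral>\<^sup>+t. indicator {0..T} t * (\<integral>\<^sup>+y. ennreal \<bar>nonlin i t y\<bar> \<partial>lborel) \<partial>lborel) < \<infinity>" .
qed (simp add: nonlin_def u_neg)

text \<open>The time derivative of the mollified component i. In each second-order term one
  derivative falls on the kernel and the other stays on the solution, so the term is governed by
  \<open>DU\<close> or \<open>dvg\<close>, whose squares are integrable in time.\<close>

definition rhs :: "(real^3 \<Rightarrow> real) \<Rightarrow> 3 \<Rightarrow> real \<Rightarrow> real^3 \<Rightarrow> real" where
  "rhs k i t x = (\<Sum>j\<in>UNIV. conv (partial j k) (DU i j t) x) + (1 / \<epsilon>) * conv (partial i k) (dvg t) x - conv k (nonlin i t) x"

lemma conv_loc_integrable: "slab p \<Longrightarrow> kernel k \<Longrightarrow> loc_integrable (\<lambda>t. conv k (p t) x)"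
  unfolding conv_def by (rule slab_loc_integrable) (auto intro: kernel_reflect)

lemma rhs_loc_integrable:
  assumes k: "test_function k"
  shows "loc_integrable (\<lambda>t. rhs k i t x)"
  unfolding rhs_def
  by (intro loc_integrable_diff loc_integrable_add loc_integrable_cmult loc_integrable_sum conv_loc_integrable
      slab_DU slab_dvg slab_nonlin test_function_kernel test_function_partial k)

text \<open>The test function is \<theta>(t) h(y) times the i-th unit vector, and each integral
  factors through \<open>slab_integrable\<close>. The grad-div term brings in every component
  \<open>U l\<close>, since the gradient of div (h e_i) has l-th entry
  \<open>partial l (partial i h)\<close>.\<close>

lemma weak_form_component:
  assumes \<theta>: "test_function \<theta>" "test_function \<theta>'" "\<And>t. (\<theta> has_real_derivative \<theta>' t) (at t)"
    and h: "test_function h"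
  shows "- (LBINT t. \<theta>' t * (LBINT y. h y * U i t y)) + (LBINT t. \<theta> t * (LBINT y. h y * nonlin i t y))
    = \<theta> 0 * (LBINT y. h y * U0 i y)
      + ((\<Sum>j\<in>UNIV. LBINT t. \<theta> t * (LBINT y. partial j (partial j h) y * U i t y))
      + (1 / \<epsilon>) * (\<Sum>l\<in>UNIV. LBINT t. \<theta> t * (LBINT y. partial l (partial i h) y * U l t y)))"
proof -
  let ?\<phi> = "\<lambda>z::real\<times>(real^3). (\<theta> (fst z) * h (snd z)) *\<^sub>R axis i (1::real)"
  have smh: "smooth h" using h by (simp add: test_function_iff)
  have test: "test_function ?\<phi>" by (rule test_function_product[OF \<theta>(1) h])
  have slabint: "integrable lborel (\<lambda>z. \<eta> (fst z) * (k (snd z) * p (fst z) (snd z)))"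
    "(LBINT z. \<eta> (fst z) * (k (snd z) * p (fst z) (snd z))) = (LBINT t. \<eta> t * (LBINT y. k y * p t y))"
    if A: "test_function \<eta>" "test_function k" "slab p" for \<eta> k and p :: "real \<Rightarrow> real^3 \<Rightarrow> real"
  proof -
    obtain B where B: "\<And>t. \<bar>\<eta> t\<bar> \<le> B" using kernel_bounded[OF test_function_kernel[OF A(1)]] by blast
    obtain T where T: "\<And>t. T < \<bar>t\<bar> \<Longrightarrow> \<eta> t = 0" using A(1) by (auto simp: test_function_iff)
    have T': "\<eta> t = 0" if "T < t" for t using T[of t] that by simp
    have m: "\<eta> \<in> borel_measurable borel" using test_function_kernel[OF A(1)] by (rule kernel_measurable)
    note S = slab_integrable[OF A(3) test_function_kernel[OF A(2)] m B T']
    show "integrable lborel (\<lambda>z. \<eta> (fst z) * (k (snd z) * p (fst z) (snd z)))"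
      using S(1) by (simp add: lborel_prod split_beta')
    show "(LBINT z. \<eta> (fst z) * (k (snd z) * p (fst z) (snd z))) = (LBINT t. \<eta> t * (LBINT y. k y * p t y))"
      using S(3) by (simp add: lborel_prod)
  qed
  note th = test_function_partial[OF test_function_partial[OF h]]
  have L: "- (u t y \<bullet> time_deriv ?\<phi> (t, y)) + (G t y *v u t y) \<bullet> ?\<phi> (t, y) + \<alpha> * (norm (u t y))\<^sup>2 * (u t y \<bullet> ?\<phi> (t, y))
    = - (\<theta>' t * (h y * U i t y)) + \<theta> t * (h y * nonlin i t y)" for t y
  proof -
    have td: "time_deriv ?\<phi> (t, y) = (\<theta>' t * h y) *\<^sub>R axis i 1"
      by (rule time_deriv_product[where \<theta>'=\<theta>', OF \<theta>(3) smh])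
    have nl: "nonlin i t y = (G t y *v u t y) $ i + \<alpha> * (norm (u t y))\<^sup>2 * U i t y"
      by (simp add: nonlin_def adv_def matrix_vector_mult_def power2_norm_eq_inner inner_vec_def sum.distrib sum_distrib_left sum_distrib_right algebra_simps)
    show ?thesis unfolding td nl by (simp add: inner_axis algebra_simps)
  qed
  have L': "- (u (fst z) (snd z) \<bullet> time_deriv ?\<phi> z) + (G (fst z) (snd z) *v u (fst z) (snd z)) \<bullet> ?\<phi> z
      + \<alpha> * (norm (u (fst z) (snd z)))\<^sup>2 * (u (fst z) (snd z) \<bullet> ?\<phi> z)
    = - (\<theta>' (fst z) * (h (snd z) * U i (fst z) (snd z))) + \<theta> (fst z) * (h (snd z) * nonlin i (fst z) (snd z))" for z
    using L[of "fst z" "snd z"] by (simp only: prod.collapse fst_conv snd_conv)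
  have R: "u t y \<bullet> laplacian (\<lambda>y. ?\<phi> (t, y)) y + (1 / \<epsilon>) * (u t y \<bullet> grad_div (\<lambda>y. ?\<phi> (t, y)) y)
    = (\<Sum>j\<in>UNIV. \<theta> t * (partial j (partial j h) y * U i t y)) + (1 / \<epsilon>) * (\<Sum>l\<in>UNIV. \<theta> t * (partial l (partial i h) y * U l t y))" for t y
  proof -
    have lap: "laplacian (\<lambda>y. ?\<phi> (t, y)) y = (\<theta> t * (\<Sum>j\<in>UNIV. partial j (partial j h) y)) *\<^sub>R axis i 1"
      using laplacian_scaleR[OF smh, of "\<theta> t" "axis i 1" y] by simp
    have gd: "grad_div (\<lambda>y. ?\<phi> (t, y)) y = (\<chi> l. \<theta> t * partial l (partial i h) y)"
      using grad_div_scaleR_axis[OF smh, of "\<theta> t" i y] by simp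
    have "u t y \<bullet> axis i 1 = U i t y" by (simp add: inner_axis)
    moreover have "u t y \<bullet> (\<chi> l. f l) = (\<Sum>l\<in>UNIV. U l t y * f l)" for f by (simp add: inner_vec_def)
    ultimately show ?thesis unfolding lap gd
      by (simp add: sum_distrib_left sum_distrib_right mult_ac)
  qed
  have I: "(LBINT y. u0 y \<bullet> ?\<phi> (0, y)) = \<theta> 0 * (LBINT y. h y * U0 i y)"
    by (simp add: inner_axis mult_ac)
  have "(LBINT z. - (\<theta>' (fst z) * (h (snd z) * U i (fst z) (snd z))) + \<theta> (fst z) * (h (snd z) * nonlin i (fst z) (snd z)))
    = \<theta> 0 * (LBINT y. h y * U0 i y) + (LBINT z. 
      (\<Sum>j\<in>UNIV. \<theta> (fst z) * (partial j (partial j h) (snd z) * U i (fst z) (snd z)))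
      + (1 / \<epsilon>) * (\<Sum>l\<in>UNIV. \<theta> (fst z) * (partial l (partial i h) (snd z) * U l (fst z) (snd z))))"
    using weak_eq[OF test] unfolding I by (simp only: L' R[unfolded fst_conv snd_conv] fst_conv snd_conv)
  moreover have "(LBINT z. - (\<theta>' (fst z) * (h (snd z) * U i (fst z) (snd z))) + \<theta> (fst z) * (h (snd z) * nonlin i (fst z) (snd z)))
    = - (LBINT t. \<theta>' t * (LBINT y. h y * U i t y)) + (LBINT t. \<theta> t * (LBINT y. h y * nonlin i t y))"
    using slabint[OF \<theta>(2) h slab_U] slabint[OF \<theta>(1) h slab_nonlin] by simp
  moreover have "(LBINT z. 
      (\<Sum>j\<in>UNIV. \<theta> (fst z) * (partial j (partial j h) (snd z) * U i (fst z) (snd z)))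
      + (1 / \<epsilon>) * (\<Sum>l\<in>UNIV. \<theta> (fst z) * (partial l (partial i h) (snd z) * U l (fst z) (snd z))))
    = (\<Sum>j\<in>UNIV. LBINT t. \<theta> t * (LBINT y. partial j (partial j h) y * U i t y))
      + (1 / \<epsilon>) * (\<Sum>l\<in>UNIV. LBINT t. \<theta> t * (LBINT y. partial l (partial i h) y * U l t y))"
    using slabint[OF \<theta>(1) th slab_U] by simp
  ultimately show ?thesis by simp
qed

text \<open>With the spatial factor \<open>h y = k (x - y)\<close> for fixed x, the weak formulation
  becomes the hypothesis of \<open>weak_ode\<close> for the function of time
  \<open>conv k (U i t) x\<close>.\<close>

lemma conv_ode:
  assumes k: "test_function k"
  shows "AE t in lborel. t > 0 \<longrightarrow> conv k (U i t) x = conv k (U0 i) x + (LBINT s. indicator {..t} s * rhs k i s x)"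
proof (rule weak_ode)
  show "loc_integrable (\<lambda>t. conv k (U i t) x)" by (intro conv_loc_integrable slab_U test_function_kernel k)
  show "loc_integrable (\<lambda>t. rhs k i t x)" by (rule rhs_loc_integrable[OF k])
  fix \<theta> \<theta>' :: "real \<Rightarrow> real"
  assume \<theta>: "test_function \<theta>" "test_function \<theta>'" "\<And>t. (\<theta> has_real_derivative \<theta>' t) (at t)"
  define h where "h y = k (x - y)" for y
  have h: "test_function h" unfolding h_def[abs_def] by (rule test_function_reflect[OF k])
  have smk: "smooth k" using k by (simp add: test_function_iff)
  have ph: "partial j h y = - partial j k (x - y)" for j y
    unfolding h_def[abs_def] by (rule partial_reflect[OF smk])
  \<comment> \<open>One derivative is moved onto u by its weak gradient; its minus sign cancels the
    one that \<open>ph\<close> gives for the remaining derivative.\<close>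
  have parts: "(LBINT y. partial j (partial l h) y * U m t y) = conv (partial l k) (DU m j t) x" for j l m t
  proof -
    have "(LBINT y. U m t y * partial j (partial l h) y) = - (LBINT y. DU m j t y * partial l h y)"
      using weak_grad[of j t m] test_function_partial[OF h] by (auto simp: weak_partial_def)
    then show ?thesis by (simp add: ph conv_def mult.commute)
  qed
  have cint: "integrable lborel (\<lambda>t. \<theta> t * conv \<kappa> (p t) x)" if "kernel \<kappa>" "slab p" for \<kappa> and p :: "real \<Rightarrow> real^3 \<Rightarrow> real"
  proof -
    obtain B where B: "\<And>t. \<bar>\<theta> t\<bar> \<le> B" using kernel_bounded[OF test_function_kernel[OF \<theta>(1)]] by blast
    obtain T where T: "\<And>t. T < \<bar>t\<bar> \<Longrightarrow> \<theta> t = 0" using \<theta>(1) by (auto simp: test_function_iff)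
    have T': "\<theta> t = 0" if "T < t" for t using T[of t] that by simp
    have m: "\<theta> \<in> borel_measurable borel" using test_function_kernel[OF \<theta>(1)] by (rule kernel_measurable)
    show ?thesis unfolding conv_def by (rule slab_integrable(2)[OF that(2) kernel_reflect[OF that(1)] m B T'])
  qed
  note kk = test_function_kernel[OF k] and kp = test_function_kernel[OF test_function_partial[OF k]]
  have dv: "conv (partial i k) (dvg t) x = (\<Sum>l\<in>UNIV. conv (partial i k) (DU l l t) x)" for t
    using conv_okD[OF conv_ok_L2[OF DU_L2] kp] by (simp add: conv_def dvg_def sum_distrib_left)
  have "- (LBINT t. \<theta>' t * conv k (U i t) x) + (LBINT t. \<theta> t * conv k (nonlin i t) x)
    = \<theta> 0 * conv k (U0 i) x + ((\<Sum>j\<in>UNIV. LBINT t. \<theta> t * conv (partial j k) (DU i j t) x)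
      + (1 / \<epsilon>) * (\<Sum>l\<in>UNIV. LBINT t. \<theta> t * conv (partial i k) (DU l l t) x))"
    using weak_form_component[OF \<theta> h, of i] unfolding parts by (simp add: conv_def h_def)
  moreover have "(LBINT t. \<theta> t * rhs k i t x) = (\<Sum>j\<in>UNIV. LBINT t. \<theta> t * conv (partial j k) (DU i j t) x)
      + (1 / \<epsilon>) * (\<Sum>l\<in>UNIV. LBINT t. \<theta> t * conv (partial i k) (DU l l t) x) - (LBINT t. \<theta> t * conv k (nonlin i t) x)"
  proof -
    have "\<theta> t * rhs k i t x = (\<Sum>j\<in>UNIV. \<theta> t * conv (partial j k) (DU i j t) x)
      + (1 / \<epsilon>) * (\<Sum>l\<in>UNIV. \<theta> t * conv (partial i k) (DU l l t) x) - \<theta> t * conv k (nonlin i t) x" for t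
      unfolding rhs_def dv by (simp add: algebra_simps sum_distrib_left)
    then show ?thesis
      using cint[OF kp slab_DU] cint[OF kk slab_nonlin] by simp
  qed
  ultimately show "- (LBINT t. \<theta>' t * conv k (U i t) x) = \<theta> 0 * conv k (U0 i) x + (LBINT t. \<theta> t * rhs k i t x)"
    by simp
qed

end

section \<open>Energy equality\<close>

context global_solution
begin

definition grad_sq :: "real \<Rightarrow> real" where
  "grad_sq t = (\<Sum>i\<in>UNIV. \<Sum>j\<in>UNIV. sq (DU i j t))"

definition conv_dissipation :: "(real^3 \<Rightarrow> real) \<Rightarrow> real \<Rightarrow> real" where
  "conv_dissipation k t = (\<Sum>i\<in>UNIV. \<Sum>j\<in>UNIV. sq (conv k (DU i j t))) + (1 / \<epsilon>) * sq (conv k (dvg t))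
     + (\<Sum>i\<in>UNIV. LBINT x. conv k (U i t) x * conv k (nonlin i t) x)"

definition conv_energy :: "(real^3 \<Rightarrow> real) \<Rightarrow> real \<Rightarrow> real" where
  "conv_energy k t = (\<Sum>i\<in>UNIV. sq (conv k (U i t)))"

lemma rhs_L2:
  assumes k: "test_function k"
  shows "in_L2 (rhs k i t)"
  unfolding rhs_def[abs_def]
  by (intro in_L2_diff in_L2_add in_L2_cmult in_L2_sum conv_Young(1) conv_Young_L1(1) kernel_integrable kernel_in_L2
      DU_L2 dvg_L2 nonlin_integrable test_function_kernel test_function_partial k)

text \<open>Qualitative only: the constants depend on k and are not uniform as the mollifier
  concentrates. They license the use of \<open>energy_identity\<close> for one fixed k.\<close>

lemma sq_rhs_integrable:
  assumes k: "test_function k"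
  shows "(\<integral>\<^sup>+t. indicator {0..T} t * L2_sqnorm (rhs k i t) \<partial>lborel) < \<infinity>"
proof -
  note kk = test_function_kernel[OF k] and kp = test_function_kernel[OF test_function_partial[OF k]]
  let ?n = "\<lambda>j. (LBINT x. \<bar>partial j k x\<bar>)\<^sup>2"
  let ?B = "\<lambda>t. 2 * (2 * (3 * (\<Sum>j\<in>UNIV. ?n j * sq (DU i j t))) + 2 * ((1 / \<epsilon>)\<^sup>2 * (?n i * sq (dvg t)))) + 2 * (sq k * (M * adv_sq t))"
  have le: "sq (rhs k i t) \<le> ?B t" for t
  proof -
    have L: "in_L2 (conv (partial j k) (DU i j t))" "in_L2 (conv (partial i k) (dvg t))" "in_L2 (conv k (nonlin i t))" for j
      by (intro conv_Young(1) conv_Young_L1(1) kernel_integrable kernel_in_L2 DU_L2 dvg_L2 nonlin_integrable kk kp)+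
    let ?a = "\<lambda>x. \<Sum>j\<in>UNIV. conv (partial j k) (DU i j t) x" and ?b = "\<lambda>x. (1 / \<epsilon>) * conv (partial i k) (dvg t) x"
      and ?c = "\<lambda>x. - conv k (nonlin i t) x"
    have a2: "in_L2 ?a" by (intro in_L2_sum L)
    have b2: "in_L2 ?b" by (intro in_L2_cmult L)
    have r: "rhs k i t = (\<lambda>x. (?a x + ?b x) + ?c x)" by (simp add: rhs_def[abs_def])
    have 1: "sq (rhs k i t) \<le> 2 * sq (\<lambda>x. ?a x + ?b x) + 2 * sq ?c"
      unfolding r by (rule sq_add_le[OF in_L2_add[OF a2 b2] in_L2_uminus[OF L(3)]])
    have 2: "sq (\<lambda>x. ?a x + ?b x) \<le> 2 * sq ?a + 2 * sq ?b" by (rule sq_add_le[OF a2 b2])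
    have 3: "sq ?a \<le> 3 * (\<Sum>j\<in>UNIV. ?n j * sq (DU i j t))"
    proof -
      have "sq ?a \<le> 3 * (\<Sum>j\<in>UNIV. sq (conv (partial j k) (DU i j t)))" using sq_sum_le[of "\<lambda>j. conv (partial j k) (DU i j t)"] L(1) by simp
      also have "\<dots> \<le> 3 * (\<Sum>j\<in>UNIV. ?n j * sq (DU i j t))"
        by (intro mult_left_mono sum_mono conv_Young(2) kernel_integrable kp DU_L2) simp
      finally show ?thesis .
    qed
    have 4: "sq ?b \<le> (1 / \<epsilon>)\<^sup>2 * (?n i * sq (dvg t))"
    proof -
      have "sq ?b = (1 / \<epsilon>)\<^sup>2 * sq (conv (partial i k) (dvg t))" unfolding sq_def power_mult_distrib by simp
      also have "\<dots> \<le> (1 / \<epsilon>)\<^sup>2 * (?n i * sq (dvg t))"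
        by (intro mult_left_mono conv_Young(2) kernel_integrable kp dvg_L2) simp
      finally show ?thesis .
    qed
    have 5: "sq ?c \<le> sq k * (M * adv_sq t)"
    proof -
      have "sq ?c = sq (conv k (nonlin i t))" by (simp add: sq_def)
      also have "\<dots> \<le> sq k * (LBINT x. \<bar>nonlin i t x\<bar>)\<^sup>2"
        by (intro conv_Young_L1(2) kernel_in_L2 kk nonlin_integrable)
      also have "\<dots> \<le> sq k * (adv_sq t * energy t)" by (intro mult_left_mono nonlin_L1_sq) simp
      also have "\<dots> \<le> sq k * (adv_sq t * M)" by (intro mult_left_mono energy_le adv_sq_nonneg) simp
      finally show ?thesis by (simp add: mult.commute)
    qed
    show ?thesis using 1 2 3 4 5 by simp
  qed
  have B: "integrable lborel ?B"
    by (intro Bochner_Integration.integrable_add integrable_mult_right Bochner_Integration.integrable_sum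
        sq_DU_integrable sq_dvg_integrable adv_sq_integrable)
  have "(\<integral>\<^sup>+t. indicator {0..T} t * L2_sqnorm (rhs k i t) \<partial>lborel) \<le> (\<integral>\<^sup>+t. ennreal (norm (?B t)) \<partial>lborel)"
  proof (rule nn_integral_mono)
    fix t
    have "indicator {0..T} t * L2_sqnorm (rhs k i t) \<le> ennreal (sq (rhs k i t))"
      by (simp add: L2_sqnorm_eq_sq[OF rhs_L2[OF k]] indicator_def)
    also have "\<dots> \<le> ennreal (norm (?B t))" using le[of t] unfolding real_norm_def
      by (intro ennreal_leI order_trans[OF _ abs_ge_self])
    finally show "indicator {0..T} t * L2_sqnorm (rhs k i t) \<le> ennreal (norm (?B t))" .
  qed
  also have "\<dots> < \<infinity>" using B unfolding integrable_iff_bounded by blast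
  finally show ?thesis .
qed

lemma rhs_measurable:
  assumes k: "test_function k"
  shows "case_prod (rhs k i) \<in> borel_measurable (borel \<Otimes>\<^sub>M borel)"
proof -
  note kk = kernel_measurable[OF test_function_kernel[OF k]] and kp = kernel_measurable[OF test_function_kernel[OF test_function_partial[OF k]]]
  note m = measurable_compose2[OF conv_measurable_param measurable_fst measurable_snd]
  have [measurable]: "(\<lambda>z. conv (partial j k) (DU i j (fst z)) (snd z)) \<in> borel_measurable (borel \<Otimes>\<^sub>M borel)" for j
    by (rule m[OF G_measurable kp])
  have [measurable]: "(\<lambda>z. conv (partial i k) (dvg (fst z)) (snd z)) \<in> borel_measurable (borel \<Otimes>\<^sub>M borel)"
    by (rule m[OF dvg_measurable kp])
  have [measurable]: "(\<lambda>z. conv k (nonlin i (fst z)) (snd z)) \<in> borel_measurable (borel \<Otimes>\<^sub>M borel)"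
    by (rule m[OF nonlin_measurable kk])
  show ?thesis unfolding split_beta' rhs_def by measurable
qed

text \<open>\<open>conv_partial_antisym\<close> moves the derivative from the kernel on the right
  factor to the one on \<open>U\<close>, where \<open>weak_partial_conv\<close> turns it into
  \<open>DU\<close>. Summed over i, the diagonal entries assemble to the square of the mollified
  divergence.\<close>

lemma conv_rhs_inner:
  assumes k: "test_function k"
  shows "(\<Sum>i\<in>UNIV. LBINT x. conv k (U i t) x * rhs k i t x) = - conv_dissipation k t"
proof -
  note kk = test_function_kernel[OF k] and kp = test_function_kernel[OF test_function_partial[OF k]]
  have L: "in_L2 (conv (partial j k) (DU i l t))" "in_L2 (conv (partial i k) (dvg t))" "in_L2 (conv k (nonlin i t))"
    "in_L2 (conv k (U i t))" "in_L2 (conv k (DU i l t))" "in_L2 (conv k (dvg t))" for i j l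
    by (intro conv_Young(1) conv_Young_L1(1) kernel_integrable kernel_in_L2 DU_L2 U_L2 dvg_L2 nonlin_integrable kk kp)+
  have wc: "conv (partial j k) (U i t) = conv k (DU i j t)" for i j
    by (rule weak_partial_conv[OF weak_grad k])
  have dv: "conv k (dvg t) x = (\<Sum>l\<in>UNIV. conv k (DU l l t) x)" for x
    using conv_okD[OF conv_ok_L2[OF DU_L2] kk] by (simp add: conv_def dvg_def sum_distrib_left)
  have a: "(LBINT x. conv k (U i t) x * conv (partial j k) (DU i j t) x) = - sq (conv k (DU i j t))" for i j
    using conv_partial_antisym[where f="U i t" and g="DU i j t" and j=j, OF k U_L2 DU_L2] by (simp add: wc sq_def power2_eq_square)
  have b: "(LBINT x. conv k (U i t) x * conv (partial i k) (dvg t) x) = - (LBINT x. conv k (DU i i t) x * conv k (dvg t) x)" for i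
    using conv_partial_antisym[where f="U i t" and g="dvg t" and j=i, OF k U_L2 dvg_L2] by (simp add: wc)
  have "(LBINT x. conv k (U i t) x * rhs k i t x) = (\<Sum>j\<in>UNIV. - sq (conv k (DU i j t)))
     - (1 / \<epsilon>) * (LBINT x. conv k (DU i i t) x * conv k (dvg t) x) - (LBINT x. conv k (U i t) x * conv k (nonlin i t) x)" for i
  proof -
    have e: "(\<lambda>x. conv k (U i t) x * rhs k i t x) = (\<lambda>x. (\<Sum>j\<in>UNIV. conv k (U i t) x * conv (partial j k) (DU i j t) x)
      + (1 / \<epsilon>) * (conv k (U i t) x * conv (partial i k) (dvg t) x) - conv k (U i t) x * conv k (nonlin i t) x)"
      by (simp add: rhs_def algebra_simps sum_distrib_left)
    show ?thesis unfolding e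
      by (simp add: in_L2_mult_integrable L a b sum_negf)
  qed
  then have "(\<Sum>i\<in>UNIV. LBINT x. conv k (U i t) x * rhs k i t x)
    = (\<Sum>i\<in>UNIV. \<Sum>j\<in>UNIV. - sq (conv k (DU i j t))) - (1 / \<epsilon>) * (\<Sum>i\<in>UNIV. LBINT x. conv k (DU i i t) x * conv k (dvg t) x)
     - (\<Sum>i\<in>UNIV. LBINT x. conv k (U i t) x * conv k (nonlin i t) x)"
    by (simp only: sum_subtractf sum_distrib_left)
  also have "(\<Sum>i\<in>UNIV. LBINT x. conv k (DU i i t) x * conv k (dvg t) x) = (LBINT x. (\<Sum>i\<in>UNIV. conv k (DU i i t) x * conv k (dvg t) x))"
    by (rule Bochner_Integration.integral_sum[symmetric]) (intro in_L2_mult_integrable L)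
  also have "\<dots> = sq (conv k (dvg t))"
    unfolding sq_def power2_eq_square by (intro Bochner_Integration.integral_cong refl) (simp only: dv sum_distrib_right)
  finally show ?thesis by (simp add: conv_dissipation_def sum_negf)
qed

lemma conv_energy_identity:
  assumes k: "test_function k"
  shows "AE t in lborel. t > 0 \<longrightarrow> conv_energy k t = (\<Sum>i\<in>UNIV. sq (conv k (U0 i))) - 2 * (LBINT s. indicator {..t} s * conv_dissipation k s)"
    and "integrable lborel (\<lambda>s. indicator {..T} s * conv_dissipation k s)"
proof -
  note kk = test_function_kernel[OF k]
  let ?H = "\<lambda>i s. LBINT x. conv k (U i s) x * rhs k i s x"
  have H: "AE t in lborel. t > 0 \<longrightarrow> sq (conv k (U i t)) = sq (conv k (U0 i)) + 2 * (LBINT s. indicator {..t} s * ?H i s)"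
    "integrable lborel (\<lambda>s. indicator {..T} s * ?H i s)" for i T
  proof -
    have wfin: "(\<integral>\<^sup>+t. indicator {0..T} t * L2_sqnorm (conv k (U i t)) \<partial>lborel) < \<infinity>" for T
    proof -
      have "(\<integral>\<^sup>+t. indicator {0..T} t * L2_sqnorm (conv k (U i t)) \<partial>lborel) \<le> (\<integral>\<^sup>+t. indicator {0..T} t * ennreal ((LBINT x. \<bar>k x\<bar>)\<^sup>2 * M) \<partial>lborel)"
      proof (intro nn_integral_mono mult_left_mono)
        fix t
        have "sq (conv k (U i t)) \<le> (LBINT x. \<bar>k x\<bar>)\<^sup>2 * sq (U i t)" by (rule conv_Young(2)[OF kernel_integrable[OF kk] U_L2])
        also have "\<dots> \<le> (LBINT x. \<bar>k x\<bar>)\<^sup>2 * M" by (intro mult_left_mono order_trans[OF sq_U_le energy_le]) simp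
        finally show "L2_sqnorm (conv k (U i t)) \<le> ennreal ((LBINT x. \<bar>k x\<bar>)\<^sup>2 * M)"
          by (simp add: L2_sqnorm_eq_sq[OF conv_Young(1)[OF kernel_integrable[OF kk] U_L2]] ennreal_leI)
      qed simp
      also have "\<dots> < \<infinity>" by (simp add: nn_integral_multc ennreal_mult_less_top emeasure_lborel_Icc_eq)
      finally show ?thesis .
    qed
    have r0: "rhs k i t x = 0" if "t \<le> 0" for t x
      using loc_integrableD(2)[OF rhs_loc_integrable[OF k] that] .
    note E = energy_identity[of "\<lambda>t. conv k (U i t)" "rhs k i" "conv k (U0 i)",
        OF conv_measurable_param[OF u_measurable kernel_measurable[OF kk]] rhs_measurable[OF k] r0
          conv_Young(1)[OF kernel_integrable[OF kk] U_L2] wfin sq_rhs_integrable[OF k]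
          conv_Young(1)[OF kernel_integrable[OF kk] u0_L2] rhs_loc_integrable[OF k] conv_ode[OF k]]
    show "AE t in lborel. t > 0 \<longrightarrow> sq (conv k (U i t)) = sq (conv k (U0 i)) + 2 * (LBINT s. indicator {..t} s * ?H i s)"
      using E(1) .
    show "integrable lborel (\<lambda>s. indicator {..T} s * ?H i s)" using E(2) .
  qed
  have D: "indicator {..T} s * conv_dissipation k s = - (\<Sum>i\<in>UNIV. indicator {..T} s * ?H i s)" for T s
    using conv_rhs_inner[OF k, of s] by (simp add: sum_distrib_left[symmetric])
  show "integrable lborel (\<lambda>s. indicator {..T} s * conv_dissipation k s)"
    unfolding D by (intro Bochner_Integration.integrable_minus Bochner_Integration.integrable_sum H(2))
  have "AE t in lborel. \<forall>i. t > 0 \<longrightarrow> sq (conv k (U i t)) = sq (conv k (U0 i)) + 2 * (LBINT s. indicator {..t} s * ?H i s)"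
    using H(1) by (intro AE_all_countable[THEN iffD2] allI)
  then show "AE t in lborel. t > 0 \<longrightarrow> conv_energy k t = (\<Sum>i\<in>UNIV. sq (conv k (U0 i))) - 2 * (LBINT s. indicator {..t} s * conv_dissipation k s)"
  proof eventually_elim
    case (elim t)
    have "(LBINT s. indicator {..t} s * conv_dissipation k s) = - (\<Sum>i\<in>UNIV. LBINT s. indicator {..t} s * ?H i s)"
      by (simp only: D Bochner_Integration.integral_minus Bochner_Integration.integral_sum[OF H(2)])
    then show ?case using elim by (simp add: conv_energy_def sum.distrib sum_distrib_left)
  qed
qed

section \<open>Removing the mollifier\<close>

definition u_sq :: "real \<Rightarrow> real^3 \<Rightarrow> real" where "u_sq t x = (\<Sum>i\<in>UNIV. (U i t x)\<^sup>2)"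

definition dissipation :: "real \<Rightarrow> real" where
  "dissipation t = grad_sq t + (1 / \<epsilon>) * sq (dvg t) + (\<Sum>i\<in>UNIV. \<Sum>j\<in>UNIV. LBINT x. U j t x * U i t x * adv i j t x)"

text \<open>Evenness of k lets the outer mollifier be moved off the nonlinearity, so no convergence
  of the mollified nonlinearity is needed: what remains is a product of two L4 functions paired with
  \<open>adv\<close> in L2.\<close>

lemma conv_nonlin_inner:
  assumes k: "test_function k" and even: "\<And>x. k (- x) = k x"
  shows "(LBINT x. conv k (U i t) x * conv k (nonlin i t) x) = (\<Sum>j\<in>UNIV. LBINT x. U j t x * conv k (conv k (U i t)) x * adv i j t x)"
proof -
  note kk = test_function_kernel[OF k]
  have L: "in_L2 (conv k (U i t))" by (intro conv_Young(1) kernel_integrable kk U_L2)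
  have L4: "in_L4 (conv k (conv k (U i t)))" by (intro conv_Young_L4(1) kernel_integrable kk u_L4)
  have "(LBINT x. conv k (U i t) x * conv k (nonlin i t) x) = (LBINT x. conv k (nonlin i t) x * conv k (U i t) x)"
    by (simp only: mult.commute)
  also have "\<dots> = (LBINT y. nonlin i t y * conv k (conv k (U i t)) y)"
    using conv_adjoint[OF kk nonlin_integrable L] by (simp add: even)
  also have "\<dots> = (LBINT y. (\<Sum>j\<in>UNIV. U j t y * conv k (conv k (U i t)) y * adv i j t y))"
    by (simp add: nonlin_def sum_distrib_right sum_distrib_left mult_ac)
  also have "\<dots> = (\<Sum>j\<in>UNIV. LBINT y. U j t y * conv k (conv k (U i t)) y * adv i j t y)"
    by (intro Bochner_Integration.integral_sum in_L2_mult_integrable in_L4_mult(1) u_L4 L4 adv_L2)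
  finally show ?thesis .
qed

text \<open>With d the error of one mollification, the error of two is the mollification of d plus
  d, and mollification contracts L4.\<close>

lemma moll_moll_L4: "(\<lambda>n. quart (\<lambda>x. conv (moll n) (conv (moll n) (U i t)) x - U i t x)) \<longlonglongrightarrow> 0"
proof -
  let ?c = "\<lambda>n f. conv (moll n) f"
  let ?d = "\<lambda>n x. ?c n (U i t) x - U i t x"
  have d2: "in_L2 (?d n)" and d4: "in_L4 (?d n)" for n
    by (intro in_L2_diff moll_L2(1) U_L2 in_L4_diff moll_L4(1) u_L4)+
  have eq: "?c n (?c n (U i t)) x - U i t x = ?c n (?d n) x + ?d n x" for n x
    using conv_add[OF conv_ok_L2[OF d2[of n]] conv_ok_L2[OF U_L2[where i=i and t=t]] test_function_kernel[OF moll_test_function[of n]], of x] by simp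
  have "(\<lambda>n. sq (\<lambda>x. (?c n (?d n) x + ?d n x) * (?c n (?d n) x + ?d n x) - 0 * 0)) \<longlonglongrightarrow> 0"
  proof (rule tendsto_L4_mult)
    have "(\<lambda>n. quart (\<lambda>x. ?c n (?d n) x + ?d n x)) \<longlonglongrightarrow> 0"
    proof (rule tendsto_zero_bound[OF sq_nonneg])
      fix n
      have c4: "in_L4 (?c n (?d n))" by (rule moll_L4(1)[OF d4 d2])
      have "quart (\<lambda>x. ?c n (?d n) x + ?d n x) \<le> (LBINT x. 8 * ((?c n (?d n) x)\<^sup>2)\<^sup>2 + 8 * ((?d n x)\<^sup>2)\<^sup>2)"
        unfolding sq_def
      proof (rule integral_mono)
        show "integrable lborel (\<lambda>x. ((?c n (?d n) x + ?d n x)\<^sup>2)\<^sup>2)"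
          using in_L4_add[OF c4 d4] by (simp add: in_L4_def in_L2_iff)
        show "integrable lborel (\<lambda>x. 8 * ((?c n (?d n) x)\<^sup>2)\<^sup>2 + 8 * ((?d n x)\<^sup>2)\<^sup>2)"
          using c4 d4[of n] by (simp add: in_L4_def in_L2_iff)
        have "((a + b)\<^sup>2)\<^sup>2 \<le> 8 * (a\<^sup>2)\<^sup>2 + 8 * (b\<^sup>2)\<^sup>2" for a b :: real
        proof -
          have "(a + b)\<^sup>2 \<le> 2 * (a\<^sup>2 + b\<^sup>2)" using sum_squares_bound[of a b] by (simp add: power2_sum)
          then have "((a + b)\<^sup>2)\<^sup>2 \<le> (2 * (a\<^sup>2 + b\<^sup>2))\<^sup>2" by (rule power_mono) simp
          also have "\<dots> = 4 * (a\<^sup>2 + b\<^sup>2)\<^sup>2" by (simp only: power_mult_distrib) simp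
          also have "(a\<^sup>2 + b\<^sup>2)\<^sup>2 \<le> 2 * ((a\<^sup>2)\<^sup>2 + (b\<^sup>2)\<^sup>2)" using sum_squares_bound[of "a\<^sup>2" "b\<^sup>2"] by (simp add: power2_sum)
          finally show ?thesis by simp
        qed
        then show "((?c n (?d n) x + ?d n x)\<^sup>2)\<^sup>2 \<le> 8 * ((?c n (?d n) x)\<^sup>2)\<^sup>2 + 8 * ((?d n x)\<^sup>2)\<^sup>2" for x .
      qed
      also have "\<dots> = 8 * quart (?c n (?d n)) + 8 * quart (?d n)"
        using c4 d4[of n] by (simp add: sq_def in_L4_def in_L2_iff)
      also have "\<dots> \<le> 16 * quart (?d n)" using moll_L4(2)[OF d4 d2, of n n] by simp
      finally show "quart (\<lambda>x. ?c n (?d n) x + ?d n x) \<le> 16 * quart (?d n)" .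
    qed (intro tendsto_mult_right_zero moll_L4(3) u_L4 U_L2)
    then show "(\<lambda>n. quart (\<lambda>x. ?c n (?d n) x + ?d n x - 0)) \<longlonglongrightarrow> 0" "(\<lambda>n. quart (\<lambda>x. ?c n (?d n) x + ?d n x - 0)) \<longlonglongrightarrow> 0" by simp_all
    show "in_L4 (\<lambda>x::real^3. 0)" "in_L4 (\<lambda>x::real^3. 0)" by (simp_all add: in_L4_def in_L2_zero)
    show "in_L4 (\<lambda>x. ?c n (?d n) x + ?d n x)" "in_L4 (\<lambda>x. ?c n (?d n) x + ?d n x)" for n
      by (intro in_L4_add moll_L4(1) d4 d2)+
  qed
  then show ?thesis unfolding eq by (simp add: power2_eq_square)
qed

lemma moll_dissipation_tendsto: "(\<lambda>n. conv_dissipation (moll n) t) \<longlonglongrightarrow> dissipation t"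
proof -
  have e: "conv_dissipation (moll n) t = (\<Sum>i\<in>UNIV. \<Sum>j\<in>UNIV. sq (conv (moll n) (DU i j t))) + (1 / \<epsilon>) * sq (conv (moll n) (dvg t))
     + (\<Sum>i\<in>UNIV. \<Sum>j\<in>UNIV. LBINT x. U j t x * conv (moll n) (conv (moll n) (U i t)) x * adv i j t x)" for n
    unfolding conv_dissipation_def using conv_nonlin_inner[OF moll_test_function mollifier_even] by simp
  have "(\<lambda>n. LBINT x. U j t x * conv (moll n) (conv (moll n) (U i t)) x * adv i j t x) \<longlonglongrightarrow> (LBINT x. U j t x * U i t x * adv i j t x)" for i j
  proof (rule tendsto_L2_inner)
    have c4: "in_L4 (conv (moll n) (conv (moll n) (U i t)))" for n by (intro moll_L4(1) u_L4 U_L2 moll_L2(1))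
    show "in_L2 (\<lambda>x. U j t x * conv (moll n) (conv (moll n) (U i t)) x)" for n by (rule in_L4_mult(1)[OF u_L4 c4])
    show "in_L2 (\<lambda>x. U j t x * U i t x)" by (rule in_L4_mult(1)[OF u_L4 u_L4])
    show "(\<lambda>n. sq (\<lambda>x. U j t x * conv (moll n) (conv (moll n) (U i t)) x - U j t x * U i t x)) \<longlonglongrightarrow> 0"
      by (rule tendsto_L4_mult[OF u_L4 u_L4 c4 u_L4 _ moll_moll_L4]) (simp add: sq_def)
    show "(\<lambda>n. sq (\<lambda>x. adv i j t x - adv i j t x)) \<longlonglongrightarrow> 0" by (simp add: sq_def)
  qed (rule adv_L2)+
  then show ?thesis unfolding e dissipation_def grad_sq_def
    by (intro tendsto_intros moll_L2(4) DU_L2 dvg_L2)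
qed

text \<open>Contraction in L2 and L4 makes the majorant independent of n, and it is integrable in
  time by the hypotheses on the gradient and on the L4 norm; this is what dominated convergence in
  time requires.\<close>

lemma moll_dissipation_bound:
  "\<bar>conv_dissipation (moll n) t\<bar> \<le> grad_sq t + (1 / \<epsilon>) * sq (dvg t) + (\<Sum>i\<in>UNIV. \<Sum>j\<in>UNIV. sq (adv i j t) + (quart (U j t) + quart (U i t)))"
proof -
  let ?c = "\<lambda>f. conv (moll n) f"
  let ?L = "\<lambda>i j. LBINT x. U j t x * ?c (?c (U i t)) x * adv i j t x"
  have e: "conv_dissipation (moll n) t = (\<Sum>i\<in>UNIV. \<Sum>j\<in>UNIV. sq (?c (DU i j t))) + (1 / \<epsilon>) * sq (?c (dvg t)) + (\<Sum>i\<in>UNIV. \<Sum>j\<in>UNIV. ?L i j)"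
    unfolding conv_dissipation_def using conv_nonlin_inner[OF moll_test_function mollifier_even] by simp
  have L: "\<bar>?L i j\<bar> \<le> sq (adv i j t) + (quart (U j t) + quart (U i t))" for i j
  proof -
    have c4: "in_L4 (?c (?c (U i t)))" by (intro moll_L4(1) u_L4 U_L2 moll_L2(1))
    have p2: "in_L2 (\<lambda>x. U j t x * ?c (?c (U i t)) x)" by (rule in_L4_mult(1)[OF u_L4 c4])
    have "(?L i j)\<^sup>2 \<le> sq (\<lambda>x. U j t x * ?c (?c (U i t)) x) * sq (adv i j t)"
      by (rule Cauchy_Schwarz_L2(1)[OF p2 adv_L2])
    also have "\<dots> \<le> (sq (adv i j t) + sq (\<lambda>x. U j t x * ?c (?c (U i t)) x))\<^sup>2"
      by (simp add: power2_sum add_nonneg_nonneg)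
    finally have "\<bar>?L i j\<bar> \<le> sq (adv i j t) + sq (\<lambda>x. U j t x * ?c (?c (U i t)) x)"
      by (simp add: abs_le_square_iff[symmetric])
    also have "sq (\<lambda>x. U j t x * ?c (?c (U i t)) x) \<le> quart (U j t) + quart (?c (?c (U i t)))" by (rule sq_mult_le[OF u_L4 c4])
    also have "quart (?c (?c (U i t))) \<le> quart (?c (U i t))" by (intro moll_L4(2) moll_L4(1) moll_L2(1) u_L4 U_L2)
    also have "\<dots> \<le> quart (U i t)" by (intro moll_L4(2) u_L4 U_L2)
    finally show ?thesis by simp
  qed
  have 1: "(\<Sum>i\<in>UNIV. \<Sum>j\<in>UNIV. sq (?c (DU i j t))) \<le> grad_sq t" unfolding grad_sq_def by (intro sum_mono moll_L2(2) DU_L2)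
  have 2: "(1 / \<epsilon>) * sq (?c (dvg t)) \<le> (1 / \<epsilon>) * sq (dvg t)" using eps by (intro mult_left_mono moll_L2(2) dvg_L2) simp
  have 3: "\<bar>\<Sum>i\<in>UNIV. \<Sum>j\<in>UNIV. ?L i j\<bar> \<le> (\<Sum>i\<in>UNIV. \<Sum>j\<in>UNIV. sq (adv i j t) + (quart (U j t) + quart (U i t)))"
    by (intro order_trans[OF sum_abs] sum_mono L)
  have 4: "0 \<le> (\<Sum>i\<in>UNIV. \<Sum>j\<in>UNIV. sq (?c (DU i j t)))" "0 \<le> (1 / \<epsilon>) * sq (?c (dvg t))"
    using eps by (auto intro!: sum_nonneg)
  show ?thesis unfolding e using 1 2 3 4 by linarith
qed

lemma grad_sq_integrable: "integrable lborel grad_sq"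
  unfolding grad_sq_def[abs_def] by (intro Bochner_Integration.integrable_sum sq_DU_integrable)

lemma dissipation_measurable_integrable: "integrable lborel dissipation"
  and energy_equality: "AE t in lborel. t > 0 \<longrightarrow> energy t = (\<Sum>i\<in>UNIV. sq (U0 i)) - 2 * (LBINT s. indicator {..t} s * dissipation s)"
proof -
  let ?B = "\<lambda>t. grad_sq t + (1 / \<epsilon>) * sq (dvg t) + (\<Sum>i\<in>UNIV. \<Sum>j\<in>UNIV. sq (adv i j t) + (quart (U j t) + quart (U i t)))"
  have B: "integrable lborel ?B"
    by (intro Bochner_Integration.integrable_add integrable_mult_right Bochner_Integration.integrable_sum
        grad_sq_integrable sq_dvg_integrable sq_adv_integrable quart_integrable)
  \<comment> \<open>Only truncations to \<open>{..T}\<close> are known to be integrable;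
    measurability on the whole line comes from exhausting it.\<close>
  have dm: "conv_dissipation (moll n) \<in> borel_measurable borel" for n
  proof (rule borel_measurable_LIMSEQ_real)
    show "(\<lambda>m. indicator {..real m} s * conv_dissipation (moll n) s) \<longlonglongrightarrow> conv_dissipation (moll n) s" for s
    proof (rule tendsto_eventually)
      obtain m0 where "s < real m0" using reals_Archimedean2 by blast
      then show "\<forall>\<^sub>F m in sequentially. indicator {..real m} s * conv_dissipation (moll n) s = conv_dissipation (moll n) s"
        by (intro eventually_sequentiallyI[of m0]) simp
    qed
    show "(\<lambda>s. indicator {..real m} s * conv_dissipation (moll n) s) \<in> borel_measurable borel" for m
      using borel_measurable_integrable[OF conv_energy_identity(2)[OF moll_test_function]] by simp
  qed
  have Dm: "dissipation \<in> borel_measurable borel"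
    by (rule borel_measurable_LIMSEQ_real[OF moll_dissipation_tendsto dm])
  have Db: "\<bar>dissipation t\<bar> \<le> ?B t" for t
    by (rule LIMSEQ_le_const2[OF tendsto_rabs[OF moll_dissipation_tendsto]]) (use moll_dissipation_bound in blast)
  show "integrable lborel dissipation"
  proof (rule Bochner_Integration.integrable_bound[OF B])
    show "AE t in lborel. norm (dissipation t) \<le> norm (?B t)"
      using Db by (intro AE_I2) (simp only: real_norm_def, rule order_trans[OF _ abs_ge_self], blast)
  qed (use Dm in simp)
  have lim: "(\<lambda>n. LBINT s. indicator {..t} s * conv_dissipation (moll n) s) \<longlonglongrightarrow> (LBINT s. indicator {..t} s * dissipation s)" for t
  proof (rule integral_dominated_convergence[OF _ _ B])
    show "AE s in lborel. (\<lambda>n. indicator {..t} s * conv_dissipation (moll n) s) \<longlonglongrightarrow> indicator {..t} s * dissipation s"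
      by (intro AE_I2 tendsto_intros moll_dissipation_tendsto)
    show "AE s in lborel. norm (indicator {..t} s * conv_dissipation (moll n) s) \<le> ?B s" for n
    proof (rule AE_I2)
      fix s
      have "norm (indicator {..t} s * conv_dissipation (moll n) s) \<le> \<bar>conv_dissipation (moll n) s\<bar>" by (simp add: indicator_def)
      then show "norm (indicator {..t} s * conv_dissipation (moll n) s) \<le> ?B s" using moll_dissipation_bound[of n s] by (rule order_trans)
    qed
  qed (use dm Dm in simp_all)
  \<comment> \<open>One null set serves all n, so that the limit can be taken at a fixed
    time.\<close>
  have "AE t in lborel. \<forall>n. t > 0 \<longrightarrow> conv_energy (moll n) t = (\<Sum>i\<in>UNIV. sq (conv (moll n) (U0 i))) - 2 * (LBINT s. indicator {..t} s * conv_dissipation (moll n) s)"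
    by (intro AE_all_countable[THEN iffD2] allI conv_energy_identity(1) moll_test_function)
  then show "AE t in lborel. t > 0 \<longrightarrow> energy t = (\<Sum>i\<in>UNIV. sq (U0 i)) - 2 * (LBINT s. indicator {..t} s * dissipation s)"
  proof eventually_elim
    case (elim t)
    show ?case
    proof
      assume t: "t > 0"
      have a: "(\<lambda>n. conv_energy (moll n) t) \<longlonglongrightarrow> energy t"
        unfolding conv_energy_def energy_def by (intro tendsto_intros moll_L2(4) U_L2)
      have b: "(\<lambda>n. (\<Sum>i\<in>UNIV. sq (conv (moll n) (U0 i))) - 2 * (LBINT s. indicator {..t} s * conv_dissipation (moll n) s))
        \<longlonglongrightarrow> (\<Sum>i\<in>UNIV. sq (U0 i)) - 2 * (LBINT s. indicator {..t} s * dissipation s)"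
        by (intro tendsto_intros moll_L2(4) u0_L2 lim)
      show "energy t = (\<Sum>i\<in>UNIV. sq (U0 i)) - 2 * (LBINT s. indicator {..t} s * dissipation s)"
        using elim t by (intro LIMSEQ_unique[OF a]) (use b in simp)
    qed
  qed
qed

end

section \<open>Energy decay over a doubling of time\<close>

lemma AE_ex_between:
  fixes a b :: real
  assumes "AE t in lborel. P t" "a < b"
  obtains t where "a < t" "t < b" "P t"
proof -
  have "\<exists>t. a < t \<and> t < b \<and> P t"
  proof (rule ccontr)
    assume "\<not> ?thesis"
    then have "AE t in lborel. t \<notin> {a<..<b}" using assms(1) by (auto elim: eventually_mono)
    then have "emeasure lborel {a<..<b} = 0"
      by (subst (asm) AE_iff_measurable[of "{a<..<b}"]) auto
    then show False using assms(2) by simp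
  qed
  then show ?thesis using that by blast
qed

context global_solution
begin

section \<open>Coercivity of the dissipation\<close>

abbreviation "initial_energy \<equiv> (\<Sum>i\<in>UNIV. sq (U0 i))"

lemma u_sq_L2: "in_L2 (u_sq t)"
  unfolding u_sq_def[abs_def] using u_L4 by (intro in_L2_sum) (simp add: in_L4_def)

text \<open>\<open>weak_partial_cubic\<close> with v = u_i and z = u_j, summed over i and j. For a
  divergence-free field the right-hand side would vanish; here it has to be absorbed.\<close>

lemma cubic_identity:
  "2 * (\<Sum>i\<in>UNIV. \<Sum>j\<in>UNIV. LBINT x. U j t x * U i t x * DU i j t x) = - (LBINT x. u_sq t x * dvg t x)"
proof -
  have i: "integrable lborel (\<lambda>x. U i t x * U i t x * DU j j t x)" for i j
    by (intro in_L2_mult_integrable in_L4_mult(1) u_L4 DU_L2)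
  have c: "2 * (LBINT x. U j t x * U i t x * DU i j t x) = - (LBINT x. U i t x * U i t x * DU j j t x)" for i j
    using weak_partial_cubic[where v="U i t" and p="DU i j t" and z="U j t" and q="DU j j t" and j=j, OF weak_grad u_L4 weak_grad u_L4] by (simp add: mult.commute[of "U i t _" "U j t _"])
  have "(LBINT x. u_sq t x * dvg t x) = (LBINT x. (\<Sum>i\<in>UNIV. \<Sum>j\<in>UNIV. U i t x * U i t x * DU j j t x))"
    by (simp add: u_sq_def dvg_def sum_product power2_eq_square)
  also have "\<dots> = (\<Sum>i\<in>UNIV. \<Sum>j\<in>UNIV. LBINT x. U i t x * U i t x * DU j j t x)"
    using i by (simp add: Bochner_Integration.integral_sum)
  finally show ?thesis by (simp only: sum_distrib_left c sum_negf)
qed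

lemma quartic_identity:
  "(\<Sum>i\<in>UNIV. \<Sum>j\<in>UNIV. LBINT x. U j t x * U i t x * (U i t x * U j t x)) = sq (u_sq t)"
proof -
  have i: "integrable lborel (\<lambda>x. U j t x * U i t x * (U i t x * U j t x))" for i j
    by (intro in_L2_mult_integrable in_L4_mult(1) u_L4)
  have "sq (u_sq t) = (LBINT x. (\<Sum>i\<in>UNIV. \<Sum>j\<in>UNIV. U j t x * U i t x * (U i t x * U j t x)))"
    unfolding sq_def u_sq_def by (simp only: power2_eq_square sum_product mult_ac)
  also have "\<dots> = (\<Sum>i\<in>UNIV. \<Sum>j\<in>UNIV. LBINT x. U j t x * U i t x * (U i t x * U j t x))"
    using i by (simp add: Bochner_Integration.integral_sum)
  finally show ?thesis by simp
qed

text \<open>The cubic term is half the integral of \<open>|u|\<^sup>2 div u\<close>, which Young's inequality distributes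
  between \<open>(1/\<epsilon>) |div u|\<^sup>2\<close> and \<open>(\<epsilon>/16) |u|\<^sup>4\<close>.\<close>

lemma dissipation_lower: "grad_sq t + (\<alpha> - \<epsilon> / 16) * sq (u_sq t) \<le> dissipation t"
proof -
  have i1: "integrable lborel (\<lambda>x. U j t x * U i t x * DU i j t x)" and i2: "integrable lborel (\<lambda>x. U j t x * U i t x * (U i t x * U j t x))" for i j
    by (intro in_L2_mult_integrable in_L4_mult(1) u_L4 DU_L2)+
  have "(LBINT x. U j t x * U i t x * adv i j t x) = (LBINT x. U j t x * U i t x * DU i j t x) + \<alpha> * (LBINT x. U j t x * U i t x * (U i t x * U j t x))" for i j
  proof -
    have "(\<lambda>x. U j t x * U i t x * adv i j t x) = (\<lambda>x. U j t x * U i t x * DU i j t x + \<alpha> * (U j t x * U i t x * (U i t x * U j t x)))"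
      by (simp add: adv_def algebra_simps)
    then show ?thesis using i1 i2 by simp
  qed
  then have d: "dissipation t = grad_sq t + (1 / \<epsilon>) * sq (dvg t)
      + (\<Sum>i\<in>UNIV. \<Sum>j\<in>UNIV. LBINT x. U j t x * U i t x * DU i j t x) + \<alpha> * sq (u_sq t)"
    by (simp only: dissipation_def sum.distrib sum_distrib_left[symmetric] quartic_identity add.assoc)
  have "(LBINT x. u_sq t x * dvg t x) \<le> (LBINT x. (2 / \<epsilon>) * (dvg t x)\<^sup>2 + (\<epsilon> / 8) * (u_sq t x)\<^sup>2)"
  proof (rule integral_mono)
    show "integrable lborel (\<lambda>x. u_sq t x * dvg t x)" by (rule in_L2_mult_integrable[OF u_sq_L2 dvg_L2])
    show "integrable lborel (\<lambda>x. (2 / \<epsilon>) * (dvg t x)\<^sup>2 + (\<epsilon> / 8) * (u_sq t x)\<^sup>2)"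
      by (intro Bochner_Integration.integrable_add integrable_mult_right in_L2_integrable u_sq_L2 dvg_L2)
    \<comment> \<open>The weights are dictated by the factor 1/2 of the cubic term: half of
      2/\<epsilon> consumes the dissipated (1/\<epsilon>) |div u|^2 exactly, and half of
      \<epsilon>/8 is the \<epsilon>/16 of the statement.\<close>
    have "b * a \<le> (2 / \<epsilon>) * a\<^sup>2 + (\<epsilon> / 8) * b\<^sup>2" for a b :: real
    proof -
      have "0 \<le> (4 * a - \<epsilon> * b)\<^sup>2 / (8 * \<epsilon>)" using eps by simp
      also have "\<dots> = (2 / \<epsilon>) * a\<^sup>2 + (\<epsilon> / 8) * b\<^sup>2 - b * a"
        using eps by (simp add: power2_eq_square field_simps)
      finally show ?thesis by simp
    qed
    then show "u_sq t x * dvg t x \<le> (2 / \<epsilon>) * (dvg t x)\<^sup>2 + (\<epsilon> / 8) * (u_sq t x)\<^sup>2" for x .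
  qed
  also have "\<dots> = (2 / \<epsilon>) * sq (dvg t) + (\<epsilon> / 8) * sq (u_sq t)"
    using in_L2_integrable[OF u_sq_L2] in_L2_integrable[OF dvg_L2] by (simp add: sq_def)
  finally have y: "(LBINT x. u_sq t x * dvg t x) \<le> (2 / \<epsilon>) * sq (dvg t) + (\<epsilon> / 8) * sq (u_sq t)" .
  have "(\<Sum>i\<in>UNIV. \<Sum>j\<in>UNIV. LBINT x. U j t x * U i t x * DU i j t x) = - (LBINT x. u_sq t x * dvg t x) / 2"
    using cubic_identity[of t] by linarith
  then show ?thesis unfolding d using y by (simp add: algebra_simps)
qed

lemma grad_sq_nonneg: "0 \<le> grad_sq t" unfolding grad_sq_def by (intro sum_nonneg) simp

text \<open>The double sum counts each fourth power three times in each index, so 2 \<alpha>^2 turns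
  into 12 \<alpha>^2. Both terms on the right are dissipated quantities.\<close>

lemma adv_sq_le: "adv_sq t \<le> 2 * grad_sq t + 12 * \<alpha>\<^sup>2 * sq (u_sq t)"
proof -
  have q: "(\<Sum>i\<in>UNIV. quart (U i t)) \<le> sq (u_sq t)"
  proof -
    have "(\<Sum>i\<in>UNIV. quart (U i t)) = (LBINT x. (\<Sum>i\<in>UNIV. ((U i t x)\<^sup>2)\<^sup>2))"
      unfolding sq_def using u_L4 by (intro Bochner_Integration.integral_sum[symmetric]) (simp add: in_L4_def in_L2_iff)
    also have "\<dots> \<le> sq (u_sq t)"
      unfolding sq_def
    proof (rule integral_mono)
      show "integrable lborel (\<lambda>x. \<Sum>i\<in>UNIV. ((U i t x)\<^sup>2)\<^sup>2)"
        using u_L4 by (intro Bochner_Integration.integrable_sum) (simp add: in_L4_def in_L2_iff)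
      show "integrable lborel (\<lambda>x. (u_sq t x)\<^sup>2)" by (rule in_L2_integrable[OF u_sq_L2])
      have q3: "a\<^sup>2 + b\<^sup>2 + c\<^sup>2 \<le> (a + b + c)\<^sup>2" if "0 \<le> a" "0 \<le> b" "0 \<le> c" for a b c :: real
        using that by (simp add: power2_eq_square algebra_simps)
      show "(\<Sum>i\<in>UNIV. ((U i t x)\<^sup>2)\<^sup>2) \<le> (u_sq t x)\<^sup>2" for x
        unfolding u_sq_def sum_3 by (rule q3) simp_all
    qed
    finally show ?thesis .
  qed
  have "adv_sq t \<le> (\<Sum>i\<in>UNIV. \<Sum>j\<in>UNIV. 2 * sq (DU i j t) + 2 * \<alpha>\<^sup>2 * (quart (U i t) + quart (U j t)))"
    unfolding adv_sq_def by (intro sum_mono sq_adv_le)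
  also have "\<dots> = 2 * grad_sq t + 12 * \<alpha>\<^sup>2 * (\<Sum>i\<in>UNIV. quart (U i t))"
    by (simp add: grad_sq_def sum.distrib sum_distrib_left[symmetric])
  also have "\<dots> \<le> 2 * grad_sq t + 12 * \<alpha>\<^sup>2 * sq (u_sq t)"
    using q by (intro add_left_mono mult_left_mono) auto
  finally show ?thesis .
qed

text \<open>Only the nonlinear part can make the mollified dissipation negative. Cauchy-Schwarz in
  space and Young's inequality for L2 with L1 bound each of its three components, hence the factor
  3.\<close>

lemma conv_dissipation_lower:
  assumes k: "test_function k"
  shows "- conv_dissipation k t \<le> 3 * (sqrt (conv_energy k t) * (sqrt (sq k) * sqrt (adv_sq t * energy t)))"
proof -
  note kk = test_function_kernel[OF k]
  have i: "- (LBINT x. conv k (U i t) x * conv k (nonlin i t) x) \<le> sqrt (conv_energy k t) * (sqrt (sq k) * sqrt (adv_sq t * energy t))" for i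
  proof -
    have L: "in_L2 (conv k (U i t))" "in_L2 (conv k (nonlin i t))"
      by (intro conv_Young(1) conv_Young_L1(1) kernel_integrable kernel_in_L2 U_L2 nonlin_integrable kk)+
    have "(LBINT x. conv k (U i t) x * conv k (nonlin i t) x)\<^sup>2 \<le> sq (conv k (U i t)) * sq (conv k (nonlin i t))"
      by (rule Cauchy_Schwarz_L2(1)[OF L])
    also have "\<dots> \<le> conv_energy k t * (sq k * (adv_sq t * energy t))"
    proof (rule mult_mono)
      show "sq (conv k (U i t)) \<le> conv_energy k t" unfolding conv_energy_def by (rule member_le_sum) auto
      have "sq (conv k (nonlin i t)) \<le> sq k * (LBINT x. \<bar>nonlin i t x\<bar>)\<^sup>2"
        by (rule conv_Young_L1(2)[OF kernel_in_L2[OF kk] nonlin_integrable])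
      also have "\<dots> \<le> sq k * (adv_sq t * energy t)" by (intro mult_left_mono nonlin_L1_sq) simp
      finally show "sq (conv k (nonlin i t)) \<le> sq k * (adv_sq t * energy t)" .
    qed (auto simp: conv_energy_def intro!: sum_nonneg)
    finally have "\<bar>LBINT x. conv k (U i t) x * conv k (nonlin i t) x\<bar> \<le> sqrt (conv_energy k t * (sq k * (adv_sq t * energy t)))"
      by (rule real_le_rsqrt[of "\<bar>_\<bar>", unfolded power2_abs])
    then show ?thesis by (simp add: real_sqrt_mult abs_le_iff)
  qed
  have "- conv_dissipation k t \<le> (\<Sum>i\<in>UNIV. - (LBINT x. conv k (U i t) x * conv k (nonlin i t) x))"
  proof -
    have "0 \<le> (\<Sum>i\<in>UNIV. \<Sum>j\<in>UNIV. sq (conv k (DU i j t)))" "0 \<le> (1 / \<epsilon>) * sq (conv k (dvg t))"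
      using eps by (auto intro!: sum_nonneg)
    then show ?thesis unfolding conv_dissipation_def sum_negf by linarith
  qed
  also have "\<dots> \<le> (\<Sum>i\<in>(UNIV::3 set). sqrt (conv_energy k t) * (sqrt (sq k) * sqrt (adv_sq t * energy t)))"
    by (intro sum_mono i)
  finally show ?thesis by simp
qed

section \<open>Growth of the mollified energy\<close>

lemma energy_zero: "t \<le> 0 \<Longrightarrow> energy t = 0" by (simp add: energy_def sq_def u_neg)

lemma energy_loc_integrable: "integrable lborel (\<lambda>t. indicator {..T} t * energy t)"
proof (rule Bochner_Integration.integrable_bound)
  show "integrable lborel (\<lambda>t. indicator {0..T} t *\<^sub>R M)"
    by (intro integrable_scaleR_left integrable_real_indicator) (auto simp: emeasure_lborel_Icc_eq)
  show "AE t in lborel. norm (indicator {..T} t * energy t) \<le> norm (indicator {0..T} t *\<^sub>R M)"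
    using energy_le energy_nonneg energy_zero M_nonneg by (intro AE_I2) (auto simp: indicator_def)
qed simp

text \<open>A Gronwall argument for the supremum S of the mollified energy: S is at most the datum
  term plus a multiple of sqrt S times J, the time integral of sqrt(adv_sq * energy). Cauchy-Schwarz
  in time bounds J^2, and absorbing half of S doubles the other terms, whence 2 and 36 = 2 *
  18.\<close>

lemma low_frequency_bound:
  assumes k: "test_function k"
  shows "AE t in lborel. 0 < t \<and> t < T \<longrightarrow> conv_energy k t \<le> 2 * (\<Sum>i\<in>UNIV. sq (conv k (U0 i)))
     + 36 * sq k * ((LBINT s. adv_sq s) * (LBINT s. indicator {..T} s * energy s))"
proof -
  note kk = test_function_kernel[OF k]
  define m0 where "m0 = (\<Sum>i\<in>UNIV. sq (conv k (U0 i)))"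
  define q where "q s = sqrt (adv_sq s * energy s)" for s
  define J where "J = (LBINT s. indicator {..T} s * q s)"
  have advm [measurable]: "adv_sq \<in> borel_measurable borel" using adv_sq_integrable by auto
  have q0: "0 \<le> q s" for s by (simp add: q_def adv_sq_nonneg energy_nonneg)
  have f2: "in_L2 (\<lambda>s. sqrt (adv_sq s))" and fs: "sq (\<lambda>s. sqrt (adv_sq s)) = (LBINT s. adv_sq s)"
    using adv_sq_integrable adv_sq_nonneg by (auto simp: in_L2_iff sq_def)
  have g2: "in_L2 (\<lambda>s. indicator {..T} s * sqrt (energy s))" and gs: "sq (\<lambda>s. indicator {..T} s * sqrt (energy s)) = (LBINT s. indicator {..T} s * energy s)"
  proof -
    have e: "(indicator {..T} s * sqrt (energy s))\<^sup>2 = indicator {..T} s * energy s" for s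
      using energy_nonneg[of s] by (simp add: indicator_def)
    show "in_L2 (\<lambda>s. indicator {..T} s * sqrt (energy s))" unfolding in_L2_iff e using energy_loc_integrable by simp
    show "sq (\<lambda>s. indicator {..T} s * sqrt (energy s)) = (LBINT s. indicator {..T} s * energy s)" unfolding sq_def e ..
  qed
  have qe: "(\<lambda>s. sqrt (adv_sq s) * (indicator {..T} s * sqrt (energy s))) = (\<lambda>s. indicator {..T} s * q s)"
    by (simp add: q_def real_sqrt_mult fun_eq_iff)
  have qi: "integrable lborel (\<lambda>s. indicator {..T} s * q s)"
    using in_L2_mult_integrable[OF f2 g2] unfolding qe .
  have J2: "J\<^sup>2 \<le> (LBINT s. adv_sq s) * (LBINT s. indicator {..T} s * energy s)"
    using Cauchy_Schwarz_L2(1)[OF f2 g2] unfolding qe fs gs J_def .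
  have J0: "0 \<le> J" unfolding J_def using q0 by (intro Bochner_Integration.integral_nonneg) simp
  \<comment> \<open>The supremum runs only over times at which the mollified energy identity holds;
    almost every time in (0, T) is among them.\<close>
  define A where "A = {t. 0 < t \<and> t < T \<and> conv_energy k t = m0 - 2 * (LBINT s. indicator {..t} s * conv_dissipation k s)}"
  have AA: "AE t in lborel. 0 < t \<and> t < T \<longrightarrow> t \<in> A"
    using conv_energy_identity(1)[OF k] by eventually_elim (simp add: A_def m0_def)
  define S where "S = (SUP t\<in>A. conv_energy k t)"
  \<comment> \<open>The solution-dependent bound \<open>M\<close> serves only to make the supremum
    finite and does not enter the estimate.\<close>
  have bdd: "bdd_above (conv_energy k ` A)"
  proof (rule bdd_aboveI2)
    fix t
    have "conv_energy k t \<le> (\<Sum>i\<in>UNIV. (LBINT x. \<bar>k x\<bar>)\<^sup>2 * sq (U i t))"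
      unfolding conv_energy_def by (intro sum_mono conv_Young(2) kernel_integrable kk U_L2)
    also have "\<dots> = (LBINT x. \<bar>k x\<bar>)\<^sup>2 * energy t" by (simp add: energy_def sum_distrib_left)
    also have "\<dots> \<le> (LBINT x. \<bar>k x\<bar>)\<^sup>2 * M" by (intro mult_left_mono energy_le) simp
    finally show "conv_energy k t \<le> (LBINT x. \<bar>k x\<bar>)\<^sup>2 * M" .
  qed
  have le_S: "conv_energy k t \<le> S" if "t \<in> A" for t unfolding S_def by (rule cSUP_upper[OF that bdd])
  have ce0: "0 \<le> conv_energy k t" for t unfolding conv_energy_def by (intro sum_nonneg) simp
  have step: "conv_energy k t \<le> m0 + 6 * (sqrt S * (sqrt (sq k) * J))" if t: "t \<in> A" for t
  proof -
    have S0: "0 \<le> S" using le_S[OF t] ce0[of t] by linarith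
    have tT: "t < T" using t by (simp add: A_def)
    have "- (LBINT s. indicator {..t} s * conv_dissipation k s) = (LBINT s. indicator {..t} s * (- conv_dissipation k s))"
      by simp
    also have "\<dots> \<le> (LBINT s. 3 * (sqrt S * sqrt (sq k)) * (indicator {..T} s * q s))"
    proof (rule integral_mono_AE)
      show "integrable lborel (\<lambda>s. indicator {..t} s * (- conv_dissipation k s))"
        using conv_energy_identity(2)[OF k, of t] by simp
      show "integrable lborel (\<lambda>s. 3 * (sqrt S * sqrt (sq k)) * (indicator {..T} s * q s))" using qi by simp
      show "AE s in lborel. indicator {..t} s * (- conv_dissipation k s) \<le> 3 * (sqrt S * sqrt (sq k)) * (indicator {..T} s * q s)"
        using AA
      proof eventually_elim
        case (elim s)
        have l: "- conv_dissipation k s \<le> 3 * (sqrt (conv_energy k s) * (sqrt (sq k) * q s))"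
          unfolding q_def by (rule conv_dissipation_lower[OF k])
        have n: "0 \<le> 3 * (sqrt S * sqrt (sq k)) * (indicator {..T} s * q s)"
          using S0 q0[of s] by simp
        show ?case
        proof (cases "s \<le> t")
          case False then show ?thesis using n by simp
        next
          case True
          have "sqrt (conv_energy k s) * (sqrt (sq k) * q s) \<le> sqrt S * (sqrt (sq k) * q s)"
          proof (cases "s > 0")
            case True
            then have "conv_energy k s \<le> S" using elim \<open>s \<le> t\<close> tT by (intro le_S) simp
            then show ?thesis using q0[of s] by (intro mult_right_mono) auto
          next
            case False
            then have "q s = 0" by (simp add: q_def energy_zero)
            then show ?thesis by simp
          qed
          then have "- conv_dissipation k s \<le> 3 * (sqrt S * (sqrt (sq k) * q s))" using l by linarith
          then show ?thesis using True tT by (simp add: mult.assoc)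
        qed
      qed
    qed
    also have "\<dots> = 3 * (sqrt S * sqrt (sq k)) * J" by (simp add: J_def)
    finally have "- (LBINT s. indicator {..t} s * conv_dissipation k s) \<le> 3 * (sqrt S * (sqrt (sq k) * J))"
      by (simp add: mult.assoc)
    moreover have "conv_energy k t = m0 - 2 * (LBINT s. indicator {..t} s * conv_dissipation k s)"
      using t by (simp only: A_def mem_Collect_eq)
    ultimately show ?thesis by linarith
  qed
  show ?thesis using AA
  proof eventually_elim
    case (elim t)
    show ?case
    proof
      assume "0 < t \<and> t < T"
      then have t: "t \<in> A" using elim by blast
      then have ne: "A \<noteq> {}" by blast
      have S0: "0 \<le> S" using le_S[OF t] ce0[of t] by linarith
      have "(SUP t\<in>A. conv_energy k t) \<le> m0 + 6 * (sqrt S * (sqrt (sq k) * J))"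
        by (rule cSUP_least[OF ne step])
      then have 1: "S \<le> m0 + 6 * (sqrt S * (sqrt (sq k) * J))" by (simp only: S_def[symmetric])
      \<comment> \<open>Young's inequality with the weight that leaves exactly S/2 to be
        absorbed.\<close>
      have "6 * (a * b) \<le> a\<^sup>2 / 2 + 18 * b\<^sup>2" for a b :: real
        using zero_le_power2[of "a - 6 * b"] by (simp add: power2_eq_square algebra_simps)
      then have "6 * (sqrt S * (sqrt (sq k) * J)) \<le> (sqrt S)\<^sup>2 / 2 + 18 * (sqrt (sq k) * J)\<^sup>2" .
      then have "6 * (sqrt S * (sqrt (sq k) * J)) \<le> S / 2 + 18 * (sq k * J\<^sup>2)" using S0 by (simp add: power_mult_distrib)
      with 1 have "S \<le> m0 + (S / 2 + 18 * (sq k * J\<^sup>2))" by linarith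
      then have "S \<le> 2 * m0 + 36 * sq k * J\<^sup>2" by (simp add: algebra_simps)
      also have "\<dots> \<le> 2 * m0 + 36 * sq k * ((LBINT s. adv_sq s) * (LBINT s. indicator {..T} s * energy s))"
        using J2 by (intro add_left_mono mult_left_mono) auto
      finally show "conv_energy k t \<le> 2 * (\<Sum>i\<in>UNIV. sq (conv k (U0 i)))
        + 36 * sq k * ((LBINT s. adv_sq s) * (LBINT s. indicator {..T} s * energy s))"
        using le_S[OF t] by (simp add: m0_def)
    qed
  qed
qed

lemma energy_splitting:
  assumes s: "s > 0"
  shows "energy t \<le> 2 * conv_energy (mollifier s) t + 2 * s\<^sup>2 * grad_sq t"
proof -
  have "sq (U i t) \<le> 2 * sq (conv (mollifier s) (U i t)) + 2 * (s\<^sup>2 * (\<Sum>j\<in>UNIV. sq (DU i j t)))" for i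
  proof -
    let ?c = "conv (mollifier s) (U i t)"
    have c: "in_L2 ?c" by (rule prob_kernel_contraction(1)[OF mollifier_prob[OF s] U_L2])
    have "sq (\<lambda>x. ?c x + (U i t x - ?c x)) \<le> 2 * sq ?c + 2 * sq (\<lambda>x. U i t x - ?c x)"
      by (rule sq_add_le[OF c in_L2_diff[OF U_L2 c]])
    moreover have "sq (\<lambda>x. U i t x - ?c x) = sq (\<lambda>x. ?c x - U i t x)" by (simp add: sq_def power2_commute)
    moreover have "sq (\<lambda>x. ?c x - U i t x) \<le> s\<^sup>2 * (\<Sum>j\<in>UNIV. sq (DU i j t))"
      by (rule mollifier_error[OF weak_grad s])
    ultimately show ?thesis by simp
  qed
  then have "energy t \<le> (\<Sum>i\<in>UNIV. 2 * sq (conv (mollifier s) (U i t)) + 2 * (s\<^sup>2 * (\<Sum>j\<in>UNIV. sq (DU i j t))))"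
    unfolding energy_def by (intro sum_mono)
  also have "\<dots> = 2 * conv_energy (mollifier s) t + 2 * s\<^sup>2 * grad_sq t"
    by (simp add: conv_energy_def grad_sq_def sum.distrib sum_distrib_left mult.assoc)
  finally show ?thesis .
qed

text \<open>The energy equality identifies the energy with this function at almost every time only.
  For \<alpha> > \<epsilon>/4 it is antitone and defined at every time, so the values at a and 2a
  can be compared without exceptions.\<close>

definition total_energy :: "real \<Rightarrow> real" where
  "total_energy t = initial_energy - 2 * (LBINT s. indicator {..t} s * dissipation s)"

context
  assumes alpha: "\<alpha> > \<epsilon> / 4"
begin

lemma dissipation_nonneg: "0 \<le> dissipation t"
proof -
  have "0 \<le> (\<alpha> - \<epsilon> / 16) * sq (u_sq t)" using alpha eps by (intro mult_nonneg_nonneg) auto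
  then show ?thesis using dissipation_lower[of t] grad_sq_nonneg[of t] by linarith
qed

lemma dissipation_part_integrable: "S \<in> sets borel \<Longrightarrow> integrable lborel (\<lambda>s. indicator S s * dissipation s)"
  by (rule Bochner_Integration.integrable_bound[OF dissipation_measurable_integrable])
     (use borel_measurable_integrable[OF dissipation_measurable_integrable] in \<open>auto simp: indicator_def\<close>)

lemma total_energy_antimono: "s \<le> t \<Longrightarrow> total_energy t \<le> total_energy s"
  unfolding total_energy_def
  by (intro diff_left_mono mult_left_mono integral_mono dissipation_part_integrable)
     (auto simp: indicator_def dissipation_nonneg)

lemma energy_eq_total: "AE t in lborel. t > 0 \<longrightarrow> energy t = total_energy t"
  using energy_equality unfolding total_energy_def .

text \<open>At some later time the value is an actual energy, and the function is antitone.\<close>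

lemma total_energy_nonneg: "0 \<le> total_energy t"
proof -
  obtain s where s: "max t 0 < s" "s > 0 \<longrightarrow> energy s = total_energy s"
    by (rule AE_ex_between[OF energy_eq_total, of "max t 0" "max t 0 + 1"]) auto
  have "energy s = total_energy s" using s by auto
  moreover have "total_energy s \<le> total_energy t" using s(1) by (intro total_energy_antimono) simp
  ultimately show ?thesis using energy_nonneg[of s] by simp
qed

lemma total_energy_le: "total_energy t \<le> initial_energy"
  unfolding total_energy_def using dissipation_nonneg by (simp add: Bochner_Integration.integral_nonneg)

text \<open>The energy dissipated up to any finite time cannot exceed the initial energy, since what
  is left is nonnegative; exhaustion of the line gives the full integral.\<close>

lemma dissipation_integral_le: "2 * (LBINT s. dissipation s) \<le> initial_energy"
proof -
  have "(\<lambda>n. LBINT s. indicator {..real n} s * dissipation s) \<longlonglongrightarrow> (LBINT s. dissipation s)"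
  proof (rule integral_dominated_convergence[OF _ _ dissipation_measurable_integrable])
    show "AE s in lborel. (\<lambda>n. indicator {..real n} s * dissipation s) \<longlonglongrightarrow> dissipation s"
    proof (intro AE_I2 tendsto_eventually)
      fix s
      obtain m0 where "s < real m0" using reals_Archimedean2 by blast
      then show "\<forall>\<^sub>F m in sequentially. indicator {..real m} s * dissipation s = dissipation s"
        by (intro eventually_sequentiallyI[of m0]) simp
    qed
    show "AE s in lborel. norm (indicator {..real n} s * dissipation s) \<le> dissipation s" for n
      by (auto simp: indicator_def dissipation_nonneg)
  qed (use borel_measurable_integrable[OF dissipation_measurable_integrable] in auto)
  then have "(\<lambda>n. 2 * (LBINT s. indicator {..real n} s * dissipation s)) \<longlonglongrightarrow> 2 * (LBINT s. dissipation s)"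
    by (intro tendsto_intros)
  then show ?thesis
    by (rule LIMSEQ_le_const2) (use total_energy_nonneg in \<open>auto simp: total_energy_def\<close>)
qed

lemma sq_u_sq_integrable: "integrable lborel (\<lambda>t. sq (u_sq t))"
proof (rule Bochner_Integration.integrable_bound)
  have "case_prod u_sq \<in> borel_measurable (borel \<Otimes>\<^sub>M borel)" unfolding split_beta' u_sq_def by measurable
  from sq_measurable_param[OF this] show "(\<lambda>t. sq (u_sq t)) \<in> borel_measurable lborel" by simp
  show "integrable lborel (\<lambda>t. dissipation t / (\<alpha> - \<epsilon> / 16))" using dissipation_measurable_integrable by simp
  have c: "\<alpha> - \<epsilon> / 16 > 0" using alpha eps by simp
  show "AE t in lborel. norm (sq (u_sq t)) \<le> norm (dissipation t / (\<alpha> - \<epsilon> / 16))"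
  proof (rule AE_I2)
    fix t
    have "(\<alpha> - \<epsilon> / 16) * sq (u_sq t) \<le> dissipation t" using dissipation_lower[of t] grad_sq_nonneg[of t] by linarith
    then have "sq (u_sq t) \<le> dissipation t / (\<alpha> - \<epsilon> / 16)" unfolding pos_le_divide_eq[OF c] by (simp only: mult.commute)
    then show "norm (sq (u_sq t)) \<le> norm (dissipation t / (\<alpha> - \<epsilon> / 16))"
      unfolding real_norm_def abs_of_nonneg[OF sq_nonneg] by (rule order_trans[OF _ abs_ge_self])
  qed
qed

text \<open>The gradient and the fourth power of u are each paid for by the dissipation, whose
  integral is at most half the initial energy: 2 * (1/2) = 1 and 12 * (1/2) = 6. The bound involves
  the solution through its datum only, so the final constant serves all solutions.\<close>

lemma adv_sq_integral_le: "(LBINT s. adv_sq s) \<le> (1 + 6 * \<alpha>\<^sup>2 / (\<alpha> - \<epsilon> / 16)) * initial_energy"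
proof -
  have c: "\<alpha> - \<epsilon> / 16 > 0" using alpha eps by simp
  let ?D = "LBINT s. dissipation s"
  have D: "?D \<le> initial_energy / 2" using dissipation_integral_le by simp
  have g: "(LBINT s. grad_sq s) \<le> ?D"
  proof (intro integral_mono grad_sq_integrable dissipation_measurable_integrable)
    fix t
    have "0 \<le> (\<alpha> - \<epsilon> / 16) * sq (u_sq t)" using c by simp
    then show "grad_sq t \<le> dissipation t" using dissipation_lower[of t] by linarith
  qed
  have "(\<alpha> - \<epsilon> / 16) * (LBINT s. sq (u_sq s)) = (LBINT s. (\<alpha> - \<epsilon> / 16) * sq (u_sq s))" by simp
  also have "\<dots> \<le> ?D"
  proof (intro integral_mono integrable_mult_right sq_u_sq_integrable dissipation_measurable_integrable)
    show "(\<alpha> - \<epsilon> / 16) * sq (u_sq t) \<le> dissipation t" for t using dissipation_lower[of t] grad_sq_nonneg[of t] by linarith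
  qed
  finally have "(\<alpha> - \<epsilon> / 16) * (LBINT s. sq (u_sq s)) \<le> initial_energy / 2" using D by linarith
  then have s: "(LBINT s. sq (u_sq s)) \<le> initial_energy / 2 / (\<alpha> - \<epsilon> / 16)"
    unfolding pos_le_divide_eq[OF c] by (simp only: mult.commute)
  have "(LBINT s. adv_sq s) \<le> (LBINT s. 2 * grad_sq s + 12 * \<alpha>\<^sup>2 * sq (u_sq s))"
    by (intro integral_mono adv_sq_integrable adv_sq_le Bochner_Integration.integrable_add integrable_mult_right grad_sq_integrable sq_u_sq_integrable)
  also have "\<dots> = 2 * (LBINT s. grad_sq s) + 12 * \<alpha>\<^sup>2 * (LBINT s. sq (u_sq s))"
    using grad_sq_integrable sq_u_sq_integrable by simp
  also have "\<dots> \<le> 2 * (initial_energy / 2) + 12 * \<alpha>\<^sup>2 * (initial_energy / 2 / (\<alpha> - \<epsilon> / 16))"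
    using g D s by (intro add_mono mult_left_mono) auto
  also have "\<dots> = (1 + 6 * \<alpha>\<^sup>2 / (\<alpha> - \<epsilon> / 16)) * initial_energy" by (simp add: field_simps)
  finally show ?thesis .
qed

text \<open>On \<open>[a, 2a]\<close> the low-frequency part has energy at most some \<open>B\<close>, so the dissipation there is at
  least \<open>(E(2a) - 2B) / (2s\<^sup>2)\<close>, and \<open>s\<^sup>2 = a/15\<close> turns the energy equality into \<open>16 E(2a) \<le> E(a) + 30 B\<close>.\<close>

lemma energy_halving:
  assumes a: "a > 0"
  defines "s \<equiv> sqrt (a / 15)"
  shows "total_energy (2 * a) \<le> total_energy a / 16
    + 2 * (2 * (\<Sum>i\<in>UNIV. sq (conv (mollifier s) (U0 i)))
      + 36 * sq (mollifier s :: real^3 \<Rightarrow> real) * ((1 + 6 * \<alpha>\<^sup>2 / (\<alpha> - \<epsilon> / 16)) * initial_energy * (LBINT t. indicator {0..2 * a} t * total_energy t)))"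
proof -
  have s: "s > 0" and s2: "s\<^sup>2 = a / 15" using a by (auto simp: s_def)
  define B where "B = 2 * (\<Sum>i\<in>UNIV. sq (conv (mollifier s) (U0 i)))
      + 36 * sq (mollifier s :: real^3 \<Rightarrow> real) * ((1 + 6 * \<alpha>\<^sup>2 / (\<alpha> - \<epsilon> / 16)) * initial_energy * (LBINT t. indicator {0..2 * a} t * total_energy t))"
  have Em: "total_energy \<in> borel_measurable borel"
  proof -
    have "mono (\<lambda>t. - total_energy t)" by (auto simp: mono_def total_energy_antimono)
    from borel_measurable_uminus[OF borel_measurable_mono[OF this]] show ?thesis by simp
  qed
  have eI: "(LBINT t. indicator {..2 * a} t * energy t) = (LBINT t. indicator {0..2 * a} t * total_energy t)"
  proof (rule integral_cong_AE)
    show "AE t in lborel. indicator {..2 * a} t * energy t = indicator {0..2 * a} t * total_energy t"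
      using energy_eq_total AE_lborel_singleton[of 0]
      by eventually_elim (auto simp: indicator_def energy_zero)
  qed (use Em in auto)
  have low: "AE t in lborel. 0 < t \<and> t < 2 * a \<longrightarrow> conv_energy (mollifier s) t \<le> B"
    using low_frequency_bound[OF mollifier_test_function[OF s], of "2 * a"]
  proof eventually_elim
    case (elim t)
    have "(LBINT s. adv_sq s) * (LBINT s. indicator {..2 * a} s * energy s) \<le>
      (1 + 6 * \<alpha>\<^sup>2 / (\<alpha> - \<epsilon> / 16)) * initial_energy * (LBINT t. indicator {0..2 * a} t * total_energy t)"
      unfolding eI by (intro mult_right_mono adv_sq_integral_le Bochner_Integration.integral_nonneg) (simp add: total_energy_nonneg)
    then have "36 * sq (mollifier s :: real^3 \<Rightarrow> real) * ((LBINT s. adv_sq s) * (LBINT s. indicator {..2 * a} s * energy s)) \<le>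
      36 * sq (mollifier s :: real^3 \<Rightarrow> real) * ((1 + 6 * \<alpha>\<^sup>2 / (\<alpha> - \<epsilon> / 16)) * initial_energy * (LBINT t. indicator {0..2 * a} t * total_energy t))"
      by (intro mult_left_mono) auto
    then show ?case using elim unfolding B_def by linarith
  qed
  \<comment> \<open>The lower bound that the splitting yields for \<open>grad_sq\<close>, and hence
    for the dissipation, at almost every time in (a, 2a). It may be negative without harm.\<close>
  define c where "c = (total_energy (2 * a) - 2 * B) / (2 * s\<^sup>2)"
  have "a * c = (LBINT t. indicator {a<..2 * a} t * c)" using a by simp
  also have "\<dots> \<le> (LBINT t. indicator {a<..2 * a} t * dissipation t)"
  proof (rule integral_mono_AE)
    show "integrable lborel (\<lambda>t. indicator {a<..2 * a} t * c)" using a by simp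
    show "integrable lborel (\<lambda>t. indicator {a<..2 * a} t * dissipation t)" by (rule dissipation_part_integrable) simp
    show "AE t in lborel. indicator {a<..2 * a} t * c \<le> indicator {a<..2 * a} t * dissipation t"
      using low energy_eq_total AE_lborel_singleton[of "2 * a"]
    proof eventually_elim
      case (elim t)
      show ?case
      proof (cases "a < t \<and> t < 2 * a")
        case True
        have "total_energy (2 * a) \<le> energy t" using elim True a by (simp add: total_energy_antimono)
        also have "\<dots> \<le> 2 * conv_energy (mollifier s) t + 2 * s\<^sup>2 * grad_sq t" by (rule energy_splitting[OF s])
        finally have "total_energy (2 * a) - 2 * B \<le> 2 * s\<^sup>2 * grad_sq t" using elim True a by simp
        then have "c \<le> grad_sq t" using s by (simp add: c_def divide_le_eq mult.commute)
        also have "\<dots> \<le> dissipation t"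
        proof -
          have "0 \<le> (\<alpha> - \<epsilon> / 16) * sq (u_sq t)" using alpha eps by (intro mult_nonneg_nonneg) auto
          then show ?thesis using dissipation_lower[of t] by linarith
        qed
        finally show ?thesis using True by simp
      next
        case False
        then have "t \<notin> {a<..2 * a}" using elim by auto
        then show ?thesis by simp
      qed
    qed
  qed
  also have "\<dots> = (LBINT t. indicator {..2 * a} t * dissipation t - indicator {..a} t * dissipation t)"
    using a by (intro Bochner_Integration.integral_cong) (auto simp: indicator_def)
  also have "\<dots> = (LBINT t. indicator {..2 * a} t * dissipation t) - (LBINT t. indicator {..a} t * dissipation t)"
    by (intro Bochner_Integration.integral_diff dissipation_part_integrable) auto
  finally have "2 * (a * c) \<le> total_energy a - total_energy (2 * a)" by (simp add: total_energy_def)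
  moreover have "2 * (a * c) = 15 * (total_energy (2 * a) - 2 * B)" using a by (simp add: c_def s2 field_simps)
  ultimately have "16 * total_energy (2 * a) \<le> total_energy a + 30 * B" by simp
  \<comment> \<open>The factor 30/16 is rounded up to 2, which requires \<open>B\<close> to be
    nonnegative.\<close>
  moreover have "0 \<le> B"
    unfolding B_def using alpha eps total_energy_nonneg
    by (intro add_nonneg_nonneg mult_nonneg_nonneg sum_nonneg Bochner_Integration.integral_nonneg) (auto intro!: sum_nonneg divide_nonneg_nonneg)
  ultimately have "total_energy (2 * a) \<le> total_energy a / 16 + 2 * B" by simp
  then show ?thesis unfolding B_def .
qed

end

end

section \<open>Plancherel's identity\<close>

text \<open>The factors may depend on the coordinate, as the one-dimensional phases with frequency
  \<open>\<xi> \<bullet> b\<close> do.\<close>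

lemma integral_lborel_prod:
  fixes h :: "'a::euclidean_space \<Rightarrow> real \<Rightarrow> 'b::{banach, second_countable_topology, real_normed_field}"
  assumes h: "\<And>b. b \<in> Basis \<Longrightarrow> integrable lborel (h b)"
  shows "(LBINT x::'a. (\<Prod>b\<in>Basis. h b (x \<bullet> b))) = (\<Prod>b\<in>Basis. LBINT t. h b t)"
    and "integrable lborel (\<lambda>x::'a. \<Prod>b\<in>Basis. h b (x \<bullet> b))"
proof -
  interpret product_sigma_finite "\<lambda>_::'a. lborel :: real measure" ..
  have [measurable]: "h b \<in> borel_measurable borel" if "b \<in> Basis" for b using h[OF that] by auto
  have T: "(\<lambda>f. \<Sum>b\<in>Basis. f b *\<^sub>R b) \<in> measurable (\<Pi>\<^sub>M b\<in>Basis. lborel) (borel :: 'a measure)"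
    by measurable
  have m: "(\<lambda>x::'a. \<Prod>b\<in>Basis. h b (x \<bullet> b)) \<in> borel_measurable borel" by measurable
  have "(LBINT x::'a. (\<Prod>b\<in>Basis. h b (x \<bullet> b))) = (LINT f|(\<Pi>\<^sub>M b\<in>Basis. lborel). (\<Prod>b\<in>Basis. h b (f b)))"
    by (subst lborel_eq) (simp add: integral_distr[OF T m])
  also have "\<dots> = (\<Prod>b\<in>Basis. LBINT t. h b t)"
    by (rule product_integral_prod) (auto intro: h)
  finally show "(LBINT x::'a. (\<Prod>b\<in>Basis. h b (x \<bullet> b))) = (\<Prod>b\<in>Basis. LBINT t. h b t)" .
  have "integrable (\<Pi>\<^sub>M b\<in>Basis. lborel) (\<lambda>f. \<Prod>b\<in>(Basis::'a set). h b (f b))"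
    by (rule product_integrable_prod) (auto intro: h)
  then show "integrable lborel (\<lambda>x::'a. \<Prod>b\<in>Basis. h b (x \<bullet> b))"
    by (subst lborel_eq) (simp add: integrable_distr_eq[OF T m])
qed

section \<open>Gaussian densities and their transforms\<close>

lemma integrable_std_normal_density: "integrable lborel std_normal_density"
  and integral_std_normal_density: "(LBINT x. std_normal_density x) = 1"
  using integrable_std_normal_moment[of 0] integral_std_normal_moment_even[of 0] by simp_all

definition gauss :: "'a::euclidean_space \<Rightarrow> real" where
  "gauss x = (\<Prod>b\<in>Basis. std_normal_density (x \<bullet> b))"

lemma gauss_eq: "gauss (x::'a::euclidean_space) = exp (- (x \<bullet> x) / 2) / (sqrt (2 * pi)) ^ DIM('a)"
proof -
  have "gauss x = (\<Prod>b\<in>(Basis::'a set). (1 / sqrt (2 * pi)) * exp (- (x \<bullet> b)\<^sup>2 / 2))"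
    by (simp add: gauss_def std_normal_density_def)
  also have "\<dots> = (1 / sqrt (2 * pi)) ^ DIM('a) * exp (\<Sum>b\<in>(Basis::'a set). - (x \<bullet> b)\<^sup>2 / 2)"
    by (simp only: prod.distrib exp_sum finite_Basis prod_constant)
  also have "(\<Sum>b\<in>(Basis::'a set). - (x \<bullet> b)\<^sup>2 / 2) = - (x \<bullet> x) / 2"
    by (simp add: euclidean_inner[of x x] power2_eq_square sum_divide_distrib[symmetric] sum_negf)
  finally show ?thesis by (simp add: power_divide)
qed

lemma gauss_pos: "0 \<le> gauss x" by (simp add: gauss_eq)

lemma gauss_measurable [measurable]: "gauss \<in> borel_measurable borel"
  unfolding gauss_def[abs_def] by measurable

lemma gauss_integrable: "integrable lborel (gauss :: 'a::euclidean_space \<Rightarrow> real)"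
  and gauss_integral: "(LBINT x::'a. gauss x) = 1"
proof -
  have i: "integrable lborel std_normal_density" by (rule integrable_std_normal_density)
  show "integrable lborel (gauss :: 'a \<Rightarrow> real)"
    using integral_lborel_prod(2)[where h="\<lambda>_::'a. std_normal_density"] i unfolding gauss_def[abs_def] by simp
  show "(LBINT x::'a. gauss x) = 1"
    using integral_lborel_prod(1)[where h="\<lambda>_::'a. std_normal_density"] i integral_std_normal_density unfolding gauss_def by simp
qed

text \<open>Complex exponentials factor over the coordinates and cosines do not, so the identity is
  proved for \<open>cis\<close> from the characteristic function of the normal distribution, and the
  real part is taken at the end.\<close>

lemma gauss_fourier: "(LBINT x. cos (\<xi> \<bullet> x) * gauss x) = exp (- (\<xi> \<bullet> \<xi>) / 2)"
  for \<xi> :: "'a::euclidean_space"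
proof -
  have c1: "(LBINT x. cis (t * x) * complex_of_real (std_normal_density x)) = complex_of_real (exp (- t\<^sup>2 / 2))" for t
  proof -
    have "complex_of_real (exp (- t\<^sup>2 / 2)) = (LINT x|std_normal_distribution. iexp (t * x))"
      using char_std_normal_distribution by (simp add: char_def fun_eq_iff)
    also have "\<dots> = (LBINT x. std_normal_density x *\<^sub>R iexp (t * x))"
      by (intro integral_density) (auto simp: normal_density_nonneg)
    finally show ?thesis by (simp add: cis_conv_exp scaleR_conv_of_real mult.commute)
  qed
  have i1: "integrable lborel (\<lambda>x. cis (t * x) * complex_of_real (std_normal_density x))" for t
  proof (rule Bochner_Integration.integrable_bound[OF integrable_std_normal_density])
    show "(\<lambda>x. cis (t * x) * complex_of_real (std_normal_density x)) \<in> borel_measurable lborel"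
      by (intro borel_measurable_times measurable_compose[OF _ borel_measurable_continuous_onI[of cis]]) (auto intro: continuous_intros)
  qed (simp add: norm_mult)
  have prod: "(\<Prod>b\<in>Basis. cis ((\<xi> \<bullet> b) * (x \<bullet> b)) * complex_of_real (std_normal_density (x \<bullet> b))) = cis (\<xi> \<bullet> x) * complex_of_real (gauss x)" for x
  proof -
    have "(\<Prod>b\<in>A. cis (g b)) = cis (\<Sum>b\<in>A. g b)" if "finite A" for g and A :: "'a set"
      using that by (induction A rule: finite_induct) (auto simp: cis_mult)
    then have "(\<Prod>b\<in>Basis. cis ((\<xi> \<bullet> b) * (x \<bullet> b))) = cis (\<xi> \<bullet> x)"
      by (subst euclidean_inner) simp
    then show ?thesis by (simp add: prod.distrib gauss_def)
  qed
  have "(LBINT x. cis (\<xi> \<bullet> x) * complex_of_real (gauss x)) = (\<Prod>b\<in>(Basis::'a set). complex_of_real (exp (- (\<xi> \<bullet> b)\<^sup>2 / 2)))"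
    using integral_lborel_prod(1)[of "\<lambda>b x. cis ((\<xi> \<bullet> b) * x) * complex_of_real (std_normal_density x)", OF i1]
    unfolding prod c1 .
  also have "\<dots> = complex_of_real (exp (\<Sum>b\<in>(Basis::'a set). - (\<xi> \<bullet> b)\<^sup>2 / 2))"
    by (simp add: exp_sum)
  also have "(\<Sum>b\<in>(Basis::'a set). - (\<xi> \<bullet> b)\<^sup>2 / 2) = - (\<xi> \<bullet> \<xi>) / 2"
    by (simp add: euclidean_inner[of \<xi> \<xi>] power2_eq_square sum_divide_distrib[symmetric] sum_negf)
  finally have E: "(LBINT x. cis (\<xi> \<bullet> x) * complex_of_real (gauss x)) = complex_of_real (exp (- (\<xi> \<bullet> \<xi>) / 2))" .
  have ic: "integrable lborel (\<lambda>x. cis (\<xi> \<bullet> x) * complex_of_real (gauss x))"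
    using integral_lborel_prod(2)[of "\<lambda>b x. cis ((\<xi> \<bullet> b) * x) * complex_of_real (std_normal_density x)", OF i1]
    unfolding prod .
  have "(LBINT x. Re (cis (\<xi> \<bullet> x) * complex_of_real (gauss x))) = Re (complex_of_real (exp (- (\<xi> \<bullet> \<xi>) / 2)))"
    using integral_Re[OF ic] E by simp
  then show ?thesis by simp
qed

lemma lborel_integral_scale:
  fixes f :: "'a::euclidean_space \<Rightarrow> real"
  assumes s: "s > 0" and [measurable]: "f \<in> borel_measurable borel"
  shows "(LBINT x. f (x /\<^sub>R s)) = s ^ DIM('a) * (LBINT x. f x)"
    and "integrable lborel f \<Longrightarrow> integrable lborel (\<lambda>x. f (x /\<^sub>R s))"
proof -
  have L: "(lborel :: 'a measure) = density (distr lborel borel (\<lambda>x. 0 + s *\<^sub>R x)) (\<lambda>_. \<bar>s\<bar> ^ DIM('a))"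
    using s by (intro lborel_affine) simp
  have sp: "0 < s ^ DIM('a)" using s by simp
  show "(LBINT x. f (x /\<^sub>R s)) = s ^ DIM('a) * (LBINT x. f x)"
    by (subst L) (use s in \<open>simp add: integral_density integral_distr\<close>)
  show "integrable lborel f \<Longrightarrow> integrable lborel (\<lambda>x. f (x /\<^sub>R s))"
    by (subst L) (use s in \<open>simp add: integrable_density integrable_distr_eq\<close>)
qed

definition gauss_scaled :: "real \<Rightarrow> 'a::euclidean_space \<Rightarrow> real" where
  "gauss_scaled s x = gauss (x /\<^sub>R s) / s ^ DIM('a)"

lemma gauss_scaled_measurable [measurable]: "gauss_scaled s \<in> borel_measurable borel"
  unfolding gauss_scaled_def[abs_def] by measurable

lemma gauss_scaled_bound:
  fixes z :: "'a::euclidean_space"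
  assumes "s > 0"
  shows "\<bar>gauss_scaled s z\<bar> \<le> 1 / sqrt (2 * pi) ^ DIM('a) / s ^ DIM('a)"
proof -
  have "gauss y \<le> 1 / sqrt (2 * pi) ^ DIM('a)" for y :: 'a
    unfolding gauss_eq by (intro divide_right_mono) (simp_all del: inverse_nonnegative_iff_nonnegative)
  then have "gauss (z /\<^sub>R s) / s ^ DIM('a) \<le> 1 / sqrt (2 * pi) ^ DIM('a) / s ^ DIM('a)"
    using assms by (intro divide_right_mono) auto
  moreover have "0 \<le> gauss_scaled s z" using assms by (simp add: gauss_scaled_def gauss_pos)
  ultimately show ?thesis by (simp only: gauss_scaled_def abs_of_nonneg)
qed

lemma gauss_scaled_prob: 
  assumes s: "s > 0" shows "prob_kernel (gauss_scaled s :: 'a::euclidean_space \<Rightarrow> real)"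
  unfolding prob_kernel_def gauss_scaled_def[abs_def]
proof (intro conjI allI)
  show "integrable lborel (\<lambda>x::'a. gauss (x /\<^sub>R s) / s ^ DIM('a))"
  proof -
    have "integrable lborel (\<lambda>x::'a. gauss (x /\<^sub>R s))"
      by (rule lborel_integral_scale(2)[OF s gauss_measurable gauss_integrable])
    then show ?thesis by simp
  qed
  show "0 \<le> gauss (x /\<^sub>R s) / s ^ DIM('a)" for x :: 'a using s by (simp add: gauss_pos)
  show "(LBINT x::'a. gauss (x /\<^sub>R s) / s ^ DIM('a)) = 1"
    using lborel_integral_scale(1)[OF s gauss_measurable, where 'a='a] gauss_integral[where 'a='a] s by simp
qed

lemma gauss_scaled_fourier:
  fixes z :: "'a::euclidean_space"
  assumes s: "s > 0"
  shows "(LBINT \<xi>. cos (\<xi> \<bullet> z) * exp (- (s\<^sup>2 * (\<xi> \<bullet> \<xi>)) / 2)) = (2 * pi) ^ DIM('a) * gauss_scaled s z"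
    and "integrable lborel (\<lambda>\<xi>::'a. exp (- (s\<^sup>2 * (\<xi> \<bullet> \<xi>)) / 2))"
proof -
  \<comment> \<open>The normalisation (2 pi)^(d/2) of the Gaussian. It enters twice, once in writing
    the weight as a dilated density and once in writing its transform as a density again, which
    accounts for (2 pi)^d.\<close>
  define c where "c = sqrt (2 * pi) ^ DIM('a)"
  have "c * c = (sqrt (2 * pi) * sqrt (2 * pi)) ^ DIM('a)" by (simp only: c_def power_mult_distrib)
  then have c: "c > 0" "c * c = (2 * pi) ^ DIM('a)" by (simp_all add: c_def)
  have g: "exp (- (y \<bullet> y) / 2) = c * gauss y" for y :: 'a using c(1) by (simp add: gauss_eq c_def)
  have e: "exp (- (s\<^sup>2 * (\<xi> \<bullet> \<xi>)) / 2) = c * gauss (\<xi> /\<^sub>R (1 / s))" for \<xi> :: 'a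
    using g[of "\<xi> /\<^sub>R (1 / s)"] by (simp add: power2_eq_square mult.assoc)
  have s': "1 / s > 0" using s by simp
  show "integrable lborel (\<lambda>\<xi>::'a. exp (- (s\<^sup>2 * (\<xi> \<bullet> \<xi>)) / 2))"
  proof -
    have "integrable lborel (\<lambda>\<xi>::'a. gauss (\<xi> /\<^sub>R (1 / s)))"
      by (rule lborel_integral_scale(2)[OF s' gauss_measurable gauss_integrable])
    then show ?thesis unfolding e by (rule integrable_mult_right)
  qed
  let ?f = "\<lambda>\<eta>::'a. cos ((z /\<^sub>R s) \<bullet> \<eta>) * gauss \<eta>"
  have "(LBINT \<xi>. cos (\<xi> \<bullet> z) * exp (- (s\<^sup>2 * (\<xi> \<bullet> \<xi>)) / 2)) = (LBINT \<xi>. c * ?f (\<xi> /\<^sub>R (1 / s)))"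
  proof -
    have "cos (\<xi> \<bullet> z) * (c * gauss (\<xi> /\<^sub>R (1 / s))) = c * ?f (\<xi> /\<^sub>R (1 / s))" for \<xi>
    proof -
      have "(z /\<^sub>R s) \<bullet> (\<xi> /\<^sub>R (1 / s)) = (inverse s * s) * (\<xi> \<bullet> z)" by (simp add: inner_commute)
      then have "(z /\<^sub>R s) \<bullet> (\<xi> /\<^sub>R (1 / s)) = \<xi> \<bullet> z" using s by simp
      then show ?thesis by simp
    qed
    then show ?thesis unfolding e by presburger
  qed
  also have "\<dots> = c * ((1 / s) ^ DIM('a) * (LBINT \<eta>. ?f \<eta>))"
    using lborel_integral_scale(1)[OF s', of ?f] by simp
  also have "(LBINT \<eta>. ?f \<eta>) = c * gauss (z /\<^sub>R s)" unfolding gauss_fourier by (rule g)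
  also have "c * ((1 / s) ^ DIM('a) * (c * gauss (z /\<^sub>R s))) = (2 * pi) ^ DIM('a) * gauss_scaled s z"
    unfolding c(2)[symmetric] by (simp add: gauss_scaled_def power_divide)
  finally show "(LBINT \<xi>. cos (\<xi> \<bullet> z) * exp (- (s\<^sup>2 * (\<xi> \<bullet> \<xi>)) / 2)) = (2 * pi) ^ DIM('a) * gauss_scaled s z" .
qed

text \<open>Rescaling turns the tail beyond d into the tail of the standard Gaussian beyond d (1 +
  n).\<close>

lemma gauss_approx_identity: "approx_identity (\<lambda>n. gauss_scaled (1 / (1 + real n)) :: 'a::euclidean_space \<Rightarrow> real)"
  unfolding approx_identity_def
proof (intro conjI allI impI)
  show "prob_kernel (gauss_scaled (1 / (1 + real n)) :: 'a \<Rightarrow> real)" for n by (rule gauss_scaled_prob) simp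
  fix d :: real assume d: "d > 0"
  have eq: "(LBINT z::'a. indicator {z. d \<le> norm z} z * gauss_scaled (1 / (1 + real n)) z) = (LBINT w::'a. indicator {w. d * (1 + real n) \<le> norm w} w * gauss w)" for n
  proof -
    define s where "s = 1 / (1 + real n)"
    have s: "s > 0" by (simp add: s_def)
    let ?f = "\<lambda>w::'a. indicator {w. d / s \<le> norm w} w * gauss w"
    have m: "{w::'a. d / s \<le> norm w} \<in> sets borel" by (intro borel_closed closed_Collect_le continuous_intros)
    have "indicator {z. d \<le> norm z} z * gauss_scaled s z = ?f (z /\<^sub>R s) / s ^ DIM('a)" for z :: 'a
      using s by (auto simp: indicator_def gauss_scaled_def field_simps)
    then have "(LBINT z::'a. indicator {z. d \<le> norm z} z * gauss_scaled s z) = (LBINT z. ?f (z /\<^sub>R s) / s ^ DIM('a))" by simp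
    also have "\<dots> = (LBINT z. ?f (z /\<^sub>R s)) / s ^ DIM('a)" by simp
    also have "\<dots> = (LBINT w. ?f w)" using m s by (subst lborel_integral_scale(1)[OF s]) auto
    finally show "(LBINT z::'a. indicator {z. d \<le> norm z} z * gauss_scaled (1 / (1 + real n)) z) = (LBINT w::'a. indicator {w. d * (1 + real n) \<le> norm w} w * gauss w)" by (simp add: s_def)
  qed
  have "(\<lambda>n. LBINT w::'a. indicator {w. d * (1 + real n) \<le> norm w} w * gauss w) \<longlonglongrightarrow> (LBINT w::'a. 0::real)"
  proof (rule integral_dominated_convergence[where w=gauss])
    show "(\<lambda>w::'a. indicator {w. d * (1 + real n) \<le> norm w} w * gauss w) \<in> borel_measurable lborel" for n
    proof -
      have "{w::'a. d * (1 + real n) \<le> norm w} \<in> sets borel" by (intro borel_closed closed_Collect_le continuous_intros)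
      then show ?thesis by simp
    qed
    show "AE w::'a in lborel. (\<lambda>n. indicator {w. d * (1 + real n) \<le> norm w} w * gauss w) \<longlonglongrightarrow> 0"
    proof (rule AE_I2)
      fix w :: 'a
      obtain N where N: "norm w / d < real N" using reals_Archimedean2 by blast
      have "\<forall>\<^sub>F n in sequentially. indicator {w. d * (1 + real n) \<le> norm w} w * gauss w = 0"
      proof (rule eventually_sequentiallyI[of N])
        fix n assume "N \<le> n"
        then have "real N \<le> 1 + real n" by simp
        then have "d * real N \<le> d * (1 + real n)" using d by simp
        moreover have "norm w < d * real N" using N d by (simp add: field_simps)
        ultimately show "indicator {w. d * (1 + real n) \<le> norm w} w * gauss w = 0" by simp
      qed
      then show "(\<lambda>n. indicator {w. d * (1 + real n) \<le> norm w} w * gauss w) \<longlonglongrightarrow> 0" by (rule tendsto_eventually)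
    qed
    show "AE w::'a in lborel. norm (indicator {w. d * (1 + real n) \<le> norm w} w * gauss w) \<le> gauss w" for n
      by (auto simp: indicator_def gauss_pos)
  qed (auto intro: gauss_integrable)
  then show "(\<lambda>n. LBINT z::'a. indicator {z. d \<le> norm z} z * gauss_scaled (1 / (1 + real n)) z) \<longlonglongrightarrow> 0"
    unfolding eq by simp
qed

text \<open>Real part and, up to sign, imaginary part of the Fourier integral of a real function.
  Working with the pair keeps the convolution calculus real-valued.\<close>

definition cos_transform :: "('a::euclidean_space \<Rightarrow> real) \<Rightarrow> 'a \<Rightarrow> real" where
  "cos_transform f \<xi> = (LBINT x. cos (\<xi> \<bullet> x) * f x)"

definition sin_transform :: "('a::euclidean_space \<Rightarrow> real) \<Rightarrow> 'a \<Rightarrow> real" where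
  "sin_transform f \<xi> = (LBINT x. sin (\<xi> \<bullet> x) * f x)"

lemma trig_integrable:
  fixes f :: "'a::euclidean_space \<Rightarrow> real"
  assumes f: "integrable lborel f"
  shows "integrable lborel (\<lambda>x. cos (c + \<xi> \<bullet> x) * f x)" "integrable lborel (\<lambda>x. sin (c + \<xi> \<bullet> x) * f x)"
    "integrable lborel (\<lambda>x. cos (\<xi> \<bullet> x) * f x)" "integrable lborel (\<lambda>x. sin (\<xi> \<bullet> x) * f x)"
proof -
  have [measurable]: "f \<in> borel_measurable borel" using f by auto
  show "integrable lborel (\<lambda>x. cos (c + \<xi> \<bullet> x) * f x)" "integrable lborel (\<lambda>x. sin (c + \<xi> \<bullet> x) * f x)"
    "integrable lborel (\<lambda>x. cos (\<xi> \<bullet> x) * f x)" "integrable lborel (\<lambda>x. sin (\<xi> \<bullet> x) * f x)"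
    by (rule Bochner_Integration.integrable_bound[OF f], simp, simp add: abs_mult mult_left_le_one_le)+
qed

lemma trig_transform_measurable [measurable]:
  assumes [measurable]: "f \<in> borel_measurable borel"
  shows "cos_transform f \<in> borel_measurable borel" "sin_transform f \<in> borel_measurable borel"
  unfolding cos_transform_def[abs_def] sin_transform_def[abs_def] by measurable

lemma trig_transform_diff:
  assumes "integrable lborel f" "integrable lborel g"
  shows "cos_transform (\<lambda>x. f x - g x) \<xi> = cos_transform f \<xi> - cos_transform g \<xi>"
    "sin_transform (\<lambda>x. f x - g x) \<xi> = sin_transform f \<xi> - sin_transform g \<xi>"
  using trig_integrable(3,4)[OF assms(1)] trig_integrable(3,4)[OF assms(2)]
  by (simp_all add: cos_transform_def sin_transform_def right_diff_distrib)

lemma abs_trig_transform_le: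
  assumes f: "integrable lborel f"
  shows "\<bar>cos_transform f \<xi>\<bar> \<le> (LBINT x. \<bar>f x\<bar>)" "\<bar>sin_transform f \<xi>\<bar> \<le> (LBINT x. \<bar>f x\<bar>)"
  using trig_integrable[OF f] f unfolding cos_transform_def sin_transform_def
  by (intro order_trans[OF integral_abs_bound] integral_mono integrable_abs; simp add: abs_mult mult_left_le_one_le)+

text \<open>The squared modulus of the Fourier integral as a double integral; the addition formula
  for cos(\<xi> . (x - y)) produces both squares.\<close>

lemma trig_transform_sq:
  fixes f :: "'a::euclidean_space \<Rightarrow> real"
  assumes f: "integrable lborel f"
  shows "(cos_transform f \<xi>)\<^sup>2 + (sin_transform f \<xi>)\<^sup>2 = (LBINT x. f x * (LBINT y. cos (\<xi> \<bullet> (x - y)) * f y))"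
proof -
  note t = trig_integrable(3,4)[OF f]
  have "(LBINT y. cos (\<xi> \<bullet> (x - y)) * f y) = cos (\<xi> \<bullet> x) * cos_transform f \<xi> + sin (\<xi> \<bullet> x) * sin_transform f \<xi>" for x
  proof -
    have "(LBINT y. cos (\<xi> \<bullet> (x - y)) * f y) = (LBINT y. cos (\<xi> \<bullet> x) * (cos (\<xi> \<bullet> y) * f y) + sin (\<xi> \<bullet> x) * (sin (\<xi> \<bullet> y) * f y))"
      by (intro Bochner_Integration.integral_cong refl) (simp add: inner_diff_right cos_diff algebra_simps)
    then show ?thesis using t by (simp add: cos_transform_def sin_transform_def)
  qed
  then have "(LBINT x. f x * (LBINT y. cos (\<xi> \<bullet> (x - y)) * f y))
    = (LBINT x. (cos (\<xi> \<bullet> x) * f x) * cos_transform f \<xi> + (sin (\<xi> \<bullet> x) * f x) * sin_transform f \<xi>)"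
    by (simp add: algebra_simps)
  also have "\<dots> = (cos_transform f \<xi>)\<^sup>2 + (sin_transform f \<xi>)\<^sup>2"
    using t by (simp add: cos_transform_def sin_transform_def power2_eq_square)
  finally show ?thesis by simp
qed

lemma Fubini_weighted:
  fixes e f :: "'a::euclidean_space \<Rightarrow> real" and h :: "'a \<Rightarrow> 'a \<Rightarrow> real"
  assumes e: "integrable lborel e" and f: "integrable lborel f"
    and hm: "(\<lambda>z. h (fst z) (snd z)) \<in> borel_measurable (borel \<Otimes>\<^sub>M borel)" and hb: "\<And>x y. \<bar>h x y\<bar> \<le> B"
  shows "(LBINT \<xi>. e \<xi> * (LBINT y. f y * h \<xi> y)) = (LBINT y. f y * (LBINT \<xi>. e \<xi> * h \<xi> y))"
proof -
  have [measurable]: "e \<in> borel_measurable borel" "f \<in> borel_measurable borel" using e f by auto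
  note [measurable] = hm
  have ef: "integrable (lborel \<Otimes>\<^sub>M lborel) (\<lambda>(\<xi>, y). B * (e \<xi> * f y))"
  proof (rule lborel_pair.Fubini_integrable)
    show "integrable lborel (\<lambda>x. LBINT y. norm (case (x, y) of (\<xi>, y) \<Rightarrow> B * (e \<xi> * f y)))"
      using e by (simp add: abs_mult mult.assoc)
    show "AE x in lborel. integrable lborel (\<lambda>y. case (x, y) of (\<xi>, y) \<Rightarrow> B * (e \<xi> * f y))"
      using f by simp
  qed measurable
  have int: "integrable (lborel \<Otimes>\<^sub>M lborel) (\<lambda>(\<xi>, y). e \<xi> * (f y * h \<xi> y))"
  proof (rule Bochner_Integration.integrable_bound[OF ef])
    show "(\<lambda>(\<xi>, y). e \<xi> * (f y * h \<xi> y)) \<in> borel_measurable (lborel \<Otimes>\<^sub>M lborel)"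
      by (simp add: split_beta') measurable
    have "\<bar>e \<xi> * (f y * h \<xi> y)\<bar> \<le> \<bar>B * (e \<xi> * f y)\<bar>" for \<xi> y
    proof -
      have "\<bar>e \<xi> * f y\<bar> * \<bar>h \<xi> y\<bar> \<le> \<bar>e \<xi> * f y\<bar> * \<bar>B\<bar>" using hb[of \<xi> y] by (intro mult_left_mono) auto
      then show ?thesis by (simp add: abs_mult mult_ac)
    qed
    then show "AE z in lborel \<Otimes>\<^sub>M lborel. norm (case z of (\<xi>, y) \<Rightarrow> e \<xi> * (f y * h \<xi> y)) \<le> norm (case z of (\<xi>, y) \<Rightarrow> B * (e \<xi> * f y))"
      by auto
  qed
  have "(LBINT \<xi>. e \<xi> * (LBINT y. f y * h \<xi> y)) = (LBINT \<xi>. LBINT y. e \<xi> * (f y * h \<xi> y))" by simp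
  also have "\<dots> = (LBINT y. LBINT \<xi>. e \<xi> * (f y * h \<xi> y))"
    using lborel_pair.Fubini_integral[OF int] by simp
  also have "\<dots> = (LBINT y. f y * (LBINT \<xi>. e \<xi> * h \<xi> y))"
    by (simp add: mult.left_commute[of "e _"])
  finally show ?thesis .
qed

text \<open>Plancherel's identity with a Gaussian weight; letting the weight tend to 1 turns the right-hand
  side into the \<open>L\<^sup>2\<close> norm because \<open>gauss_scaled\<close> is an approximate identity.\<close>

lemma Plancherel_gauss:
  fixes f :: "'a::euclidean_space \<Rightarrow> real"
  assumes f: "integrable lborel f" and s: "s > 0"
  shows "(LBINT \<xi>. exp (- (s\<^sup>2 * (\<xi> \<bullet> \<xi>)) / 2) * ((cos_transform f \<xi>)\<^sup>2 + (sin_transform f \<xi>)\<^sup>2))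
     = (2 * pi) ^ DIM('a) * (LBINT x. f x * conv (gauss_scaled s) f x)"
proof -
  have [measurable]: "f \<in> borel_measurable borel" using f by auto
  let ?e = "\<lambda>\<xi>::'a. exp (- (s\<^sup>2 * (\<xi> \<bullet> \<xi>)) / 2)"
  note e = gauss_scaled_fourier(2)[OF s, where 'a='a]
  let ?B = "LBINT y. \<bar>f y\<bar>"
  have in1: "integrable lborel (\<lambda>y. cos (\<xi> \<bullet> (x - y)) * f y)" for \<xi> x :: 'a
    by (rule Bochner_Integration.integrable_bound[OF f]) (auto simp: abs_mult mult_left_le_one_le)
  have hb: "\<bar>LBINT y. cos (\<xi> \<bullet> (x - y)) * f y\<bar> \<le> ?B" for \<xi> x :: 'a
  proof -
    have "\<bar>LBINT y. cos (\<xi> \<bullet> (x - y)) * f y\<bar> \<le> (LBINT y. \<bar>cos (\<xi> \<bullet> (x - y)) * f y\<bar>)" by (rule integral_abs_bound)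
    also have "\<dots> \<le> ?B" using in1 f by (intro integral_mono integrable_abs) (auto simp: abs_mult mult_left_le_one_le)
    finally show ?thesis .
  qed
  have hm: "(\<lambda>z::'a\<times>'a. LBINT y. cos (fst z \<bullet> (snd z - y)) * f y) \<in> borel_measurable (borel \<Otimes>\<^sub>M borel)"
    by measurable
  have "(LBINT \<xi>. ?e \<xi> * ((cos_transform f \<xi>)\<^sup>2 + (sin_transform f \<xi>)\<^sup>2))
    = (LBINT \<xi>. ?e \<xi> * (LBINT x. f x * (LBINT y. cos (\<xi> \<bullet> (x - y)) * f y)))"
    by (simp only: trig_transform_sq[OF f])
  also have "\<dots> = (LBINT x. f x * (LBINT \<xi>. ?e \<xi> * (LBINT y. cos (\<xi> \<bullet> (x - y)) * f y)))"
    by (rule Fubini_weighted[OF e f hm hb])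
  also have "\<dots> = (LBINT x. f x * ((2 * pi) ^ DIM('a) * conv (gauss_scaled s) f x))"
  proof -
    have "(LBINT \<xi>. ?e \<xi> * (LBINT y. cos (\<xi> \<bullet> (x - y)) * f y)) = (2 * pi) ^ DIM('a) * conv (gauss_scaled s) f x" for x
    proof -
      have "(LBINT \<xi>. ?e \<xi> * (LBINT y. cos (\<xi> \<bullet> (x - y)) * f y)) = (LBINT \<xi>. ?e \<xi> * (LBINT y. f y * cos (\<xi> \<bullet> (x - y))))"
        by (simp only: mult.commute)
      also have "\<dots> = (LBINT y. f y * (LBINT \<xi>. ?e \<xi> * cos (\<xi> \<bullet> (x - y))))"
        by (rule Fubini_weighted[OF e f, where B=1]) auto
      also have "\<dots> = (LBINT y. f y * ((2 * pi) ^ DIM('a) * gauss_scaled s (x - y)))"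
        by (simp only: mult.commute[of "?e _"] gauss_scaled_fourier(1)[OF s])
      also have "\<dots> = (LBINT y. (2 * pi) ^ DIM('a) * (gauss_scaled s (x - y) * f y))"
        by (simp only: mult_ac)
      finally show ?thesis by (simp add: conv_def)
    qed
    then show ?thesis by simp
  qed
  also have "\<dots> = (2 * pi) ^ DIM('a) * (LBINT x. f x * conv (gauss_scaled s) f x)"
    by (simp add: mult.left_commute[of "f _"])
  finally show ?thesis .
qed

text \<open>With values in \<open>ennreal\<close> the identity also states that the transform is
  square integrable. The Gaussian weights increase to 1, so the left-hand sides converge by monotone
  convergence with no prior knowledge of it.\<close>

theorem Plancherel:
  fixes f :: "'a::euclidean_space \<Rightarrow> real"
  assumes f: "integrable lborel f" and f2: "in_L2 f"
  shows "(\<integral>\<^sup>+\<xi>. ennreal ((cos_transform f \<xi>)\<^sup>2 + (sin_transform f \<xi>)\<^sup>2) \<partial>lborel) = ennreal ((2 * pi) ^ DIM('a) * sq f)"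
proof -
  have [measurable]: "f \<in> borel_measurable borel" using f by auto
  let ?s = "\<lambda>n. 1 / (1 + real n)"
  let ?g = "\<lambda>\<xi>. (cos_transform f \<xi>)\<^sup>2 + (sin_transform f \<xi>)\<^sup>2"
  let ?e = "\<lambda>n \<xi>::'a. exp (- ((?s n)\<^sup>2 * (\<xi> \<bullet> \<xi>)) / 2)"
  let ?B = "LBINT y. \<bar>f y\<bar>"
  have ci: "integrable lborel (\<lambda>y. gauss_scaled (?s n) (x - y) * f y)" for n x
  proof -
    have gb: "\<bar>gauss_scaled (?s n) z\<bar> \<le> 1 / sqrt (2 * pi) ^ DIM('a) / (?s n) ^ DIM('a)" for z :: 'a
      by (rule gauss_scaled_bound) simp
    have "\<bar>gauss_scaled (?s n) (x - y) * f y\<bar> \<le> \<bar>1 / sqrt (2 * pi) ^ DIM('a) / (?s n) ^ DIM('a) * f y\<bar>" for y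
      unfolding abs_mult by (intro mult_right_mono order_trans[OF gb abs_ge_self]) simp
    then show ?thesis
      by (intro Bochner_Integration.integrable_bound[OF integrable_mult_right[OF f, of "1 / sqrt (2 * pi) ^ DIM('a) / (?s n) ^ DIM('a)"]] AE_I2)
         (simp_all only: real_norm_def, measurable)
  qed
  have gb: "?g \<xi> \<le> ?B\<^sup>2 + ?B\<^sup>2" for \<xi>
  proof (rule add_mono)
    show "(cos_transform f \<xi>)\<^sup>2 \<le> ?B\<^sup>2" "(sin_transform f \<xi>)\<^sup>2 \<le> ?B\<^sup>2"
      using abs_trig_transform_le[OF f, of \<xi>] by (simp_all flip: abs_le_square_iff)
  qed
  have ei: "integrable lborel (\<lambda>\<xi>. ?e n \<xi> * ?g \<xi>)" for n
  proof (rule Bochner_Integration.integrable_bound)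
    show "integrable lborel (\<lambda>\<xi>. ?e n \<xi> * (?B\<^sup>2 + ?B\<^sup>2))" by (intro integrable_mult_left gauss_scaled_fourier(2)) simp
    show "AE \<xi> in lborel. norm (?e n \<xi> * ?g \<xi>) \<le> norm (?e n \<xi> * (?B\<^sup>2 + ?B\<^sup>2))"
      using gb by (intro AE_I2) (simp add: abs_mult)
  qed simp
  have val: "(\<integral>\<^sup>+\<xi>. ennreal (?e n \<xi> * ?g \<xi>) \<partial>lborel) = ennreal ((2 * pi) ^ DIM('a) * (LBINT x. f x * conv (gauss_scaled (?s n)) f x))" for n
    using ei Plancherel_gauss[OF f, of "?s n"] by (subst nn_integral_eq_integral) auto
  have conv2: "in_L2 (conv (gauss_scaled (?s n)) f)" for n
    using prob_kernel_contraction(1)[OF gauss_scaled_prob f2] by simp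
  have "(\<lambda>n. LBINT x. f x * conv (gauss_scaled (?s n)) f x) \<longlonglongrightarrow> (LBINT x. f x * f x)"
  proof (rule tendsto_L2_inner[OF f2 f2 conv2 f2])
    show "(\<lambda>n. sq (\<lambda>x. conv (gauss_scaled (?s n)) f x - f x)) \<longlonglongrightarrow> 0"
      by (rule approx_identity_L2[OF gauss_approx_identity ci f2])
  qed (simp add: sq_def)
  then have "(\<lambda>n. ennreal ((2 * pi) ^ DIM('a) * (LBINT x. f x * conv (gauss_scaled (?s n)) f x))) \<longlonglongrightarrow> ennreal ((2 * pi) ^ DIM('a) * sq f)"
    unfolding sq_def power2_eq_square[of "f _"] by (intro tendsto_ennrealI tendsto_intros)
  moreover have "(\<lambda>n. \<integral>\<^sup>+\<xi>. ennreal (?e n \<xi> * ?g \<xi>) \<partial>lborel) \<longlonglongrightarrow> (\<integral>\<^sup>+\<xi>. ennreal (?g \<xi>) \<partial>lborel)"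
  proof (rule nn_integral_LIMSEQ)
    show "incseq (\<lambda>n \<xi>. ennreal (?e n \<xi> * ?g \<xi>))"
    proof (intro incseq_SucI le_funI ennreal_leI mult_right_mono)
      fix n and \<xi> :: 'a
      have "(?s (Suc n))\<^sup>2 \<le> (?s n)\<^sup>2" by (intro power_mono) (auto simp: field_simps)
      then have "(?s (Suc n))\<^sup>2 * (\<xi> \<bullet> \<xi>) \<le> (?s n)\<^sup>2 * (\<xi> \<bullet> \<xi>)" by (rule mult_right_mono) simp
      then show "?e n \<xi> \<le> ?e (Suc n) \<xi>" by simp
    qed simp
    show "(\<lambda>n. ennreal (?e n \<xi> * ?g \<xi>)) \<longlonglongrightarrow> ennreal (?g \<xi>)" for \<xi>
    proof -
      have "(\<lambda>n. ?s n) \<longlonglongrightarrow> 0"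
        using LIMSEQ_inverse_real_of_nat by (simp add: inverse_eq_divide add.commute)
      then have "(\<lambda>n. ?e n \<xi> * ?g \<xi>) \<longlonglongrightarrow> exp (- (0\<^sup>2 * (\<xi> \<bullet> \<xi>)) / 2) * ?g \<xi>" by (intro tendsto_intros) auto
      then show ?thesis by (intro tendsto_ennrealI) simp
    qed
  qed simp
  ultimately show ?thesis unfolding val by (rule LIMSEQ_unique[rotated])
qed

text \<open>For an even kernel the sine integral vanishes, so cosine and sine transforms are
  multiplied by the same real factor and do not mix.\<close>

lemma trig_transform_conv:
  fixes k f :: "'a::euclidean_space \<Rightarrow> real"
  assumes k: "kernel k" and even: "\<And>x. k (- x) = k x" and f: "integrable lborel f"
  shows "cos_transform (conv k f) \<xi> = cos_transform k \<xi> * cos_transform f \<xi>"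
    and "sin_transform (conv k f) \<xi> = cos_transform k \<xi> * sin_transform f \<xi>"
    and "integrable lborel (conv k f)"
proof -
  have ki: "integrable lborel k" using k by (rule kernel_integrable)
  have [measurable]: "k \<in> borel_measurable borel" "f \<in> borel_measurable borel" using kernel_measurable[OF k] f by auto
  have S0: "(LBINT z. sin (\<xi> \<bullet> z) * k z) = 0"
  proof -
    have "(LBINT z. sin (\<xi> \<bullet> z) * k z) = (LBINT z. sin (\<xi> \<bullet> (0 - z)) * k (0 - z))"
      by (rule integral_lborel_shift(2)[symmetric]) simp
    also have "\<dots> = - (LBINT z. sin (\<xi> \<bullet> z) * k z)" by (simp add: even)
    finally show ?thesis by simp
  qed
  have int: "integrable (lborel \<Otimes>\<^sub>M lborel) (\<lambda>(x, y). k (x - y) * f y)"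
  proof (rule integrableI_bounded)
    have "(\<integral>\<^sup>+z. ennreal (norm (case z of (x, y) \<Rightarrow> k (x - y) * f y)) \<partial>(lborel \<Otimes>\<^sub>M lborel))
      = (\<integral>\<^sup>+x. \<integral>\<^sup>+y. ennreal \<bar>k (x - y)\<bar> * ennreal \<bar>f y\<bar> \<partial>lborel \<partial>lborel)"
      by (subst lborel.nn_integral_fst[symmetric]) (simp_all add: abs_mult ennreal_mult)
    also have "\<dots> = (\<integral>\<^sup>+x. ennreal \<bar>k x\<bar> \<partial>lborel) * (\<integral>\<^sup>+x. ennreal \<bar>f x\<bar> \<partial>lborel)"
      by (rule nn_conv_integral) auto
    also have "\<dots> < \<infinity>" using ki f by (simp add: integrable_iff_bounded ennreal_mult_less_top)
    finally show "(\<integral>\<^sup>+z. ennreal (norm (case z of (x, y) \<Rightarrow> k (x - y) * f y)) \<partial>(lborel \<Otimes>\<^sub>M lborel)) < \<infinity>" .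
  qed measurable
  show "integrable lborel (conv k f)"
    using lborel_pair.integrable_fst'[OF int] by (simp add: conv_def[abs_def])
  have swap: "(LBINT x. h x * conv k f x) = (LBINT y. f y * (LBINT z. h (z + y) * k z))"
    if [measurable]: "h \<in> borel_measurable borel" and hb: "\<And>x. \<bar>h x\<bar> \<le> 1" for h :: "'a \<Rightarrow> real"
  proof -
    have i: "integrable (lborel \<Otimes>\<^sub>M lborel) (\<lambda>(x, y). h x * (k (x - y) * f y))"
    proof (rule Bochner_Integration.integrable_bound[OF int])
      show "AE z in lborel \<Otimes>\<^sub>M lborel. norm (case z of (x, y) \<Rightarrow> h x * (k (x - y) * f y)) \<le> norm (case z of (x, y) \<Rightarrow> k (x - y) * f y)"
      proof -
        have "\<bar>h x * a\<bar> \<le> \<bar>a\<bar>" for x a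
          using mult_right_mono[OF hb, of "\<bar>a\<bar>" x] by (simp add: abs_mult)
        then show ?thesis by (intro AE_I2) (simp add: split_beta')
      qed
    qed measurable
    have "(LBINT x. h x * conv k f x) = (LBINT x. LBINT y. h x * (k (x - y) * f y))" by (simp add: conv_def)
    also have "\<dots> = (LBINT y. LBINT x. h x * (k (x - y) * f y))"
      using lborel_pair.Fubini_integral[OF i] by simp
    also have "\<dots> = (LBINT y. f y * (LBINT x. h x * k (x - y)))" by (simp add: mult.commute[of _ "f _"] mult.left_commute[of _ "f _"])
    also have "\<dots> = (LBINT y. f y * (LBINT z. h (z + y) * k z))"
    proof -
      have "(LBINT x. h x * k (x - y)) = (LBINT z. h (z + y) * k z)" for y
        using integral_lborel_shift(1)[of "\<lambda>z. h (z + y) * k z" y] by simp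
      then show ?thesis by simp
    qed
    finally show ?thesis .
  qed
  have c: "(LBINT z. cos (\<xi> \<bullet> (z + y)) * k z) = cos (\<xi> \<bullet> y) * cos_transform k \<xi>"
    and s: "(LBINT z. sin (\<xi> \<bullet> (z + y)) * k z) = sin (\<xi> \<bullet> y) * cos_transform k \<xi>" for y
  proof -
    have "(LBINT z. cos (\<xi> \<bullet> (z + y)) * k z) = (LBINT z. cos (\<xi> \<bullet> y) * (cos (\<xi> \<bullet> z) * k z) - sin (\<xi> \<bullet> y) * (sin (\<xi> \<bullet> z) * k z))"
      by (intro Bochner_Integration.integral_cong refl) (simp add: inner_add_right cos_add algebra_simps)
    then show "(LBINT z. cos (\<xi> \<bullet> (z + y)) * k z) = cos (\<xi> \<bullet> y) * cos_transform k \<xi>"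
      using trig_integrable(3,4)[OF ki] S0 by (simp add: cos_transform_def)
    have "(LBINT z. sin (\<xi> \<bullet> (z + y)) * k z) = (LBINT z. cos (\<xi> \<bullet> y) * (sin (\<xi> \<bullet> z) * k z) + sin (\<xi> \<bullet> y) * (cos (\<xi> \<bullet> z) * k z))"
      by (intro Bochner_Integration.integral_cong refl) (simp add: inner_add_right sin_add algebra_simps)
    then show "(LBINT z. sin (\<xi> \<bullet> (z + y)) * k z) = sin (\<xi> \<bullet> y) * cos_transform k \<xi>"
      using trig_integrable(3,4)[OF ki] S0 by (simp add: cos_transform_def)
  qed
  have "cos_transform (conv k f) \<xi> = (LBINT y. f y * (cos (\<xi> \<bullet> y) * cos_transform k \<xi>))"
    using swap[of "\<lambda>x. cos (\<xi> \<bullet> x)"] unfolding c by (simp add: cos_transform_def)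
  also have "\<dots> = (LBINT y. cos_transform k \<xi> * (cos (\<xi> \<bullet> y) * f y))" by (simp only: mult_ac)
  finally show "cos_transform (conv k f) \<xi> = cos_transform k \<xi> * cos_transform f \<xi>"
    by (simp add: cos_transform_def)
  have "sin_transform (conv k f) \<xi> = (LBINT y. f y * (sin (\<xi> \<bullet> y) * cos_transform k \<xi>))"
    using swap[of "\<lambda>x. sin (\<xi> \<bullet> x)"] unfolding s by (simp add: sin_transform_def)
  also have "\<dots> = (LBINT y. cos_transform k \<xi> * (sin (\<xi> \<bullet> y) * f y))" by (simp only: mult_ac)
  finally show "sin_transform (conv k f) \<xi> = cos_transform k \<xi> * sin_transform f \<xi>"
    by (simp add: sin_transform_def)
qed

section \<open>The \<open>L\<^sup>2\<close> Fourier transform\<close>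

lemma sum_telescope_convergent:
  fixes f :: "nat \<Rightarrow> real"
  assumes "summable (\<lambda>k. f (Suc k) - f k)"
  shows "convergent f"
proof -
  have "convergent (\<lambda>n. \<Sum>k<n. f (Suc k) - f k)" using assms by (simp add: summable_iff_convergent)
  then have "convergent (\<lambda>n. f n - f 0)" by (simp add: sum_lessThan_telescope)
  then show ?thesis by (simp add: convergent_diff_const_right_iff)
qed

text \<open>Either |d_k| \<le> 2^(-k), or 2^k |d_k| > 1 and then |d_k| \<le> 2^k d_k^2; both bounds
  are summable.\<close>

lemma summable_of_weighted_squares:
  fixes d :: "nat \<Rightarrow> real"
  assumes "summable (\<lambda>k. 2 ^ k * (d k)\<^sup>2)"
  shows "summable d"
proof (rule summable_comparison_test)
  have "summable (\<lambda>k. (1/2::real) ^ k)" by (rule summable_geometric) simp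
  then show "summable (\<lambda>k. (1/2) ^ k + 2 ^ k * (d k)\<^sup>2)" using assms by (rule summable_add)
  have "norm (d k) \<le> (1/2) ^ k + 2 ^ k * (d k)\<^sup>2" for k
  proof (cases "\<bar>d k\<bar> \<le> (1/2) ^ k")
    case True
    moreover have "0 \<le> 2 ^ k * (d k)\<^sup>2" by simp
    ultimately show ?thesis unfolding real_norm_def by linarith
  next
    case False
    have "\<bar>d k\<bar> = 2 ^ k * ((1/2) ^ k * \<bar>d k\<bar>)" by (simp add: power_divide)
    also have "\<dots> \<le> 2 ^ k * (\<bar>d k\<bar> * \<bar>d k\<bar>)" using False by (intro mult_left_mono mult_right_mono) auto
    also have "\<dots> = 2 ^ k * (d k)\<^sup>2" by (simp add: power2_eq_square)
    finally show ?thesis by (simp add: add_increasing)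
  qed
  then show "\<exists>N. \<forall>k\<ge>N. norm (d k) \<le> (1/2) ^ k + 2 ^ k * (d k)\<^sup>2" by blast
qed

text \<open>The Riesz-Fischer argument. Squared increments of size 4^(-k) along a subsequence remain
  summable after weighting by 2^k, so the subsequence converges at almost every point; Fatou's lemma
  carries the Cauchy estimate to the limit.\<close>

lemma L2_complete:
  fixes p :: "nat \<Rightarrow> 'a::euclidean_space \<Rightarrow> real"
  assumes p: "\<And>n. in_L2 (p n)" and Cauchy: "\<And>e. e > 0 \<Longrightarrow> \<exists>N. \<forall>m\<ge>N. \<forall>n\<ge>N. sq (\<lambda>x. p m x - p n x) \<le> e"
  obtains q where "in_L2 q" "(\<lambda>n. sq (\<lambda>x. p n x - q x)) \<longlonglongrightarrow> 0"
proof -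
  have pm [measurable]: "p n \<in> borel_measurable borel" for n using p by (rule in_L2_measurable)
  have "\<forall>k. \<exists>N. \<forall>m\<ge>N. \<forall>n\<ge>N. sq (\<lambda>x. p m x - p n x) \<le> (1/4) ^ k" using Cauchy by auto
  then obtain N0 where N0: "\<And>k m n. m \<ge> N0 k \<Longrightarrow> n \<ge> N0 k \<Longrightarrow> sq (\<lambda>x. p m x - p n x) \<le> (1/4) ^ k"
    unfolding choice_iff by blast
  \<comment> \<open>The partial sum makes the subsequence monotone and at least \<open>N0 k\<close>;
    the added k makes it tend to infinity.\<close>
  define r where "r k = k + (\<Sum>i\<le>k. N0 i)" for k
  have r_ge: "N0 k \<le> r k" for k unfolding r_def using member_le_sum[of k "{..k}" N0] by simp
  have r_Suc: "r k \<le> r (Suc k)" for k by (simp add: r_def)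
  have r_id: "k \<le> r k" for k by (simp add: r_def)
  define d where "d k x = p (r (Suc k)) x - p (r k) x" for k x
  have [measurable]: "d k \<in> borel_measurable borel" for k unfolding d_def[abs_def] by measurable
  have dL: "in_L2 (d k)" for k unfolding d_def[abs_def] by (intro in_L2_diff p)
  have dsq: "sq (d k) \<le> (1/4) ^ k" for k
    unfolding d_def[abs_def] using r_ge[of k] r_Suc[of k] by (intro N0) auto
  have "(\<integral>\<^sup>+x. (\<Sum>k. ennreal (2 ^ k * (d k x)\<^sup>2)) \<partial>lborel) = (\<Sum>k. \<integral>\<^sup>+x. ennreal (2 ^ k * (d k x)\<^sup>2) \<partial>lborel)"
    by (rule nn_integral_suminf) measurable
  also have "\<dots> \<le> (\<Sum>k. ennreal ((1/2) ^ k))"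
  proof (intro suminf_le summableI)
    fix k
    have "(\<integral>\<^sup>+x. ennreal (2 ^ k * (d k x)\<^sup>2) \<partial>lborel) = ennreal (2 ^ k * sq (d k))"
      using in_L2_integrable[OF dL] by (subst nn_integral_eq_integral) (auto simp: sq_def)
    also have "\<dots> \<le> ennreal (2 ^ k * (1/4) ^ k)" using dsq by (intro ennreal_leI mult_left_mono) auto
    also have "2 ^ k * (1/4) ^ k = (1/2::real) ^ k" by (simp add: power_mult_distrib[symmetric])
    finally show "(\<integral>\<^sup>+x. ennreal (2 ^ k * (d k x)\<^sup>2) \<partial>lborel) \<le> ennreal ((1/2) ^ k)" .
  qed
  also have "\<dots> = ennreal (\<Sum>k. (1/2) ^ k)" by (intro suminf_ennreal2 summable_geometric) auto
  also have "\<dots> < \<infinity>" by simp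
  finally have fin: "(\<integral>\<^sup>+x. (\<Sum>k. ennreal (2 ^ k * (d k x)\<^sup>2)) \<partial>lborel) \<noteq> \<infinity>" by simp
  have "AE x in lborel. (\<Sum>k. ennreal (2 ^ k * (d k x)\<^sup>2)) \<noteq> \<infinity>"
    by (rule nn_integral_PInf_AE[OF _ fin]) measurable
  then have conv: "AE x in lborel. convergent (\<lambda>k. p (r k) x)"
  proof eventually_elim
    case (elim x)
    have "summable (\<lambda>k. 2 ^ k * (d k x)\<^sup>2)" using elim by (intro summable_suminf_not_top) auto
    then have "summable (\<lambda>k. d k x)" by (rule summable_of_weighted_squares)
    then show ?case unfolding d_def by (rule sum_telescope_convergent)
  qed
  define q where "q x = lim (\<lambda>k. p (r k) x)" for x
  have [measurable]: "q \<in> borel_measurable borel" unfolding q_def[abs_def] by measurable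
  have qlim: "AE x in lborel. (\<lambda>k. p (r k) x) \<longlonglongrightarrow> q x"
    using conv by eventually_elim (simp add: q_def convergent_LIMSEQ_iff)
  have fatou: "L2_sqnorm (\<lambda>x. p n x - q x) \<le> ennreal e"
    if n: "\<And>m n. m \<ge> N \<Longrightarrow> n \<ge> N \<Longrightarrow> sq (\<lambda>x. p m x - p n x) \<le> e" "n \<ge> N" for n N e
  proof -
    have "L2_sqnorm (\<lambda>x. p n x - q x) = (\<integral>\<^sup>+x. liminf (\<lambda>k. ennreal ((p n x - p (r k) x)\<^sup>2)) \<partial>lborel)"
      unfolding L2_sqnorm_real
    proof (rule nn_integral_cong_AE)
      show "AE x in lborel. ennreal ((p n x - q x)\<^sup>2) = liminf (\<lambda>k. ennreal ((p n x - p (r k) x)\<^sup>2))"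
        using qlim
      proof eventually_elim
        case (elim x)
        have "(\<lambda>k. ennreal ((p n x - p (r k) x)\<^sup>2)) \<longlonglongrightarrow> ennreal ((p n x - q x)\<^sup>2)"
          by (intro tendsto_ennrealI tendsto_intros elim)
        then show ?case by (rule lim_imp_Liminf[OF trivial_limit_sequentially, symmetric])
      qed
    qed
    also have "\<dots> \<le> liminf (\<lambda>k. \<integral>\<^sup>+x. ennreal ((p n x - p (r k) x)\<^sup>2) \<partial>lborel)"
      by (rule nn_integral_liminf) measurable
    also have "\<dots> \<le> ennreal e"
    proof (rule Liminf_le, simp)
      show "\<forall>\<^sub>F k in sequentially. (\<integral>\<^sup>+x. ennreal ((p n x - p (r k) x)\<^sup>2) \<partial>lborel) \<le> ennreal e"
      proof (rule eventually_sequentiallyI[of N])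
        fix k assume "N \<le> k"
        then have "N \<le> r k" using r_id[of k] by simp
        then have "sq (\<lambda>x. p n x - p (r k) x) \<le> e" using n by blast
        then show "(\<integral>\<^sup>+x. ennreal ((p n x - p (r k) x)\<^sup>2) \<partial>lborel) \<le> ennreal e"
          using L2_sqnorm_eq_sq[OF in_L2_diff[OF p[of n] p[of "r k"]]] by (simp add: L2_sqnorm_real ennreal_leI)
      qed
    qed
    finally show ?thesis .
  qed
  have diff2: "in_L2 (\<lambda>x. p n x - q x)" "sq (\<lambda>x. p n x - q x) \<le> e"
    if n: "\<And>m n. m \<ge> N \<Longrightarrow> n \<ge> N \<Longrightarrow> sq (\<lambda>x. p m x - p n x) \<le> e" "n \<ge> N" "e \<ge> 0" for n N e
    using in_L2I_bound[OF _ fatou[OF n(1,2)] n(3)] by simp_all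
  have "in_L2 q"
  proof -
    obtain N where N: "\<And>m n. m \<ge> N \<Longrightarrow> n \<ge> N \<Longrightarrow> sq (\<lambda>x. p m x - p n x) \<le> 1" using Cauchy[of 1] by auto
    have "in_L2 (\<lambda>x. p N x - q x)" by (rule diff2(1)[OF N order_refl zero_le_one])
    from in_L2_diff[OF p[of N] this] show ?thesis by simp
  qed
  moreover have "(\<lambda>n. sq (\<lambda>x. p n x - q x)) \<longlonglongrightarrow> 0"
  proof (rule LIMSEQ_I)
    fix e :: real assume e: "e > 0"
    obtain N where N: "\<And>m n. m \<ge> N \<Longrightarrow> n \<ge> N \<Longrightarrow> sq (\<lambda>x. p m x - p n x) \<le> e / 2" using Cauchy[of "e / 2"] e by auto
    have "norm (sq (\<lambda>x. p n x - q x) - 0) < e" if "n \<ge> N" for n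
      using diff2(2)[OF N that] e by simp
    then show "\<exists>N. \<forall>n\<ge>N. norm (sq (\<lambda>x. p n x - q x) - 0) < e" by blast
  qed
  ultimately show ?thesis using that by blast
qed

section \<open>Truncation to balls\<close>

definition truncate :: "real \<Rightarrow> ('a::euclidean_space \<Rightarrow> real) \<Rightarrow> 'a \<Rightarrow> real" where
  "truncate R f x = indicator (cball 0 R) x * f x"

lemma truncate_measurable [measurable]: "f \<in> borel_measurable borel \<Longrightarrow> truncate R f \<in> borel_measurable borel"
  unfolding truncate_def[abs_def]
  by (intro borel_measurable_times borel_measurable_indicator) auto

lemma truncate_L2:
  fixes f :: "'a::euclidean_space \<Rightarrow> real"
  assumes f: "in_L2 f" shows "in_L2 (truncate R f)"
proof -
  have [measurable]: "f \<in> borel_measurable borel" using f by (rule in_L2_measurable)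
  have "integrable lborel (\<lambda>x. (truncate R f x)\<^sup>2)"
    by (rule Bochner_Integration.integrable_bound[OF in_L2_integrable[OF f]]) (auto simp: truncate_def indicator_def)
  then show ?thesis by (simp add: in_L2_iff)
qed

lemma truncate_integrable:
  fixes f :: "'a::euclidean_space \<Rightarrow> real"
  assumes f: "in_L2 f" shows "integrable lborel (truncate R f)"
proof -
  have "in_L2 (indicator (cball 0 R) :: 'a \<Rightarrow> real)"
  proof -
    have "(\<lambda>x. (indicator (cball 0 R) x :: real)\<^sup>2) = (indicator (cball (0::'a) R) :: 'a \<Rightarrow> real)"
      by (auto simp: indicator_def)
    moreover have "integrable lborel (indicator (cball 0 R) :: 'a \<Rightarrow> real)"
      by (intro integrable_real_indicator emeasure_bounded_finite) auto
    ultimately show ?thesis by (simp add: in_L2_iff borel_measurable_integrable[of lborel, simplified])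
  qed
  from in_L2_mult_integrable[OF this f] show ?thesis unfolding truncate_def[abs_def] .
qed

lemma sq_truncate_mono:
  fixes f :: "'a::euclidean_space \<Rightarrow> real"
  assumes f: "in_L2 f" and "N \<le> R" "N \<le> S"
  shows "sq (\<lambda>x. truncate R f x - truncate S f x) \<le> sq (\<lambda>x. truncate N f x - f x)"
  unfolding sq_def
proof (rule integral_mono)
  show "integrable lborel (\<lambda>x. (truncate R f x - truncate S f x)\<^sup>2)"
    "integrable lborel (\<lambda>x. (truncate N f x - f x)\<^sup>2)"
    by (intro in_L2_integrable in_L2_diff truncate_L2 f)+
  show "(truncate R f x - truncate S f x)\<^sup>2 \<le> (truncate N f x - f x)\<^sup>2" for x
    using assms(2,3) by (auto simp: truncate_def indicator_def)
qed

lemma truncate_tendsto: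
  fixes f :: "'a::euclidean_space \<Rightarrow> real"
  assumes f: "in_L2 f"
  shows "(\<lambda>n. sq (\<lambda>x. truncate (real n) f x - f x)) \<longlonglongrightarrow> 0"
proof -
  have [measurable]: "f \<in> borel_measurable borel" using f by (rule in_L2_measurable)
  have "(\<lambda>n. LBINT x. (truncate (real n) f x - f x)\<^sup>2) \<longlonglongrightarrow> (LBINT x::'a. (0::real))"
  proof (rule integral_dominated_convergence[where w="\<lambda>x. (f x)\<^sup>2"])
    show "AE x in lborel. (\<lambda>n. (truncate (real n) f x - f x)\<^sup>2) \<longlonglongrightarrow> 0"
    proof (intro AE_I2 tendsto_eventually)
      fix x :: 'a
      obtain N where "norm x < real N" using reals_Archimedean2 by blast
      then show "\<forall>\<^sub>F n in sequentially. (truncate (real n) f x - f x)\<^sup>2 = 0"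
        by (intro eventually_sequentiallyI[of N]) (simp add: truncate_def)
    qed
    show "AE x in lborel. norm ((truncate (real n) f x - f x)\<^sup>2) \<le> (f x)\<^sup>2" for n
      by (auto simp: truncate_def indicator_def)
  qed (use in_L2_integrable[OF f] in auto)
  then show ?thesis by (simp add: sq_def)
qed

lemma trig_transform_L2:
  fixes f :: "'a::euclidean_space \<Rightarrow> real"
  assumes f: "integrable lborel f" "in_L2 f"
  shows "in_L2 (cos_transform f)" "sq (cos_transform f) \<le> (2 * pi) ^ DIM('a) * sq f"
    "in_L2 (sin_transform f)" "sq (sin_transform f) \<le> (2 * pi) ^ DIM('a) * sq f"
proof -
  have [measurable]: "f \<in> borel_measurable borel" using f by auto
  have nn: "0 \<le> (2 * pi) ^ DIM('a) * sq f" by simp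
  have c: "L2_sqnorm (cos_transform f) \<le> ennreal ((2 * pi) ^ DIM('a) * sq f)"
    unfolding Plancherel[OF f, symmetric] L2_sqnorm_real by (intro nn_integral_mono ennreal_leI) simp
  have s: "L2_sqnorm (sin_transform f) \<le> ennreal ((2 * pi) ^ DIM('a) * sq f)"
    unfolding Plancherel[OF f, symmetric] L2_sqnorm_real by (intro nn_integral_mono ennreal_leI) simp
  show "in_L2 (cos_transform f)" "sq (cos_transform f) \<le> (2 * pi) ^ DIM('a) * sq f"
    by (rule in_L2I_bound[OF _ c nn], simp)+
  show "in_L2 (sin_transform f)" "sq (sin_transform f) \<le> (2 * pi) ^ DIM('a) * sq f"
    by (rule in_L2I_bound[OF _ s nn], simp)+
qed

text \<open>Completeness gives a limit along integer radii, whereas the L2 Fourier transform is a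
  limit over real radii. The tail of f beyond n bounds the difference of any two transforms with
  radii at least n, which bridges the two.\<close>

lemma L2_limit_at_top:
  fixes T :: "real \<Rightarrow> 'a::euclidean_space \<Rightarrow> real" and f :: "'a \<Rightarrow> real"
  assumes T: "\<And>R. in_L2 (T R)" and f: "in_L2 f" and K: "K \<ge> 0"
    and le: "\<And>R S. sq (\<lambda>x. T R x - T S x) \<le> K * sq (\<lambda>x. truncate R f x - truncate S f x)"
  obtains q where "in_L2 q" "((\<lambda>R. sq (\<lambda>x. T R x - q x)) \<longlongrightarrow> 0) at_top"
proof -
  let ?t = "\<lambda>n. sq (\<lambda>x. truncate (real n) f x - f x)"
  have le': "sq (\<lambda>x. T R x - T S x) \<le> K * ?t n" if "real n \<le> R" "real n \<le> S" for R S n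
    by (rule order_trans[OF le mult_left_mono[OF sq_truncate_mono[OF f that] K]])
  have tail: "(\<lambda>n. K * ?t n) \<longlonglongrightarrow> 0" by (rule tendsto_mult_right_zero[OF truncate_tendsto[OF f]])
  have tailE: "\<exists>n. K * ?t n \<le> e" if "e > 0" for e
    using LIMSEQ_D[OF tail that] by (metis abs_le_iff diff_zero le_refl less_imp_le real_norm_def)
  obtain q where q: "in_L2 q" "(\<lambda>n. sq (\<lambda>x. T (real n) x - q x)) \<longlonglongrightarrow> 0"
  proof (rule L2_complete[of "\<lambda>n. T (real n)"])
    fix e :: real assume "e > 0"
    then obtain N where "K * ?t N \<le> e" using tailE by blast
    then show "\<exists>N. \<forall>m\<ge>N. \<forall>n\<ge>N. sq (\<lambda>x. T (real m) x - T (real n) x) \<le> e"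
      using le'[of N] by (intro exI[of _ N]) (meson of_nat_le_iff order_trans)
  qed (use T in auto)
  have "((\<lambda>R. sq (\<lambda>x. T R x - q x)) \<longlongrightarrow> 0) at_top"
    unfolding tendsto_iff
  proof (intro allI impI)
    fix e :: real assume e: "e > 0"
    obtain n where n: "K * ?t n \<le> e / 8" using tailE[of "e / 8"] e by auto
    obtain N where N: "\<And>m. m \<ge> N \<Longrightarrow> sq (\<lambda>x. T (real m) x - q x) < e / 8"
      using LIMSEQ_D[OF q(2), of "e / 8"] e by auto
    define m where "m = max n N"
    have "dist (sq (\<lambda>x. T R x - q x)) 0 < e" if R: "real n \<le> R" for R
    proof -
      have "sq (\<lambda>x. (T R x - T (real m) x) + (T (real m) x - q x)) \<le> 2 * sq (\<lambda>x. T R x - T (real m) x) + 2 * sq (\<lambda>x. T (real m) x - q x)"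
        by (intro sq_add_le in_L2_diff T q)
      moreover have "sq (\<lambda>x. T R x - T (real m) x) \<le> e / 8" using le'[OF R, of "real m"] n by (simp add: m_def)
      moreover have "sq (\<lambda>x. T (real m) x - q x) < e / 8" by (rule N) (simp add: m_def)
      ultimately show ?thesis using e by simp
    qed
    then show "\<forall>\<^sub>F R in at_top. dist (sq (\<lambda>x. T R x - q x)) 0 < e"
      unfolding eventually_at_top_linorder by blast
  qed
  with q(1) that show ?thesis by blast
qed

section \<open>Vector-valued transforms in real coordinates\<close>

lemma vec_lambda_eq_sum_axis:
  fixes h :: "'n::finite \<Rightarrow> complex"
  shows "(\<chi> j. h j) = (\<Sum>j\<in>UNIV. axis j (h j))"
  by (simp add: vec_eq_iff axis_def)

lemma bounded_linear_axis: "bounded_linear (axis j :: complex \<Rightarrow> complex^'n)"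
proof (rule bounded_linear_intro[where K=1])
  fix x :: complex
  have "norm (axis j x) = sqrt (\<Sum>i\<in>UNIV. if i = j then (norm x)\<^sup>2 else 0)"
    unfolding norm_vec_def L2_set_def axis_def by (intro arg_cong[where f=sqrt] sum.cong) auto
  then show "norm (axis j x) \<le> norm x * 1" by simp
qed (auto simp: vec_eq_iff axis_def)

text \<open>The minus sign before the sine transform is that of the phase
  \<open>cis (- (\<xi> \<bullet> x))\<close>. Truncated L2 functions are integrable, so the set
  integral really is a Fourier integral and not a default value.\<close>

lemma truncated_fourier_eq:
  fixes f :: "real^'n \<Rightarrow> real^'m"
  assumes f: "\<And>j. in_L2 (\<lambda>x. f x $ j)"
  shows "truncated_fourier R f \<xi> = (\<chi> j. Complex (cos_transform (truncate R (\<lambda>x. f x $ j)) \<xi>) (- sin_transform (truncate R (\<lambda>x. f x $ j)) \<xi>))"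
proof -
  let ?h = "\<lambda>j x. Complex (cos (\<xi> \<bullet> x) * truncate R (\<lambda>x. f x $ j) x) (- (sin (\<xi> \<bullet> x) * truncate R (\<lambda>x. f x $ j) x))"
  have e: "indicator (cball 0 R) x *\<^sub>R (\<chi> j. cis (- (\<xi> \<bullet> x)) * complex_of_real (f x $ j)) = (\<Sum>j\<in>UNIV. axis j (?h j x))" for x
    unfolding vec_lambda_eq_sum_axis[symmetric] by (simp add: vec_eq_iff truncate_def indicator_def complex_eq_iff)
  note ti = trig_integrable(3,4)[OF truncate_integrable[OF f]]
  have hi: "integrable lborel (?h j)" for j
    unfolding Complex_eq using integrable_of_real[OF ti(1)[of \<xi> R j], where 'a=complex] integrable_of_real[OF ti(2)[of \<xi> R j], where 'a=complex]
    by (intro Bochner_Integration.integrable_add integrable_mult_right) simp_all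
  have hv: "(LBINT x. ?h j x) = Complex (cos_transform (truncate R (\<lambda>x. f x $ j)) \<xi>) (- sin_transform (truncate R (\<lambda>x. f x $ j)) \<xi>)" for j
    using integral_Re[OF hi[of j]] integral_Im[OF hi[of j]] by (intro complex_eqI) (simp_all add: cos_transform_def sin_transform_def)
  have "truncated_fourier R f \<xi> = (LBINT x. (\<Sum>j\<in>UNIV. axis j (?h j x)))"
    unfolding truncated_fourier_def set_lebesgue_integral_def e ..
  also have "\<dots> = (\<Sum>j\<in>UNIV. axis j (LBINT x. ?h j x))"
    using hi by (subst Bochner_Integration.integral_sum)
      (auto intro!: integrable_bounded_linear[OF bounded_linear_axis] sum.cong integral_bounded_linear[OF bounded_linear_axis])
  finally show ?thesis unfolding hv vec_lambda_eq_sum_axis[symmetric] .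
qed

lemma norm_complex_vec_sq: "(norm (v :: complex^'m))\<^sup>2 = (\<Sum>j\<in>UNIV. (Re (v $ j))\<^sup>2 + (Im (v $ j))\<^sup>2)"
  by (simp add: norm_vec_def L2_set_def sum_nonneg cmod_power2)

lemma L2_sqnorm_complex_vec:
  fixes c s :: "'m::finite \<Rightarrow> 'a::euclidean_space \<Rightarrow> real"
  assumes c: "\<And>j. in_L2 (c j)" and s: "\<And>j. in_L2 (s j)"
  shows "L2_sqnorm (\<lambda>\<xi>. (\<chi> j. Complex (c j \<xi>) (s j \<xi>)) :: complex^'m) = ennreal (\<Sum>j\<in>UNIV. sq (c j) + sq (s j))"
proof -
  have "L2_sqnorm (\<lambda>\<xi>. (\<chi> j. Complex (c j \<xi>) (s j \<xi>)) :: complex^'m) = (\<integral>\<^sup>+\<xi>. ennreal (\<Sum>j\<in>UNIV. (c j \<xi>)\<^sup>2 + (s j \<xi>)\<^sup>2) \<partial>lborel)"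
    by (simp add: L2_sqnorm_def norm_complex_vec_sq)
  also have "\<dots> = ennreal (LBINT \<xi>. (\<Sum>j\<in>UNIV. (c j \<xi>)\<^sup>2 + (s j \<xi>)\<^sup>2))"
    by (intro nn_integral_eq_integral Bochner_Integration.integrable_sum Bochner_Integration.integrable_add in_L2_integrable c s) (auto intro!: sum_nonneg)
  also have "(LBINT \<xi>. (\<Sum>j\<in>UNIV. (c j \<xi>)\<^sup>2 + (s j \<xi>)\<^sup>2)) = (\<Sum>j\<in>UNIV. sq (c j) + sq (s j))"
    using c s by (simp add: sq_def in_L2_integrable)
  finally show ?thesis .
qed

lemma sq_minus: "sq (\<lambda>x. - f x) = sq f" by (simp add: sq_def)

lemma complex_vec_measurable:
  fixes c s :: "'m::finite \<Rightarrow> 'a::euclidean_space \<Rightarrow> real"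
  assumes [measurable]: "\<And>j. c j \<in> borel_measurable borel" "\<And>j. s j \<in> borel_measurable borel"
  shows "(\<lambda>\<xi>. (\<chi> j. Complex (c j \<xi>) (s j \<xi>)) :: complex^'m) \<in> borel_measurable borel"
proof -
  have "(\<lambda>\<xi>. axis j (Complex (c j \<xi>) (s j \<xi>)) :: complex^'m) \<in> borel_measurable borel" for j
    unfolding Complex_eq
    by (rule measurable_compose[OF _ borel_measurable_continuous_onI[OF linear_continuous_on[OF bounded_linear_axis]]]) measurable
  then show ?thesis unfolding vec_lambda_eq_sum_axis by simp
qed

text \<open>\<open>L2_fourier\<close> is a choice by \<open>SOME\<close>; existence is what gives
  the chosen function its defining property. By Plancherel's bound, the transforms of the
  truncations inherit the Cauchy property of the truncations themselves.\<close>

lemma is_L2_fourier_exists: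
  fixes f :: "real^'n \<Rightarrow> real^'m"
  assumes f: "\<And>j. in_L2 (\<lambda>x. f x $ j)"
  shows "\<exists>g. is_L2_fourier f g"
proof -
  let ?C = "\<lambda>j R. cos_transform (truncate R (\<lambda>x. f x $ j))" and ?S = "\<lambda>j R. sin_transform (truncate R (\<lambda>x. f x $ j))"
  let ?K = "(2 * pi) ^ CARD('n)"
  note ti = truncate_integrable[OF f] and t2 = truncate_L2[OF f]
  have C2: "in_L2 (?C j R)" and S2: "in_L2 (?S j R)" for j R using trig_transform_L2[OF ti t2] by auto
  have le: "sq (\<lambda>x. ?C j R x - ?C j S x) \<le> ?K * sq (\<lambda>x. truncate R (\<lambda>x. f x $ j) x - truncate S (\<lambda>x. f x $ j) x)"
    "sq (\<lambda>x. ?S j R x - ?S j S x) \<le> ?K * sq (\<lambda>x. truncate R (\<lambda>x. f x $ j) x - truncate S (\<lambda>x. f x $ j) x)" for j R S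
  proof -
    let ?h = "\<lambda>x. truncate R (\<lambda>x. f x $ j) x - truncate S (\<lambda>x. f x $ j) x"
    have h: "integrable lborel ?h" "in_L2 ?h" by (intro Bochner_Integration.integrable_diff in_L2_diff ti t2)+
    have "cos_transform ?h = (\<lambda>x. ?C j R x - ?C j S x)" "sin_transform ?h = (\<lambda>x. ?S j R x - ?S j S x)"
      by (intro ext trig_transform_diff ti)+
    then show "sq (\<lambda>x. ?C j R x - ?C j S x) \<le> ?K * sq ?h" "sq (\<lambda>x. ?S j R x - ?S j S x) \<le> ?K * sq ?h"
      using trig_transform_L2(2,4)[OF h] by simp_all
  qed
  have "\<forall>j. \<exists>q. in_L2 q \<and> ((\<lambda>R. sq (\<lambda>x. ?C j R x - q x)) \<longlongrightarrow> 0) at_top"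
    by (rule allI, rule L2_limit_at_top[OF C2 f _ le(1)]) auto
  from choice[OF this] obtain c where c: "\<And>j. in_L2 (c j)" "\<And>j. ((\<lambda>R. sq (\<lambda>x. ?C j R x - c j x)) \<longlongrightarrow> 0) at_top" by blast
  have "\<forall>j. \<exists>q. in_L2 q \<and> ((\<lambda>R. sq (\<lambda>x. ?S j R x - q x)) \<longlongrightarrow> 0) at_top"
    by (rule allI, rule L2_limit_at_top[OF S2 f _ le(2)]) auto
  from choice[OF this] obtain s where s: "\<And>j. in_L2 (s j)" "\<And>j. ((\<lambda>R. sq (\<lambda>x. ?S j R x - s j x)) \<longlongrightarrow> 0) at_top" by blast
  define g where "g \<xi> = (\<chi> j. Complex (c j \<xi>) (- s j \<xi>))" for \<xi> :: "real^'n"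
  have "is_L2_fourier f g"
    unfolding is_L2_fourier_def in_L2_def
  proof (intro conjI)
    have [measurable]: "c j \<in> borel_measurable borel" "s j \<in> borel_measurable borel" for j using c s in_L2_measurable by auto
    show "g \<in> borel_measurable lborel"
      unfolding g_def[abs_def] by (simp, rule complex_vec_measurable) measurable
    show "L2_sqnorm g < \<infinity>"
      unfolding g_def[abs_def] L2_sqnorm_complex_vec[OF c(1) in_L2_uminus[OF s(1)]] by simp
    have "L2_sqnorm (\<lambda>\<xi>. truncated_fourier R f \<xi> - g \<xi>) = ennreal (\<Sum>j\<in>UNIV. sq (\<lambda>x. ?C j R x - c j x) + sq (\<lambda>x. ?S j R x - s j x))" for R
    proof -
      have tg: "truncated_fourier R f \<xi> - g \<xi> = (\<chi> j. Complex (?C j R \<xi> - c j \<xi>) (- (?S j R \<xi> - s j \<xi>)))" for \<xi>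
        unfolding truncated_fourier_eq[OF f] g_def by (simp add: vec_eq_iff complex_eq_iff)
      show ?thesis
        unfolding tg
        using L2_sqnorm_complex_vec[of "\<lambda>j \<xi>. ?C j R \<xi> - c j \<xi>" "\<lambda>j \<xi>. - (?S j R \<xi> - s j \<xi>)",
            OF in_L2_diff[OF C2 c(1)] in_L2_uminus[OF in_L2_diff[OF S2 s(1)]]]
        by (simp only: sq_minus)
    qed
    moreover have "((\<lambda>R. ennreal (\<Sum>j\<in>UNIV. sq (\<lambda>x. ?C j R x - c j x) + sq (\<lambda>x. ?S j R x - s j x))) \<longlongrightarrow> ennreal (\<Sum>j\<in>(UNIV::'m set). 0 + 0)) at_top"
      by (intro tendsto_ennrealI tendsto_intros c s)
    ultimately show "((\<lambda>R. L2_sqnorm (\<lambda>\<xi>. truncated_fourier R f \<xi> - g \<xi>)) \<longlongrightarrow> 0) at_top" by simp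
  qed
  then show ?thesis by blast
qed

section \<open>Low frequencies and the decay character\<close>

lemma conv_diff: "conv_ok f \<Longrightarrow> conv_ok g \<Longrightarrow> kernel k \<Longrightarrow> conv k (\<lambda>x. f x - g x) x = conv k f x - conv k g x"
  by (simp add: conv_def right_diff_distrib conv_okD)

text \<open>Plancherel for the truncated functions, with |t|^2 \<le> 2 |g|^2 + 2 |t - g|^2 to pass
  from their transforms t to the L2 transform g. The factor 2 is harmless here and spares an
  identity for g.\<close>

lemma conv_sq_fourier_le:
  fixes f :: "real^'n \<Rightarrow> real^'m"
  assumes f: "\<And>j. in_L2 (\<lambda>x. f x $ j)" and g: "is_L2_fourier f g"
    and k: "kernel k" "\<And>x. k (- x) = k x" "prob_kernel k" and k1: "\<And>\<xi>. (cos_transform k \<xi>)\<^sup>2 \<le> 1"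
  shows "ennreal ((2 * pi) ^ CARD('n) * (\<Sum>j\<in>UNIV. sq (conv k (\<lambda>x. f x $ j))))
    \<le> 2 * (\<integral>\<^sup>+\<xi>. ennreal ((cos_transform k \<xi>)\<^sup>2) * ennreal ((norm (g \<xi>))\<^sup>2) \<partial>lborel)"
proof -
  let ?k = "cos_transform k"
  let ?T = "\<lambda>n j. truncate (real n) (\<lambda>x. f x $ j)"
  let ?t = "\<lambda>n. truncated_fourier (real n) f"
  let ?A = "\<integral>\<^sup>+\<xi>. ennreal ((?k \<xi>)\<^sup>2) * ennreal ((norm (g \<xi>))\<^sup>2) \<partial>lborel"
  have [measurable]: "k \<in> borel_measurable borel" using k(1) by (rule kernel_measurable)
  have [measurable]: "g \<in> borel_measurable borel" using g by (simp add: is_L2_fourier_def in_L2_def)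
  have [measurable]: "(\<lambda>x. f x $ j) \<in> borel_measurable borel" for j using f by (rule in_L2_measurable)
  have t_eq: "?t n = (\<lambda>\<xi>. (\<chi> j. Complex (cos_transform (?T n j) \<xi>) (- sin_transform (?T n j) \<xi>)))" for n
    by (rule ext, rule truncated_fourier_eq[OF f])
  have t_meas [measurable]: "?t n \<in> borel_measurable borel" for n
    unfolding t_eq by (rule complex_vec_measurable) measurable
  have T: "integrable lborel (?T n j)" "in_L2 (?T n j)" for n j
    by (intro truncate_integrable truncate_L2 f)+
  have conv2: "in_L2 (conv k h)" "sq (conv k h) \<le> sq h" if "in_L2 h" for h
    using prob_kernel_contraction(1,2)[OF k(3) that] .
  have le: "ennreal ((2 * pi) ^ CARD('n) * (\<Sum>j\<in>UNIV. sq (conv k (?T n j)))) \<le> 2 * ?A + 2 * L2_sqnorm (\<lambda>\<xi>. ?t n \<xi> - g \<xi>)" for n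
  proof -
    have "ennreal ((2 * pi) ^ CARD('n) * (\<Sum>j\<in>UNIV. sq (conv k (?T n j)))) = (\<Sum>j\<in>UNIV. ennreal ((2 * pi) ^ CARD('n) * sq (conv k (?T n j))))"
      by (simp add: sum_distrib_left)
    also have "\<dots> = (\<Sum>j\<in>UNIV. \<integral>\<^sup>+\<xi>. ennreal ((?k \<xi>)\<^sup>2 * ((cos_transform (?T n j) \<xi>)\<^sup>2 + (sin_transform (?T n j) \<xi>)\<^sup>2)) \<partial>lborel)"
    proof (rule sum.cong[OF refl])
      fix j
      note c = trig_transform_conv[OF k(1,2) T(1)[of n j]]
      show "ennreal ((2 * pi) ^ CARD('n) * sq (conv k (?T n j))) = (\<integral>\<^sup>+\<xi>. ennreal ((?k \<xi>)\<^sup>2 * ((cos_transform (?T n j) \<xi>)\<^sup>2 + (sin_transform (?T n j) \<xi>)\<^sup>2)) \<partial>lborel)"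
        using Plancherel[OF c(3) conv2(1)[OF T(2)]] by (simp add: c(1,2) power_mult_distrib distrib_left)
    qed
    also have "\<dots> = (\<integral>\<^sup>+\<xi>. (\<Sum>j\<in>UNIV. ennreal ((?k \<xi>)\<^sup>2 * ((cos_transform (?T n j) \<xi>)\<^sup>2 + (sin_transform (?T n j) \<xi>)\<^sup>2))) \<partial>lborel)"
      by (rule nn_integral_sum[symmetric]) measurable
    also have "\<dots> = (\<integral>\<^sup>+\<xi>. ennreal ((?k \<xi>)\<^sup>2 * (norm (?t n \<xi>))\<^sup>2) \<partial>lborel)"
      by (simp add: t_eq norm_complex_vec_sq sum_distrib_left)
    also have "\<dots> \<le> (\<integral>\<^sup>+\<xi>. 2 * (ennreal ((?k \<xi>)\<^sup>2) * ennreal ((norm (g \<xi>))\<^sup>2)) + 2 * ennreal ((norm (?t n \<xi> - g \<xi>))\<^sup>2) \<partial>lborel)"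
    proof (rule nn_integral_mono)
      fix \<xi>
      have "norm (?t n \<xi>) \<le> norm (g \<xi>) + norm (?t n \<xi> - g \<xi>)" using norm_triangle_ineq[of "g \<xi>" "?t n \<xi> - g \<xi>"] by simp
      then have "(norm (?t n \<xi>))\<^sup>2 \<le> (norm (g \<xi>) + norm (?t n \<xi> - g \<xi>))\<^sup>2" by (intro power_mono) auto
      also have "\<dots> \<le> 2 * (norm (g \<xi>))\<^sup>2 + 2 * (norm (?t n \<xi> - g \<xi>))\<^sup>2"
        using sum_squares_bound[of "norm (g \<xi>)" "norm (?t n \<xi> - g \<xi>)"] by (simp add: power2_sum)
      finally have "(?k \<xi>)\<^sup>2 * (norm (?t n \<xi>))\<^sup>2 \<le> (?k \<xi>)\<^sup>2 * (2 * (norm (g \<xi>))\<^sup>2 + 2 * (norm (?t n \<xi> - g \<xi>))\<^sup>2)"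
        by (intro mult_left_mono) auto
      also have "\<dots> = 2 * ((?k \<xi>)\<^sup>2 * (norm (g \<xi>))\<^sup>2) + (?k \<xi>)\<^sup>2 * (2 * (norm (?t n \<xi> - g \<xi>))\<^sup>2)"
        by (simp add: algebra_simps)
      \<comment> \<open>In the error term the multiplier is bounded by 1, so that the unweighted L2
        convergence suffices.\<close>
      also have "(?k \<xi>)\<^sup>2 * (2 * (norm (?t n \<xi> - g \<xi>))\<^sup>2) \<le> 1 * (2 * (norm (?t n \<xi> - g \<xi>))\<^sup>2)"
        by (intro mult_right_mono k1) auto
      finally have "(?k \<xi>)\<^sup>2 * (norm (?t n \<xi>))\<^sup>2 \<le> 2 * ((?k \<xi>)\<^sup>2 * (norm (g \<xi>))\<^sup>2) + 2 * (norm (?t n \<xi> - g \<xi>))\<^sup>2" by simp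
      then have "ennreal ((?k \<xi>)\<^sup>2 * (norm (?t n \<xi>))\<^sup>2) \<le> ennreal (2 * ((?k \<xi>)\<^sup>2 * (norm (g \<xi>))\<^sup>2) + 2 * (norm (?t n \<xi> - g \<xi>))\<^sup>2)"
        by (rule ennreal_leI)
      also have "\<dots> = 2 * (ennreal ((?k \<xi>)\<^sup>2) * ennreal ((norm (g \<xi>))\<^sup>2)) + 2 * ennreal ((norm (?t n \<xi> - g \<xi>))\<^sup>2)"
        by (simp add: ennreal_plus ennreal_mult)
      finally show "ennreal ((?k \<xi>)\<^sup>2 * (norm (?t n \<xi>))\<^sup>2) \<le> 2 * (ennreal ((?k \<xi>)\<^sup>2) * ennreal ((norm (g \<xi>))\<^sup>2)) + 2 * ennreal ((norm (?t n \<xi> - g \<xi>))\<^sup>2)" .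
    qed
    also have "\<dots> = 2 * ?A + 2 * L2_sqnorm (\<lambda>\<xi>. ?t n \<xi> - g \<xi>)"
      unfolding L2_sqnorm_def by (subst nn_integral_add) (auto simp: nn_integral_cmult)
    finally show ?thesis .
  qed
  have "(\<lambda>n. sq (conv k (?T n j))) \<longlonglongrightarrow> sq (conv k (\<lambda>x. f x $ j))" for j
  proof (rule tendsto_L2_sq[OF conv2(1)[OF T(2)] conv2(1)[OF f]])
    show "(\<lambda>n. sq (\<lambda>x. conv k (?T n j) x - conv k (\<lambda>x. f x $ j) x)) \<longlonglongrightarrow> 0"
    proof (rule tendsto_zero_bound[OF _ _ truncate_tendsto[OF f[of j]]])
      fix n
      have "sq (conv k (\<lambda>x. ?T n j x - f x $ j)) \<le> sq (\<lambda>x. ?T n j x - f x $ j)"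
        by (intro conv2 in_L2_diff T f)
      then show "sq (\<lambda>x. conv k (?T n j) x - conv k (\<lambda>x. f x $ j) x) \<le> sq (\<lambda>x. ?T n j x - f x $ j)"
        by (simp add: conv_diff[OF conv_ok_L2[OF T(2)] conv_ok_L2[OF f] k(1), abs_def])
    qed simp
  qed
  then have lhs: "(\<lambda>n. ennreal ((2 * pi) ^ CARD('n) * (\<Sum>j\<in>UNIV. sq (conv k (?T n j))))) \<longlonglongrightarrow> ennreal ((2 * pi) ^ CARD('n) * (\<Sum>j\<in>UNIV. sq (conv k (\<lambda>x. f x $ j))))"
    by (intro tendsto_ennrealI tendsto_intros)
  have "(\<lambda>n. L2_sqnorm (\<lambda>\<xi>. ?t n \<xi> - g \<xi>)) \<longlonglongrightarrow> 0"
    using g filterlim_compose[OF _ filterlim_real_sequentially] by (auto simp: is_L2_fourier_def)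
  then have "(\<lambda>n. 2 * ?A + 2 * L2_sqnorm (\<lambda>\<xi>. ?t n \<xi> - g \<xi>)) \<longlonglongrightarrow> 2 * ?A + 2 * 0"
    by (intro tendsto_add tendsto_const ennreal_tendsto_cmult) auto
  from tendsto_le[OF sequentially_bot this lhs] le show ?thesis by simp
qed

section \<open>The Fourier multiplier of the mollifier\<close>

lemma mollifier_scale:
  fixes x :: "'a::euclidean_space"
  assumes s: "s > 0" shows "mollifier s x = mollifier 1 (x /\<^sub>R s) / s ^ DIM('a)"
proof -
  have "(\<lambda>y::'a. flat 0 (1 - y \<bullet> y)) \<in> borel_measurable borel"
    using kernel_measurable[OF test_function_kernel[OF bump_test_function[of 1, where 'a='a]]] by simp
  from lborel_integral_scale(1)[OF s this] show ?thesis by (simp add: mollifier_def)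
qed

lemma mollifier_measurable [measurable]: "s > 0 \<Longrightarrow> mollifier s \<in> borel_measurable borel"
  by (intro kernel_measurable mollifier_kernel)

lemma sq_mollifier:
  assumes s: "s > 0" shows "sq (mollifier s :: 'a::euclidean_space \<Rightarrow> real) = sq (mollifier 1 :: 'a \<Rightarrow> real) / s ^ DIM('a)"
proof -
  have m: "(\<lambda>x::'a. (mollifier 1 x)\<^sup>2) \<in> borel_measurable borel" by measurable
  have "sq (mollifier s :: 'a \<Rightarrow> real) = (LBINT x::'a. (mollifier 1 (x /\<^sub>R s))\<^sup>2) / s ^ DIM('a) / s ^ DIM('a)"
    unfolding sq_def mollifier_scale[OF s] by (simp add: power_divide power2_eq_square[of "s ^ _"])
  also have "(LBINT x::'a. (mollifier 1 (x /\<^sub>R s))\<^sup>2) = s ^ DIM('a) * (LBINT x::'a. (mollifier 1 x)\<^sup>2)"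
    by (rule lborel_integral_scale(1)[OF s m])
  finally show ?thesis using s by (simp add: sq_def)
qed

lemma cos_transform_mollifier:
  fixes \<xi> :: "'a::euclidean_space"
  assumes s: "s > 0" shows "cos_transform (mollifier s) \<xi> = cos_transform (mollifier 1) (s *\<^sub>R \<xi>)"
proof -
  have m: "(\<lambda>x::'a. cos ((s *\<^sub>R \<xi>) \<bullet> x) * mollifier 1 x) \<in> borel_measurable borel" by measurable
  have "cos_transform (mollifier s) \<xi> = (LBINT x. cos ((s *\<^sub>R \<xi>) \<bullet> (x /\<^sub>R s)) * mollifier 1 (x /\<^sub>R s)) / s ^ DIM('a)"
  proof -
    have "(s *\<^sub>R \<xi>) \<bullet> (x /\<^sub>R s) = \<xi> \<bullet> x" for x using s by simp
    then show ?thesis unfolding cos_transform_def mollifier_scale[OF s]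
      by (simp only: times_divide_eq_right integral_divide_zero)
  qed
  also have "(LBINT x. cos ((s *\<^sub>R \<xi>) \<bullet> (x /\<^sub>R s)) * mollifier 1 (x /\<^sub>R s)) = s ^ DIM('a) * (LBINT x. cos ((s *\<^sub>R \<xi>) \<bullet> x) * mollifier 1 x)"
    by (rule lborel_integral_scale(1)[OF s m])
  finally show ?thesis using s by (simp add: cos_transform_def)
qed

text \<open>Both integrations by parts are done in one step: the function cos * k_j + \<xi>_j * sin
  * k, with k_j the derivative of k, has derivative cos * k_jj + \<xi>_j^2 * cos * k, the mixed
  terms cancelling.\<close>

lemma cos_transform_second_partial:
  fixes k :: "real^'n \<Rightarrow> real"
  assumes k: "test_function k"
  shows "(\<xi> $ j)\<^sup>2 * cos_transform k \<xi> = - cos_transform (partial j (partial j k)) \<xi>"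
proof -
  let ?d = "partial j k" and ?dd = "partial j (partial j k)"
  note kp = test_function_partial[OF k, of j]
  note kpp = test_function_partial[OF kp, of j]
  note ints = kernel_integrable[OF test_function_kernel[OF k]] kernel_integrable[OF test_function_kernel[OF kp]] kernel_integrable[OF test_function_kernel[OF kpp]]
  have ax: "\<xi> \<bullet> (x + s *\<^sub>R axis j 1) = \<xi> \<bullet> x + s * \<xi> $ j" for x s by (simp add: inner_add_right inner_axis)
  have dc: "dir_deriv (axis j 1) (\<lambda>x. cos (\<xi> \<bullet> x)) (\<lambda>x. - (\<xi> $ j) * sin (\<xi> \<bullet> x))"
    and ds: "dir_deriv (axis j 1) (\<lambda>x. \<xi> $ j * sin (\<xi> \<bullet> x)) (\<lambda>x. \<xi> $ j * (\<xi> $ j * cos (\<xi> \<bullet> x)))"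
    unfolding dir_deriv_def ax has_real_derivative_iff_has_vector_derivative[symmetric]
    by (auto intro!: derivative_eq_intros)
  have add: "dir_deriv e a a' \<Longrightarrow> dir_deriv e b b' \<Longrightarrow> dir_deriv e (\<lambda>x. a x + b x) (\<lambda>x. a' x + b' x)"
    for a a' b b' :: "real^'n \<Rightarrow> real" and e unfolding dir_deriv_def by (simp add: has_vector_derivative_add)
  note D = add[OF dir_deriv_mult[OF dc test_function_dir_deriv[OF kp]] dir_deriv_mult[OF ds test_function_dir_deriv[OF k]]]
  have D': "dir_deriv (axis j 1) (\<lambda>x. cos (\<xi> \<bullet> x) * ?d x + \<xi> $ j * (sin (\<xi> \<bullet> x) * k x))
     (\<lambda>x. cos (\<xi> \<bullet> x) * ?dd x + (\<xi> $ j)\<^sup>2 * (cos (\<xi> \<bullet> x) * k x))"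
    using D by (simp add: power2_eq_square mult.assoc)
  have "(LBINT x. cos (\<xi> \<bullet> x) * ?dd x + (\<xi> $ j)\<^sup>2 * (cos (\<xi> \<bullet> x) * k x)) = 0"
  proof (rule integral_dir_deriv_zero[OF D'])
    show "continuous_on UNIV (\<lambda>x. cos (\<xi> \<bullet> x) * ?dd x + (\<xi> $ j)\<^sup>2 * (cos (\<xi> \<bullet> x) * k x))"
      using test_function_kernel[OF k] test_function_kernel[OF kpp] unfolding kernel_def by (intro continuous_intros) auto
  qed (intro Bochner_Integration.integrable_add integrable_mult_right trig_integrable(3,4) ints)+
  then show ?thesis using trig_integrable(3)[OF ints(3)] trig_integrable(3)[OF ints(1)] by (simp add: cos_transform_def)
qed

lemma cos_transform_decay:
  fixes k :: "real^'n \<Rightarrow> real"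
  assumes k: "test_function k"
  obtains B where "B \<ge> 1" "\<And>\<xi>. (norm \<xi>)\<^sup>2 * \<bar>cos_transform k \<xi>\<bar> \<le> B"
proof
  let ?N = "\<lambda>j. LBINT x. \<bar>partial j (partial j k) x\<bar>"
  show "1 \<le> 1 + (\<Sum>j\<in>UNIV. ?N j)" by (simp add: sum_nonneg)
  fix \<xi> :: "real^'n"
  have "(\<xi> $ j)\<^sup>2 * \<bar>cos_transform k \<xi>\<bar> \<le> ?N j" for j
  proof -
    have "(\<xi> $ j)\<^sup>2 * \<bar>cos_transform k \<xi>\<bar> = \<bar>(\<xi> $ j)\<^sup>2 * cos_transform k \<xi>\<bar>" by (simp add: abs_mult)
    also have "\<dots> = \<bar>cos_transform (partial j (partial j k)) \<xi>\<bar>" by (simp add: cos_transform_second_partial[OF k])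
    also have "\<dots> \<le> ?N j"
      by (intro abs_trig_transform_le(1) kernel_integrable test_function_kernel test_function_partial k)
    finally show ?thesis .
  qed
  then have "(\<Sum>j\<in>UNIV. (\<xi> $ j)\<^sup>2 * \<bar>cos_transform k \<xi>\<bar>) \<le> (\<Sum>j\<in>UNIV. ?N j)" by (rule sum_mono)
  moreover have "(norm \<xi>)\<^sup>2 = (\<Sum>j\<in>UNIV. (\<xi> $ j)\<^sup>2)" by (simp add: norm_vec_def L2_set_def sum_nonneg)
  ultimately show "(norm \<xi>)\<^sup>2 * \<bar>cos_transform k \<xi>\<bar> \<le> 1 + (\<Sum>j\<in>UNIV. ?N j)" by (simp add: sum_distrib_right)
qed

text \<open>Take m with 2^(m-1) \<le> |s \<xi>| < 2^m. The multiplier decays like the inverse square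
  of |s \<xi>|, its square like the inverse fourth power, hence 16^(-m), with a factor 16 lost
  because the lower end is 2^(m-1). The index m = 0 covers |s \<xi>| < 1, where the multiplier is at
  most 1.\<close>

lemma cos_transform_mollifier_dyadic:
  obtains B where "B \<ge> 0" "\<And>s \<xi>::real^'n. s > 0 \<Longrightarrow> \<exists>m. norm \<xi> < 2 ^ m / s \<and> (cos_transform (mollifier s) \<xi>)\<^sup>2 \<le> B * (1/16) ^ m"
    and "\<And>s \<xi>::real^'n. s > 0 \<Longrightarrow> (cos_transform (mollifier s) \<xi>)\<^sup>2 \<le> 1"
proof -
  let ?k = "cos_transform (mollifier 1 :: real^'n \<Rightarrow> real)"
  have k1: "(?k \<eta>)\<^sup>2 \<le> 1" for \<eta>
  proof -
    have "\<bar>?k \<eta>\<bar> \<le> (LBINT x::real^'n. \<bar>mollifier 1 x\<bar>)"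
      by (intro abs_trig_transform_le(1) kernel_integrable mollifier_kernel) simp
    also have "\<dots> = 1" using mollifier_prob[of 1, where 'a="real^'n"] by (simp add: prob_kernel_def)
    finally show ?thesis by (simp add: abs_square_le_1)
  qed
  obtain B where B: "B \<ge> 1" "\<And>\<eta>. (norm \<eta>)\<^sup>2 * \<bar>?k \<eta>\<bar> \<le> B"
    using cos_transform_decay[OF mollifier_test_function[of 1, where 'a="real^'n"]] by auto
  have main: "\<exists>m. norm \<eta> < 2 ^ m \<and> (?k \<eta>)\<^sup>2 \<le> 16 * B\<^sup>2 * (1/16) ^ m" for \<eta> :: "real^'n"
  proof (cases "norm \<eta> < 1")
    case True
    have "1 \<le> B\<^sup>2" using B(1) by (simp add: one_le_power)
    then show ?thesis using True k1[of \<eta>] by (intro exI[of _ 0]) simp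
  next
    case False
    obtain m0 where "norm \<eta> < 2 ^ m0" using real_arch_pow[of 2 "norm \<eta>"] by auto
    define m where "m = (LEAST m. norm \<eta> < 2 ^ m)"
    have m: "norm \<eta> < 2 ^ m" unfolding m_def by (rule LeastI) fact
    have "m \<noteq> 0" using m False by (intro notI) simp
    then obtain l where l: "m = Suc l" by (cases m) auto
    have ge: "2 ^ l \<le> norm \<eta>" using not_less_Least[of l "\<lambda>m. norm \<eta> < 2 ^ m"] l unfolding m_def[symmetric] by simp
    have "(2 ^ l)\<^sup>2 * \<bar>?k \<eta>\<bar> \<le> (norm \<eta>)\<^sup>2 * \<bar>?k \<eta>\<bar>" using ge by (intro mult_right_mono power_mono) auto
    also have "\<dots> \<le> B" by (rule B)
    finally have "\<bar>?k \<eta>\<bar> \<le> B / 4 ^ l" by (simp add: field_simps power2_eq_square flip: power_mult_distrib)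
    then have "(?k \<eta>)\<^sup>2 \<le> (B / 4 ^ l)\<^sup>2" by (metis abs_ge_zero power2_abs power_mono)
    also have "\<dots> = 16 * B\<^sup>2 * (1/16) ^ m"
      by (simp add: l power_divide power2_eq_square[of "4 ^ l"] flip: power_mult_distrib)
    finally show ?thesis using m by blast
  qed
  show ?thesis
  proof
    show "0 \<le> 16 * B\<^sup>2" by simp
    fix s :: real and \<xi> :: "real^'n" assume s: "s > 0"
    show "(cos_transform (mollifier s) \<xi>)\<^sup>2 \<le> 1" unfolding cos_transform_mollifier[OF s] by (rule k1)
    show "\<exists>m. norm \<xi> < 2 ^ m / s \<and> (cos_transform (mollifier s) \<xi>)\<^sup>2 \<le> 16 * B\<^sup>2 * (1/16) ^ m"
      using main[of "s *\<^sub>R \<xi>"] s unfolding cos_transform_mollifier[OF s] by (simp add: pos_less_divide_eq mult.commute)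
  qed
qed

text \<open>The ball of radius 2^m / s has mass at most \<open>C * 8 ^ m * s powr (-p)\<close>
  because p \<le> 3, while the squared multiplier contributes 16^(-m), so the series is geometric
  with ratio 1/2. This is where the exponent is capped at 3.\<close>

lemma low_frequency_mass:
  fixes f :: "real^'n \<Rightarrow> real^'m"
  assumes f: "\<And>j. in_L2 (\<lambda>x. f x $ j)" and g: "is_L2_fourier f g" and p: "p \<le> 3" and C: "C \<ge> 0"
    and mass: "\<And>\<rho>. \<rho> > 0 \<Longrightarrow> (\<integral>\<^sup>+\<xi>\<in>ball 0 \<rho>. ennreal ((norm (g \<xi>))\<^sup>2) \<partial>lborel) \<le> ennreal (C * \<rho> powr p)"
  obtains D where "D \<ge> 0" "\<And>s. s > 0 \<Longrightarrow> (\<Sum>j\<in>UNIV. sq (conv (mollifier s) (\<lambda>x. f x $ j))) \<le> D * s powr (- p)"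
proof -
  obtain B where B: "B \<ge> 0" "\<And>s \<xi>::real^'n. s > 0 \<Longrightarrow> \<exists>m. norm \<xi> < 2 ^ m / s \<and> (cos_transform (mollifier s) \<xi>)\<^sup>2 \<le> B * (1/16) ^ m"
    and k1: "\<And>s \<xi>::real^'n. s > 0 \<Longrightarrow> (cos_transform (mollifier s) \<xi>)\<^sup>2 \<le> 1"
    using cos_transform_mollifier_dyadic[where 'n='n] by blast
  have [measurable]: "g \<in> borel_measurable borel" using g by (simp add: is_L2_fourier_def in_L2_def)
  let ?P = "(2 * pi) ^ CARD('n)"
  have P: "?P > 0" by simp
  show ?thesis
  proof
    \<comment> \<open>The factor 4 is the 2 of \<open>conv_sq_fourier_le\<close> times the sum 2 of
      the geometric series; \<open>?P\<close> is the Plancherel constant.\<close>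
    show "0 \<le> 4 * B * C / ?P" using B(1) C by simp
    fix s :: real assume s: "s > 0"
    let ?b = "\<lambda>m::nat. ball (0::real^'n) (2 ^ m / s)"
    have bound: "(\<integral>\<^sup>+\<xi>\<in>?b m. ennreal ((norm (g \<xi>))\<^sup>2) \<partial>lborel) * ennreal (B * (1/16) ^ m) \<le> ennreal (B * C * s powr (- p) * (1/2) ^ m)" for m
    proof -
      have "(\<integral>\<^sup>+\<xi>\<in>?b m. ennreal ((norm (g \<xi>))\<^sup>2) \<partial>lborel) * ennreal (B * (1/16) ^ m) \<le> ennreal (C * (2 ^ m / s) powr p) * ennreal (B * (1/16) ^ m)"
        using s by (intro mult_right_mono mass) auto
      also have "\<dots> = ennreal (C * (2 ^ m / s) powr p * (B * (1/16) ^ m))"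
        using C B(1) by (intro ennreal_mult[symmetric]) auto
      also have "\<dots> \<le> ennreal (B * C * s powr (- p) * (1/2) ^ m)"
      proof (rule ennreal_leI)
        have "(2 ^ m / s) powr p = (2 ^ m) powr p * s powr (- p)" using s by (simp add: powr_divide powr_minus_divide)
        also have "\<dots> \<le> (2 ^ m) powr 3 * s powr (- p)" using p by (intro mult_right_mono powr_mono) auto
        also have "(2 ^ m) powr 3 = (8::real) ^ m" by (simp add: powr_numeral power3_eq_cube flip: power_mult_distrib)
        finally have "C * (2 ^ m / s) powr p * (B * (1/16) ^ m) \<le> C * (8 ^ m * s powr (- p)) * (B * (1/16) ^ m)"
          using C B(1) by (intro mult_right_mono mult_left_mono) auto
        also have "\<dots> = B * C * s powr (- p) * ((8 * (1/16)) ^ m)" by (simp only: power_mult_distrib mult_ac)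
        finally show "C * (2 ^ m / s) powr p * (B * (1/16) ^ m) \<le> B * C * s powr (- p) * (1/2) ^ m" by simp
      qed
      finally show ?thesis .
    qed
    have "ennreal (?P * (\<Sum>j\<in>UNIV. sq (conv (mollifier s) (\<lambda>x. f x $ j)))) \<le> 2 * (\<integral>\<^sup>+\<xi>. ennreal ((cos_transform (mollifier s) \<xi>)\<^sup>2) * ennreal ((norm (g \<xi>))\<^sup>2) \<partial>lborel)"
      by (rule conv_sq_fourier_le[OF f g]) (use s in \<open>auto intro: mollifier_kernel mollifier_even mollifier_prob k1\<close>)
    also have "\<dots> \<le> 2 * (\<integral>\<^sup>+\<xi>. (\<Sum>m. ennreal ((norm (g \<xi>))\<^sup>2) * indicator (?b m) \<xi> * ennreal (B * (1/16) ^ m)) \<partial>lborel)"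
    proof (intro mult_left_mono nn_integral_mono)
      fix \<xi> :: "real^'n"
      let ?F = "\<lambda>m. ennreal ((norm (g \<xi>))\<^sup>2) * indicator (?b m) \<xi> * ennreal (B * (1/16) ^ m)"
      obtain m where m: "norm \<xi> < 2 ^ m / s" "(cos_transform (mollifier s) \<xi>)\<^sup>2 \<le> B * (1/16) ^ m" using B(2)[OF s] by blast
      have "ennreal ((cos_transform (mollifier s) \<xi>)\<^sup>2) * ennreal ((norm (g \<xi>))\<^sup>2) \<le> ennreal (B * (1/16) ^ m) * ennreal ((norm (g \<xi>))\<^sup>2)"
        using m by (intro mult_right_mono ennreal_leI) auto
      also have "\<dots> = ?F m" using m by (simp add: mult.commute)
      also have "\<dots> = sum ?F {m}" by simp
      also have "\<dots> \<le> suminf ?F" by (rule sum_le_suminf) (auto intro: summableI)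
      finally show "ennreal ((cos_transform (mollifier s) \<xi>)\<^sup>2) * ennreal ((norm (g \<xi>))\<^sup>2) \<le> suminf ?F" .
    qed simp
    also have "\<dots> = 2 * (\<Sum>m. (\<integral>\<^sup>+\<xi>\<in>?b m. ennreal ((norm (g \<xi>))\<^sup>2) \<partial>lborel) * ennreal (B * (1/16) ^ m))"
    proof -
      have [measurable]: "(\<lambda>\<xi>. ennreal ((norm (g \<xi>))\<^sup>2) * indicator (?b m) \<xi>) \<in> borel_measurable borel" for m
        by (intro borel_measurable_times_ennreal borel_measurable_indicator) auto
      show ?thesis by (subst nn_integral_suminf) (auto simp: nn_integral_multc)
    qed
    also have "\<dots> \<le> 2 * (\<Sum>m. ennreal (B * C * s powr (- p) * (1/2) ^ m))"
      by (intro mult_left_mono suminf_le bound summableI) simp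
    also have "(\<Sum>m. ennreal (B * C * s powr (- p) * (1/2) ^ m)) = ennreal (\<Sum>m. B * C * s powr (- p) * (1/2) ^ m)"
      using B(1) C by (intro suminf_ennreal2 summable_mult summable_geometric) auto
    also have "(\<Sum>m. B * C * s powr (- p) * (1/2) ^ m) = B * C * s powr (- p) * 2"
      by (subst suminf_mult) (auto simp: suminf_geometric summable_geometric)
    also have "2 * ennreal (B * C * s powr (- p) * 2) = ennreal (4 * B * C * s powr (- p))"
      using B(1) C by (simp add: ennreal_mult[symmetric] flip: ennreal_numeral) 
    finally have "?P * (\<Sum>j\<in>UNIV. sq (conv (mollifier s) (\<lambda>x. f x $ j))) \<le> 4 * B * C * s powr (- p)"
      using B(1) C by (subst (asm) ennreal_le_iff) auto
    then show "(\<Sum>j\<in>UNIV. sq (conv (mollifier s) (\<lambda>x. f x $ j))) \<le> 4 * B * C / ?P * s powr (- p)"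
      using P by (simp add: field_simps)
  qed
qed

text \<open>The decay indicator controls the mass of small balls only; for the remaining radii the
  total mass N is bounded by a multiple of \<open>\<rho> powr p\<close>. The result is the bound for
  all radii that \<open>low_frequency_mass\<close> needs.\<close>

lemma decay_character_low_frequency:
  fixes f :: "real^'n \<Rightarrow> real^'m"
  assumes f: "\<And>j. in_L2 (\<lambda>x. f x $ j)" and dc: "has_decay_character f (ereal r)" and r: "- (real CARD('n) / 2) < r"
  obtains D where "D \<ge> 0"
    "\<And>s. s > 0 \<Longrightarrow> (\<Sum>j\<in>UNIV. sq (conv (mollifier s) (\<lambda>x. f x $ j))) \<le> D * s powr (- min (2 * r + real CARD('n)) 3)"
proof -
  define g where "g = L2_fourier f"
  define p where "p = min (2 * r + real CARD('n)) 3"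
  have g: "is_L2_fourier f g" unfolding g_def L2_fourier_def by (rule someI_ex[OF is_L2_fourier_exists[OF f]])
  have p: "p \<le> 3" "p > 0" "p \<le> 2 * r + real CARD('n)" using r by (auto simp: p_def)
  \<comment> \<open>The two degenerate alternatives of the decay character are excluded, one by r >
    -n/2 and the other by r being finite.\<close>
  have "pos_finite_indicator f r" using dc r by (auto simp: has_decay_character_def)
  then obtain P where P: "has_decay_indicator f r P" "P < \<infinity>" by (auto simp: pos_finite_indicator_def)
  let ?\<Phi> = "\<lambda>\<rho>. \<integral>\<^sup>+\<xi>\<in>ball 0 \<rho>. ennreal ((norm (g \<xi>))\<^sup>2) \<partial>lborel"
  define q where "q = - 2 * r - real CARD('n)"
  obtain K where K: "P < ennreal K" "K > 0"
  proof -
    have "P < ennreal (enn2real P + 1)" using P(2) by (cases P) (auto simp: ennreal_less_iff)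
    then show ?thesis by (rule that) (simp add: add_nonneg_pos)
  qed
  have "\<forall>\<^sub>F \<rho> in at_right 0. ennreal (\<rho> powr q) * ?\<Phi> \<rho> < ennreal K"
    using P(1) K(1) unfolding has_decay_indicator_def g_def[symmetric] q_def[symmetric] by (rule order_tendstoD(2))
  then obtain d where d: "d > 0" "\<And>\<rho>. 0 < \<rho> \<Longrightarrow> \<rho> < d \<Longrightarrow> ennreal (\<rho> powr q) * ?\<Phi> \<rho> < ennreal K"
    unfolding eventually_at_right_field by auto
  obtain N where N: "L2_sqnorm g = ennreal N" "N \<ge> 0"
    using g by (cases "L2_sqnorm g") (auto simp: is_L2_fourier_def in_L2_def)
  \<comment> \<open>Below d the limit is effective; below 1 a smaller exponent gives a larger power,
    which permits replacing 2r + n by p.\<close>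
  define e where "e = min d 1"
  have e: "e > 0" "e \<le> 1" "e \<le> d" using d by (auto simp: e_def)
  have mass: "?\<Phi> \<rho> \<le> ennreal ((K + N * e powr (- p)) * \<rho> powr p)" if \<rho>: "\<rho> > 0" for \<rho>
  proof -
    have \<Phi>N: "?\<Phi> \<rho> \<le> ennreal N" unfolding N(1)[symmetric] L2_sqnorm_def by (intro nn_integral_mono) (auto simp: indicator_def)
    then obtain \<phi> where \<phi>: "?\<Phi> \<rho> = ennreal \<phi>" "\<phi> \<ge> 0" by (cases "?\<Phi> \<rho>") (auto simp: top_unique)
    have "\<phi> \<le> (K + N * e powr (- p)) * \<rho> powr p"
    proof (cases "\<rho> < e")
      case True
      then have "ennreal (\<rho> powr q) * ennreal \<phi> < ennreal K" using d(2)[of \<rho>] \<rho> e \<phi>(1) by simp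
      then have "\<rho> powr q * \<phi> < K" using \<phi>(2) by (simp add: ennreal_mult[symmetric] ennreal_less_iff)
      then have "\<rho> powr (- q) * (\<rho> powr q * \<phi>) \<le> \<rho> powr (- q) * K" by (intro mult_left_mono) auto
      moreover have "\<rho> powr (- q) * \<rho> powr q = 1" using \<rho> by (simp add: powr_minus)
      then have "\<rho> powr (- q) * (\<rho> powr q * \<phi>) = \<phi>" by (simp only: mult.assoc[symmetric] mult_1_left)
      moreover have "\<rho> powr (- q) \<le> \<rho> powr p" using \<rho> True e p by (intro powr_mono') (auto simp: q_def)
      then have "\<rho> powr (- q) * K \<le> \<rho> powr p * K" using K by (intro mult_right_mono) auto
      moreover have "0 \<le> N * e powr (- p) * \<rho> powr p" using N by simp
      ultimately have "\<phi> \<le> \<rho> powr p * K + N * e powr (- p) * \<rho> powr p" by linarith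
      then show ?thesis by (simp only: distrib_right mult.commute[of _ K])
    next
      case False
      have "1 = e powr (- p) * e powr p" using e by (simp add: powr_minus)
      also have "\<dots> \<le> e powr (- p) * \<rho> powr p" using False e p by (intro mult_left_mono powr_mono2) auto
      finally have "N * 1 \<le> N * (e powr (- p) * \<rho> powr p)" using N(2) by (rule mult_left_mono)
      moreover have "\<phi> \<le> N" using \<Phi>N \<phi> N by simp
      moreover have "0 \<le> K * \<rho> powr p" using K by simp
      ultimately show ?thesis by (simp add: distrib_right mult.assoc)
    qed
    then show ?thesis unfolding \<phi>(1) by (rule ennreal_leI)
  qed
  have "0 \<le> K + N * e powr (- p)" using K N by simp
  from low_frequency_mass[OF f g p(1) this mass] that show ?thesis unfolding p_def by blast
qed

section \<open>Iteration over dyadic times\<close>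

text \<open>The square root of 8 is less than 3. Multiplied by the gain 1/16 of one doubling of time
  this leaves 3/16 < 1/4.\<close>

lemma powr_le_3: "\<gamma> \<le> 3 / 2 \<Longrightarrow> (2::real) powr \<gamma> \<le> 3"
proof -
  assume "\<gamma> \<le> 3 / 2"
  then have "(2::real) powr \<gamma> \<le> 2 powr (3 / 2)" by (intro powr_mono) auto
  also have "(2 powr (3 / 2))\<^sup>2 \<le> (3::real)\<^sup>2" by (simp add: power2_eq_square flip: powr_add)
  then have "(2::real) powr (3 / 2) \<le> 3" by (rule power2_le_imp_le) simp
  finally show ?thesis .
qed

text \<open>The weights y^j are summable, so beyond some N their sum is small enough for the
  nonlocal term to be absorbed. The finitely many earlier terms are controlled by the a priori
  growth 3^j E0, which keeps K independent of the sequence.\<close>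

lemma weighted_recursion_bounded:
  fixes y :: real
  assumes y: "0 \<le> y" "y < 1" and A: "A \<ge> 0" and B: "B \<ge> 0" and E0: "E0 \<ge> 0"
  obtains K where "K \<ge> 0" "\<forall>m. (\<forall>j. 0 \<le> m j) \<longrightarrow> (\<forall>j. m j \<le> 3 ^ j * E0) \<longrightarrow>
    (\<forall>n. m (Suc n) \<le> m n / 4 + A + B * (\<Sum>j\<le>n. y ^ j * m j)) \<longrightarrow> (\<forall>n. m n \<le> K)"
proof -
  have "summable (\<lambda>j. y ^ j)" using y by (intro summable_geometric) simp
  then have "\<exists>N. \<forall>m\<ge>N. \<forall>n. norm (\<Sum>j=m..<n. y ^ j) < 1 / (4 * (B + 1))"
    using B unfolding summable_Cauchy by (auto intro: add_nonneg_pos)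
  then obtain N where N: "\<And>n. norm (\<Sum>j=N..<n. y ^ j) < 1 / (4 * (B + 1))" by blast
  define L where "L = 3 ^ N * E0"
  \<comment> \<open>In the induction step K/4 comes from the previous term and at most K/4 from the
    weights beyond N; K is chosen so that the other half covers the rest.\<close>
  define K where "K = L + 2 * (A + B * (real N * L))"
  have L: "L \<ge> 0" using E0 by (simp add: L_def)
  have K: "K \<ge> L" using A B L by (simp add: K_def)
  show ?thesis
  proof
    show "0 \<le> K" using K L by simp
    show "\<forall>m. (\<forall>j. 0 \<le> m j) \<longrightarrow> (\<forall>j. m j \<le> 3 ^ j * E0) \<longrightarrow>
      (\<forall>n. m (Suc n) \<le> m n / 4 + A + B * (\<Sum>j\<le>n. y ^ j * m j)) \<longrightarrow> (\<forall>n. m n \<le> K)"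
    proof (intro allI impI)
      fix m :: "nat \<Rightarrow> real" and n
      assume m0: "\<forall>j. 0 \<le> m j" and m1: "\<forall>j. m j \<le> 3 ^ j * E0"
        and rec: "\<forall>n. m (Suc n) \<le> m n / 4 + A + B * (\<Sum>j\<le>n. y ^ j * m j)"
      have small: "m j \<le> L" if "j \<le> N" for j
      proof -
        have "m j \<le> 3 ^ j * E0" using m1 by blast
        also have "\<dots> \<le> L" unfolding L_def using that E0 by (intro mult_right_mono power_increasing) auto
        finally show ?thesis .
      qed
      show "m n \<le> K"
      proof (induction n rule: less_induct)
        case (less n)
        show ?case
        proof (cases "n \<le> N")
          case True
          then show ?thesis using small[of n] K by simp
        next
          case False
          then obtain l where l: "n = Suc l" "N \<le> l" by (cases n) auto
          have "(\<Sum>j\<le>l. y ^ j * m j) = (\<Sum>j<N. y ^ j * m j) + (\<Sum>j=N..<Suc l. y ^ j * m j)"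
            using l sum.atLeastLessThan_concat[of 0 N "Suc l" "\<lambda>j. y ^ j * m j"] by (simp add: atLeast0LessThan lessThan_Suc_atMost)
          also have "(\<Sum>j<N. y ^ j * m j) \<le> (\<Sum>j<N. 1 * L)"
            using y small m0 by (intro sum_mono mult_mono power_le_one) auto
          also have "(\<Sum>j=N..<Suc l. y ^ j * m j) \<le> (\<Sum>j=N..<Suc l. y ^ j * K)"
            using y l less by (intro sum_mono mult_left_mono) auto
          also have "\<dots> = (\<Sum>j=N..<Suc l. y ^ j) * K" by (simp only: sum_distrib_right)
          also have "\<dots> \<le> 1 / (4 * (B + 1)) * K"
            using N[of "Suc l"] K L by (intro mult_right_mono) auto
          finally have "(\<Sum>j\<le>l. y ^ j * m j) \<le> real N * L + 1 / (4 * (B + 1)) * K" by simp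
          then have "B * (\<Sum>j\<le>l. y ^ j * m j) \<le> B * (real N * L + 1 / (4 * (B + 1)) * K)" using B by (rule mult_left_mono)
          also have "\<dots> = B * (real N * L) + B / (B + 1) * (K / 4)" by (simp add: distrib_left)
          also have "B / (B + 1) * (K / 4) \<le> 1 * (K / 4)" using B K L by (intro mult_right_mono) auto
          finally have "B * (\<Sum>j\<le>l. y ^ j * m j) \<le> B * (real N * L) + K / 4" by simp
          moreover have "m l \<le> K" using less l by simp
          moreover have "m n \<le> m l / 4 + A + B * (\<Sum>j\<le>l. y ^ j * m j)" using rec l by simp
          ultimately have "m n \<le> K / 2 + (A + B * (real N * L))" by simp
          also have "\<dots> \<le> K" using L by (simp add: K_def)
          finally show ?thesis .
        qed
      qed
    qed
  qed
qed

text \<open>A dyadic upper sum: on [2^j, 2^(j+1)] an antitone function is at most its value at the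
  left end.\<close>

lemma antimono_integral_le:
  fixes E :: "real \<Rightarrow> real"
  assumes E: "antimono E" "\<And>t. 0 \<le> E t" "\<And>t. E t \<le> E0"
  shows "(LBINT t. indicator {0..2 ^ n} t * E t) \<le> E0 + (\<Sum>j<n. 2 ^ j * E (2 ^ j))"
proof -
  have [measurable]: "E \<in> borel_measurable borel"
  proof -
    have "(\<lambda>t. - E t) \<in> borel_measurable borel"
      by (rule borel_measurable_mono) (use E(1) in \<open>auto simp: mono_def antimono_def\<close>)
    then have "(\<lambda>t. - (- E t)) \<in> borel_measurable borel" by (rule borel_measurable_uminus)
    then show ?thesis by simp
  qed
  have ci: "integrable lborel (\<lambda>t. indicator {a..b} t * c)" "(LBINT t. indicator {a..b} t * c) = (b - a) * c"
    if "a \<le> b" for a b c :: real using that by (auto simp: integrable_real_indicator)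
  have int: "integrable lborel (\<lambda>t. indicator {a..b} t * E t)" for a b :: real
  proof (rule Bochner_Integration.integrable_bound)
    show "integrable lborel (\<lambda>t. indicator {a..b} t * E0)" by (cases "a \<le> b") (auto intro: ci)
    have "\<bar>E t\<bar> \<le> \<bar>E0\<bar>" for t using E(2,3)[of t] by simp
    then show "AE t in lborel. norm (indicator {a..b} t * E t) \<le> norm (indicator {a..b} t * E0)" by (simp add: indicator_def)
  qed measurable
  show ?thesis
  proof (induction n)
    case 0
    have "(LBINT t. indicator {0..1} t * E t) \<le> (LBINT t::real. indicator {0..1} t * E0)"
    proof (rule integral_mono[OF int])
      show "integrable lborel (\<lambda>t. indicator {0..1::real} t * E0)" by (rule ci) simp
      show "indicator {0..1} t * E t \<le> indicator {0..1} t * E0" for t using E(3)[of t] by (simp add: indicator_def)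
    qed
    then show ?case by (simp add: ci)
  next
    case (Suc n)
    have "(LBINT t. indicator {0..2 ^ Suc n} t * E t) \<le> (LBINT t. indicator {0..2 ^ n} t * E t + indicator {2 ^ n..2 ^ Suc n} t * E (2 ^ n))"
    proof (rule integral_mono[OF int Bochner_Integration.integrable_add[OF int ci(1)]])
      fix t :: real
      show "indicator {0..2 ^ Suc n} t * E t \<le> indicator {0..2 ^ n} t * E t + indicator {2 ^ n..2 ^ Suc n} t * E (2 ^ n)"
        using E(2)[of t] E(2)[of "2 ^ n"] antimonoD[OF E(1), of "2 ^ n" t] by (auto simp: indicator_def)
    qed simp
    also have "\<dots> = (LBINT t. indicator {0..2 ^ n} t * E t) + 2 ^ n * E (2 ^ n)"
      by (subst Bochner_Integration.integral_add[OF int ci(1)]) (simp_all add: ci)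
    finally show ?case using Suc by simp
  qed
qed

lemma power_powr_minus: "((2::real) ^ n) powr (- c) = 1 / (2 powr c) ^ n"
proof -
  have "((2::real) ^ n) powr c = (2 powr c) ^ n"
    by (simp add: powr_realpow[symmetric] powr_powr mult.commute)
  then show ?thesis by (simp add: powr_minus_divide)
qed

text \<open>The weighted values \<open>m j = x ^ j * E (2 ^ j)\<close> with x = 2^\<gamma> satisfy
  the recursion of \<open>weighted_recursion_bounded\<close>: one doubling multiplies the old term
  by x/16 \<le> 1/4. K is fixed before E, so it serves all solutions at once.\<close>

lemma doubling_decay:
  fixes \<gamma> A B E0 :: real
  assumes \<gamma>: "0 < \<gamma>" "\<gamma> \<le> 3 / 2" and A: "A \<ge> 0" and B: "B \<ge> 0" and E0: "E0 \<ge> 0"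
  obtains K where "K \<ge> 0" "\<forall>E. antimono E \<longrightarrow> (\<forall>t. 0 \<le> E t) \<longrightarrow> (\<forall>t. E t \<le> E0) \<longrightarrow>
    (\<forall>a>0. E (2 * a) \<le> E a / 16 + A * a powr (- \<gamma>) + B * a powr (- (3 / 2)) * (LBINT t. indicator {0..2 * a} t * E t)) \<longrightarrow>
    (\<forall>t>0. E t \<le> K * (1 + t) powr (- \<gamma>))"
proof -
  define x where "x = (2::real) powr \<gamma>"
  \<comment> \<open>\<open>z\<close> is the dyadic growth of a^(3/2), and z y = 2 is the length
    ratio of consecutive dyadic intervals; x \<le> z expresses \<gamma> \<le> 3/2.\<close>
  define z where "z = (2::real) powr (3 / 2)"
  define y where "y = (2::real) powr (- (1 / 2))"
  have x: "1 \<le> x" "x \<le> 3" using \<gamma> powr_le_3[OF \<gamma>(2)] by (auto simp: x_def intro: ge_one_powr_ge_zero)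
  have xz: "x \<le> z" unfolding x_def z_def using \<gamma> by (intro powr_mono) auto
  have zy: "z * y = 2" by (simp add: z_def y_def flip: powr_add)
  have y: "0 \<le> y" "y < 1" by (auto simp: y_def powr_minus powr_half_sqrt field_simps)
  have z: "z > 0" by (simp add: z_def)
  obtain K where K: "K \<ge> 0" "\<forall>m. (\<forall>j. 0 \<le> m j) \<longrightarrow> (\<forall>j. m j \<le> 3 ^ j * E0) \<longrightarrow>
    (\<forall>n. m (Suc n) \<le> m n / 4 + (3 * A + 3 * B * E0) + 3 * B * (\<Sum>j\<le>n. y ^ j * m j)) \<longrightarrow> (\<forall>n. m n \<le> K)"
  proof -
    have c: "0 \<le> 3 * A + 3 * B * E0" "0 \<le> 3 * B" using A B E0 by auto
    show ?thesis by (rule weighted_recursion_bounded[OF y c E0]) (rule that)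
  qed
  show ?thesis
  proof
    show "0 \<le> 9 * K + 3 * E0" using K(1) E0 by simp
    show "\<forall>E. antimono E \<longrightarrow> (\<forall>t. 0 \<le> E t) \<longrightarrow> (\<forall>t. E t \<le> E0) \<longrightarrow>
    (\<forall>a>0. E (2 * a) \<le> E a / 16 + A * a powr (- \<gamma>) + B * a powr (- (3 / 2)) * (LBINT t. indicator {0..2 * a} t * E t)) \<longrightarrow>
    (\<forall>t>0. E t \<le> (9 * K + 3 * E0) * (1 + t) powr (- \<gamma>))"
    proof (intro allI impI)
      fix E :: "real \<Rightarrow> real" and t :: real
      assume E': "antimono E" "\<forall>t. 0 \<le> E t" "\<forall>t. E t \<le> E0" and t: "t > 0"
        and rec: "\<forall>a>0. E (2 * a) \<le> E a / 16 + A * a powr (- \<gamma>) + B * a powr (- (3 / 2)) * (LBINT t. indicator {0..2 * a} t * E t)"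
      have E: "antimono E" "\<And>t. 0 \<le> E t" "\<And>t. E t \<le> E0" using E' by auto
      define m where "m j = x ^ j * E (2 ^ j)" for j :: nat
      have m0: "0 \<le> m j" for j using x E by (simp add: m_def)
      have bound: "\<forall>n. m n \<le> K"
      proof (rule K(2)[THEN spec, THEN mp, THEN mp, THEN mp]; intro allI m0)
        show "m j \<le> 3 ^ j * E0" for j unfolding m_def using x E by (intro mult_mono power_mono) auto
        fix n
        let ?S = "\<Sum>j\<le>n. 2 ^ j * E (2 ^ j)"
        have I: "(LBINT t. indicator {0..2 * 2 ^ n} t * E t) \<le> E0 + ?S"
          using antimono_integral_le[OF E, of "Suc n"] by (simp add: lessThan_Suc_atMost)
        have "E (2 ^ Suc n) \<le> E (2 ^ n) / 16 + A / x ^ n + B / z ^ n * (LBINT t. indicator {0..2 * 2 ^ n} t * E t)"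
          using rec[rule_format, of "2 ^ n"] unfolding power_powr_minus x_def z_def by simp
        also have "\<dots> \<le> E (2 ^ n) / 16 + A / x ^ n + B / z ^ n * (E0 + ?S)"
          using B z I by (intro add_left_mono mult_left_mono) auto
        finally have "x ^ Suc n * E (2 ^ Suc n) \<le> x ^ Suc n * (E (2 ^ n) / 16 + A / x ^ n + B / z ^ n * (E0 + ?S))"
          using x by (intro mult_left_mono) auto
        also have "\<dots> = x * (m n / 16) + x * A + x * (B * ((x / z) ^ n * (E0 + ?S)))"
          using x by (simp add: m_def distrib_left power_divide mult_ac)
        also have "x * (m n / 16) \<le> 3 * (m n / 16)" using x m0 by (intro mult_right_mono) auto
        also have "x * A \<le> 3 * A" using x A by (intro mult_right_mono) auto
        also have "x * (B * ((x / z) ^ n * (E0 + ?S))) \<le> 3 * (B * (E0 + (\<Sum>j\<le>n. y ^ j * m j)))"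
        proof (intro mult_mono x)
          have q: "0 \<le> x / z" "x / z \<le> 1" using x z xz by auto
          have "(x / z) ^ n * E0 \<le> 1 * E0" using q E0 by (intro mult_right_mono power_le_one) auto
          moreover have "(x / z) ^ n * ?S \<le> (\<Sum>j\<le>n. y ^ j * m j)"
            unfolding sum_distrib_left
          proof (rule sum_mono)
            \<comment> \<open>As x/z \<le> 1, the exponent n may be lowered to j. Then (x/z)^j 2^j =
              x^j y^j, which is the weight that the recursion expects.\<close>
            fix j assume "j \<in> {..n}"
            then have "(x / z) ^ n * (2 ^ j * E (2 ^ j)) \<le> (x / z) ^ j * (2 ^ j * E (2 ^ j))"
              using q E by (intro mult_right_mono power_decreasing) auto
            also have "\<dots> = ((x / z) ^ j * (z * y) ^ j) * E (2 ^ j)" unfolding zy by simp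
            also have "(x / z) ^ j * (z * y) ^ j = y ^ j * x ^ j" using z by (simp add: field_simps flip: power_mult_distrib)
            finally show "(x / z) ^ n * (2 ^ j * E (2 ^ j)) \<le> y ^ j * m j" by (simp add: m_def mult.assoc)
          qed
          ultimately show "(x / z) ^ n * (E0 + ?S) \<le> E0 + (\<Sum>j\<le>n. y ^ j * m j)" by (simp add: distrib_left)
          show "0 \<le> (x / z) ^ n * (E0 + ?S)" "0 \<le> B * ((x / z) ^ n * (E0 + ?S))"
            using q E0 E B by (auto intro!: mult_nonneg_nonneg add_nonneg_nonneg sum_nonneg)
        qed (use B in auto)
        finally show "m (Suc n) \<le> m n / 4 + (3 * A + 3 * B * E0) + 3 * B * (\<Sum>j\<le>n. y ^ j * m j)"
          using m0[of n] by (simp add: m_def[of "Suc n"] distrib_left mult.assoc)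
      qed
      show "E t \<le> (9 * K + 3 * E0) * (1 + t) powr (- \<gamma>)"
      proof (cases "t < 1")
        case True
        have "1 = x * 2 powr (- \<gamma>)" by (simp add: x_def flip: powr_add)
        also have "\<dots> \<le> 3 * (1 + t) powr (- \<gamma>)" using True t x \<gamma> by (intro mult_mono powr_mono2') auto
        finally have "E0 * 1 \<le> E0 * (3 * (1 + t) powr (- \<gamma>))" using E0 by (rule mult_left_mono)
        moreover have "0 \<le> K * (1 + t) powr (- \<gamma>)" using K by simp
        ultimately show ?thesis using E(3)[of t] by (simp add: distrib_right)
      next
        case False
        obtain n0 where "t < 2 ^ n0" using real_arch_pow[of 2 t] by auto
        define n where "n = (LEAST n. t < 2 ^ n)"
        have n: "t < 2 ^ n" unfolding n_def by (rule LeastI) fact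
        have "n \<noteq> 0" using n False by (intro notI) simp
        then obtain l where l: "n = Suc l" by (cases n) auto
        have ge: "2 ^ l \<le> t" using not_less_Least[of l "\<lambda>m. t < 2 ^ m"] l unfolding n_def[symmetric] by simp
        have "E t \<le> E (2 ^ l)" using ge by (rule antimonoD[OF E(1)])
        also have "\<dots> \<le> K / x ^ l" using bound[rule_format, of l] x by (simp add: m_def pos_le_divide_eq mult.commute)
        \<comment> \<open>With t < 2^(l+1) and t \<ge> 1 one has 1 + t \<le> 2^(l+2); the two extra
          powers of 2 cost x^2 \<le> 9.\<close>
        also have "\<dots> = K * (x\<^sup>2 * (2 ^ (l + 2)) powr (- \<gamma>))"
          unfolding power_powr_minus x_def[symmetric] using x by (simp add: power_add power2_eq_square field_simps)
        also have "\<dots> \<le> K * (9 * (1 + t) powr (- \<gamma>))"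
        proof (intro mult_left_mono mult_mono K(1))
          show "x\<^sup>2 \<le> 9" using power_mono[OF x(2), of 2] x by simp
          have "1 + t \<le> 2 * 2 ^ n" using n False by simp
          then show "(2 ^ (l + 2)) powr (- \<gamma>) \<le> (1 + t) powr (- \<gamma>)"
            using t \<gamma> l by (intro powr_mono2') auto
        qed auto
        also have "\<dots> \<le> (9 * K + 3 * E0) * (1 + t) powr (- \<gamma>)" using E0 by (simp add: distrib_right)
        finally show ?thesis .
      qed
    qed
  qed
qed

section \<open>Decay of weak solutions\<close>

text \<open>The constant is obtained before M, u and G are introduced: it is built from \<alpha>,
  \<epsilon> and the datum, and the iteration lemma is uniform over all functions E.\<close>

lemma global_solution_decay:
  fixes \<epsilon> \<alpha> r :: real and u0 :: "real^3 \<Rightarrow> real^3"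
  assumes eps: "\<epsilon> > 0" and u0: "\<And>i. in_L2 (\<lambda>x. u0 x $ i)" and dc: "has_decay_character u0 (ereal r)"
    and r: "- (3 / 2) < r" and alpha: "\<alpha> > \<epsilon> / 4"
  obtains K where "K \<ge> 0" "\<And>M u G. global_solution \<epsilon> \<alpha> M u0 u G \<Longrightarrow>
    AE t in lborel. t > 0 \<longrightarrow> (\<Sum>i\<in>UNIV. sq (\<lambda>x. u t x $ i)) \<le> K * (1 + t) powr (- min (3 / 2 + r) (3 / 2))"
proof -
  define \<gamma> where "\<gamma> = min (3 / 2 + r) (3 / 2)"
  have \<gamma>: "0 < \<gamma>" "\<gamma> \<le> 3 / 2" "min (2 * r + real CARD(3)) 3 = 2 * \<gamma>" using r by (auto simp: \<gamma>_def min_def)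
  obtain D where D: "D \<ge> 0" "\<And>s. s > 0 \<Longrightarrow> (\<Sum>i\<in>UNIV. sq (conv (mollifier s) (\<lambda>x. u0 x $ i))) \<le> D * s powr (- (2 * \<gamma>))"
    using decay_character_low_frequency[OF u0 dc] r \<gamma>(3) by auto
  define E0 where "E0 = (\<Sum>i\<in>UNIV. sq (\<lambda>x. u0 x $ i))"
  define S where "S = sq (mollifier 1 :: real^3 \<Rightarrow> real)"
  define c where "c = (1 + 6 * \<alpha>\<^sup>2 / (\<alpha> - \<epsilon> / 16)) * E0"
  \<comment> \<open>\<open>A\<close> and \<open>B\<close> are the coefficients of
    \<open>energy_halving\<close> at s = sqrt(a/15): 2 * 2 * D for the datum and 2 * 36 * S * c for
    the nonlinearity, with powers of 15 left over from s.\<close>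
  define A where "A = 4 * D * 15 powr \<gamma>"
  define B where "B = 72 * S * 15 powr (3 / 2) * c"
  have E0: "E0 \<ge> 0" by (simp add: E0_def sum_nonneg)
  have c: "c \<ge> 0" unfolding c_def using eps alpha E0 by (intro mult_nonneg_nonneg add_nonneg_nonneg divide_nonneg_nonneg) auto
  have AB: "A \<ge> 0" "B \<ge> 0" using D c by (auto simp: A_def B_def S_def)
  obtain K where K: "K \<ge> 0" "\<forall>E. antimono E \<longrightarrow> (\<forall>t. 0 \<le> E t) \<longrightarrow> (\<forall>t. E t \<le> E0) \<longrightarrow>
    (\<forall>a>0. E (2 * a) \<le> E a / 16 + A * a powr (- \<gamma>) + B * a powr (- (3 / 2)) * (LBINT t. indicator {0..2 * a} t * E t)) \<longrightarrow>
    (\<forall>t>0. E t \<le> K * (1 + t) powr (- \<gamma>))"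
    using doubling_decay[OF \<gamma>(1,2) AB E0] by blast
  show ?thesis
  proof
    show "K \<ge> 0" by (rule K)
    fix M u G assume "global_solution \<epsilon> \<alpha> M u0 u G"
    then interpret global_solution \<epsilon> \<alpha> M u0 u G .
    let ?E = "total_energy"
    have decay: "\<forall>t>0. ?E t \<le> K * (1 + t) powr (- \<gamma>)"
    proof (rule K(2)[THEN spec, THEN mp, THEN mp, THEN mp, THEN mp])
      show "antimono ?E" using total_energy_antimono[OF alpha] by (simp add: antimono_def)
      show "\<forall>t. 0 \<le> ?E t" using total_energy_nonneg[OF alpha] by blast
      show "\<forall>t. ?E t \<le> E0" unfolding E0_def using total_energy_le[OF alpha] by blast
      show "\<forall>a>0. ?E (2 * a) \<le> ?E a / 16 + A * a powr (- \<gamma>) + B * a powr (- (3 / 2)) * (LBINT t. indicator {0..2 * a} t * ?E t)"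
      proof (intro allI impI)
        fix a :: real assume a: "a > 0"
        define s where "s = sqrt (a / 15)"
        have s: "s > 0" using a by (simp add: s_def)
        have spow: "s powr b = (a / 15) powr (b / 2)" for b
          using a unfolding s_def by (simp add: powr_half_sqrt[symmetric] powr_powr)
        have apow: "(a / 15) powr (- b) = 15 powr b * a powr (- b)" for b
          using a by (simp add: powr_divide powr_minus field_simps)
        let ?I = "LBINT t. indicator {0..2 * a} t * ?E t"
        have I: "?I \<ge> 0" using total_energy_nonneg[OF alpha] by (intro Bochner_Integration.integral_nonneg) auto
        have sqm: "sq (mollifier s :: real^3 \<Rightarrow> real) = S * (15 powr (3 / 2) * a powr (- (3 / 2)))"
        proof -
          have "s ^ 3 = (a / 15) powr (3 / 2)" using s spow[of 3] by (simp add: powr_numeral)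
          moreover have "sq (mollifier s :: real^3 \<Rightarrow> real) = S / s ^ 3" using sq_mollifier[OF s, where 'a="real^3"] by (simp add: S_def)
          ultimately have "sq (mollifier s :: real^3 \<Rightarrow> real) = S * (a / 15) powr (- (3 / 2))" by (simp add: powr_minus_divide)
          then show ?thesis unfolding apow .
        qed
        have low: "(\<Sum>i\<in>UNIV. sq (conv (mollifier s) (U0 i))) \<le> D * (15 powr \<gamma> * a powr (- \<gamma>))"
          using D(2)[OF s] spow[of "- (2 * \<gamma>)"] apow[of \<gamma>] by simp
        have "?E (2 * a) \<le> ?E a / 16 + 2 * (2 * (\<Sum>i\<in>UNIV. sq (conv (mollifier s) (U0 i)))
          + 36 * sq (mollifier s :: real^3 \<Rightarrow> real) * (c * ?I))"
          using energy_halving[OF alpha a] unfolding s_def c_def E0_def .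
        also have "\<dots> \<le> ?E a / 16 + 2 * (2 * (D * (15 powr \<gamma> * a powr (- \<gamma>))) + 36 * (S * (15 powr (3 / 2) * a powr (- (3 / 2)))) * (c * ?I))"
          unfolding sqm using low by simp
        also have "\<dots> = ?E a / 16 + A * a powr (- \<gamma>) + B * a powr (- (3 / 2)) * ?I"
          by (simp add: A_def B_def algebra_simps)
        finally show "?E (2 * a) \<le> ?E a / 16 + A * a powr (- \<gamma>) + B * a powr (- (3 / 2)) * ?I" .
      qed
    qed
    show "AE t in lborel. t > 0 \<longrightarrow> (\<Sum>i\<in>UNIV. sq (\<lambda>x. u t x $ i)) \<le> K * (1 + t) powr (- min (3 / 2 + r) (3 / 2))"
      using energy_eq_total[OF alpha] unfolding \<gamma>_def[symmetric] energy_def[symmetric] by eventually_elim (use decay in simp)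
  qed
qed

section \<open>From weak solutions to normalised solutions\<close>

lemma norm_sq_vec: "(norm (x :: real^'n))\<^sup>2 = (\<Sum>i\<in>UNIV. (x $ i)\<^sup>2)"
  by (simp add: norm_vec_def L2_set_def sum_nonneg)

lemma norm_nth_nth_le: "\<bar>A $ i $ j\<bar> \<le> norm (A :: real^'n^'m)"
  by (metis Finite_Cartesian_Product.norm_nth_le order_trans real_norm_def)

lemma vec_nth_measurable [measurable (raw)]:
  "f \<in> borel_measurable M \<Longrightarrow> (\<lambda>x. f x $ i) \<in> borel_measurable M" for f :: "'a \<Rightarrow> 'b::{second_countable_topology, real_normed_vector}^'n"
  by (rule measurable_compose[OF _ borel_measurable_continuous_onI[OF linear_continuous_on[OF bounded_linear_vec_nth]]])

lemma in_L2_component: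
  fixes f :: "'a::euclidean_space \<Rightarrow> real^'n"
  assumes f: "in_L2 f"
  shows "in_L2 (\<lambda>x. f x $ i)" "L2_sqnorm f = ennreal (\<Sum>i\<in>UNIV. sq (\<lambda>x. f x $ i))"
proof -
  have [measurable]: "f \<in> borel_measurable borel" using f by (simp add: in_L2_def)
  have c: "in_L2 (\<lambda>x. f x $ i)" for i
  proof -
    have "L2_sqnorm (\<lambda>x. f x $ i) \<le> L2_sqnorm f"
      unfolding L2_sqnorm_def by (intro nn_integral_mono ennreal_leI power_mono) (auto simp: component_le_norm_cart)
    then show ?thesis using f unfolding in_L2_def by (auto intro: le_less_trans)
  qed
  then show "in_L2 (\<lambda>x. f x $ i)" .
  have "L2_sqnorm f = (\<integral>\<^sup>+x. (\<Sum>i\<in>UNIV. ennreal ((f x $ i)\<^sup>2)) \<partial>lborel)"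
    by (simp add: L2_sqnorm_def norm_sq_vec)
  also have "\<dots> = (\<Sum>i\<in>UNIV. \<integral>\<^sup>+x. ennreal ((f x $ i)\<^sup>2) \<partial>lborel)" by (rule nn_integral_sum) measurable
  also have "\<dots> = (\<Sum>i\<in>UNIV. ennreal (sq (\<lambda>x. f x $ i)))"
    using L2_sqnorm_eq_sq[OF c] by (simp add: L2_sqnorm_real)
  finally show "L2_sqnorm f = ennreal (\<Sum>i\<in>UNIV. sq (\<lambda>x. f x $ i))" by simp
qed

lemma partial_slice:
  fixes \<phi> :: "real \<times> (real^'n) \<Rightarrow> 'b::real_normed_vector"
  assumes "smooth \<phi>"
  shows "partial j (\<lambda>y. \<phi> (t, y)) x = frechet_derivative \<phi> (at (t, x)) (0, axis j 1)"
proof -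
  have "((\<lambda>y. (t, y)) has_derivative (\<lambda>h. (0, h))) (at x)" by (auto intro!: derivative_eq_intros)
  then have "((\<lambda>y. \<phi> (t, y)) has_derivative (\<lambda>h. frechet_derivative \<phi> (at (t, x)) (0, h))) (at x)"
    by (rule has_derivative_compose[OF _ smooth_has_derivative[OF assms]])
  from frechet_derivative_at[OF this] show ?thesis unfolding partial_def by metis
qed

text \<open>Replacing u by its modification under the space-time integral needs integrands
  measurable in (t, x) jointly, while the operators act on slices at fixed t.
  \<open>partial_slice\<close> rewrites them as derivatives of the full function in directions (0,
  e_j), which are continuous.\<close>

lemma slice_operators_measurable:
  fixes \<phi> :: "real \<times> (real^3) \<Rightarrow> real^3"
  assumes \<phi>: "smooth \<phi>"
  shows "(\<lambda>z. laplacian (\<lambda>y. \<phi> (fst z, y)) (snd z)) \<in> borel_measurable borel"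
    and "(\<lambda>z. grad_div (\<lambda>y. \<phi> (fst z, y)) (snd z) $ i) \<in> borel_measurable borel"
    and "time_deriv \<phi> \<in> borel_measurable borel"
proof -
  let ?d = "\<lambda>j z. frechet_derivative \<phi> (at z) (0, axis j 1)"
  have d: "smooth (?d j)" for j by (rule smooth_derivative[OF \<phi>])
  have p: "partial j (\<lambda>y. \<phi> (t, y)) = (\<lambda>y. ?d j (t, y))" for j t by (rule ext) (rule partial_slice[OF \<phi>])
  have "(\<lambda>z. frechet_derivative (?d j) (at z) (0, axis j 1)) \<in> borel_measurable borel" for j
    by (intro borel_measurable_continuous_onI smooth_continuous smooth_derivative d)
  then show "(\<lambda>z. laplacian (\<lambda>y. \<phi> (fst z, y)) (snd z)) \<in> borel_measurable borel"
    unfolding laplacian_def p partial_slice[OF d] by simp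
  let ?v = "\<lambda>z. \<Sum>j\<in>UNIV. ?d j z $ j"
  have v: "smooth ?v"
  proof
    fix k
    have c: "Ck k (\<lambda>z. ?d j z $ j)" for j using d[of j] by (intro Ck_bounded_linear_left[OF bounded_linear_vec_nth]) auto
    have "Ck k (\<lambda>z. \<Sum>j\<in>F. ?d j z $ j)" if "finite F" for F
      using that by (induction F rule: finite_induct) (auto intro: Ck_const Ck_add c)
    then show "Ck k ?v" by simp
  qed
  have dv: "divergence (\<lambda>y. \<phi> (t, y)) = (\<lambda>y. ?v (t, y))" for t by (rule ext) (simp add: divergence_def p)
  have "(\<lambda>z. frechet_derivative ?v (at z) (0, axis i 1)) \<in> borel_measurable borel"
    by (intro borel_measurable_continuous_onI smooth_continuous smooth_derivative v)
  then show "(\<lambda>z. grad_div (\<lambda>y. \<phi> (fst z, y)) (snd z) $ i) \<in> borel_measurable borel"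
    unfolding grad_div_def dv by (simp add: partial_slice[OF v])
  show "time_deriv \<phi> \<in> borel_measurable borel"
    unfolding time_deriv_def[abs_def] by (intro borel_measurable_continuous_onI smooth_continuous smooth_derivative \<phi>)
qed


text \<open>On a Borel null set of times where one of the almost-everywhere properties fails, and at nonpositive
  times, the solution and its gradient are replaced by 0; the properties then hold at all times.\<close>

lemma weak_solution_regularization:
  assumes w: "weak_solution \<epsilon> \<alpha> u0 u" and eps: "\<epsilon> > 0" and u0: "\<And>i. in_L2 (\<lambda>x. u0 x $ i)"
  obtains M v H where "global_solution \<epsilon> \<alpha> M u0 v H"
    "AE t in lborel. t > 0 \<longrightarrow> L2_sqnorm (u t) = ennreal (\<Sum>i\<in>UNIV. sq (\<lambda>x. v t x $ i))"
proof -
  from w obtain G where um0: "(\<lambda>(t, x). u t x) \<in> borel_measurable lborel" and "in_Linf_L2 u" and L4: "in_L4_L4 u"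
    and G: "in_L2_H1_dot u G" and sol: "solves_distributionally \<epsilon> \<alpha> u0 u G"
    unfolding weak_solution_def by blast
  then obtain M' where M': "AE t in lborel. 0 < t \<longrightarrow> L2_sqnorm (u t) \<le> ennreal M'" by (auto simp: in_Linf_L2_def)
  \<comment> \<open>The essential bound may be a negative real, read as 0 by \<open>ennreal\<close>;
    a nonnegative one allows the return to real inequalities.\<close>
  define M where "M = max M' 0"
  have um: "(\<lambda>z. u (fst z) (snd z)) \<in> borel_measurable (borel \<Otimes>\<^sub>M borel)"
    using um0 by (simp add: borel_prod split_beta')
  have Gm: "(\<lambda>z. G (fst z) (snd z)) \<in> borel_measurable (borel \<Otimes>\<^sub>M borel)"
    using G by (simp add: in_L2_H1_dot_def borel_prod split_beta')
  have u_sec [measurable]: "u t \<in> borel_measurable borel" and G_sec [measurable]: "G t \<in> borel_measurable borel" for t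
    using measurable_compose[OF _ um, of "\<lambda>x. (t, x)" borel] measurable_compose[OF _ Gm, of "\<lambda>x. (t, x)" borel] by simp_all
  let ?Q = "\<lambda>t. \<integral>\<^sup>+x. ennreal ((norm (u t x)) ^ 4) \<partial>lborel"
  have AE_fin: "AE t in lborel. 0 < t \<longrightarrow> h t < \<infinity>"
    if "h \<in> borel_measurable borel" "(\<integral>\<^sup>+t\<in>{0<..}. h t \<partial>lborel) < \<infinity>" for h :: "real \<Rightarrow> ennreal"
  proof -
    have "AE t in lborel. h t * indicator {0<..} t \<noteq> \<infinity>"
      using that by (intro nn_integral_PInf_AE) auto
    then show ?thesis by eventually_elim (auto simp: less_top)
  qed
  have Qm: "?Q \<in> borel_measurable borel"
  proof -
    have "(\<lambda>z. ennreal ((norm (u (fst z) (snd z))) ^ 4)) \<in> borel_measurable (borel \<Otimes>\<^sub>M lborel)"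
      using um by (simp add: measurable_cong_sets[OF sets_pair_measure_cong[OF refl sets_lborel] refl])
    from lborel.borel_measurable_nn_integral_fst[OF this] show ?thesis by simp
  qed
  have Nm: "(\<lambda>t. L2_sqnorm (G t)) \<in> borel_measurable borel"
  proof -
    have "(\<lambda>z. ennreal ((norm (G (fst z) (snd z)))\<^sup>2)) \<in> borel_measurable (borel \<Otimes>\<^sub>M lborel)"
      using Gm by (simp add: measurable_cong_sets[OF sets_pair_measure_cong[OF refl sets_lborel] refl])
    from lborel.borel_measurable_nn_integral_fst[OF this] show ?thesis by (simp add: L2_sqnorm_def)
  qed
  let ?good = "\<lambda>t. L2_sqnorm (u t) \<le> ennreal M \<and> ?Q t < \<infinity> \<and> L2_sqnorm (G t) < \<infinity> \<and> is_weak_gradient (u t) (G t)"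
  have "AE t in lborel. 0 < t \<longrightarrow> ?good t"
  proof -
    have "AE t in lborel. 0 < t \<longrightarrow> is_weak_gradient (u t) (G t)" using G by (simp add: in_L2_H1_dot_def)
    moreover have "AE t in lborel. 0 < t \<longrightarrow> ?Q t < \<infinity>" using L4 by (intro AE_fin Qm) (simp add: in_L4_L4_def)
    moreover have "AE t in lborel. 0 < t \<longrightarrow> L2_sqnorm (G t) < \<infinity>" using G by (intro AE_fin Nm) (simp add: in_L2_H1_dot_def)
    moreover have "AE t in lborel. 0 < t \<longrightarrow> L2_sqnorm (u t) \<le> ennreal M"
      using M' by eventually_elim (auto simp: M_def intro: order_trans ennreal_leI)
    ultimately show ?thesis by eventually_elim blast
  qed
  \<comment> \<open>The exceptional set is chosen Borel, so that cutting it out preserves Borel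
    measurability.\<close>
  then obtain N where N: "\<And>t. 0 < t \<Longrightarrow> t \<notin> N \<Longrightarrow> ?good t" "emeasure lborel N = 0" "N \<in> sets lborel"
    by (elim AE_E) auto
  have N_null: "N \<in> null_sets lborel" using N by (simp add: null_sets_def)
  define S where "S = {0<..} - N"
  have S [measurable]: "S \<in> sets borel" using N by (auto simp: S_def)
  define v where "v t x = indicator S t *\<^sub>R u t x" for t x
  define H where "H t x = indicator S t *\<^sub>R G t x" for t x
  have good: "?good t" if "t \<in> S" for t using N(1) that by (auto simp: S_def)
  have in_S: "v t = u t" "H t = G t" if "t \<in> S" for t using that by (auto simp: v_def H_def)
  have not_S: "v t = (\<lambda>x. 0)" "H t = (\<lambda>x. 0)" if "t \<notin> S" for t using that by (auto simp: v_def H_def)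
  have vm: "(\<lambda>z. v (fst z) (snd z)) \<in> borel_measurable (borel \<Otimes>\<^sub>M borel)"
    and Hm: "(\<lambda>z. H (fst z) (snd z)) \<in> borel_measurable (borel \<Otimes>\<^sub>M borel)"
    unfolding v_def H_def using um Gm by measurable
  have v2: "in_L2 (v t)" and vM: "L2_sqnorm (v t) \<le> ennreal M" for t
  proof -
    show "L2_sqnorm (v t) \<le> ennreal M"
      using good[of t] in_S[of t] not_S[of t] by (cases "t \<in> S") (auto simp: L2_sqnorm_def)
    then show "in_L2 (v t)" by (auto simp: in_L2_def v_def[abs_def] intro: le_less_trans)
  qed
  have H2: "in_L2 (H t)" for t
    using good[of t] in_S[of t] not_S[of t] by (cases "t \<in> S") (auto simp: in_L2_def L2_sqnorm_def)
  have Hc: "in_L2 (\<lambda>x. H t x $ i $ j)" "ennreal (sq (\<lambda>x. H t x $ i $ j)) \<le> L2_sqnorm (H t)" for t i j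
  proof -
    have le: "L2_sqnorm (\<lambda>x. H t x $ i $ j) \<le> L2_sqnorm (H t)"
      unfolding L2_sqnorm_def by (intro nn_integral_mono ennreal_leI power_mono) (auto intro: norm_nth_nth_le)
    then show i: "in_L2 (\<lambda>x. H t x $ i $ j)" using H2[of t] unfolding in_L2_def by (auto intro: le_less_trans)
    from le show "ennreal (sq (\<lambda>x. H t x $ i $ j)) \<le> L2_sqnorm (H t)" unfolding L2_sqnorm_eq_sq[OF i] .
  qed
  have v4: "in_L4 (\<lambda>x. v t x $ i)" "ennreal (quart (\<lambda>x. v t x $ i)) \<le> (\<integral>\<^sup>+x. ennreal ((norm (v t x)) ^ 4) \<partial>lborel)" for t i
  proof -
    have [measurable]: "(\<lambda>x. v t x $ i) \<in> borel_measurable borel" using in_L2_component(1)[OF v2] by (rule in_L2_measurable)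
    have "((v t x $ i)\<^sup>2)\<^sup>2 \<le> (norm (v t x)) ^ 4" for x
      using power_mono[OF component_le_norm_cart[of "v t x" i], of 4] by simp
    then have le: "L2_sqnorm (\<lambda>x. (v t x $ i)\<^sup>2) \<le> (\<integral>\<^sup>+x. ennreal ((norm (v t x)) ^ 4) \<partial>lborel)"
      unfolding L2_sqnorm_real by (intro nn_integral_mono ennreal_leI)
    also have "\<dots> < \<infinity>" using good[of t] in_S[of t] not_S[of t] by (cases "t \<in> S") auto
    finally have i: "in_L2 (\<lambda>x. (v t x $ i)\<^sup>2)" by (simp add: in_L2_def)
    then show "in_L4 (\<lambda>x. v t x $ i)" by (simp add: in_L4_def)
    from le show "ennreal (quart (\<lambda>x. v t x $ i)) \<le> (\<integral>\<^sup>+x. ennreal ((norm (v t x)) ^ 4) \<partial>lborel)"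
      unfolding L2_sqnorm_eq_sq[OF i] .
  qed
  have AE_S: "AE t in lborel. 0 < t \<longrightarrow> t \<in> S"
    using AE_not_in[OF N_null] by eventually_elim (simp add: S_def)
  \<comment> \<open>A null set of times stays null after multiplication with all of space, as 0
    times infinity is 0 for the product measure.\<close>
  have AE_S2: "AE z in (lborel :: (real \<times> (real^3)) measure). 0 < fst z \<longrightarrow> fst z \<in> S"
  proof -
    have "N \<times> UNIV \<in> null_sets (lborel \<Otimes>\<^sub>M (lborel :: (real^3) measure))"
      using N(2,3) by (intro null_setsI) (simp_all add: lborel.emeasure_pair_measure_Times pair_measureI)
    from AE_not_in[OF this[unfolded lborel_prod]] show ?thesis by eventually_elim (auto simp: S_def)
  qed
  have "global_solution \<epsilon> \<alpha> M u0 v H"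
  proof
    show "\<epsilon> > 0" by (rule eps)
    show "in_L2 (\<lambda>x. u0 x $ i)" for i by (rule u0)
    show "case_prod (\<lambda>t x. v t x $ i) \<in> borel_measurable (borel \<Otimes>\<^sub>M borel)" for i
      using vec_nth_measurable[OF vm] by (simp add: split_beta')
    show "case_prod (\<lambda>t x. H t x $ i $ j) \<in> borel_measurable (borel \<Otimes>\<^sub>M borel)" for i j
      using vec_nth_measurable[OF vec_nth_measurable[OF Hm]] by (simp add: split_beta')
    show "v t x = 0" "H t x = 0" if "t \<le> 0" for t x using that not_S[of t] by (auto simp: S_def)
    show "(\<Sum>i\<in>UNIV. sq (\<lambda>x. v t x $ i)) \<le> M" for t
      using vM[of t] unfolding in_L2_component(2)[OF v2] by (subst (asm) ennreal_le_iff) (auto simp: M_def)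
    show "in_L4 (\<lambda>x. v t x $ i)" for i t by (rule v4)
    show "(\<integral>\<^sup>+t. ennreal (quart (\<lambda>x. v t x $ i)) \<partial>lborel) < \<infinity>" for i
    proof (rule le_less_trans)
      show "(\<integral>\<^sup>+t. ennreal (quart (\<lambda>x. v t x $ i)) \<partial>lborel) \<le> (\<integral>\<^sup>+t\<in>{0<..}. ?Q t \<partial>lborel)"
      proof (rule nn_integral_mono)
        show "ennreal (quart (\<lambda>x. v t x $ i)) \<le> ?Q t * indicator {0<..} t" for t
          using v4(2)[of t i] in_S[of t] not_S[of t] by (cases "t \<in> S") (auto simp: S_def sq_def)
      qed
    qed (use L4 in \<open>simp add: in_L4_L4_def\<close>)
    show "(\<integral>\<^sup>+t. ennreal (sq (\<lambda>x. H t x $ i $ j)) \<partial>lborel) < \<infinity>" for i j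
    proof (rule le_less_trans)
      show "(\<integral>\<^sup>+t. ennreal (sq (\<lambda>x. H t x $ i $ j)) \<partial>lborel) \<le> (\<integral>\<^sup>+t\<in>{0<..}. L2_sqnorm (G t) \<partial>lborel)"
      proof (rule nn_integral_mono)
        show "ennreal (sq (\<lambda>x. H t x $ i $ j)) \<le> L2_sqnorm (G t) * indicator {0<..} t" for t
          using Hc(2)[of t i j] in_S[of t] not_S[of t] by (cases "t \<in> S") (auto simp: S_def sq_def)
      qed
    qed (use G in \<open>simp add: in_L2_H1_dot_def\<close>)
    show "weak_partial j (\<lambda>x. v t x $ i) (\<lambda>x. H t x $ i $ j)" for i j t
      using good[of t] in_S[of t] not_S[of t] in_L2_component(1)[OF v2[of t], of i] Hc(1)[of t i j]
      by (cases "t \<in> S") (auto simp: weak_partial_def is_weak_gradient_def)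
  next
    fix \<phi> :: "real \<times> (real^3) \<Rightarrow> real^3" assume \<phi>: "test_function \<phi>"
    then have sm: "smooth \<phi>" by (simp add: test_function_iff)
    note [measurable] = slice_operators_measurable[OF sm] vm[unfolded borel_prod] Hm[unfolded borel_prod] um[unfolded borel_prod] Gm[unfolded borel_prod]
    have [measurable]: "\<phi> \<in> borel_measurable borel" using smooth_continuous[OF sm] by (rule borel_measurable_continuous_onI)
    let ?L = "\<lambda>u G z. - (u (fst z) (snd z) \<bullet> time_deriv \<phi> z) + (G (fst z) (snd z) *v u (fst z) (snd z)) \<bullet> \<phi> z
            + \<alpha> * (norm (u (fst z) (snd z)))\<^sup>2 * (u (fst z) (snd z) \<bullet> \<phi> z)"
    let ?R = "\<lambda>u z. u (fst z) (snd z) \<bullet> laplacian (\<lambda>y. \<phi> (fst z, y)) (snd z)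
            + (1 / \<epsilon>) * (u (fst z) (snd z) \<bullet> grad_div (\<lambda>y. \<phi> (fst z, y)) (snd z))"
    have Lm: "?L w K \<in> borel_measurable borel" if [measurable]: "(\<lambda>z. w (fst z) (snd z)) \<in> borel_measurable borel" "(\<lambda>z. K (fst z) (snd z)) \<in> borel_measurable borel"
      for w :: "real \<Rightarrow> real^3 \<Rightarrow> real^3" and K :: "real \<Rightarrow> real^3 \<Rightarrow> real^3^3"
      unfolding inner_vec_def[of "_ *v _"] unfolding matrix_vector_mult_def inner_real_def by simp
    have Rm: "?R w \<in> borel_measurable borel" if [measurable]: "(\<lambda>z. w (fst z) (snd z)) \<in> borel_measurable borel"
      for w :: "real \<Rightarrow> real^3 \<Rightarrow> real^3"
      unfolding inner_vec_def[of _ "grad_div _ _"] inner_real_def by measurable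
    have sets: "({0<..} :: real set) \<times> (UNIV :: (real^3) set) \<in> sets borel" by (intro borel_open open_Times) auto
    \<comment> \<open>For positive times outside \<open>S\<close> the two integrands may differ, but
      such points form a null set; at nonpositive times the left one vanishes by construction and
      the right one by the indicator.\<close>
    have cut: "(LBINT z. f z) = (LBINT z. indicat_real ({0<..} \<times> UNIV) z *\<^sub>R g z)"
      if [measurable]: "f \<in> borel_measurable borel" "g \<in> borel_measurable borel"
        and fg: "\<And>z. fst z \<in> S \<Longrightarrow> f z = g z" "\<And>z. fst z \<notin> S \<Longrightarrow> f z = 0" for f g :: "real \<times> (real^3) \<Rightarrow> real"
    proof (rule integral_cong_AE)
      show "(\<lambda>z. indicat_real ({0<..} \<times> UNIV) z *\<^sub>R g z) \<in> borel_measurable lborel"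
        using sets by (intro borel_measurable_scaleR borel_measurable_indicator) auto
      show "AE z in lborel. f z = indicat_real ({0<..} \<times> UNIV) z *\<^sub>R g z"
        using AE_S2
      proof eventually_elim
        case (elim z)
        then show ?case using fg[of z] by (cases "fst z \<in> S") (auto simp: S_def mem_Times_iff indicator_def)
      qed
    qed simp
    have L: "(LBINT z. ?L v H z) = (LINT (t, x):{0<..} \<times> UNIV|lborel.
            - (u t x \<bullet> time_deriv \<phi> (t, x)) + (G t x *v u t x) \<bullet> \<phi> (t, x) + \<alpha> * (norm (u t x))\<^sup>2 * (u t x \<bullet> \<phi> (t, x)))"
      unfolding set_lebesgue_integral_def split_beta' prod.collapse
      by (rule cut; (intro Lm)?) (simp_all add: in_S not_S)
    have R: "(LBINT z. ?R v z) = (LINT (t, x):{0<..} \<times> UNIV|lborel.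
            u t x \<bullet> laplacian (\<lambda>y. \<phi> (t, y)) x + (1 / \<epsilon>) * (u t x \<bullet> grad_div (\<lambda>y. \<phi> (t, y)) x))"
      unfolding set_lebesgue_integral_def split_beta' prod.collapse
      by (rule cut; (intro Rm)?) (simp_all add: in_S not_S)
    show "(LBINT z. ?L v H z) = (LBINT x. u0 x \<bullet> \<phi> (0, x)) + (LBINT z. ?R v z)"
      unfolding L R using sol \<phi> unfolding solves_distributionally_def by blast
  qed
  moreover have "AE t in lborel. t > 0 \<longrightarrow> L2_sqnorm (u t) = ennreal (\<Sum>i\<in>UNIV. sq (\<lambda>x. v t x $ i))"
    using AE_S by eventually_elim (simp add: in_S(1)[symmetric] in_L2_component(2)[OF v2])
  ultimately show ?thesis using that by blast
qed

theorem theorem1p3: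
  fixes \<epsilon> \<alpha> r :: real and u0 :: "real^3 \<Rightarrow> real^3"
  assumes "\<epsilon> > 0"
    and "in_L2 u0"
    and "has_decay_character u0 (ereal r)"
    and "- (3 / 2) < r"
    and "\<alpha> > \<epsilon> / 4"
  shows "\<exists>C>0. \<forall>u. weak_solution \<epsilon> \<alpha> u0 u \<longrightarrow>
           (\<forall>\<delta>>0. AE t in lborel. t > 0 \<longrightarrow>
              L2_sqnorm (u t) \<le> ennreal (C * (1 + t) powr (- min (3 / 2 + r) (3 / 2 - \<delta>))))"
proof -
  note u0 = in_L2_component(1)[OF assms(2)]
  obtain K where K: "K \<ge> 0" "\<And>M u G. global_solution \<epsilon> \<alpha> M u0 u G \<Longrightarrow>
    AE t in lborel. t > 0 \<longrightarrow> (\<Sum>i\<in>UNIV. sq (\<lambda>x. u t x $ i)) \<le> K * (1 + t) powr (- min (3 / 2 + r) (3 / 2))"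
    using global_solution_decay[OF assms(1) u0 assms(3-5)] by blast
  show ?thesis
  \<comment> \<open>The value \<open>K\<close> may be 0, so 1 is added to make the constant
    positive.\<close>
  proof (intro exI[of _ "K + 1"] conjI allI impI)
    show "K + 1 > 0" using K(1) by simp
    fix u and \<delta> :: real assume u: "weak_solution \<epsilon> \<alpha> u0 u" and \<delta>: "\<delta> > 0"
    obtain M v H where v: "global_solution \<epsilon> \<alpha> M u0 v H"
      "AE t in lborel. t > 0 \<longrightarrow> L2_sqnorm (u t) = ennreal (\<Sum>i\<in>UNIV. sq (\<lambda>x. v t x $ i))"
      by (rule weak_solution_regularization[OF u assms(1) u0])
    show "AE t in lborel. t > 0 \<longrightarrow> L2_sqnorm (u t) \<le> ennreal ((K + 1) * (1 + t) powr (- min (3 / 2 + r) (3 / 2 - \<delta>)))"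
      using K(2)[OF v(1)] v(2)
    proof eventually_elim
      case (elim t)
      \<comment> \<open>The bound obtained has \<delta> = 0. A positive \<delta> only enlarges the
        right-hand side, since 1 + t \<ge> 1, so one constant works for all \<delta>.\<close>
      have "- min (3 / 2 + r) (3 / 2) \<le> - min (3 / 2 + r) (3 / 2 - \<delta>)" using \<delta> by linarith
      then have "K * (1 + t) powr (- min (3 / 2 + r) (3 / 2)) \<le> (K + 1) * (1 + t) powr (- min (3 / 2 + r) (3 / 2 - \<delta>))" if "t > 0"
        using that K(1) by (intro mult_mono powr_mono) auto
      then show ?case using elim by (auto intro!: ennreal_leI intro: order_trans)
    qed
  qed
qed

end
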